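(* Suppose that $(\mathbf{L}^0,\mathbf{p})$ is a Brascamp--Lieb datum and $G:H\to H$ is a positive semi-definite linear map such that $\mathrm{BL}_G(\mathbf{L}^0,\mathbf{p})<\infty$. Then there exist $\delta>0$ and a constant $C<\infty$ such that $$\mathrm{BL}_G(\mathbf{L},\mathbf{p})\leq C$$ for every Brascamp--Lieb datum $(\mathbf{L},\mathbf{p})$ (with the same spaces $H,H_1,\ldots,H_m$ and the same exponents $\mathbf{p}$) satisfying $\|\mathbf{L}-\mathbf{L}^0\|<\delta$.
   Context: Let $m$ be a positive integer and let $H$, $H_1,\ldots,H_m$ be euclidean spaces of finite dimensions $n$ and $n_j\le n$ respectively, equipped with Lebesgue measure. A Brascamp--Lieb datum $(\mathbf{L},\mathbf{p})$ consists of an $m$-tuple $\mathbf{L}=(L_j)_{j=1}^m$ of surjective linear maps $L_j:H\to H_j$ with $\bigcap_{j=1}^m\ker L_j=\{0\}$ and an $m$-tuple $\mathbf{p}=(p_j)_{j=1}^m$ of real exponents $0\le p_j\le 1$. For a positive semi-definite (self-adjoint) linear map $G:H\to H$, the partially localised Brascamp--Lieb constant $\mathrm{BL}_G(\mathbf{L},\mathbf{p})\in[0,\infty]$ is the smallest constant $C$ for which $$\int_{\{x\in H:\,|\langle Gx,x\rangle|<1\}}\prod_{j=1}^m (f_j\circ L_j)^{p_j}\leq C\prod_{j=1}^m\Big(\int_{H_j}f_j\Big)^{p_j}$$ holds for all nonnegative $f_j\in L^1(H_j)$, $1\le j\le m$. The norm $\|\cdot\|$ on tuples is any fixed norm on the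 finite-dimensional space of $m$-tuples of linear maps $H\to H_j$. *)

theory Defs
  imports "HOL-Analysis.Analysis"
begin

text \<open>
  A finite-dimensional euclidean space is a linear subspace, possibly zero, of an ambient type of class
  \<^class>\<open>euclidean_space\<close>, with the inherited inner product. This allows a family of spaces of
  different dimensions. A linear map between two such spaces is a function on the ambient type of
  which only the values on the source space matter.
\<close>

definition linear_map_on ::
    "'a::euclidean_space set \<Rightarrow> 'b::euclidean_space set \<Rightarrow> ('a \<Rightarrow> 'b) \<Rightarrow> bool" where
  "linear_map_on V W T \<longleftrightarrow>
     T ` V \<subseteq> W \<and>
     (\<forall>x\<in>V. \<forall>y\<in>V. T (x + y) = T x + T y) \<and>
     (\<forall>c. \<forall>x\<in>V. T (c *\<^sub>R x) = c *\<^sub>R T x)"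

definition orthonormal_basis_of :: "'a::euclidean_space set \<Rightarrow> 'a set \<Rightarrow> bool" where
  "orthonormal_basis_of V B \<longleftrightarrow>
     pairwise orthogonal B \<and> (\<forall>b\<in>B. norm b = 1) \<and> span B = V"

text \<open>
  Lebesgue measure on a subspace is defined on its Borel sets exactly as \<^const>\<open>lborel\<close> is on
  the whole type: by coordinates in an orthonormal basis. The choice of basis is immaterial, by
  rotation invariance. On the zero space this is the unit point mass.
\<close>

definition subspace_lborel :: "'a::euclidean_space set \<Rightarrow> 'a measure" where
  "subspace_lborel V =
     (let B = (SOME B. orthonormal_basis_of V B)
      in distr (\<Pi>\<^sub>M b\<in>B. (lborel :: real measure)) (restrict_space borel V)
           (\<lambda>f. \<Sum>b\<in>B. f b *\<^sub>R b))"

definition psd_on :: "'a::euclidean_space set \<Rightarrow> ('a \<Rightarrow> 'a) \<Rightarrow> bool" where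
  "psd_on H G \<longleftrightarrow>
     linear_map_on H H G \<and>
     (\<forall>x\<in>H. \<forall>y\<in>H. G x \<bullet> y = x \<bullet> G y) \<and>
     (\<forall>x\<in>H. 0 \<le> G x \<bullet> x)"

definition BL_datum ::
    "'a::euclidean_space set \<Rightarrow> ('j::finite \<Rightarrow> 'b::euclidean_space set) \<Rightarrow>
     ('j \<Rightarrow> 'a \<Rightarrow> 'b) \<Rightarrow> ('j \<Rightarrow> real) \<Rightarrow> bool" where
  "BL_datum H Hs L p \<longleftrightarrow>
     (\<forall>j. linear_map_on H (Hs j) (L j) \<and> L j ` H = Hs j) \<and>
     (\<Inter>j. {x\<in>H. L j x = 0}) = {0} \<and>
     (\<forall>j. 0 \<le> p j \<and> p j \<le> 1)"

text \<open>
  Every zeroth power is \<open>1\<close>, including that of \<open>0\<close>, whereas \<open>0 powr 0 = 0\<close>.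
\<close>

definition rpow :: "real \<Rightarrow> real \<Rightarrow> real" where
  "rpow x a = (if a = 0 then 1 else x powr a)"

definition BL_bound ::
    "'a::euclidean_space set \<Rightarrow> ('j::finite \<Rightarrow> 'b::euclidean_space set) \<Rightarrow> ('a \<Rightarrow> 'a) \<Rightarrow>
     ('j \<Rightarrow> 'a \<Rightarrow> 'b) \<Rightarrow> ('j \<Rightarrow> real) \<Rightarrow> ennreal \<Rightarrow> bool" where
  "BL_bound H Hs G L p C \<longleftrightarrow>
     (\<forall>f :: 'j \<Rightarrow> 'b \<Rightarrow> real.
        (\<forall>j. integrable (subspace_lborel (Hs j)) (f j) \<and> (\<forall>y\<in>Hs j. 0 \<le> f j y)) \<longrightarrow>
        (\<integral>\<^sup>+x\<in>{x\<in>H. \<bar>G x \<bullet> x\<bar> < 1}. ennreal (\<Prod>j\<in>UNIV. rpow (f j (L j x)) (p j))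
            \<partial>subspace_lborel H)
          \<le> C * ennreal (\<Prod>j\<in>UNIV. rpow (\<integral>y. f j y \<partial>subspace_lborel (Hs j)) (p j)))"

definition BL_const ::
    "'a::euclidean_space set \<Rightarrow> ('j::finite \<Rightarrow> 'b::euclidean_space set) \<Rightarrow> ('a \<Rightarrow> 'a) \<Rightarrow>
     ('j \<Rightarrow> 'a \<Rightarrow> 'b) \<Rightarrow> ('j \<Rightarrow> real) \<Rightarrow> ennreal" where
  "BL_const H Hs G L p = Inf {C. BL_bound H Hs G L p C}"

text \<open>
  A norm on the space of tuples of linear maps from \<open>H\<close> to \<open>Hs j\<close>. Tuples agreeing on \<open>H\<close>
  represent the same element; by definiteness and the triangle inequality \<open>N\<close> does not distinguish them.
\<close>

definition tuple_norm ::
    "'a::euclidean_space set \<Rightarrow> ('j::finite \<Rightarrow> 'b::euclidean_space set) \<Rightarrow>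
     (('j \<Rightarrow> 'a \<Rightarrow> 'b) \<Rightarrow> real) \<Rightarrow> bool" where
  "tuple_norm H Hs N \<longleftrightarrow>
     (let X = {L. \<forall>j. linear_map_on H (Hs j) (L j)} in
       (\<forall>L\<in>X. 0 \<le> N L) \<and>
       (\<forall>L\<in>X. N L = 0 \<longleftrightarrow> (\<forall>j. \<forall>x\<in>H. L j x = 0)) \<and>
       (\<forall>c. \<forall>L\<in>X. N (\<lambda>j x. c *\<^sub>R L j x) = \<bar>c\<bar> * N L) \<and>
       (\<forall>L\<in>X. \<forall>M\<in>X. N (\<lambda>j x. L j x + M j x) \<le> N L + N M))"

end

theory Submission
  imports Defs "HOL-Probability.Probability"
begin

abbreviation borel_fun :: "('a::topological_space => 'b::topological_space) => bool" where
  "borel_fun f \<equiv> f \<in> borel_measurable borel"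

abbreviation nn_lebesgue :: "('a::euclidean_space => ennreal) => ennreal" (binder "\<L>" 10) where
  "nn_lebesgue f \<equiv> nn_integral lborel f"

definition onb :: "(nat => 'a::euclidean_space) => bool" where
  "onb e \<longleftrightarrow> (\<forall>i<DIM('a). \<forall>k<DIM('a). e i \<bullet> e k = (if i = k then 1 else 0))"

definition dg :: "(nat => 'a::euclidean_space) => (nat => real) => 'a => 'a" where
  "dg e c x = (\<Sum>i<DIM('a). (c i * (x \<bullet> e i)) *\<^sub>R e i)"

lemma onb_inner: "onb (e :: nat => 'a::euclidean_space) ==> i < DIM('a) ==> k < DIM('a) ==> e i \<bullet> e k = (if i = k then 1 else 0)"
  by (simp add: onb_def)

lemma onb_norm: "onb (e :: nat => 'a::euclidean_space) ==> i < DIM('a) ==> norm (e i) = 1"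
  by (simp add: onb_def norm_eq_sqrt_inner)

lemma onb_inj: "onb (e :: nat => 'a::euclidean_space) ==> inj_on e {..<DIM('a)}"
  unfolding onb_def inj_on_def
  by (metis lessThan_iff zero_neq_one)

lemma onb_span: 
  fixes e :: "nat => 'a::euclidean_space"
  assumes "onb e" shows "span (e ` {..<DIM('a)}) = UNIV" "independent (e ` {..<DIM('a)})"
proof -
  let ?B = "e ` {..<DIM('a)}"
  have "pairwise orthogonal ?B"
    using assms by (auto simp: pairwise_def orthogonal_def onb_def)
  moreover have "0 \<notin> ?B" using onb_norm[OF assms] by force
  ultimately show i: "independent ?B" by (rule pairwise_orthogonal_independent)
  have "card ?B = DIM('a)" using onb_inj[OF assms] by (simp add: card_image)
  then have "UNIV \<subseteq> span ?B" using card_ge_dim_independent[of ?B UNIV] i by simp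
  then show "span ?B = UNIV" by auto
qed

lemma onb_expand:
  fixes e :: "nat => 'a::euclidean_space"
  assumes "onb e" shows "(\<Sum>i<DIM('a). (x \<bullet> e i) *\<^sub>R e i) = x"
proof -
  define y where "y = x - (\<Sum>i<DIM('a). (x \<bullet> e i) *\<^sub>R e i)"
  have "y \<bullet> e k = 0" if "k < DIM('a)" for k
  proof -
    have "(\<Sum>i<DIM('a). (x \<bullet> e i) *\<^sub>R e i) \<bullet> e k = (\<Sum>i<DIM('a). (x \<bullet> e i) * (e i \<bullet> e k))"
      by (simp add: inner_sum_left)
    also have "... = (\<Sum>i<DIM('a). if i = k then x \<bullet> e i else 0)"
      using onb_inner[OF assms _ that] by (intro sum.cong) auto
    also have "... = x \<bullet> e k" using that by simp
    finally show ?thesis by (simp add: y_def inner_diff_left)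
  qed
  then have "\<forall>z\<in>span (e ` {..<DIM('a)}). orthogonal y z"
    using orthogonal_to_span[of _ "e ` {..<DIM('a)}" y] by (auto simp: orthogonal_def)
  then have "orthogonal y y" using onb_span(1)[OF assms] by auto
  then show ?thesis by (simp add: orthogonal_def y_def)
qed

lemma onb_parseval:
  fixes e :: "nat => 'a::euclidean_space"
  assumes "onb e" shows "x \<bullet> y = (\<Sum>i<DIM('a). (x \<bullet> e i) * (y \<bullet> e i))"
proof -
  have "x \<bullet> y = x \<bullet> (\<Sum>i<DIM('a). (y \<bullet> e i) *\<^sub>R e i)" by (simp only: onb_expand[OF assms])
  then show ?thesis by (simp add: inner_sum_right mult.commute)
qed

lemma onb_norm2:
  fixes e :: "nat => 'a::euclidean_space"
  assumes "onb e" shows "(norm x)^2 = (\<Sum>i<DIM('a). (x \<bullet> e i)^2)"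
  unfolding power2_norm_eq_inner by (subst onb_parseval[OF assms]) (simp add: power2_eq_square)

lemma sum_onb_inner:
  fixes e :: "nat => 'a::euclidean_space"
  assumes "onb e" "k < DIM('a)" shows "(\<Sum>i<DIM('a). c i *\<^sub>R e i) \<bullet> e k = c k"
proof -
  have "(\<Sum>i<DIM('a). c i *\<^sub>R e i) \<bullet> e k = (\<Sum>i<DIM('a). if i = k then c i else 0)"
    unfolding inner_sum_left
    using onb_inner[OF assms(1) _ assms(2)] by (intro sum.cong) auto
  then show ?thesis using assms(2) by simp
qed

lemma dg_inner:
  fixes e :: "nat => 'a::euclidean_space"
  assumes "onb e" "k < DIM('a)" shows "dg e c x \<bullet> e k = c k * (x \<bullet> e k)"
  unfolding dg_def by (rule sum_onb_inner[OF assms])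

lemma onb_eqI:
  fixes e :: "nat => 'a::euclidean_space"
  assumes "onb e" "\<And>k. k < DIM('a) ==> x \<bullet> e k = y \<bullet> e k" shows "x = y"
proof -
  have "(\<Sum>i<DIM('a). (x \<bullet> e i) *\<^sub>R e i) = (\<Sum>i<DIM('a). (y \<bullet> e i) *\<^sub>R e i)"
    using assms(2) by (intro sum.cong) auto
  then show ?thesis by (simp add: onb_expand[OF assms(1)])
qed

lemma linear_dg: "linear (dg e c)"
  unfolding dg_def
  by (intro linearI) (simp_all add: inner_add_left algebra_simps sum.distrib scaleR_sum_right)

lemma dg_dg:
  fixes e :: "nat => 'a::euclidean_space"
  assumes "onb e" shows "dg e c (dg e d x) = dg e (\<lambda>i. c i * d i) x"
  by (rule onb_eqI[OF assms]) (simp add: dg_inner assms)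

lemma dg_one:
  fixes e :: "nat => 'a::euclidean_space"
  assumes "onb e" "\<And>i. i < DIM('a) ==> c i = 1" shows "dg e c x = x"
  by (rule onb_eqI[OF assms(1)]) (simp add: dg_inner assms)

lemma dg_self_adjoint:
  fixes e :: "nat => 'a::euclidean_space"
  assumes "onb e" shows "dg e c x \<bullet> y = x \<bullet> dg e c y"
proof -
  have "dg e c x \<bullet> y = (\<Sum>i<DIM('a). (dg e c x \<bullet> e i) * (y \<bullet> e i))" by (rule onb_parseval[OF assms])
  also have "... = (\<Sum>i<DIM('a). (x \<bullet> e i) * (dg e c y \<bullet> e i))"
    by (intro sum.cong) (auto simp: dg_inner assms)
  also have "... = x \<bullet> dg e c y" by (rule onb_parseval[OF assms, symmetric])
  finally show ?thesis .
qed

lemma dg_norm2: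
  fixes e :: "nat => 'a::euclidean_space"
  assumes "onb e" shows "(norm (dg e c x))^2 = (\<Sum>i<DIM('a). (c i)^2 * (x \<bullet> e i)^2)"
  unfolding onb_norm2[OF assms] by (intro sum.cong) (auto simp: dg_inner assms power_mult_distrib)

lemma dg_norm_le:
  fixes e :: "nat => 'a::euclidean_space"
  assumes "onb e" "\<And>i. i < DIM('a) ==> \<bar>c i\<bar> <= C" shows "norm (dg e c x) <= C * norm x"
proof -
  have C: "0 <= C" using assms(2)[of 0] by force
  have "(norm (dg e c x))^2 <= (\<Sum>i<DIM('a). C\<^sup>2 * (x \<bullet> e i)^2)"
    unfolding dg_norm2[OF assms(1)]
  proof (intro sum_mono mult_right_mono)
    fix i assume "i \<in> {..<DIM('a)}"
    then have "\<bar>c i\<bar> <= \<bar>C\<bar>" using assms(2)[of i] by simp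
    then show "(c i)^2 <= C\<^sup>2" by (simp only: abs_le_square_iff)
  qed simp
  also have "... = (C * norm x)^2"
    unfolding power_mult_distrib onb_norm2[OF assms(1), of x] sum_distrib_left[symmetric] ..
  finally show ?thesis by (rule power2_le_imp_le) (use C in simp)
qed

definition bas :: "nat => 'a::euclidean_space" where
  "bas = (SOME b. bij_betw b {..<DIM('a)} Basis)"

lemma bij_bas: "bij_betw (bas :: nat => 'a::euclidean_space) {..<DIM('a)} Basis"
proof -
  have "\<exists>b :: nat => 'a. bij_betw b {..<DIM('a)} Basis"
    using ex_bij_betw_nat_finite[of "Basis :: 'a set"] by (auto simp: atLeast0LessThan)
  then show ?thesis unfolding bas_def by (rule someI_ex)
qed

lemma onb_bas: "onb (bas :: nat => 'a::euclidean_space)"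
  unfolding onb_def
proof (intro allI impI)
  fix i k assume ik: "i < DIM('a)" "k < DIM('a)"
  have "bas i \<in> (Basis :: 'a set)" "bas k \<in> (Basis :: 'a set)"
    using bij_bas[where 'a='a] ik by (auto simp: bij_betw_def)
  moreover have "bas i = (bas k :: 'a) \<longleftrightarrow> i = k"
    using bij_bas[where 'a='a] ik by (auto simp: bij_betw_def inj_on_def)
  ultimately show "bas i \<bullet> (bas k :: 'a) = (if i = k then 1 else (0::real))"
    using inner_Basis[of "bas i :: 'a" "bas k"] by simp
qed

text \<open>Spectral theorem\<close>

lemma spectral_step:
  fixes K :: "'a::euclidean_space => 'a"
  assumes K: "linear K" and sym: "\<And>x y. K x \<bullet> y = x \<bullet> K y"
  assumes k: "k <= DIM('a)"
  shows "\<exists>e l. (\<forall>i<k. \<forall>j<k. e i \<bullet> e j = (if i = j then 1 else (0::real))) \<and> (\<forall>i<k. K (e i) = l i *\<^sub>R e i)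
    \<and> (\<forall>i j. i <= j \<longrightarrow> j < k \<longrightarrow> l j <= (l i :: real)) \<and> (\<forall>i<k. \<forall>x. (\<forall>m<k. x \<bullet> e m = 0) \<longrightarrow> K x \<bullet> x <= l i * (x \<bullet> x))"
  using k
proof (induction k)
  case 0 then show ?case by auto
next
  case (Suc k)
  have "k <= DIM('a)" using Suc.prems by simp
  from Suc.IH[OF this] obtain e :: "nat => 'a" and l :: "nat => real"
    where *: "(\<forall>i<k. \<forall>j<k. e i \<bullet> e j = (if i = j then 1 else (0::real))) \<and> (\<forall>i<k. K (e i) = l i *\<^sub>R e i)
    \<and> (\<forall>i j. i <= j \<longrightarrow> j < k \<longrightarrow> l j <= (l i :: real)) \<and> (\<forall>i<k. \<forall>x. (\<forall>m<k. x \<bullet> e m = 0) \<longrightarrow> K x \<bullet> x <= l i * (x \<bullet> x))"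
    by (elim exE)
  have e: "e i \<bullet> e j = (if i = j then 1 else (0::real))" if "i < k" "j < k" for i j using * that by blast
  have l: "K (e i) = l i *\<^sub>R e i" if "i < k" for i using * that by blast
  have mono: "l j <= l i" if "i <= j" "j < k" for i j using * that by blast
  have up: "K x \<bullet> x <= l i * (x \<bullet> x)" if "i < k" "\<forall>m<k. x \<bullet> e m = 0" for i x using * that by blast
  define W where "W = {x. \<forall>m<k. x \<bullet> e m = 0}"
  have Wadd: "x + t *\<^sub>R y \<in> W" if "x \<in> W" "y \<in> W" for x y t
    using that by (auto simp: W_def inner_add_left)
  have WK: "K x \<in> W" if "x \<in> W" for x using that l by (auto simp: W_def sym)
  have "dim (e ` {..<k}) <= card (e ` {..<k})" by (rule dim_le_card') simp
  also have "... <= k" using card_image_le[of "{..<k}" e] by simp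
  finally have "dim (e ` {..<k}) < DIM('a)" using Suc.prems by simp
  then obtain x0 where x0: "x0 \<noteq> 0" "\<And>y. y \<in> span (e ` {..<k}) ==> orthogonal x0 y"
    using orthogonal_to_subspace_exists by metis
  have x0W: "x0 \<in> W" using x0(2) by (auto simp: W_def orthogonal_def span_base)
  define S where "S = sphere 0 1 \<inter> W"
  have "W = (\<Inter>m\<in>{..<k}. {x. x \<bullet> e m = 0})" by (auto simp: W_def)
  moreover have "closed {x::'a. x \<bullet> e m = 0}" for m
    by (intro closed_Collect_eq continuous_intros)
  ultimately have "closed W" by auto
  then have "compact S" unfolding S_def by (intro compact_Int_closed) auto
  moreover have "x0 /\<^sub>R norm x0 \<in> S"
    using x0 x0W by (auto simp: S_def W_def)
  moreover have "continuous_on S (\<lambda>x. K x \<bullet> x)"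
    by (intro continuous_intros linear_continuous_on linear_conv_bounded_linear[THEN iffD1] K)
  ultimately obtain v where v: "v \<in> S" and vmax: "\<And>y. y \<in> S ==> K y \<bullet> y <= K v \<bullet> v"
    using continuous_attains_sup[of S "\<lambda>x. K x \<bullet> x"] by blast
  define m where "m = K v \<bullet> v"
  have vW: "v \<in> W" and vv: "v \<bullet> v = 1" using v by (auto simp: S_def dot_square_norm)
  have max: "K x \<bullet> x <= m * (x \<bullet> x)" if "x \<in> W" for x
  proof (cases "x = 0")
    case False
    let ?y = "x /\<^sub>R norm x"
    have "?y \<in> S" using that False by (auto simp: S_def W_def)
    from vmax[OF this] have "K ?y \<bullet> ?y <= m" by (simp add: m_def)
    moreover have "K ?y \<bullet> ?y = (K x \<bullet> x) / (x \<bullet> x)"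
      by (simp add: linear_scale[OF K] dot_square_norm power2_eq_square divide_inverse)
    ultimately have "(K x \<bullet> x) / (x \<bullet> x) <= m" by (simp only:)
    moreover have "0 < x \<bullet> x" using False by simp
    ultimately show ?thesis by (simp only: pos_divide_le_eq)
  qed (simp add: linear_0[OF K])
  define w where "w = K v - m *\<^sub>R v"
  have wW: "w \<in> W" using Wadd[OF WK[OF vW] vW, of "-m"] by (simp add: w_def)
  define b where "b = K v \<bullet> w - m * (v \<bullet> w)"
  define c where "c = m * (w \<bullet> w) - K w \<bullet> w"
  have *: "0 <= - 2 * t * b + t\<^sup>2 * c" for t
  proof -
    have "K (v + t *\<^sub>R w) \<bullet> (v + t *\<^sub>R w) <= m * ((v + t *\<^sub>R w) \<bullet> (v + t *\<^sub>R w))"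
      by (rule max[OF Wadd[OF vW wW]])
    moreover have "K (v + t *\<^sub>R w) \<bullet> (v + t *\<^sub>R w) = m + 2 * t * (K v \<bullet> w) + t\<^sup>2 * (K w \<bullet> w)"
      using sym[of w v] 
      by (simp add: linear_add[OF K] linear_scale[OF K] inner_add_left inner_add_right m_def inner_commute power2_eq_square algebra_simps)
    moreover have "(v + t *\<^sub>R w) \<bullet> (v + t *\<^sub>R w) = 1 + 2 * t * (v \<bullet> w) + t\<^sup>2 * (w \<bullet> w)"
      by (simp add: inner_add_left inner_add_right vv inner_commute power2_eq_square algebra_simps)
    ultimately have "m + 2 * t * (K v \<bullet> w) + t\<^sup>2 * (K w \<bullet> w) <= m * (1 + 2 * t * (v \<bullet> w) + t\<^sup>2 * (w \<bullet> w))"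
      by (simp only:)
    then show ?thesis by (simp add: b_def c_def algebra_simps)
  qed
  have "b = 0"
  proof (rule ccontr)
    assume "b \<noteq> 0"
    have c0: "0 <= c" using max[OF wW] by (simp add: c_def)
    define t where "t = b / (c + 1)"
    have b: "b = t * (c + 1)" using c0 by (simp add: t_def)
    have "0 <= - 2 * t * b + t\<^sup>2 * c" by (rule *)
    also have "... = - (t\<^sup>2 * (c + 2))" by (simp add: b power2_eq_square algebra_simps)
    finally have "t\<^sup>2 * (c + 2) <= 0" by simp
    moreover have "0 < t\<^sup>2 * (c + 2)" using c0 \<open>b \<noteq> 0\<close> by (simp add: t_def)
    ultimately show False by simp
  qed
  then have "w \<bullet> w = 0" unfolding b_def w_def by (simp add: inner_diff_left)
  then have Kv: "K v = m *\<^sub>R v" by (simp add: w_def)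
  have ve: "v \<bullet> e i = 0" "e i \<bullet> v = 0" if "i < k" for i using vW that by (auto simp: W_def inner_commute)
  have ml: "m <= l i" if "i < k" for i
    using up[OF that, of v] vW vv by (simp add: W_def m_def)
  show ?case
  proof (intro exI[of _ "e(k := v)"] exI[of _ "l(k := m)"] conjI allI impI)
    fix i j show "i < Suc k ==> j < Suc k ==> (e(k := v)) i \<bullet> (e(k := v)) j = (if i = j then 1 else 0)"
      using e ve vv by (auto simp: less_Suc_eq)
  next
    fix i show "i < Suc k ==> K ((e(k := v)) i) = (l(k := m)) i *\<^sub>R (e(k := v)) i"
      using l Kv by (auto simp: less_Suc_eq)
  next
    fix i j :: nat show "i <= j ==> j < Suc k ==> (l(k := m)) j <= (l(k := m)) i"
      using mono[of i j] ml[of i] by (auto simp: less_Suc_eq)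
  next
    fix i x assume i: "i < Suc k" and x: "\<forall>m<Suc k. x \<bullet> (e(k := v)) m = 0"
    have xW: "x \<in> W" unfolding W_def
    proof (intro CollectI allI impI)
      fix m assume "m < k" then show "x \<bullet> e m = 0" using x[rule_format, of m] by simp
    qed
    show "K x \<bullet> x <= (l(k := m)) i * (x \<bullet> x)"
      using max[OF xW] up[of i x] xW i by (auto simp: less_Suc_eq W_def)
  qed
qed

theorem spectral:
  fixes K :: "'a::euclidean_space => 'a"
  assumes K: "linear K" and sym: "\<And>x y. K x \<bullet> y = x \<bullet> K y"
  obtains e l where "onb e" "\<And>i. i < DIM('a) ==> K (e i) = l i *\<^sub>R e i"
    "\<And>i j. i <= j ==> j < DIM('a) ==> l j <= (l i :: real)"
proof -
  from spectral_step[OF K sym order_refl] obtain e :: "nat => 'a" and l :: "nat => real"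
    where *: "(\<forall>i<DIM('a). \<forall>j<DIM('a). e i \<bullet> e j = (if i = j then 1 else (0::real))) \<and> (\<forall>i<DIM('a). K (e i) = l i *\<^sub>R e i)
    \<and> (\<forall>i j. i <= j \<longrightarrow> j < DIM('a) \<longrightarrow> l j <= (l i :: real)) \<and> (\<forall>i<DIM('a). \<forall>x. (\<forall>m<DIM('a). x \<bullet> e m = 0) \<longrightarrow> K x \<bullet> x <= l i * (x \<bullet> x))"
    by (elim exE)
  show ?thesis
    by (rule that[of e l]) (use * in \<open>unfold onb_def, blast+\<close>)
qed

lemma svd:
  fixes T :: "'a::euclidean_space => 'a"
  assumes T: "linear T" and inj: "inj T"
  obtains e f s where "onb e" "onb f" "\<And>i. i < DIM('a) ==> T (f i) = s i *\<^sub>R e i"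
    "\<And>i. i < DIM('a) ==> 0 < s i" "\<And>i j. i <= j ==> j < DIM('a) ==> s j <= (s i :: real)"
    "\<And>i. i < DIM('a) ==> s i = norm (adjoint T (e i))"
proof -
  let ?A = "adjoint T"
  have A: "linear ?A" by (rule adjoint_linear[OF T])
  have AT: "x \<bullet> ?A y = T x \<bullet> y" for x y by (rule adjoint_works[OF T])
  have surj: "surj T" using linear_inj_imp_surj[OF T inj] .
  have A0: "y = 0" if "?A y = 0" for y
  proof -
    obtain x where "T x = y" using surj by (metis surjD)
    then show ?thesis using AT[of x y] that by simp
  qed
  have KL: "linear (T \<circ> ?A)" by (rule linear_compose[OF A T])
  have Ks: "(T \<circ> ?A) x \<bullet> y = x \<bullet> (T \<circ> ?A) y" for x y
    using AT[of "?A x" y] AT[of "?A y" x] by (simp add: inner_commute)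
  obtain e l where e: "onb e" and l: "\<And>i. i < DIM('a) ==> (T \<circ> ?A) (e i) = l i *\<^sub>R e i"
    and mono: "\<And>i j. i <= j ==> j < DIM('a) ==> l j <= (l i :: real)"
    using spectral[OF KL Ks] by blast
  have AA: "?A (e i) \<bullet> ?A (e j) = (if i = j then l i else 0)" if "i < DIM('a)" "j < DIM('a)" for i j
    using AT[of "?A (e i)" "e j"] l[OF that(1)] onb_inner[OF e that] by simp
  have lpos: "0 < l i" if "i < DIM('a)" for i
  proof -
    have "e i \<noteq> 0" using onb_norm[OF e that] by force
    then have "?A (e i) \<noteq> 0" using A0 by auto
    then show ?thesis using AA[OF that that] by (metis inner_gt_zero_iff)
  qed
  define s where "s i = sqrt (l i)" for i
  have spos: "0 < s i" if "i < DIM('a)" for i using lpos[OF that] by (simp add: s_def)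
  have ss: "s i * s i = l i" if "i < DIM('a)" for i using lpos[OF that] by (simp add: s_def)
  define f where "f i = ?A (e i) /\<^sub>R s i" for i
  show ?thesis
  proof (rule that[of e f s])
    show "onb e" by fact
    show "onb f" unfolding onb_def f_def
      using AA ss[symmetric] spos by (auto simp: field_simps less_imp_neq[OF spos, symmetric])
    show "T (f i) = s i *\<^sub>R e i" if "i < DIM('a)" for i
      using l[OF that] ss[OF that, symmetric] spos[OF that] by (simp add: f_def linear_scale[OF T])
    show "s j <= s i" if "i <= j" "j < DIM('a)" for i j using mono[OF that] by (simp add: s_def)
    show "s i = norm (?A (e i))" if "i < DIM('a)" for i
      using AA[OF that that] by (simp add: s_def norm_eq_sqrt_inner)
  qed (rule spos)
qed

text \<open>Haar\<close>

lemma haar_exchange: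
  fixes M N :: "'a::euclidean_space measure" and \<phi> \<psi> :: "'a => ennreal"
  assumes V: "subspace V"
    and M: "sigma_finite_measure M" "sets M = sets (restrict_space borel V)"
    and N: "sigma_finite_measure N" "sets N = sets (restrict_space borel V)"
    and M1: "\<And>v \<phi>. v \<in> V ==> \<phi> \<in> borel_measurable borel ==> (\<integral>\<^sup>+x. \<phi> (v + x) \<partial>M) = (\<integral>\<^sup>+x. \<phi> x \<partial>M)"
    and M2: "\<And>\<phi>. \<phi> \<in> borel_measurable borel ==> (\<integral>\<^sup>+x. \<phi> (- x) \<partial>M) = (\<integral>\<^sup>+x. \<phi> x \<partial>M)"
    and N1: "\<And>v \<phi>. v \<in> V ==> \<phi> \<in> borel_measurable borel ==> (\<integral>\<^sup>+x. \<phi> (v + x) \<partial>N) = (\<integral>\<^sup>+x. \<phi> x \<partial>N)"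
    and [measurable]: "borel_fun \<phi>" "borel_fun \<psi>"
  shows "(\<integral>\<^sup>+x. \<phi> x \<partial>M) * (\<integral>\<^sup>+x. \<psi> x \<partial>N) = (\<integral>\<^sup>+x. \<psi> x \<partial>M) * (\<integral>\<^sup>+x. \<phi> x \<partial>N)"
proof -
  interpret M: sigma_finite_measure M by fact
  interpret N: sigma_finite_measure N by fact
  interpret P: pair_sigma_finite M N ..
  have spM: "space M = V" using sets_eq_imp_space_eq[OF M(2)] by (simp add: space_restrict_space)
  have spN: "space N = V" using sets_eq_imp_space_eq[OF N(2)] by (simp add: space_restrict_space)
  have [measurable]: "(\<lambda>x. x) \<in> measurable M borel" "(\<lambda>x. x) \<in> measurable N borel"
    unfolding measurable_cong_sets[OF M(2) refl] measurable_cong_sets[OF N(2) refl]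
    by (auto intro: measurable_restrict_space1)
  have [measurable]: "fst \<in> borel_measurable (M \<Otimes>\<^sub>M N)" "snd \<in> borel_measurable (M \<Otimes>\<^sub>M N)"
    using measurable_compose[OF measurable_fst, of "\<lambda>x. x" M borel N]
     measurable_compose[OF measurable_snd, of "\<lambda>x. x" N borel M] by simp_all
  have "(\<integral>\<^sup>+x. \<phi> x \<partial>M) * (\<integral>\<^sup>+x. \<psi> x \<partial>N) = (\<integral>\<^sup>+x. \<phi> x * (\<integral>\<^sup>+y. \<psi> y \<partial>N) \<partial>M)"
    by (simp add: nn_integral_multc)
  also have "... = (\<integral>\<^sup>+x. \<integral>\<^sup>+y. \<phi> x * \<psi> (y - x) \<partial>N \<partial>M)"
  proof (rule nn_integral_cong)
    fix x assume "x \<in> space M"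
    then have "- x \<in> V" using spM V by (simp add: subspace_neg)
    from N1[OF this, of \<psi>] show "\<phi> x * (\<integral>\<^sup>+y. \<psi> y \<partial>N) = (\<integral>\<^sup>+y. \<phi> x * \<psi> (y - x) \<partial>N)"
      by (simp add: nn_integral_cmult)
  qed
  also have "... = (\<integral>\<^sup>+y. \<integral>\<^sup>+x. \<phi> x * \<psi> (y - x) \<partial>M \<partial>N)"
    by (rule P.Fubini'[symmetric]) (simp add: split_beta')
  also have "... = (\<integral>\<^sup>+y. \<integral>\<^sup>+x. \<psi> x * \<phi> (y - x) \<partial>M \<partial>N)"
  proof (rule nn_integral_cong)
    fix y assume "y \<in> space N"
    then have y: "y \<in> V" using spN by simp
    have "(\<integral>\<^sup>+x. \<psi> x * \<phi> (y - x) \<partial>M) = (\<integral>\<^sup>+x. \<psi> (y + x) * \<phi> (- x) \<partial>M)"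
      using M1[OF y, of "\<lambda>x. \<psi> x * \<phi> (y - x)"] by simp
    also have "... = (\<integral>\<^sup>+x. \<psi> (y - x) * \<phi> x \<partial>M)"
      using M2[of "\<lambda>x. \<psi> (y + x) * \<phi> (- x)"] by simp
    finally show "(\<integral>\<^sup>+x. \<phi> x * \<psi> (y - x) \<partial>M) = (\<integral>\<^sup>+x. \<psi> x * \<phi> (y - x) \<partial>M)"
      by (simp add: mult.commute)
  qed
  also have "... = (\<integral>\<^sup>+x. \<integral>\<^sup>+y. \<psi> x * \<phi> (y - x) \<partial>N \<partial>M)"
    by (rule P.Fubini') (simp add: split_beta')
  also have "... = (\<integral>\<^sup>+x. \<psi> x * (\<integral>\<^sup>+y. \<phi> y \<partial>N) \<partial>M)"
  proof (rule nn_integral_cong)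
    fix x assume "x \<in> space M"
    then have "- x \<in> V" using spM V by (simp add: subspace_neg)
    from N1[OF this, of \<phi>] show "(\<integral>\<^sup>+y. \<psi> x * \<phi> (y - x) \<partial>N) = \<psi> x * (\<integral>\<^sup>+y. \<phi> y \<partial>N)"
      by (simp add: nn_integral_cmult)
  qed
  also have "... = (\<integral>\<^sup>+x. \<psi> x \<partial>M) * (\<integral>\<^sup>+x. \<phi> x \<partial>N)"
    by (simp add: nn_integral_multc)
  finally show ?thesis .
qed


lemma nn_lborel_shift:
  fixes \<phi> :: "'a::euclidean_space => ennreal"
  assumes [measurable]: "borel_fun \<phi>"
  shows "(\<L> x. \<phi> (v + x)) = (\<L> x. \<phi> x)"
  by (subst (2) lborel_distr_plus[of v, symmetric]) (simp add: nn_integral_distr)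

lemma nn_lborel_neg:
  fixes \<phi> :: "'a::euclidean_space => ennreal"
  assumes [measurable]: "borel_fun \<phi>"
  shows "(\<L> x. \<phi> (- x)) = (\<L> x. \<phi> x)"
  by (subst (2) lborel_affine[of "-1" 0]) (simp_all add: nn_integral_distr density_1)

text \<open>Standard Gaussian\<close>

definition gd :: "'a::euclidean_space => real" where
  "gd z = (1 / sqrt (2 * pi)) ^ DIM('a) * exp (- (norm z)\<^sup>2 / 2)"

lemma gd_pos: "0 < gd z" by (simp add: gd_def)

lemma gd_measurable[measurable]: "borel_fun gd"
  unfolding gd_def[abs_def] by measurable

lemma gd_prod: "gd (z::'a::euclidean_space) = (\<Prod>b\<in>Basis. std_normal_density (z \<bullet> b))"
proof -
  have "(norm z)^2 = (\<Sum>b\<in>Basis. (z \<bullet> b)^2)"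
    unfolding power2_norm_eq_inner by (subst euclidean_inner) (simp add: power2_eq_square)
  then have "- (norm z)\<^sup>2 / 2 = (\<Sum>b\<in>Basis. - (z \<bullet> b)\<^sup>2 / 2)"
    by (simp add: sum_negf sum_divide_distrib[symmetric])
  then show ?thesis
    by (simp add: gd_def normal_density_def exp_sum prod_dividef power_divide)
qed

lemma nn_gd: "(\<L> z. ennreal (gd (z::'a::euclidean_space))) = 1"
proof -
  have "(\<L> x. ennreal (std_normal_density x)) = 1"
    using prob_space.emeasure_space_1[OF prob_space_normal_density[of 1 0]]
    by (simp add: emeasure_density)
  then have "(\<Prod>b\<in>(Basis::'a set). (\<L> x. ennreal (std_normal_density x))) = 1" by simp
  then show ?thesis
    unfolding gd_prod
    by (subst (asm) nn_integral_lborel_prod[symmetric]) (simp_all add: prod_ennreal)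
qed

lemma isometry_props:
  fixes U :: "'a::euclidean_space => 'a"
  assumes U: "linear U" "\<And>x. norm (U x) = norm x"
  shows "bij U" "linear (inv U)" "\<And>x. U (inv U x) = x" "\<And>x. norm (inv U x) = norm x" "\<And>x y. U x \<bullet> U y = x \<bullet> y"
proof -
  have inj: "inj U" using U by (metis linear_injective_0 norm_eq_zero)
  then show b: "bij U" using linear_inj_imp_surj[OF U(1)] by (auto simp: bij_def)
  show "linear (inv U)" using linear_inj_imp_surj[OF U(1) inj] inj U(1)
    by (metis bij_imp_bij_inv inj_iff linear_inverse_left b left_right_inverse_eq inv_unique_comp surj_iff linear_injective_left_inverse)
  show i: "U (inv U x) = x" for x using b by (simp add: bij_def surj_f_inv_f)
  show "norm (inv U x) = norm x" for x using U(2)[of "inv U x"] i by simp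
  have "(norm (U x + U y))^2 = (norm (x + y))^2" for x y
    using U(2)[of "x + y"] by (simp add: linear_add[OF U(1)])
  then show "U x \<bullet> U y = x \<bullet> y" for x y
    using U(2)[of x] U(2)[of y] unfolding dot_norm by simp
qed

lemma lborel_isometry:
  fixes U :: "'a::euclidean_space => 'a" and \<phi> :: "'a => ennreal"
  assumes U: "linear U" "\<And>x. norm (U x) = norm x" and \<phi>[measurable]: "borel_fun \<phi>"
  shows "(\<L> x. \<phi> (U x)) = (\<L> x. \<phi> x)"
proof -
  note iso = isometry_props[OF U]
  have [measurable]: "borel_fun U"
    using U(1) by (intro borel_measurable_continuous_onI linear_continuous_on linear_conv_bounded_linear[THEN iffD1])
  have gU: "gd (U z) = gd z" for z by (simp add: gd_def U)
  let ?N = "distr lborel borel U"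
  have N1: "(\<integral>\<^sup>+x. \<phi> (v + x) \<partial>?N) = (\<integral>\<^sup>+x. \<phi> x \<partial>?N)" if [measurable]: "borel_fun \<phi>" for v and \<phi> :: "'a => ennreal"
    using nn_lborel_shift[of "\<lambda>x. \<phi> (U x)" "inv U v"]
    by (simp add: nn_integral_distr linear_add[OF U(1)] iso)
  have sf: "sigma_finite_measure ?N"
  proof
    let ?A = "range (\<lambda>n::nat. ball (0::'a) n)"
    have "emeasure ?N (ball 0 n) \<noteq> \<infinity>" for n
    proof -
      have "U -` ball 0 n = ball 0 n" by (auto simp: U)
      then show ?thesis using emeasure_bounded_finite[OF bounded_ball, of "0::'a" n] by (simp add: emeasure_distr less_top[symmetric])
    qed
    moreover have "\<Union>?A = UNIV" by (auto simp: reals_Archimedean2)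
    ultimately show "\<exists>A. countable A \<and> A \<subseteq> sets ?N \<and> \<Union> A = space ?N \<and> (\<forall>a\<in>A. emeasure ?N a \<noteq> \<infinity>)"
      by (intro exI[of _ ?A]) auto
  qed
  have "(\<L> x. \<phi> x) * (\<integral>\<^sup>+x. ennreal (gd x) \<partial>?N) = (\<L> x. ennreal (gd (x::'a))) * (\<integral>\<^sup>+x. \<phi> x \<partial>?N)"
    by (rule haar_exchange[where V="UNIV :: 'a set" and M=lborel and N="?N" and \<phi>=\<phi> and \<psi>="\<lambda>x. ennreal (gd x)"])
       (auto simp: sf sigma_finite_lborel nn_lborel_shift nn_lborel_neg N1 sets_restrict_UNIV)
  then show ?thesis by (simp add: nn_integral_distr gU nn_gd)
qed

definition rot :: "(nat => 'a::euclidean_space) => 'a => 'a" where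
  "rot e x = (\<Sum>i<DIM('a). (x \<bullet> bas i) *\<^sub>R e i)"

lemma linear_rot: "linear (rot e)"
  unfolding rot_def
  by (intro linearI) (simp_all add: inner_add_left algebra_simps sum.distrib scaleR_sum_right)

lemma rot_inner:
  fixes e :: "nat => 'a::euclidean_space"
  assumes "onb e" "k < DIM('a)" shows "rot e x \<bullet> e k = x \<bullet> bas k"
  unfolding rot_def by (rule sum_onb_inner[OF assms])

lemma rot_norm: "onb e ==> norm (rot e x) = norm x"
proof -
  assume e: "onb e"
  have "(norm (rot e x))^2 = (norm x)^2"
    unfolding onb_norm2[OF e, of "rot e x"] onb_norm2[OF onb_bas, of x] by (intro sum.cong) (auto simp: rot_inner[OF e])
  then show ?thesis by simp
qed

lemma dg_rot: assumes e: "onb e" shows "dg e c (rot e x) = rot e (dg bas c x)"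
  by (rule onb_eqI[OF e]) (simp add: dg_inner[OF e] rot_inner[OF e] dg_inner[OF onb_bas])

lemma measurable_linear: 
  fixes T :: "'a::euclidean_space => 'b::euclidean_space"
  shows "linear T ==> T \<in> borel_measurable borel"
  by (intro borel_measurable_continuous_onI linear_continuous_on linear_conv_bounded_linear[THEN iffD1])

lemma dg_measurable[measurable]: "borel_fun (dg e c)"
  by (rule measurable_linear[OF linear_dg])

lemma rot_measurable[measurable]: "borel_fun (rot e)"
  by (rule measurable_linear[OF linear_rot])

lemma nn_dg:
  fixes e :: "nat => 'a::euclidean_space" and \<phi> :: "'a => ennreal"
  assumes e: "onb e" and c: "\<And>i. i < DIM('a) ==> 0 < c i" and [measurable]: "borel_fun \<phi>"
  shows "(\<L> x. \<phi> x) = ennreal (\<Prod>i<DIM('a). c i) * (\<L> x. \<phi> (dg e c x))"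
proof -
  define c' where "c' b = c (the_inv_into {..<DIM('a)} bas b)" for b :: 'a
  have b: "inj_on (bas :: nat => 'a) {..<DIM('a)}" "bas ` {..<DIM('a)} = (Basis :: 'a set)"
    using bij_bas[where 'a='a] by (auto simp: bij_betw_def)
  have c'b: "c' (bas i) = c i" if "i < DIM('a)" for i
    using that by (simp add: c'_def the_inv_into_f_f[OF b(1)])
  have c'pos: "0 < c' j" if "j \<in> Basis" for j
  proof -
    have "j \<in> bas ` {..<DIM('a)}" using b(2) that by simp
    then show ?thesis using c'b c by auto
  qed
  have T: "dg bas c x = 0 + (\<Sum>j\<in>Basis. (c' j * (x \<bullet> j)) *\<^sub>R j)" for x :: 'a
    unfolding dg_def by (simp add: sum.reindex_bij_betw[OF bij_bas, symmetric] c'b)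
  have P: "(\<Prod>i<DIM('a). c i) = (\<Prod>j\<in>Basis. \<bar>c' j\<bar>)"
  proof -
    have "(\<Prod>j\<in>Basis. \<bar>c' j\<bar>) = (\<Prod>i<DIM('a). \<bar>c' (bas i)\<bar>)"
      by (rule prod.reindex_bij_betw[OF bij_bas, symmetric])
    also have "... = (\<Prod>i<DIM('a). c i)" by (intro prod.cong) (auto simp: c'b c less_imp_le)
    finally show ?thesis ..
  qed
  have "(\<L> x. \<phi> x) = (\<L> x. \<phi> (rot e x))"
    by (rule lborel_isometry[symmetric]) (auto simp: linear_rot rot_norm[OF e])
  also have "... = (\<integral>\<^sup>+x. \<phi> (rot e x) \<partial>density (distr lborel borel (dg bas c)) (\<lambda>_. ennreal (\<Prod>i<DIM('a). c i)))"
    unfolding P T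
    by (subst lborel_affine_euclidean[of c' 0, symmetric]) (use c'pos in force, simp)
  also have "... = ennreal (\<Prod>i<DIM('a). c i) * (\<L> x. \<phi> (rot e (dg bas c x)))"
    by (simp add: nn_integral_density nn_integral_distr nn_integral_cmult)
  also have "(\<L> x. \<phi> (rot e (dg bas c x))) = (\<L> x. \<phi> (dg e c (rot e x)))"
    by (simp add: dg_rot[OF e])
  also have "... = (\<L> x. \<phi> (dg e c x))"
    by (rule lborel_isometry[of "rot e" "\<lambda>x. \<phi> (dg e c x)"]) (auto simp: linear_rot rot_norm[OF e])
  finally show ?thesis .
qed

definition gauss :: "'a::euclidean_space measure" where "gauss = density lborel (\<lambda>z. ennreal (gd z))"

abbreviation gauss_expectation :: "('a::euclidean_space => real) => real" (binder "\<E>" 10) where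
  "gauss_expectation f \<equiv> integral\<^sup>L gauss f"


lemma sets_gauss[simp, measurable_cong]: "sets gauss = sets borel" by (simp add: gauss_def)
lemma space_gauss[simp]: "space gauss = UNIV" by (simp add: gauss_def)

lemma prob_space_gauss: "prob_space gauss"
  by (intro prob_spaceI) (simp add: gauss_def emeasure_density nn_gd)

interpretation gauss: prob_space gauss by (rule prob_space_gauss)

lemma nn_gauss: "borel_fun f ==> (\<integral>\<^sup>+z. f z \<partial>gauss) = (\<L> z. ennreal (gd z) * f z)"
  by (simp add: gauss_def nn_integral_density)

lemma integral_gauss: "borel_fun f ==> (\<E> z. f z) = (\<integral>z. gd z * f z \<partial>lborel)" for f :: "_ => real"
  unfolding gauss_def by (subst integral_density) (auto simp: gd_pos less_imp_le)

lemma integrable_gauss_iff: "borel_fun f ==> integrable gauss f \<longleftrightarrow> integrable lborel (\<lambda>z. gd z * f z)" for f :: "_ => real"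
  unfolding gauss_def by (subst integrable_density) (auto simp: gd_pos less_imp_le)

lemma gauss_isometry:
  fixes U :: "'a::euclidean_space => 'a"
  assumes U: "linear U" "\<And>x. norm (U x) = norm x"
  shows "distr gauss borel U = gauss"
proof (rule measure_eqI)
  fix A assume A: "A \<in> sets (distr gauss borel U)"
  then have [measurable]: "A \<in> sets borel" by simp
  have [measurable]: "borel_fun U" by (rule measurable_linear[OF U(1)])
  have gU: "gd (U z) = gd z" for z by (simp add: gd_def U)
  have "emeasure (distr gauss borel U) A = (\<integral>\<^sup>+z. indicator A z \<partial>distr gauss borel U)" by simp
  also have "... = (\<L> z. ennreal (gd (U z)) * indicator A (U z))"
    by (simp add: nn_integral_distr nn_gauss gU del: nn_integral_indicator)
  also have "... = (\<L> z. ennreal (gd z) * indicator A z)"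
    by (rule lborel_isometry[OF U]) simp
  also have "... = emeasure gauss A" by (simp add: gauss_def emeasure_density)
  finally show "emeasure (distr gauss borel U) A = emeasure gauss A" .
qed simp

lemma gd_Pair: "gd (x::'a::euclidean_space, y::'b::euclidean_space) = gd x * gd y"
proof -
  have "- (norm (x, y))\<^sup>2 / 2 = - (norm x)\<^sup>2 / 2 + - (norm y)\<^sup>2 / 2"
    by (simp add: norm_Pair)
  then show ?thesis unfolding gd_def DIM_prod power_add by (simp only: exp_add ac_simps)
qed

lemma gauss_pair: "gauss \<Otimes>\<^sub>M gauss = (gauss :: ('a::euclidean_space \<times> 'b::euclidean_space) measure)"
proof -
  have "gauss \<Otimes>\<^sub>M gauss = density (lborel \<Otimes>\<^sub>M lborel) (\<lambda>(x::'a, y::'b). ennreal (gd x) * ennreal (gd y))"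
    unfolding gauss_def
    by (rule pair_measure_density) (auto intro: prob_space_imp_sigma_finite prob_space_gauss[unfolded gauss_def] sigma_finite_lborel)
  also have "(\<lambda>(x::'a, y::'b). ennreal (gd x) * ennreal (gd y)) = (\<lambda>z. ennreal (gd z))"
    by (auto simp: fun_eq_iff gd_Pair ennreal_mult gd_pos less_imp_le)
  finally show ?thesis by (simp add: lborel_prod gauss_def)
qed

lemma nn_scale:
  fixes \<phi> :: "'a::euclidean_space => ennreal"
  assumes c: "0 < c" and [measurable]: "borel_fun \<phi>"
  shows "(\<L> x. \<phi> x) = ennreal (c ^ DIM('a)) * (\<L> x. \<phi> (c *\<^sub>R x))"
proof -
  have *: "dg bas (\<lambda>_. c) x = c *\<^sub>R x" for x :: 'a
    by (rule onb_eqI[OF onb_bas]) (simp add: dg_inner[OF onb_bas])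
  show ?thesis using nn_dg[OF onb_bas, of "\<lambda>_. c" \<phi>] c by (simp add: *)
qed

lemma one_le_exp2: "1 + t\<^sup>2 <= 2 * exp (t::real)" if "0 <= t"
  using exp_lower_Taylor_quadratic[OF that] that by simp

lemma nn_gauss_exp: "(\<integral>\<^sup>+z. ennreal (exp (norm (z::'a::euclidean_space))) \<partial>gauss) < \<infinity>"
proof -
  let ?s = "sqrt 2 :: real"
  have b: "gd z * exp (norm z) <= exp 1 * gd ((1 / ?s) *\<^sub>R z)" for z :: 'a
  proof -
    have "0 <= (norm z / 2 - 1)^2" by simp
    then have "- (norm z)\<^sup>2 / 2 + norm z <= 1 + (- (norm ((1 / ?s) *\<^sub>R z))\<^sup>2 / 2)"
      by (simp add: power_divide power2_eq_square algebra_simps)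
    then have "exp (- (norm z)\<^sup>2 / 2 + norm z) <= exp (1 + (- (norm ((1 / ?s) *\<^sub>R z))\<^sup>2 / 2))" by simp
    then have "exp (- (norm z)\<^sup>2 / 2) * exp (norm z) <= exp 1 * exp (- (norm ((1 / ?s) *\<^sub>R z))\<^sup>2 / 2)"
      by (simp only: exp_add)
    then have "(1 / sqrt (2 * pi)) ^ DIM('a) * (exp (- (norm z)\<^sup>2 / 2) * exp (norm z)) <= (1 / sqrt (2 * pi)) ^ DIM('a) * (exp 1 * exp (- (norm ((1 / ?s) *\<^sub>R z))\<^sup>2 / 2))"
      by (intro mult_left_mono) simp_all
    then show ?thesis unfolding gd_def by (simp only: ac_simps)
  qed
  have "(\<integral>\<^sup>+z. ennreal (exp (norm (z::'a))) \<partial>gauss) = (\<L> z. ennreal (gd z * exp (norm (z::'a))))"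
    by (simp add: nn_gauss ennreal_mult gd_pos less_imp_le)
  also have "... <= (\<L> z. ennreal (exp 1) * ennreal (gd ((1 / ?s) *\<^sub>R (z::'a))))"
    by (intro nn_integral_mono) (simp add: ennreal_mult[symmetric] gd_pos less_imp_le b)
  also have "... = ennreal (exp 1) * (\<L> z. ennreal (gd ((1 / ?s) *\<^sub>R (z::'a))))"
    by (simp add: nn_integral_cmult)
  also have "(\<L> z. ennreal (gd ((1 / ?s) *\<^sub>R (z::'a)))) = ennreal (?s ^ DIM('a)) * (\<L> z. ennreal (gd (z::'a)))"
    by (subst nn_scale[of ?s]) simp_all
  finally have "(\<integral>\<^sup>+z. ennreal (exp (norm (z::'a))) \<partial>gauss) <= ennreal (exp 1 * ?s ^ DIM('a))"
    by (simp add: nn_gd ennreal_mult)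
  then show ?thesis by (rule le_less_trans) simp
qed

lemma gauss_integrable:
  fixes f :: "'a::euclidean_space => real"
  assumes [measurable]: "borel_fun f" and b: "\<And>z. \<bar>f z\<bar> <= C * exp (norm z)"
  shows "integrable gauss f"
proof (rule Bochner_Integration.integrable_bound[where f="\<lambda>z. C * exp (norm z)"])
  have "integrable gauss (\<lambda>z::'a. exp (norm z))"
    using nn_gauss_exp[where 'a='a] by (intro integrableI_bounded) auto
  then show "integrable gauss (\<lambda>z::'a. C * exp (norm z))" by simp
  show "AE z in gauss. norm (f z) <= norm (C * exp (norm z))"
    using b by (intro AE_I2) (auto intro: order_trans[OF b abs_ge_self])
qed simp

definition qg :: "('a::euclidean_space => real) => bool" where
  "qg f \<longleftrightarrow> f \<in> borel_measurable borel \<and> (\<exists>C. \<forall>y. \<bar>f y\<bar> <= C * (1 + (norm y)^2))"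

lemma qgI: "borel_fun f ==> (\<And>y. \<bar>f y\<bar> <= C * (1 + (norm y)^2)) ==> qg f"
  unfolding qg_def by blast

lemma qg_measurable[measurable_dest]: "qg f ==> f \<in> borel_measurable borel" by (simp add: qg_def)

lemma qgE: assumes "qg f" obtains C where "0 <= C" "\<And>y. \<bar>f y\<bar> <= C * (1 + (norm y)^2)"
proof -
  obtain C where C: "\<And>y. \<bar>f y\<bar> <= C * (1 + (norm y)^2)" using assms by (auto simp: qg_def)
  have "0 <= C" using C[of 0] by simp
  then show ?thesis using C that by blast
qed

lemma qg_integrable: assumes q: "qg f" shows "integrable gauss f"
proof -
  obtain C where C: "0 <= C" "\<And>y. \<bar>f y\<bar> <= C * (1 + (norm y)^2)" using qgE[OF q] by metis
  have "\<bar>f z\<bar> <= (C * 2) * exp (norm z)" for z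
    using C(2)[of z] mult_left_mono[OF one_le_exp2[OF norm_ge_zero, of z] C(1)] by simp
  then show "integrable gauss f" using q by (intro gauss_integrable[of _ "C * 2"]) auto
qed

lemma qg_add: assumes q: "qg f" "qg g" shows "qg (\<lambda>y. f y + g y)"
proof -
  obtain C where C: "\<And>y. \<bar>f y\<bar> <= C * (1 + (norm y)^2)" using qgE[OF q(1)] by metis
  obtain D where D: "\<And>y. \<bar>g y\<bar> <= D * (1 + (norm y)^2)" using qgE[OF q(2)] by metis
  have "\<bar>f y + g y\<bar> <= (C + D) * (1 + (norm y)^2)" for y
    using abs_triangle_ineq[of "f y" "g y"] C[of y] D[of y] by (simp add: algebra_simps)
  then show ?thesis using q by (intro qgI[where C="C + D"]) auto
qed

lemma qg_cmult: assumes q: "qg f" shows "qg (\<lambda>y. c * f y)"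
proof -
  obtain C where C: "\<And>y. \<bar>f y\<bar> <= C * (1 + (norm y)^2)" using qgE[OF q] by metis
  have "\<bar>c * f y\<bar> <= (\<bar>c\<bar> * C) * (1 + (norm y)^2)" for y
    using mult_left_mono[OF C[of y], of "\<bar>c\<bar>"] by (simp add: abs_mult algebra_simps)
  then show ?thesis using q by (intro qgI[where C="\<bar>c\<bar> * C"]) auto
qed

lemma qg_diff: "qg f ==> qg g ==> qg (\<lambda>y. f y - g y)"
  using qg_add[of f "\<lambda>y. (-1) * g y"] qg_cmult[of g "-1"] by simp

lemma qg_const: "qg (\<lambda>_. c)"
proof (rule qgI)
  fix y :: 'a show "\<bar>c\<bar> <= \<bar>c\<bar> * (1 + (norm y)^2)" by (simp add: mult_le_cancel_left1)
qed simp

lemma qg_norm2: "qg (\<lambda>y. (norm y)^2)"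
  by (rule qgI[where C=1]) simp_all

lemma qg_norm: "qg norm"
proof (rule qgI[where C=1])
  fix y :: 'a show "\<bar>norm y\<bar> <= 1 * (1 + (norm y)^2)"
    using sum_squares_bound[of "norm y" 1] by (auto simp: abs_if) (smt (verit) zero_le_power2)+
qed simp

lemma qg_sum: "(\<And>i. i \<in> I ==> qg (f i)) ==> qg (\<lambda>y. \<Sum>i\<in>I. f i y)"
  by (induction I rule: infinite_finite_induct) (simp_all add: qg_const qg_add)

lemma qg_affine:
  fixes B :: "'c::euclidean_space => 'a::euclidean_space"
  assumes f: "qg f" and B: "linear B" shows "qg (\<lambda>z. f (a + B z))"
proof -
  obtain C where C: "0 <= C" "\<And>y. \<bar>f y\<bar> <= C * (1 + (norm y)^2)" using qgE[OF f] by metis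
  obtain D where D: "0 < D" "\<And>z. norm (B z) <= D * norm z"
    using linear_bounded_pos[OF B] by (auto simp: mult.commute)
  have [measurable]: "borel_fun B" by (rule measurable_linear[OF B])
  note qg_measurable[OF f, measurable]
  show ?thesis
  proof (rule qgI)
    fix z
    have "(norm (a + B z))^2 <= (norm a + D * norm z)^2"
      using norm_triangle_ineq[of a "B z"] D(2)[of z] by (intro power_mono) auto
    also have "... <= 2 * (norm a)^2 + 2 * D\<^sup>2 * (norm z)^2"
      using sum_squares_bound[of "norm a" "D * norm z"] by (simp add: power2_eq_square algebra_simps)
    also have "... <= (2 * (norm a)^2 + 2 * D\<^sup>2) * (1 + (norm z)^2)"
      by (simp add: algebra_simps)
    finally have "1 + (norm (a + B z))^2 <= (1 + 2 * (norm a)^2 + 2 * D\<^sup>2) * (1 + (norm z)^2)"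
      by (simp add: algebra_simps add_increasing)
    then have "C * (1 + (norm (a + B z))^2) <= C * ((1 + 2 * (norm a)^2 + 2 * D\<^sup>2) * (1 + (norm z)^2))"
      by (rule mult_left_mono[OF _ C(1)])
    then show "\<bar>f (a + B z)\<bar> <= (C * (1 + 2 * (norm a)^2 + 2 * D\<^sup>2)) * (1 + (norm z)^2)"
      using C(2)[of "a + B z"] by (simp add: mult.assoc)
  qed measurable
qed

lemma qg_shift: "qg f ==> qg (\<lambda>z. f (a + z))"
  using qg_affine[of f "\<lambda>z. z" a] by (simp add: linear_ident[unfolded id_def] linear_id[unfolded id_def])

text \<open>Moments\<close>

lemma integral_gauss_distr:
  fixes f :: "'a::euclidean_space => real" and U :: "'a => 'a"
  assumes "linear U" "\<And>x. norm (U x) = norm x" "borel_fun f"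
  shows "(\<E> z. f (U z)) = (\<E> z. f z)"
proof -
  have "U \<in> borel_measurable gauss" using measurable_linear[OF assms(1)] by measurable
  moreover have "integral\<^sup>L (distr gauss borel U) f = integral\<^sup>L gauss f" by (simp add: gauss_isometry[OF assms(1,2)])
  ultimately show ?thesis using assms(3) by (simp add: integral_distr)
qed

lemma gauss_neg: "borel_fun f ==> (\<E> z. f (- z)) = (\<E> z. f (z::'a::euclidean_space))" for f :: "_ => real"
  by (rule integral_gauss_distr) (auto intro: linear_uminus linearI)

lemma gauss_mean: "(\<E> z. z \<bullet> v) = 0"
  using gauss_neg[of "\<lambda>z. z \<bullet> v"] by simp

lemma qg_inner2: "qg (\<lambda>z. (z \<bullet> v) * (z \<bullet> w))"
proof (rule qgI)
  fix z :: 'a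
  have "\<bar>(z \<bullet> v) * (z \<bullet> w)\<bar> <= (norm z * norm v) * (norm z * norm w)"
    unfolding abs_mult by (intro mult_mono Cauchy_Schwarz_ineq2) auto
  also have "... <= (norm v * norm w) * (1 + (norm z)^2)"
    by (simp add: power2_eq_square algebra_simps)
  finally show "\<bar>(z \<bullet> v) * (z \<bullet> w)\<bar> <= (norm v * norm w) * (1 + (norm z)^2)" .
qed simp

lemma qg_inner: "qg (\<lambda>z. z \<bullet> v)"
proof (rule qgI)
  fix z :: 'a
  have "\<bar>z \<bullet> v\<bar> <= norm v * norm z" using Cauchy_Schwarz_ineq2[of z v] by (simp add: mult.commute)
  also have "... <= norm v * (1 + (norm z)^2)"
    using sum_squares_bound[of "norm z" 1] by (intro mult_left_mono) (auto, smt (verit) zero_le_power2)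
  finally show "\<bar>z \<bullet> v\<bar> <= norm v * (1 + (norm z)^2)" .
qed simp

lemma gauss_basis2:
  fixes b :: "'a::euclidean_space"
  assumes b: "b \<in> Basis" shows "(\<E> z. (z \<bullet> b) * (z \<bullet> b)) = 1"
proof -
  define f where "f b' x = std_normal_density x * (if b' = b then x\<^sup>2 else 1)" for b' :: 'a and x :: real
  have 1: "(\<L> x. ennreal (std_normal_density x)) = 1"
    using prob_space.emeasure_space_1[OF prob_space_normal_density[of 1 0]]
    by (simp add: emeasure_density)
  have 2: "(\<L> x. ennreal (std_normal_density x * x\<^sup>2)) = 1"
    using std_normal_moment_even[of 1] 
    by (subst nn_integral_eq_integral) (auto simp: has_bochner_integral_iff fact_numeral)
  have "(\<integral>\<^sup>+z. ennreal ((z \<bullet> b) * (z \<bullet> b)) \<partial>gauss) = (\<L> z. (\<Prod>b'\<in>Basis. ennreal (f b' (z \<bullet> b'))))"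
  proof (subst nn_gauss, simp, rule nn_integral_cong)
    fix z :: 'a
    have "(\<Prod>b'\<in>Basis. f b' (z \<bullet> b')) = gd z * (\<Prod>b'\<in>Basis. if b' = b then (z \<bullet> b')^2 else 1)"
      by (simp add: f_def prod.distrib gd_prod)
    also have "(\<Prod>b'\<in>Basis. if b' = b then (z \<bullet> b')^2 else 1) = (z \<bullet> b)^2"
      using b by (subst prod.delta) auto
    finally have "(\<Prod>b'\<in>Basis. f b' (z \<bullet> b')) = gd z * (z \<bullet> b)^2" .
    moreover have "(\<Prod>b'\<in>Basis. ennreal (f b' (z \<bullet> b'))) = ennreal (\<Prod>b'\<in>Basis. f b' (z \<bullet> b'))"
      by (rule prod_ennreal) (simp add: f_def)
    ultimately show "ennreal (gd z) * ennreal ((z \<bullet> b) * (z \<bullet> b)) = (\<Prod>b'\<in>Basis. ennreal (f b' (z \<bullet> b')))"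
      by (simp add: ennreal_mult gd_pos less_imp_le power2_eq_square)
  qed
  also have "... = (\<Prod>b'\<in>Basis. (\<L> x. ennreal (f b' x)))"
    by (rule nn_integral_lborel_prod) (auto simp: f_def)
  also have "... = 1"
  proof (rule prod.neutral, intro ballI)
    fix b' :: 'a show "(\<L> x. ennreal (f b' x)) = 1"
      by (cases "b' = b") (simp_all add: f_def 1 2)
  qed
  finally show ?thesis
    using nn_integral_eq_integral[OF qg_integrable[OF qg_inner2[of b b]]]
    by simp
qed

lemma gauss_onb2:
  fixes e :: "nat => 'a::euclidean_space"
  assumes e: "onb e" and i: "i < DIM('a)" "j < DIM('a)"
  shows "(\<E> z. (z \<bullet> e i) * (z \<bullet> e j)) = (if i = j then 1 else 0)"
proof (cases "i = j")
  case True
  have "(\<E> z. (z \<bullet> e i) * (z \<bullet> e i)) = (\<E> z. (rot e z \<bullet> e i) * (rot e z \<bullet> e i))"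
    by (rule integral_gauss_distr[symmetric]) (auto simp: linear_rot rot_norm[OF e])
  also have "... = 1" using bij_bas[where 'a='a] i
    by (auto simp: rot_inner[OF e] bij_betw_def intro!: gauss_basis2)
  finally show ?thesis using True by simp
next
  case False
  define c where "c k = (if k = i then -1 else (1::real))" for k
  have n: "norm (dg e c x) = norm x" for x
  proof -
    have "(norm (dg e c x))^2 = (norm x)^2"
      unfolding dg_norm2[OF e] onb_norm2[OF e, of x] by (intro sum.cong) (auto simp: c_def)
    then show ?thesis by simp
  qed
  have "(\<E> z. (z \<bullet> e i) * (z \<bullet> e j)) = (\<E> z. (dg e c z \<bullet> e i) * (dg e c z \<bullet> e j))"
    by (rule integral_gauss_distr[symmetric]) (auto simp: linear_dg n)
  also have "... = - (\<E> z. (z \<bullet> e i) * (z \<bullet> e j))"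
    using False i by (simp add: dg_inner[OF e] c_def)
  finally show ?thesis using False by simp
qed

lemma gauss_second:
  fixes v w :: "'a::euclidean_space"
  shows "(\<E> z. (z \<bullet> v) * (z \<bullet> w)) = v \<bullet> w"
proof -
  note B = onb_bas[where 'a='a]
  have int: "integrable gauss (\<lambda>z. (v \<bullet> bas i) * (w \<bullet> bas j) * ((z \<bullet> bas i) * (z \<bullet> bas j)))" for i j
    by (intro integrable_mult_right qg_integrable qg_inner2)
  have "(z \<bullet> v) * (z \<bullet> w) = (\<Sum>i<DIM('a). \<Sum>j<DIM('a). (v \<bullet> bas i) * (w \<bullet> bas j) * ((z \<bullet> bas i) * (z \<bullet> bas j)))" for z
    unfolding onb_parseval[OF B, of z v] onb_parseval[OF B, of z w] sum_product
    by (intro sum.cong) (auto simp: algebra_simps)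
  then have "(\<E> z. (z \<bullet> v) * (z \<bullet> w)) = (\<Sum>i<DIM('a). \<Sum>j<DIM('a). (v \<bullet> bas i) * (w \<bullet> bas j) * (\<E> z. ((z::'a) \<bullet> bas i) * (z \<bullet> bas j)))"
    by (simp only: Bochner_Integration.integral_sum Bochner_Integration.integrable_sum int integral_mult_right_zero)
  also have "... = (\<Sum>i<DIM('a). \<Sum>j<DIM('a). if i = j then (v \<bullet> bas i) * (w \<bullet> bas j) else 0)"
    by (intro sum.cong) (auto simp: gauss_onb2[OF B])
  also have "... = v \<bullet> w" by (simp add: onb_parseval[OF B, of v w])
  finally show ?thesis .
qed

lemma gauss_dg2:
  fixes e :: "nat => 'a::euclidean_space"
  assumes e: "onb e" shows "(\<E> z. (norm (dg e c z))^2) = (\<Sum>i<DIM('a). (c i)^2)"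
proof -
  have "(\<E> z. (norm (dg e c z))^2) = (\<E> z. (\<Sum>i<DIM('a). (c i)^2 * ((z \<bullet> e i) * (z \<bullet> e i))))"
    by (simp only: dg_norm2[OF e] power2_eq_square[of "_ \<bullet> _"])
  also have "... = (\<Sum>i<DIM('a). (c i)^2 * (\<E> z. (z \<bullet> e i) * (z \<bullet> e i)))"
    by (simp add: integral_sum integrable_mult_right qg_integrable qg_inner2)
  also have "... = (\<Sum>i<DIM('a). (c i)^2)"
    by (intro sum.cong) (auto simp: gauss_onb2[OF e])
  finally show ?thesis .
qed

lemma gauss_norm2: "(\<E> z. (norm (z::'a::euclidean_space))^2) = DIM('a)"
  using gauss_dg2[OF onb_bas, of "\<lambda>_. 1"] by (simp add: dg_one[OF onb_bas])

lemma gauss_mix: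
  fixes e :: "nat => 'a::euclidean_space"
  assumes e: "onb e" and cd: "\<And>i. i < DIM('a) ==> (c i)\<^sup>2 + (d i)^2 = 1"
  shows "distr (gauss \<Otimes>\<^sub>M gauss) borel (\<lambda>(z, z'). dg e c z + dg e d z') = gauss"
proof -
  define U where "U p = (dg e c (fst p) + dg e d (snd p), dg e c (snd p) - dg e d (fst p))" for p
  have l: "linear U"
    unfolding U_def
    by (intro linearI) (simp_all add: linear_add[OF linear_dg] linear_scale[OF linear_dg] algebra_simps)
  have n: "norm (U p) = norm p" for p
  proof -
    have "(norm (U p))^2 = (\<Sum>i<DIM('a). ((dg e c (fst p) + dg e d (snd p)) \<bullet> e i)^2) + (\<Sum>i<DIM('a). ((dg e c (snd p) - dg e d (fst p)) \<bullet> e i)^2)"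
      by (simp add: U_def norm_Pair onb_norm2[OF e, symmetric])
    also have "... = (\<Sum>i<DIM('a). (fst p \<bullet> e i)^2) + (\<Sum>i<DIM('a). (snd p \<bullet> e i)^2)"
      unfolding sum.distrib[symmetric]
    proof (intro sum.cong refl)
      fix i assume "i \<in> {..<DIM('a)}"
      then have i: "i < DIM('a)" by simp
      let ?x = "fst p \<bullet> e i" and ?y = "snd p \<bullet> e i"
      have "((dg e c (fst p) + dg e d (snd p)) \<bullet> e i)^2 + ((dg e c (snd p) - dg e d (fst p)) \<bullet> e i)^2 = (c i * ?x + d i * ?y)^2 + (c i * ?y - d i * ?x)^2"
        by (simp add: inner_add_left inner_diff_left dg_inner[OF e i])
      also have "... = ((c i)^2 + (d i)^2) * (?x\<^sup>2 + ?y\<^sup>2)" by (simp add: power2_eq_square algebra_simps)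
      finally show "((dg e c (fst p) + dg e d (snd p)) \<bullet> e i)^2 + ((dg e c (snd p) - dg e d (fst p)) \<bullet> e i)^2 = ?x\<^sup>2 + ?y\<^sup>2"
        by (simp add: cd[OF i])
    qed
    also have "... = (norm p)^2" by (simp add: onb_norm2[OF e, symmetric] norm_prod_def)
    finally show ?thesis by simp
  qed
  have [measurable]: "borel_fun U" by (rule measurable_linear[OF l])
  have [measurable]: "fst \<in> borel_measurable (borel :: ('a \<times> 'a) measure)"
    by (intro borel_measurable_continuous_onI continuous_intros)
  have f: "distr (gauss :: ('a \<times> 'a) measure) borel fst = (gauss :: 'a measure)"
  proof -
    have "distr (gauss :: ('a \<times> 'a) measure) borel fst = distr ((gauss :: 'a measure) \<Otimes>\<^sub>M (gauss :: 'a measure)) (gauss :: 'a measure) fst"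
      unfolding gauss_pair by (rule distr_cong) simp_all
    also have "... = gauss" by (rule gauss.distr_pair_fst)
    finally show ?thesis .
  qed
  have "distr (gauss \<Otimes>\<^sub>M gauss) borel (\<lambda>(z, z'). dg e c z + dg e d z') = distr (gauss :: ('a \<times> 'a) measure) borel (fst \<circ> U)"
    unfolding gauss_pair by (rule distr_cong) (auto simp: U_def)
  also have "... = distr (distr gauss borel U) borel fst"
    by (rule distr_distr[symmetric]) simp_all
  also have "... = gauss" by (simp add: gauss_isometry[OF l n] f)
  finally show ?thesis .
qed

lemma gauss_add:
  fixes e :: "nat => 'a::euclidean_space"
  assumes e: "onb e" and d: "\<And>i. i < DIM('a) ==> 0 < d i" and cd: "\<And>i. i < DIM('a) ==> (d i)\<^sup>2 = 1 + (c i)^2"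
  shows "distr gauss borel (dg e d) = distr (gauss \<Otimes>\<^sub>M gauss) borel (\<lambda>(z, z'). z + dg e c z')"
proof -
  have "(1 / d i)^2 + (c i / d i)^2 = 1" if "i < DIM('a)" for i
    using d[OF that] by (simp add: power_divide add_divide_distrib[symmetric] cd[OF that, symmetric])
  from gauss_mix[OF e, of "\<lambda>i. 1 / d i" "\<lambda>i. c i / d i", OF this]
  have "distr gauss borel (dg e d) = distr (distr (gauss \<Otimes>\<^sub>M gauss) borel (\<lambda>(z, z'). dg e (\<lambda>i. 1 / d i) z + dg e (\<lambda>i. c i / d i) z')) borel (dg e d)"
    by simp
  also have "... = distr (gauss \<Otimes>\<^sub>M gauss) borel (dg e d \<circ> (\<lambda>(z, z'). dg e (\<lambda>i. 1 / d i) z + dg e (\<lambda>i. c i / d i) z'))"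
    by (rule distr_distr) simp_all
  also have "dg e d \<circ> (\<lambda>(z, z'). dg e (\<lambda>i. 1 / d i) z + dg e (\<lambda>i. c i / d i) z') = (\<lambda>(z, z'). z + dg e c z')"
  proof (rule ext)
    fix p :: "'a \<times> 'a" obtain z z' where p: "p = (z, z')" by force
    have "dg e d (dg e (\<lambda>i. 1 / d i) z + dg e (\<lambda>i. c i / d i) z') = z + dg e c z'"
      by (rule onb_eqI[OF e]) (use d in \<open>simp add: linear_add[OF linear_dg] inner_add_left dg_inner[OF e] less_imp_neq[OF d, symmetric]\<close>)
    then show "(dg e d \<circ> (\<lambda>(z, z'). dg e (\<lambda>i. 1 / d i) z + dg e (\<lambda>i. c i / d i) z')) p = (case p of (z, z') => z + dg e c z')"
      by (simp add: p)
  qed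
  finally show ?thesis .
qed

lemma qg_between:
  assumes [measurable]: "borel_fun f" and l: "qg l" and h: "qg h"
    and b: "\<And>y. l y <= f y" "\<And>y. f y <= h y"
  shows "qg f"
proof -
  obtain C where C: "\<And>y. \<bar>l y\<bar> <= C * (1 + (norm y)^2)" using qgE[OF l] by metis
  obtain D where D: "\<And>y. \<bar>h y\<bar> <= D * (1 + (norm y)^2)" using qgE[OF h] by metis
  show ?thesis
  proof (rule qgI)
    fix y
    have "\<bar>f y\<bar> <= \<bar>l y\<bar> + \<bar>h y\<bar>" using b[of y] by linarith
    also have "... <= (C + D) * (1 + (norm y)^2)"
      using C[of y] D[of y] by (simp add: distrib_right)
    finally show "\<bar>f y\<bar> <= (C + D) * (1 + (norm y)^2)" .
  qed simp
qed

definition gd0 :: "'a::euclidean_space itself => real" where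
  "gd0 _ = (1 / sqrt (2 * pi)) ^ DIM('a)"

lemma gd0_pos[simp]: "0 < gd0 TYPE('a::euclidean_space)" by (simp add: gd0_def)

declare gd_pos[simp]

lemma gauss_UNIV[simp]: "measure gauss UNIV = 1" using gauss.prob_space by simp

lemma gd_le: "gd (z::'a::euclidean_space) <= gd0 TYPE('a)"
  unfolding gd_def gd0_def by (simp add: mult_le_cancel_left1)

lemma ln_gd: "ln (gd (z::'a::euclidean_space)) = ln (gd0 TYPE('a)) - (norm z)^2 / 2"
  unfolding gd_def gd0_def by (subst ln_mult) auto

lemma qg_ln_gd: "qg (\<lambda>z. ln (gd z))"
  unfolding ln_gd using qg_diff[OF qg_const qg_cmult[OF qg_norm2, of "1/2"]] by simp

definition uu :: "'i set => ('i => real) => ('i => 'a::euclidean_space) => 'a => real" where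
  "uu I w x y = (\<Sum>i\<in>I. w i * gd (y - x i))"

definition kk :: "real => ('a::euclidean_space => 'b::euclidean_space) => 'b => real" where
  "kk \<delta> A c = (\<E> z. gd ((c - A z) /\<^sub>R \<delta>) / \<delta> ^ DIM('b))"

definition vv :: "real => ('a::euclidean_space => 'b::euclidean_space) => 'i set => ('i => real) => ('i => 'b) => 'b => real" where
  "vv \<delta> A I w a y = (\<Sum>i\<in>I. w i * kk \<delta> A (y - a i))"

definition BB :: "real => ('a::euclidean_space => 'b::euclidean_space) => 'a \<times> 'b => 'b" where
  "BB \<delta> A = (\<lambda>\<zeta>. A (fst \<zeta>) + \<delta> *\<^sub>R snd \<zeta>)"

definition ha :: "'i set => ('i => real) => ('i => 'a::euclidean_space) => real" where
  "ha I w x = - (\<Sum>i\<in>I. w i * (\<E> z. ln (uu I w x (x i + z))))"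

definition hb :: "real => ('a::euclidean_space => 'b::euclidean_space) => 'i set => ('i => real) => ('i => 'b) => real" where
  "hb \<delta> A I w a = - (\<Sum>i\<in>I. w i * (\<E> \<zeta>. ln (vv \<delta> A I w a (a i + BB \<delta> A \<zeta>))))"

lemma linear_BB: "linear A ==> linear (BB \<delta> A)"
  unfolding BB_def
  by (intro linearI) (simp_all add: linear_add linear_scale algebra_simps)

lemma gauss_fst_measure: "distr (gauss :: ('a::euclidean_space \<times> 'b::euclidean_space) measure) borel fst = (gauss :: 'a measure)"
proof -
  have "distr (gauss :: ('a \<times> 'b) measure) borel fst = distr ((gauss :: 'a measure) \<Otimes>\<^sub>M (gauss :: 'b measure)) (gauss :: 'a measure) fst"
    unfolding gauss_pair by (rule distr_cong) simp_all
  also have "... = gauss" by (rule gauss.distr_pair_fst)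
  finally show ?thesis .
qed

lemma fst_borel[measurable]: "fst \<in> borel_measurable (borel :: ('a::euclidean_space \<times> 'b::euclidean_space) measure)"
  by (intro borel_measurable_continuous_onI continuous_intros)

lemma snd_borel[measurable]: "snd \<in> borel_measurable (borel :: ('a::euclidean_space \<times> 'b::euclidean_space) measure)"
  by (intro borel_measurable_continuous_onI continuous_intros)

lemma integral_gauss_fst:
  fixes f :: "'a::euclidean_space => real"
  assumes [measurable]: "borel_fun f"
  shows "(\<integral>\<zeta>. f (fst \<zeta>) \<partial>(gauss :: ('a \<times> 'b::euclidean_space) measure)) = (\<E> z. f z)"
  by (subst gauss_fst_measure[where 'b='b, symmetric]) (simp add: integral_distr)

lemma integrable_gauss_fst:
  fixes f :: "'a::euclidean_space => real"
  assumes [measurable]: "borel_fun f" and i: "integrable gauss f"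
  shows "integrable (gauss :: ('a \<times> 'b::euclidean_space) measure) (\<lambda>\<zeta>. f (fst \<zeta>))"
  using i by (subst (asm) gauss_fst_measure[where 'b='b, symmetric]) (simp add: integrable_distr_eq)

lemma nn_gauss_pair:
  fixes f :: "'a::euclidean_space \<times> 'b::euclidean_space => ennreal"
  assumes [measurable]: "borel_fun f"
  shows "(\<integral>\<^sup>+\<zeta>. f \<zeta> \<partial>gauss) = (\<integral>\<^sup>+z. \<integral>\<^sup>+m. f (z, m) \<partial>gauss \<partial>gauss)"
proof -
  have [measurable]: "f \<in> borel_measurable (gauss \<Otimes>\<^sub>M gauss)" unfolding gauss_pair by simp
  show ?thesis unfolding gauss_pair[symmetric] by (rule gauss.nn_integral_fst[symmetric]) simp
qed

lemma nn_gauss_shift: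
  fixes f :: "'a::euclidean_space => ennreal"
  assumes [measurable]: "borel_fun f"
  shows "(\<integral>\<^sup>+z. f (x + z) \<partial>gauss) = (\<L> y. ennreal (gd (y - x)) * f y)"
  using nn_lborel_shift[of "\<lambda>y. ennreal (gd (y - x)) * f y" x] by (simp add: nn_gauss)

lemma integral_gauss_shift:
  fixes f :: "'a::euclidean_space => real"
  assumes f: "qg f"
  shows "(\<E> z. f (x + z)) = (\<integral>y. gd (y - x) * f y \<partial>lborel)" "integrable lborel (\<lambda>y. gd (y - x) * f y)"
proof -
  note [measurable] = qg_measurable[OF f]
  have "integrable gauss (\<lambda>z. f (x + z))" by (intro qg_integrable qg_shift f)
  then have i: "integrable lborel (\<lambda>z. gd z * f (x + z))" by (simp add: integrable_gauss_iff)
  then have i2: "integrable (distr lborel borel ((+) x)) (\<lambda>y. gd (y - x) * f y)"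
    by (subst integrable_distr_eq) simp_all
  then show "integrable lborel (\<lambda>y. gd (y - x) * f y)" by (simp add: lborel_distr_plus)
  have "(\<integral>y. gd (y - x) * f y \<partial>distr lborel borel ((+) x)) = (\<integral>z. gd z * f (x + z) \<partial>lborel)"
    by (subst integral_distr) simp_all
  then show "(\<E> z. f (x + z)) = (\<integral>y. gd (y - x) * f y \<partial>lborel)"
    by (simp add: lborel_distr_plus integral_gauss)
qed

section \<open>kernels\<close>

lemma kk_measurable_aux:
  fixes A :: "'a::euclidean_space => 'b::euclidean_space"
  assumes "linear A"
  shows "(\<lambda>(c, z). gd ((c - A z) /\<^sub>R \<delta>) / \<delta> ^ DIM('b)) \<in> borel_measurable (borel \<Otimes>\<^sub>M gauss)"
proof -
  have [measurable]: "borel_fun A" by (rule measurable_linear[OF assms])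
  show ?thesis by measurable
qed

lemma kk_measurable: "linear A ==> kk \<delta> A \<in> borel_measurable borel"
  unfolding kk_def[abs_def] by (rule gauss.borel_measurable_lebesgue_integral[OF kk_measurable_aux])

lemma kk_integrable:
  fixes A :: "'a::euclidean_space => 'b::euclidean_space"
  assumes A: "linear A" and \<delta>: "0 < \<delta>"
  shows "integrable gauss (\<lambda>z. gd ((c - A z) /\<^sub>R \<delta>) / \<delta> ^ DIM('b))"
proof (rule gauss.integrable_const_bound)
  have [measurable]: "borel_fun A" by (rule measurable_linear[OF A])
  show "(\<lambda>z. gd ((c - A z) /\<^sub>R \<delta>) / \<delta> ^ DIM('b)) \<in> borel_measurable gauss" by measurable
  show "AE z in gauss. norm (gd ((c - A z) /\<^sub>R \<delta>) / \<delta> ^ DIM('b)) <= gd0 TYPE('b) / \<delta> ^ DIM('b)"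
    using \<delta> gd_pos[of "(c - A z) /\<^sub>R \<delta>" for z] gd_le[of "(c - A z) /\<^sub>R \<delta>" for z]
    by (intro AE_I2) (auto simp: divide_right_mono less_imp_le)
qed

lemma kk_le:
  fixes A :: "'a::euclidean_space => 'b::euclidean_space"
  assumes A: "linear A" and \<delta>: "0 < \<delta>"
  shows "kk \<delta> A c <= gd0 TYPE('b) / \<delta> ^ DIM('b)"
proof -
  have "kk \<delta> A c <= (\<integral>z. gd0 TYPE('b) / \<delta> ^ DIM('b) \<partial>(gauss::'a measure))"
    unfolding kk_def using \<delta> by (intro integral_mono kk_integrable A) (auto intro!: divide_right_mono gd_le)
  then show ?thesis by simp
qed

lemma kk_ge:
  fixes A :: "'a::euclidean_space => 'b::euclidean_space"
  assumes A: "linear A" and \<delta>: "0 < \<delta>"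
  obtains D where "\<And>c. exp (ln (gd0 TYPE('b) / \<delta> ^ DIM('b)) - D * (1 + (norm c)^2)) <= kk \<delta> A c"
proof -
  let ?q = "\<lambda>c z. - (norm ((c - A z) /\<^sub>R \<delta>))\<^sup>2 / 2"
  let ?g = "gd0 TYPE('b) / \<delta> ^ DIM('b)"
  obtain M where M: "0 < M" "\<And>z. norm (A z) <= M * norm z"
    using linear_bounded_pos[OF A] by (auto simp: mult.commute)
  have g: "0 < ?g" using \<delta> by simp
  define D where "D = (1 + M\<^sup>2 * DIM('a)) / \<delta>\<^sup>2"
  have n: "(norm (y /\<^sub>R \<delta>))^2 = (norm y)^2 / \<delta>\<^sup>2" for y :: 'b
    by (simp add: power_mult_distrib power_inverse divide_inverse mult.commute)
  have qgq: "qg (?q c)" for c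
  proof -
    have "qg (\<lambda>y::'b. (-1 / (2 * \<delta>\<^sup>2)) * (norm y)^2)" by (intro qg_cmult qg_norm2)
    from qg_affine[OF this linear_compose_neg[OF A], of c]
    have "qg (\<lambda>z. (-1 / (2 * \<delta>\<^sup>2)) * (norm (c + - A z))^2)" .
    also have "(\<lambda>z. (-1 / (2 * \<delta>\<^sup>2)) * (norm (c + - A z))^2) = ?q c"
      unfolding n by (rule ext) simp
    finally show ?thesis .
  qed
  have int: "integrable gauss (?q c)" for c by (intro qg_integrable qgq)
  have low: "- D * (1 + (norm c)^2) <= integral\<^sup>L gauss (?q c)" for c
  proof -
    have "- ((norm c)^2 + M\<^sup>2 * (norm z)^2) / \<delta>\<^sup>2 <= ?q c z" for z
    proof -
      have "(norm (c - A z))^2 <= (norm c + M * norm z)^2"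
        using norm_triangle_ineq4[of c "A z"] M(2)[of z] by (intro power_mono) auto
      also have "... <= 2 * (norm c)^2 + 2 * (M\<^sup>2 * (norm z)^2)"
        using sum_squares_bound[of "norm c" "M * norm z"] by (simp add: power2_eq_square algebra_simps)
      finally have "(norm (c - A z))^2 / 2 <= (norm c)^2 + M\<^sup>2 * (norm z)^2" by simp
      from divide_right_mono[OF this, of "\<delta>\<^sup>2"] show ?thesis
        unfolding n minus_divide_left[symmetric] by (simp add: mult.commute)
    qed
    moreover have i2: "integrable gauss (\<lambda>z::'a. - ((norm c)^2 + M\<^sup>2 * (norm z)^2) / \<delta>\<^sup>2)"
      by (intro integrable_divide integrable_minus Bochner_Integration.integrable_add integrable_mult_right qg_integrable qg_norm2 qg_const)
    ultimately have "(\<E> z. - ((norm c)^2 + M\<^sup>2 * (norm (z::'a))^2) / \<delta>\<^sup>2) <= integral\<^sup>L gauss (?q c)"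
      by (intro integral_mono int) 
    moreover have "(\<E> z. - ((norm c)^2 + M\<^sup>2 * (norm (z::'a))^2) / \<delta>\<^sup>2) = - ((norm c)^2 + M\<^sup>2 * DIM('a)) / \<delta>\<^sup>2"
      by (simp add: Bochner_Integration.integral_add qg_integrable qg_norm2 gauss_norm2 gauss.prob_space)
    moreover have "- D * (1 + (norm c)^2) <= - ((norm c)^2 + M\<^sup>2 * DIM('a)) / \<delta>\<^sup>2"
    proof -
      have "0 <= M\<^sup>2 * DIM('a) * (norm c)^2" by simp
      then have "(norm c)^2 + M\<^sup>2 * DIM('a) <= (1 + M\<^sup>2 * DIM('a)) * (1 + (norm c)^2)"
        by (simp add: algebra_simps)
      from divide_right_mono[OF this, of "\<delta>\<^sup>2"] show ?thesis
        unfolding D_def minus_divide_left[symmetric] mult_minus_left times_divide_eq_left by (rule le_imp_neg_le) simp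
    qed
    ultimately show ?thesis by linarith
  qed
  have "exp (ln ?g - D * (1 + (norm c)^2)) <= kk \<delta> A c" for c
  proof -
    let ?s = "integral\<^sup>L gauss (?q c)"
    have e: "gd ((c - A z) /\<^sub>R \<delta>) / \<delta> ^ DIM('b) = ?g * exp (?q c z)" for z
      by (simp add: gd_def gd0_def)
    have "exp (ln ?g - D * (1 + (norm c)^2)) = ?g * exp (- D * (1 + (norm c)^2))"
      using g by (simp add: exp_diff exp_minus divide_inverse)
    also have "... <= ?g * exp ?s"
      using g low by (intro mult_left_mono) auto
    also have "... = (\<E> z. ?g * (exp ?s * (1 + (?q c z - ?s))))"
      using int[of c] by (simp add: gauss.prob_space)
    also have "... <= (\<E> z. ?g * exp (?q c z))"
    proof (rule integral_mono)
      show "integrable gauss (\<lambda>z. ?g * (exp ?s * (1 + (?q c z - ?s))))" using int[of c] by simp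
      show "integrable gauss (\<lambda>z. ?g * exp (?q c z))" using kk_integrable[OF A \<delta>, of c] by (simp only: e)
      fix z
      have "exp ?s * (1 + (?q c z - ?s)) <= exp ?s * exp (?q c z - ?s)"
        by (intro mult_left_mono exp_ge_add_one_self) simp
      also have "... = exp (?q c z)" by (simp add: exp_add[symmetric])
      finally show "?g * (exp ?s * (1 + (?q c z - ?s))) <= ?g * exp (?q c z)"
        using g by (intro mult_left_mono) auto
    qed
    also have "... = kk \<delta> A c" unfolding kk_def e ..
    finally show ?thesis .
  qed
  then show ?thesis by (rule that)
qed

lemma kk_pos: "linear A ==> 0 < \<delta> ==> 0 < kk \<delta> A c"
  by (rule kk_ge[of A \<delta>]) (auto intro: less_le_trans[OF exp_gt_zero])

lemma nn_BB:
  fixes A :: "'a::euclidean_space => 'b::euclidean_space" and \<phi> :: "'b => ennreal"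
  assumes A: "linear A" and \<delta>: "0 < \<delta>" and [measurable]: "borel_fun \<phi>"
  shows "(\<integral>\<^sup>+\<zeta>. \<phi> (c + BB \<delta> A \<zeta>) \<partial>gauss) = (\<L> y. ennreal (kk \<delta> A (y - c)) * \<phi> y)"
proof -
  have [measurable]: "borel_fun A" by (rule measurable_linear[OF A])
  have [measurable]: "BB \<delta> A \<in> borel_measurable borel" by (rule measurable_linear[OF linear_BB[OF A]])
  let ?K = "\<lambda>c z. gd ((c - A z) /\<^sub>R \<delta>) / \<delta> ^ DIM('b)"
  have K0: "0 <= ?K c z" for c z using \<delta> by (simp add: gd_pos less_imp_le)
  have "(\<integral>\<^sup>+\<zeta>. \<phi> (c + BB \<delta> A \<zeta>) \<partial>gauss) = (\<integral>\<^sup>+z. \<integral>\<^sup>+m. \<phi> (c + (A z + \<delta> *\<^sub>R m)) \<partial>gauss \<partial>gauss)"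
    by (subst nn_gauss_pair) (simp_all add: BB_def)
  also have "... = (\<integral>\<^sup>+z. (\<L> y. ennreal (?K (y - c) z) * \<phi> y) \<partial>gauss)"
  proof (rule nn_integral_cong)
    fix z :: 'a
    have "(\<L> y. ennreal (?K (y - c) z) * \<phi> y) = (\<L> y. ennreal (?K ((c + A z + y) - c) z) * \<phi> (c + A z + y))"
      by (rule nn_lborel_shift[symmetric]) simp
    also have "... = ennreal (\<delta> ^ DIM('b)) * (\<L> y. ennreal (gd y / \<delta> ^ DIM('b)) * \<phi> (c + A z + \<delta> *\<^sub>R y))"
      using \<delta> by (subst nn_scale[OF \<delta>]) simp_all
    also have "... = (\<L> y. ennreal (\<delta> ^ DIM('b)) * (ennreal (gd y / \<delta> ^ DIM('b)) * \<phi> (c + A z + \<delta> *\<^sub>R y)))"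
      by (rule nn_integral_cmult[symmetric]) simp
    also have "... = (\<L> y. ennreal (gd y) * \<phi> (c + A z + \<delta> *\<^sub>R y))"
      using \<delta> by (intro nn_integral_cong) (simp add: mult.assoc[symmetric] ennreal_mult[symmetric] gd_pos less_imp_le)
    also have "... = (\<integral>\<^sup>+m. \<phi> (c + (A z + \<delta> *\<^sub>R m)) \<partial>gauss)"
      by (simp add: nn_gauss add.assoc)
    finally show "(\<integral>\<^sup>+m. \<phi> (c + (A z + \<delta> *\<^sub>R m)) \<partial>gauss) = (\<L> y. ennreal (?K (y - c) z) * \<phi> y)" ..
  qed
  also have "... = (\<L> y. \<integral>\<^sup>+z. ennreal (?K (y - c) z) * \<phi> y \<partial>gauss)"
  proof -
    interpret pair_sigma_finite "gauss :: 'a measure" "lborel :: 'b measure" ..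
    show ?thesis by (rule Fubini'[symmetric]) measurable
  qed
  also have "... = (\<L> y. ennreal (kk \<delta> A (y - c)) * \<phi> y)"
  proof (rule nn_integral_cong)
    fix y :: 'b
    have "(\<integral>\<^sup>+z. ennreal (?K (y - c) z) * \<phi> y \<partial>gauss) = (\<integral>\<^sup>+z. ennreal (?K (y - c) z) \<partial>gauss) * \<phi> y"
      by (rule nn_integral_multc) simp
    also have "(\<integral>\<^sup>+z. ennreal (?K (y - c) z) \<partial>gauss) = ennreal (kk \<delta> A (y - c))"
      unfolding kk_def by (rule nn_integral_eq_integral[OF kk_integrable[OF A \<delta>]]) (use K0 in auto)
    finally show "(\<integral>\<^sup>+z. ennreal (?K (y - c) z) * \<phi> y \<partial>gauss) = ennreal (kk \<delta> A (y - c)) * \<phi> y" .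
  qed
  finally show ?thesis .
qed

locale mixture =
  fixes I :: "'i set" and w :: "'i => real"
  assumes fin: "finite I" and wpos: "\<And>i. i \<in> I ==> 0 < w i" and wsum: "(\<Sum>i\<in>I. w i) = 1"
begin

lemma nonempty: "I \<noteq> {}" using wsum by auto

lemma avg_le: "(\<And>i. i \<in> I ==> f i <= c) ==> (\<Sum>i\<in>I. w i * f i) <= c"
  using sum_mono[of I "\<lambda>i. w i * f i" "\<lambda>i. w i * c"] wpos
  by (simp add: sum_distrib_right[symmetric] wsum less_imp_le mult_left_mono)

lemma avg_const: "(\<Sum>i\<in>I. w i * c) = c" by (simp add: sum_distrib_right[symmetric] wsum)

lemma uu_measurable[measurable]: "borel_fun (uu I w x)"
  unfolding uu_def[abs_def] by measurable

lemma uu_pos: "0 < uu I w x y"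
  unfolding uu_def using fin nonempty wpos by (intro sum_pos) (auto simp: gd_pos)

lemma uu_le: "uu I w x (y::'a::euclidean_space) <= gd0 TYPE('a)"
  unfolding uu_def by (rule avg_le) (rule gd_le)

lemma qg_ln_uu: 
  fixes x :: "'i => 'a::euclidean_space" shows "qg (\<lambda>y. ln (uu I w x y))"
proof -
  obtain i where i: "i \<in> I" using nonempty by auto
  have "w i * gd (y - x i) <= uu I w x y" for y
    unfolding uu_def using wpos i fin by (intro member_le_sum) (auto simp: gd_pos less_imp_le)
  then have "ln (w i * gd (y - x i)) <= ln (uu I w x y)" for y
    using wpos[OF i] uu_pos by (subst ln_le_cancel_iff) auto
  then have lo: "ln (w i) + ln (gd (- x i + y)) <= ln (uu I w x y)" for y
    using wpos[OF i] less_imp_neq[OF gd_pos[of "y - x i"]] by (simp add: ln_mult less_imp_neq[OF gd_pos, symmetric])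
  have hi: "ln (uu I w x y) <= ln (gd0 TYPE('a))" for y using uu_pos uu_le by (subst ln_le_cancel_iff) auto
  show ?thesis
    by (rule qg_between[OF _ qg_add[OF qg_const[of "ln (w i)"] qg_shift[OF qg_ln_gd, of "- x i"]] qg_const[of "ln (gd0 TYPE('a))"] lo hi])
       measurable
qed

lemma nn_uu:
  assumes [measurable]: "borel_fun \<phi>"
  shows "(\<Sum>i\<in>I. ennreal (w i) * (\<integral>\<^sup>+z. \<phi> (x i + z) \<partial>gauss)) = (\<L> y. ennreal (uu I w x y) * \<phi> y)"
proof -
  have "(\<Sum>i\<in>I. ennreal (w i) * (\<integral>\<^sup>+z. \<phi> (x i + z) \<partial>gauss)) = (\<Sum>i\<in>I. (\<L> y. ennreal (w i) * (ennreal (gd (y - x i)) * \<phi> y)))"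
    by (simp add: nn_gauss_shift nn_integral_cmult)
  also have "... = (\<L> y. (\<Sum>i\<in>I. ennreal (w i) * (ennreal (gd (y - x i)) * \<phi> y)))"
    by (rule nn_integral_sum[symmetric]) simp
  also have "... = (\<L> y. ennreal (uu I w x y) * \<phi> y)"
  proof (rule nn_integral_cong)
    fix y
    have "(\<Sum>i\<in>I. ennreal (w i) * (ennreal (gd (y - x i)) * \<phi> y)) = (\<Sum>i\<in>I. ennreal (w i * gd (y - x i))) * \<phi> y"
      unfolding sum_distrib_right using wpos by (intro sum.cong) (auto simp: ennreal_mult gd_pos less_imp_le mult.assoc)
    also have "(\<Sum>i\<in>I. ennreal (w i * gd (y - x i))) = ennreal (uu I w x y)"
      unfolding uu_def using wpos by (intro sum_ennreal) (auto simp: gd_pos less_imp_le)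
    finally show "(\<Sum>i\<in>I. ennreal (w i) * (ennreal (gd (y - x i)) * \<phi> y)) = ennreal (uu I w x y) * \<phi> y" .
  qed
  finally show ?thesis .
qed

lemma sum_w_ennreal: "(\<Sum>i\<in>I. ennreal (w i)) = 1"
  using sum_ennreal[of I w] wpos by (simp add: wsum less_imp_le)

lemma nn_uu1: "(\<L> y. ennreal (uu I w x y)) = 1"
  using nn_uu[of "\<lambda>_. 1" x] by (simp add: gauss.emeasure_space_1[simplified] sum_w_ennreal)

lemma vv_measurable: "linear A ==> vv \<delta> A I w a \<in> borel_measurable borel"
proof -
  assume "linear A"
  note [measurable] = kk_measurable[OF this]
  show ?thesis unfolding vv_def[abs_def] by measurable
qed

lemma vv_pos: "linear A ==> 0 < \<delta> ==> 0 < vv \<delta> A I w a y"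
  unfolding vv_def using fin nonempty wpos by (intro sum_pos) (auto simp: kk_pos)

lemma qg_ln_vv: 
  fixes A :: "'a::euclidean_space => 'b::euclidean_space"
  assumes A: "linear A" and \<delta>: "0 < \<delta>" shows "qg (\<lambda>y. ln (vv \<delta> A I w a y))"
proof -
  obtain i where i: "i \<in> I" using nonempty by auto
  let ?g = "gd0 TYPE('b) / \<delta> ^ DIM('b)"
  obtain D where D: "\<And>c. exp (ln ?g - D * (1 + (norm c)^2)) <= kk \<delta> A c" using kk_ge[OF A \<delta>] by metis
  note [measurable] = vv_measurable[OF A]
  let ?l = "\<lambda>y. ln (w i) + (ln ?g - D * (1 + (norm (- a i + y))^2))"
  show ?thesis
  proof (rule qg_between[where l="?l" and h="\<lambda>_. ln ?g"])
    have "qg (\<lambda>y::'b. ln (w i) + (ln ?g - D * (1 + (norm y)^2)))"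
      by (intro qg_add qg_diff qg_cmult qg_const qg_norm2)
    from qg_shift[OF this, of "- a i"] show "qg ?l" .
    show "qg (\<lambda>_::'b. ln ?g)" by (rule qg_const)
    fix y
    have "exp (?l y) = w i * exp (ln ?g - D * (1 + (norm (- a i + y))^2))" using wpos[OF i] by (simp add: exp_add)
    also have "... <= w i * kk \<delta> A (y - a i)"
      using D[of "y - a i"] wpos[OF i] by (intro mult_left_mono) auto
    also have "... <= vv \<delta> A I w a y"
      unfolding vv_def using wpos i fin by (intro member_le_sum) (auto simp: kk_pos[OF A \<delta>] less_imp_le)
    finally show "?l y <= ln (vv \<delta> A I w a y)" using vv_pos[OF A \<delta>] by (simp add: ln_ge_iff)
    have "vv \<delta> A I w a y <= ?g" unfolding vv_def by (rule avg_le) (rule kk_le[OF A \<delta>])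
    then show "ln (vv \<delta> A I w a y) <= ln ?g" using vv_pos[OF A \<delta>] \<delta> by (subst ln_le_cancel_iff) auto
  qed simp
qed

lemma nn_vv:
  fixes A :: "'a::euclidean_space => 'b::euclidean_space"
  assumes A: "linear A" and \<delta>: "0 < \<delta>" and [measurable]: "borel_fun \<phi>"
  shows "(\<Sum>i\<in>I. ennreal (w i) * (\<integral>\<^sup>+\<zeta>. \<phi> (a i + BB \<delta> A \<zeta>) \<partial>gauss)) = (\<L> y. ennreal (vv \<delta> A I w a y) * \<phi> y)"
proof -
  note [measurable] = kk_measurable[OF A]
  have "(\<Sum>i\<in>I. ennreal (w i) * (\<integral>\<^sup>+\<zeta>. \<phi> (a i + BB \<delta> A \<zeta>) \<partial>gauss)) = (\<Sum>i\<in>I. (\<L> y. ennreal (w i) * (ennreal (kk \<delta> A (y - a i)) * \<phi> y)))"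
    by (simp add: nn_BB[OF A \<delta>] nn_integral_cmult)
  also have "... = (\<L> y. (\<Sum>i\<in>I. ennreal (w i) * (ennreal (kk \<delta> A (y - a i)) * \<phi> y)))"
    by (rule nn_integral_sum[symmetric]) simp
  also have "... = (\<L> y. ennreal (vv \<delta> A I w a y) * \<phi> y)"
  proof (rule nn_integral_cong)
    fix y
    have "(\<Sum>i\<in>I. ennreal (w i) * (ennreal (kk \<delta> A (y - a i)) * \<phi> y)) = (\<Sum>i\<in>I. ennreal (w i * kk \<delta> A (y - a i))) * \<phi> y"
      unfolding sum_distrib_right using wpos by (intro sum.cong) (auto simp: ennreal_mult kk_pos[OF A \<delta>] less_imp_le mult.assoc)
    also have "(\<Sum>i\<in>I. ennreal (w i * kk \<delta> A (y - a i))) = ennreal (vv \<delta> A I w a y)"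
      unfolding vv_def using wpos by (intro sum_ennreal) (auto simp: kk_pos[OF A \<delta>] less_imp_le)
    finally show "(\<Sum>i\<in>I. ennreal (w i) * (ennreal (kk \<delta> A (y - a i)) * \<phi> y)) = ennreal (vv \<delta> A I w a y) * \<phi> y" .
  qed
  finally show ?thesis .
qed

lemma nn_vv1:
  assumes A: "linear A" and \<delta>: "0 < \<delta>"
  shows "(\<L> y. ennreal (vv \<delta> A I w a y)) = 1"
  using nn_vv[OF A \<delta>, of "\<lambda>_. 1" a] by (simp add: gauss.emeasure_space_1[simplified] sum_w_ennreal)

text \<open>Gibbs inequality\<close>

lemma gibbs:
  fixes t :: "'i => 'c::euclidean_space => real"
  assumes [measurable]: "\<And>i. i \<in> I ==> t i \<in> borel_measurable borel" and pos: "\<And>i z. i \<in> I ==> 0 < t i z"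
    and int: "\<And>i. i \<in> I ==> integrable gauss (\<lambda>z. ln (t i z))"
    and le: "(\<Sum>i\<in>I. ennreal (w i) * (\<integral>\<^sup>+z. ennreal (t i z) \<partial>gauss)) <= 1"
  shows "(\<Sum>i\<in>I. w i * (\<E> z. ln (t i z))) <= 0"
proof -
  have f: "(\<integral>\<^sup>+z. ennreal (t i z) \<partial>gauss) < \<infinity>" if i: "i \<in> I" for i
  proof (rule ccontr)
    assume "\<not> ?thesis"
    then have "ennreal (w i) * (\<integral>\<^sup>+z. ennreal (t i z) \<partial>gauss) = \<infinity>"
      using wpos[OF i] by (simp add: less_top[symmetric] ennreal_mult_eq_top_iff)
    moreover have "ennreal (w i) * (\<integral>\<^sup>+z. ennreal (t i z) \<partial>gauss) <= (\<Sum>i\<in>I. ennreal (w i) * (\<integral>\<^sup>+z. ennreal (t i z) \<partial>gauss))"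
      by (rule member_le_sum[OF i _ fin]) simp
    ultimately show False using le by (metis ennreal_one_less_top infinity_ennreal_def leD order_trans top.extremum_uniqueI ennreal_one_neq_top)
  qed
  have ti: "integrable gauss (t i)" if i: "i \<in> I" for i
    using f[OF i] pos[OF i] i by (intro integrableI_nonneg) (auto simp: less_imp_le)
  have "(\<E> z. ln (t i z)) <= (\<E> z. t i z) - 1" if i: "i \<in> I" for i
  proof -
    have "(\<E> z. ln (t i z)) <= (\<E> z. t i z - 1)"
      using int[OF i] ti[OF i] pos[OF i] by (intro integral_mono) (auto simp: ln_le_minus_one)
    then show ?thesis using ti[OF i] by (simp add: gauss.prob_space)
  qed
  then have "(\<Sum>i\<in>I. w i * (\<E> z. ln (t i z))) <= (\<Sum>i\<in>I. w i * ((\<E> z. t i z) - 1))"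
    using wpos by (intro sum_mono mult_left_mono) (auto simp: less_imp_le)
  also have "... = (\<Sum>i\<in>I. w i * (\<E> z. t i z)) - 1"
    by (simp add: right_diff_distrib sum_subtractf wsum)
  also have "(\<Sum>i\<in>I. w i * (\<E> z. t i z)) <= 1"
  proof -
    have "(\<Sum>i\<in>I. ennreal (w i) * (\<integral>\<^sup>+z. ennreal (t i z) \<partial>gauss)) = (\<Sum>i\<in>I. ennreal (w i * (\<E> z. t i z)))"
    proof (rule sum.cong[OF refl])
      fix i assume i: "i \<in> I"
      have "(\<integral>\<^sup>+z. ennreal (t i z) \<partial>gauss) = ennreal (\<E> z. t i z)"
        using ti[OF i] pos[OF i] by (intro nn_integral_eq_integral) (auto simp: less_imp_le)
      then show "ennreal (w i) * (\<integral>\<^sup>+z. ennreal (t i z) \<partial>gauss) = ennreal (w i * (\<E> z. t i z))"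
        using wpos[OF i] pos[OF i] by (simp add: ennreal_mult less_imp_le)
    qed
    also have "... = ennreal (\<Sum>i\<in>I. w i * (\<E> z. t i z))"
      using wpos pos by (intro sum_ennreal) (auto simp: less_imp_le intro!: mult_nonneg_nonneg integral_nonneg)
    finally show ?thesis using le by simp
  qed
  finally show ?thesis by simp
qed

lemma hb_gibbs:
  fixes A :: "'a::euclidean_space => 'b::euclidean_space"
  assumes A: "linear A" and \<delta>: "0 < \<delta>" and [measurable]: "borel_fun r" and r: "\<And>y. 0 < r y" "qg (\<lambda>y. ln (r y))"
    and le: "(\<L> y. ennreal (r y)) <= 1"
  shows "hb \<delta> A I w a <= - (\<Sum>i\<in>I. w i * (\<E> \<zeta>. ln (r (a i + BB \<delta> A \<zeta>))))"
proof -
  let ?v = "vv \<delta> A I w a"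
  note [measurable] = vv_measurable[OF A] measurable_linear[OF linear_BB[OF A]]
  define t where "t i \<zeta> = r (a i + BB \<delta> A \<zeta>) / ?v (a i + BB \<delta> A \<zeta>)" for i \<zeta>
  have lt: "ln (t i \<zeta>) = ln (r (a i + BB \<delta> A \<zeta>)) - ln (?v (a i + BB \<delta> A \<zeta>))" for i \<zeta>
    unfolding t_def using r(1)[of "a i + BB \<delta> A \<zeta>"] vv_pos[OF A \<delta>, of a "a i + BB \<delta> A \<zeta>"] by (simp add: ln_div)
  have i1: "integrable gauss (\<lambda>\<zeta>. ln (r (a i + BB \<delta> A \<zeta>)))" for i
    by (intro qg_integrable qg_affine[OF r(2)] linear_BB A)
  have i2: "integrable gauss (\<lambda>\<zeta>. ln (?v (a i + BB \<delta> A \<zeta>)))" for i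
    by (intro qg_integrable qg_affine[OF qg_ln_vv] linear_BB A \<delta>)
  have "(\<Sum>i\<in>I. ennreal (w i) * (\<integral>\<^sup>+\<zeta>. ennreal (t i \<zeta>) \<partial>gauss)) = (\<L> y. ennreal (?v y) * ennreal (r y / ?v y))"
    unfolding t_def by (rule nn_vv[OF A \<delta>]) simp
  also have "... = (\<L> y. ennreal (r y))"
    using r(1) vv_pos[OF A \<delta>, of a]
    by (intro nn_integral_cong) (simp add: ennreal_mult[symmetric] less_imp_le less_imp_neq[symmetric])
  finally have "(\<Sum>i\<in>I. ennreal (w i) * (\<integral>\<^sup>+\<zeta>. ennreal (t i \<zeta>) \<partial>gauss)) <= 1" using le by simp
  then have "(\<Sum>i\<in>I. w i * (\<E> \<zeta>. ln (t i \<zeta>))) <= 0"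
    by (intro gibbs) (auto simp: lt i1 i2, auto simp: t_def r vv_pos A \<delta>)
  then show ?thesis
    unfolding lt hb_def by (simp add: i1 i2 right_diff_distrib sum_subtractf)
qed

lemma ha_gibbs:
  fixes x :: "'i => 'a::euclidean_space"
  assumes [measurable]: "borel_fun r" and r: "\<And>y. 0 < r y" "qg (\<lambda>y. ln (r y))"
    and le: "(\<L> y. ennreal (r y)) <= 1"
  shows "ha I w x <= - (\<Sum>i\<in>I. w i * (\<E> z. ln (r (x i + z))))"
proof -
  let ?v = "uu I w x"
  define t where "t i z = r (x i + z) / ?v (x i + z)" for i z
  have lt: "ln (t i z) = ln (r (x i + z)) - ln (?v (x i + z))" for i z
    unfolding t_def using r(1)[of "x i + z"] uu_pos[of x "x i + z"] by (simp add: ln_div)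
  have i1: "integrable gauss (\<lambda>z. ln (r (x i + z)))" for i
    by (intro qg_integrable qg_shift[OF r(2)])
  have i2: "integrable gauss (\<lambda>z. ln (?v (x i + z)))" for i
    by (intro qg_integrable qg_shift[OF qg_ln_uu])
  have "(\<Sum>i\<in>I. ennreal (w i) * (\<integral>\<^sup>+z. ennreal (t i z) \<partial>gauss)) = (\<L> y. ennreal (?v y) * ennreal (r y / ?v y))"
    unfolding t_def by (rule nn_uu) simp
  also have "... = (\<L> y. ennreal (r y))"
    using r(1) uu_pos[of x]
    by (intro nn_integral_cong) (simp add: ennreal_mult[symmetric] less_imp_le less_imp_neq[symmetric])
  finally have "(\<Sum>i\<in>I. ennreal (w i) * (\<integral>\<^sup>+z. ennreal (t i z) \<partial>gauss)) <= 1" using le by simp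
  then have "(\<Sum>i\<in>I. w i * (\<E> z. ln (t i z))) <= 0"
    by (intro gibbs) (auto simp: lt i1 i2, auto simp: t_def r uu_pos)
  then show ?thesis
    unfolding lt ha_def by (simp add: i1 i2 right_diff_distrib sum_subtractf)
qed

end

lemma exp_taylor2:
  fixes t b :: real assumes "\<bar>t\<bar> <= b" "b <= 1"
  shows "\<bar>exp t - 1 - t - t\<^sup>2 / 2\<bar> <= b ^ 3 / 2"
proof -
  obtain s where s: "\<bar>s\<bar> <= \<bar>t\<bar>" "exp t = (\<Sum>m<3. t ^ m / fact m) + (exp s / fact 3) * t ^ 3"
    using Maclaurin_exp_le[of t 3] by blast
  have "exp t - 1 - t - t\<^sup>2 / 2 = (exp s / 6) * t ^ 3"
    using s(2) by (simp add: eval_nat_numeral fact_numeral)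
  moreover have "exp s <= 3" using s(1) assms exp_le order_trans[of "exp s" "exp 1" 3] by auto
  moreover have "\<bar>t\<bar> ^ 3 <= b ^ 3" using assms by (intro power_mono) auto
  ultimately have "\<bar>exp t - 1 - t - t\<^sup>2 / 2\<bar> = (exp s / 6) * \<bar>t\<bar> ^ 3"
    by (simp only: abs_mult power_abs) simp
  also have "... <= (3 / 6) * b ^ 3"
    using \<open>exp s <= 3\<close> \<open>\<bar>t\<bar> ^ 3 <= b ^ 3\<close> by (intro mult_mono) auto
  finally show ?thesis by simp
qed

lemma cumulant_bound:
  fixes p t :: "'i => real"
  assumes I: "finite I" and p: "\<And>i. i \<in> I ==> 0 <= p i" "(\<Sum>i\<in>I. p i) = 1" and m: "(\<Sum>i\<in>I. p i * t i) = 0"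
    and b: "\<And>i. i \<in> I ==> \<bar>t i\<bar> <= b"
  shows "\<bar>ln (\<Sum>i\<in>I. p i * exp (t i)) - (\<Sum>i\<in>I. p i * (t i)^2) / 2\<bar> <= 2 * b ^ 3"
proof -
  define S where "S = (\<Sum>i\<in>I. p i * exp (t i))"
  define V where "V = (\<Sum>i\<in>I. p i * (t i)^2)"
  have "I \<noteq> {}" using p(2) by auto
  then have b0: "0 <= b" using b by (metis abs_ge_zero all_not_in_conv order_trans)
  have wavg: "(\<Sum>i\<in>I. p i * c) = c" for c by (simp add: sum_distrib_right[symmetric] p)
  have "(\<Sum>i\<in>I. p i * (1 + t i)) <= S"
    unfolding S_def using p(1) by (intro sum_mono mult_left_mono) auto
  moreover have "(\<Sum>i\<in>I. p i * (1 + t i)) = 1" by (simp add: distrib_left sum.distrib m p)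
  ultimately have S1: "1 <= S" by simp
  have V0: "0 <= V" unfolding V_def using p(1) by (intro sum_nonneg) auto
  have "V <= (\<Sum>i\<in>I. p i * b\<^sup>2)"
    unfolding V_def using p(1) b b0 by (intro sum_mono mult_left_mono) (auto simp: abs_le_square_iff[symmetric])
  then have Vb: "V <= b\<^sup>2" by (simp add: wavg)
  have "S <= (\<Sum>i\<in>I. p i * exp b)"
    unfolding S_def using p(1) b by (intro sum_mono mult_left_mono) (auto simp: abs_le_iff)
  then have "S <= exp b" by (simp add: wavg)
  then have lSb: "ln S <= b" using S1 ln_mono[of S "exp b"] by simp
  have lS0: "0 <= ln S" using S1 by simp
  show ?thesis unfolding S_def[symmetric] V_def[symmetric]
  proof (cases "b <= 1")
    case False
    then have "b <= b ^ 3" "b\<^sup>2 <= b ^ 3" using b0 self_le_power[of b 3] power_increasing[of 2 3 b] by auto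
    then show "\<bar>ln S - V / 2\<bar> <= 2 * b ^ 3" using lSb lS0 V0 Vb by (simp add: abs_if)
  next
    case True
    have "\<bar>S - 1 - V / 2\<bar> <= b ^ 3 / 2"
    proof -
      have "S - 1 - V / 2 = (\<Sum>i\<in>I. p i * (exp (t i) - 1 - t i - (t i)^2 / 2))"
        unfolding S_def V_def using m p(2)
        by (simp add: right_diff_distrib sum_subtractf sum_divide_distrib)
      also have "\<bar>...\<bar> <= (\<Sum>i\<in>I. p i * (b ^ 3 / 2))"
      proof (intro order_trans[OF sum_abs] sum_mono)
        fix i assume i: "i \<in> I"
        show "\<bar>p i * (exp (t i) - 1 - t i - (t i)^2 / 2)\<bar> <= p i * (b ^ 3 / 2)"
          unfolding abs_mult abs_of_nonneg[OF p(1)[OF i]] by (rule mult_left_mono[OF exp_taylor2[OF b[OF i] True] p(1)[OF i]])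
      qed
      finally show ?thesis unfolding wavg .
    qed
    from abs_le_D1[OF this] abs_le_D2[OF this]
    have u: "S - 1 <= V / 2 + b ^ 3 / 2" and l: "V / 2 - b ^ 3 / 2 <= S - 1" by linarith+
    have b32: "b ^ 3 <= b\<^sup>2" using b0 True power_decreasing[of 2 3 b] by simp
    have Sb: "S - 1 <= b\<^sup>2" using u Vb b32 by simp
    have b21: "b\<^sup>2 <= 1" using b0 True by (simp add: power_le_one)
    have "ln S <= S - 1" using S1 by (intro ln_le_minus_one) simp
    moreover have "(S - 1) - (S - 1)^2 <= ln S"
      using ln_one_plus_pos_lower_bound[of "S - 1"] S1 Sb b21 by simp
    moreover have "(S - 1)^2 <= b ^ 3"
    proof -
      have "(S - 1)^2 <= (b\<^sup>2)^2" using S1 Sb by (intro power_mono) auto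
      also have "... = b ^ 4" by (simp flip: power_mult)
      also have "... <= b ^ 3" using b0 True by (intro power_decreasing) auto
      finally show ?thesis .
    qed
    ultimately show "\<bar>ln S - V / 2\<bar> <= 2 * b ^ 3" using u l b0 zero_le_power[OF b0, of 3] by (simp add: abs_le_iff)
  qed
qed

lemma gd_shift: "gd (a + v) = gd a * exp (- (a \<bullet> v) - (norm v)^2 / 2)"
proof -
  have "- (norm (a + v))\<^sup>2 / 2 = - (norm a)\<^sup>2 / 2 + (- (a \<bullet> v) - (norm v)^2 / 2)"
    by (simp add: power2_norm_eq_inner inner_add_left inner_add_right inner_commute)
  then show ?thesis unfolding gd_def by (simp only: exp_add ac_simps)
qed

lemma qg_bounded: "borel_fun f ==> (\<And>y. \<bar>f y\<bar> <= C) ==> qg f"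
  by (rule qg_between[of _ "\<lambda>_. - C" "\<lambda>_. C"]) (auto simp: qg_const abs_le_iff minus_le_iff)

lemma qg_affine_sq: "qg (\<lambda>y. (c - y \<bullet> a)^2)"
proof -
  have l: "linear (\<lambda>y. - (y \<bullet> a))" by (intro linearI) (simp_all add: inner_add_left)
  from qg_affine[OF qg_norm2 l, of c] show ?thesis by simp
qed

lemma gauss_affine_sq: "(\<E> z. (c - z \<bullet> a)^2) = c\<^sup>2 + (norm a)^2"
proof -
  have "(\<E> z. (c - z \<bullet> a)^2) = (\<E> z. c\<^sup>2 - 2 * c * (z \<bullet> a) + (z \<bullet> a) * (z \<bullet> a))"
    by (simp add: power2_eq_square algebra_simps)
  also have "... = c\<^sup>2 - 2 * c * (\<E> z. z \<bullet> a) + (\<E> z. (z \<bullet> a) * (z \<bullet> a))"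
    by (simp add: qg_integrable qg_inner qg_inner2)
  finally show ?thesis by (simp add: gauss_mean gauss_second power2_norm_eq_inner)
qed

definition DD :: "'i set => ('i => real) => ('i => 'a::euclidean_space) => 'a => real" where
  "DD I w x v = (\<Sum>i\<in>I. w i * (\<E> z. ln (uu I w x (x i + z)) - ln (uu I w x (x i + z + v))))"

definition DDb :: "real => ('a::euclidean_space => 'b::euclidean_space) => 'i set => ('i => real) => ('i => 'b) => 'b => real" where
  "DDb \<delta> A I w a c = (\<Sum>i\<in>I. w i * (\<E> \<zeta>. ln (vv \<delta> A I w a (a i + BB \<delta> A \<zeta>)) - ln (vv \<delta> A I w a (a i + BB \<delta> A \<zeta> + c))))"

context mixture begin

definition pp :: "('i => 'a::euclidean_space) => 'i => 'a => real" where
  "pp x i y = w i * gd (y - x i) / uu I w x y"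

definition mm :: "('i => 'a::euclidean_space) => 'a => 'a" where
  "mm x y = (\<Sum>i\<in>I. pp x i y *\<^sub>R x i)"

definition BV :: "('i => 'a::euclidean_space) => 'a => 'a => 'a => real" where
  "BV x v v' y = (\<Sum>i\<in>I. pp x i y * (((x i - mm x y) \<bullet> v) * ((x i - mm x y) \<bullet> v')))"

definition Bform :: "('i => 'a::euclidean_space) => 'a => 'a => real" where
  "Bform x v v' = (\<Sum>l\<in>I. w l * (\<E> z. BV x v v' (x l + z)))"

definition Kop :: "('i => 'a::euclidean_space) => 'a => 'a" where
  "Kop x v = v - (\<Sum>b\<in>Basis. Bform x v b *\<^sub>R b)"

lemma pp_measurable[measurable]: "borel_fun (pp x i)"
  unfolding pp_def[abs_def] by measurable

lemma pp_nonneg: "i \<in> I ==> 0 <= pp x i y"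
  unfolding pp_def using wpos[of i] uu_pos[of x y] by (simp add: less_imp_le)

lemma pp_sum: "(\<Sum>i\<in>I. pp x i y) = 1"
  unfolding pp_def sum_divide_distrib[symmetric] using uu_pos[of x y] by (simp add: uu_def)

lemma mm_measurable[measurable]: "borel_fun (mm x)"
  unfolding mm_def[abs_def] by measurable

lemma mm_norm: assumes "\<And>i. i \<in> I ==> norm (x i) <= R" shows "norm (mm x y) <= R"
proof -
  have "norm (mm x y) <= (\<Sum>i\<in>I. pp x i y * R)"
    unfolding mm_def
  proof (intro order_trans[OF norm_sum] sum_mono)
    fix i assume i: "i \<in> I"
    show "norm (pp x i y *\<^sub>R x i) <= pp x i y * R"
      unfolding norm_scaleR abs_of_nonneg[OF pp_nonneg[OF i]] by (rule mult_left_mono[OF assms[OF i] pp_nonneg[OF i]])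
  qed
  then show ?thesis by (simp add: sum_distrib_right[symmetric] pp_sum)
qed

lemma tower:
  fixes x :: "'i => 'a::euclidean_space"
  assumes q: "\<And>i. i \<in> I ==> qg (\<psi> i)" and F: "qg (\<lambda>y. \<Sum>i\<in>I. pp x i y * \<psi> i y)"
  shows "(\<Sum>l\<in>I. w l * (\<E> z. (\<Sum>i\<in>I. pp x i (x l + z) * \<psi> i (x l + z)))) = (\<Sum>i\<in>I. w i * (\<E> z. \<psi> i (x i + z)))"
proof -
  let ?F = "\<lambda>y. \<Sum>i\<in>I. pp x i y * \<psi> i y"
  have "(\<Sum>l\<in>I. w l * (\<E> z. ?F (x l + z))) = (\<Sum>l\<in>I. (\<integral>y. w l * (gd (y - x l) * ?F y) \<partial>lborel))"
    by (simp only: integral_gauss_shift(1)[OF F] integral_mult_right_zero)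
  also have "... = (\<integral>y. (\<Sum>l\<in>I. w l * (gd (y - x l) * ?F y)) \<partial>lborel)"
    by (rule Bochner_Integration.integral_sum[symmetric]) (intro integrable_mult_right integral_gauss_shift(2)[OF F])
  also have "... = (\<integral>y. (\<Sum>i\<in>I. w i * (gd (y - x i) * \<psi> i y)) \<partial>lborel)"
  proof (rule Bochner_Integration.integral_cong[OF refl])
    fix y
    have "(\<Sum>l\<in>I. w l * (gd (y - x l) * ?F y)) = uu I w x y * ?F y"
      unfolding uu_def by (simp only: sum_distrib_right mult.assoc)
    also have "... = (\<Sum>i\<in>I. w i * (gd (y - x i) * \<psi> i y))"
      unfolding sum_distrib_left pp_def using uu_pos[of x y] by (intro sum.cong) (auto simp: mult.assoc)
    finally show "(\<Sum>l\<in>I. w l * (gd (y - x l) * ?F y)) = (\<Sum>i\<in>I. w i * (gd (y - x i) * \<psi> i y))" .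
  qed
  also have "... = (\<Sum>i\<in>I. (\<integral>y. w i * (gd (y - x i) * \<psi> i y) \<partial>lborel))"
    by (rule Bochner_Integration.integral_sum) (intro integrable_mult_right integral_gauss_shift(2) q)
  also have "... = (\<Sum>i\<in>I. w i * (\<E> z. \<psi> i (x i + z)))"
    by (intro sum.cong refl) (simp only: integral_mult_right_zero integral_gauss_shift(1)[OF q])
  finally show ?thesis .
qed

lemma qg_tower:
  assumes q: "\<And>i. i \<in> I ==> qg (\<psi> i)" shows "qg (\<lambda>y. \<Sum>i\<in>I. pp x i y * \<psi> i y)"
proof (rule qg_sum)
  fix i assume i: "i \<in> I"
  note [measurable] = qg_measurable[OF q[OF i]]
  obtain C where C: "\<And>y. \<bar>\<psi> i y\<bar> <= C * (1 + (norm y)^2)" using qgE[OF q[OF i]] by metis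
  show "qg (\<lambda>y. pp x i y * \<psi> i y)"
  proof (rule qgI)
    fix y
    have "pp x i y <= (\<Sum>i\<in>I. pp x i y)" by (rule member_le_sum[OF i _ fin]) (simp add: pp_nonneg)
    then have "\<bar>pp x i y\<bar> <= 1" using pp_nonneg[OF i, of x y] by (simp add: pp_sum)
    then have "\<bar>pp x i y\<bar> * \<bar>\<psi> i y\<bar> <= 1 * \<bar>\<psi> i y\<bar>" by (intro mult_right_mono) auto
    then show "\<bar>pp x i y * \<psi> i y\<bar> <= C * (1 + (norm y)^2)" using C[of y] by (simp add: abs_mult)
  qed simp
qed

lemma BV_measurable[measurable]: "borel_fun (BV x v v')"
  unfolding BV_def[abs_def] by measurable

lemma qg_BV: 
  fixes x :: "'i => 'a::euclidean_space" shows "qg (BV x v v')"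
proof (rule qg_bounded)
  define R where "R = (\<Sum>i\<in>I. norm (x i))"
  have R: "norm (x i) <= R" if "i \<in> I" for i unfolding R_def by (rule member_le_sum[OF that _ fin]) simp
  fix y
  have d: "norm (x i - mm x y) <= 2 * R" if "i \<in> I" for i
    using norm_triangle_ineq4[of "x i" "mm x y"] R[OF that] mm_norm[of x R y, OF R] by simp
  have "\<bar>BV x v v' y\<bar> <= (\<Sum>i\<in>I. pp x i y * ((2 * R * norm v) * (2 * R * norm v')))"
    unfolding BV_def
  proof (intro order_trans[OF sum_abs] sum_mono)
    fix i assume i: "i \<in> I"
    have c: "\<bar>(x i - mm x y) \<bullet> u\<bar> <= 2 * R * norm u" for u
      using Cauchy_Schwarz_ineq2[of "x i - mm x y" u] mult_right_mono[OF d[OF i], of "norm u"] by simp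
    have "\<bar>(x i - mm x y) \<bullet> v\<bar> * \<bar>(x i - mm x y) \<bullet> v'\<bar> <= (2 * R * norm v) * (2 * R * norm v')"
      using order_trans[OF abs_ge_zero c[of v]] c[of v] c[of v'] by (intro mult_mono) auto
    then show "\<bar>pp x i y * (((x i - mm x y) \<bullet> v) * ((x i - mm x y) \<bullet> v'))\<bar> <= pp x i y * ((2 * R * norm v) * (2 * R * norm v'))"
      using pp_nonneg[OF i, of x y] by (simp add: abs_mult mult_left_mono)
  qed
  then show "\<bar>BV x v v' y\<bar> <= (2 * R * norm v) * (2 * R * norm v')"
    by (simp add: sum_distrib_right[symmetric] pp_sum)
qed simp

lemma Bform_sym: "Bform x v v' = Bform x v' v"
  unfolding Bform_def BV_def by (simp add: mult.commute)

lemma Bform_add: "Bform x v (a + b) = Bform x v a + Bform x v b"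
proof -
  have "BV x v (a + b) y = BV x v a y + BV x v b y" for y
    unfolding BV_def by (simp add: inner_add_right distrib_left sum.distrib)
  then show ?thesis unfolding Bform_def
    by (simp add: qg_integrable qg_shift[OF qg_BV] distrib_left sum.distrib)
qed

lemma Bform_scale: "Bform x v (r *\<^sub>R a) = r * Bform x v a"
proof -
  have "BV x v (r *\<^sub>R a) y = r * BV x v a y" for y
    unfolding BV_def by (simp add: sum_distrib_left algebra_simps)
  then show ?thesis unfolding Bform_def
    by (simp add: sum_distrib_left algebra_simps)
qed

lemma Bform_nonneg: "0 <= Bform x v v"
proof -
  have "0 <= BV x v v y" for y
    unfolding BV_def by (intro sum_nonneg mult_nonneg_nonneg[OF pp_nonneg zero_le_square])
  then show ?thesis unfolding Bform_def using wpos
    by (intro sum_nonneg mult_nonneg_nonneg integral_nonneg) (auto simp: less_imp_le)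
qed

lemma Kop_inner: "Kop x v \<bullet> a = v \<bullet> a - Bform x v a"
proof -
  have "linear (Bform x v)" by (intro linearI) (simp_all add: Bform_add Bform_scale)
  then have "Bform x v a = (\<Sum>b\<in>Basis. (a \<bullet> b) * Bform x v b)"
    by (subst euclidean_representation[of a, symmetric]) (simp add: linear_sum linear_scale)
  also have "... = (\<Sum>b\<in>Basis. Bform x v b *\<^sub>R b) \<bullet> a"
    by (simp add: inner_sum_left inner_commute[of a] mult.commute)
  finally show ?thesis by (simp add: Kop_def inner_diff_left)
qed

lemma Kop_sym: "Kop x v \<bullet> a = v \<bullet> Kop x a"
  using Kop_inner[of x v a] Kop_inner[of x a v] Bform_sym[of x v a] by (simp add: inner_commute)

lemma linear_Kop: "linear (Kop x)"
proof (rule linearI)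
  have B: "Bform x (a + b) c = Bform x a c + Bform x b c" "Bform x (r *\<^sub>R a) c = r * Bform x a c" for a b c r
    using Bform_add[of x c a b] Bform_scale[of x c r a] by (simp_all add: Bform_sym[of x _ c])
  show "Kop x (a + b) = Kop x a + Kop x b" for a b
    by (simp add: Kop_def B scaleR_add_left sum.distrib)
  show "Kop x (r *\<^sub>R a) = r *\<^sub>R Kop x a" for r a
    by (simp add: Kop_def B scaleR_diff_right scaleR_sum_right)
qed

lemma Bform_upper:
  fixes x :: "'i => 'a::euclidean_space"
  shows "Bform x v v <= (\<Sum>i\<in>I. w i * ((v - a) \<bullet> x i)^2) + (norm a)^2"
proof -
  let ?F = "\<lambda>y. \<Sum>i\<in>I. pp x i y * (x i \<bullet> v - y \<bullet> a)^2"
  have q: "qg ?F" by (rule qg_tower) (rule qg_affine_sq)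
  have le: "BV x v v y <= ?F y" for y
  proof -
    define c where "c = mm x y \<bullet> v - y \<bullet> a"
    have z: "(\<Sum>i\<in>I. pp x i y * ((x i - mm x y) \<bullet> v)) = 0"
    proof -
      have "(\<Sum>i\<in>I. pp x i y * ((x i - mm x y) \<bullet> v)) = (\<Sum>i\<in>I. pp x i y * (x i \<bullet> v)) - (\<Sum>i\<in>I. pp x i y) * (mm x y \<bullet> v)"
        by (simp add: inner_diff_left right_diff_distrib sum_subtractf sum_distrib_right)
      also have "(\<Sum>i\<in>I. pp x i y * (x i \<bullet> v)) = mm x y \<bullet> v" by (simp add: mm_def inner_sum_left)
      finally show ?thesis by (simp add: pp_sum)
    qed
    have "?F y = (\<Sum>i\<in>I. pp x i y * (((x i - mm x y) \<bullet> v) * ((x i - mm x y) \<bullet> v)) + 2 * c * (pp x i y * ((x i - mm x y) \<bullet> v)) + pp x i y * c\<^sup>2)"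
      by (intro sum.cong refl) (simp add: c_def inner_diff_left power2_eq_square algebra_simps)
    also have "... = BV x v v y + 2 * c * (\<Sum>i\<in>I. pp x i y * ((x i - mm x y) \<bullet> v)) + (\<Sum>i\<in>I. pp x i y) * c\<^sup>2"
      unfolding BV_def by (simp add: sum.distrib sum_distrib_left sum_distrib_right)
    finally show ?thesis by (simp add: z pp_sum)
  qed
  have "Bform x v v <= (\<Sum>l\<in>I. w l * (\<E> z. ?F (x l + z)))"
    unfolding Bform_def using wpos
    by (intro sum_mono mult_left_mono integral_mono qg_integrable qg_shift[OF q] qg_shift[OF qg_BV] le) (auto simp: less_imp_le)
  also have "... = (\<Sum>i\<in>I. w i * (\<E> z. (x i \<bullet> v - (x i + z) \<bullet> a)^2))"
    by (rule tower[OF _ q]) (rule qg_affine_sq)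
  also have "... = (\<Sum>i\<in>I. w i * (((v - a) \<bullet> x i)^2 + (norm a)^2))"
  proof (intro sum.cong refl arg_cong2[where f="(*)"])
    fix i
    have "(x i \<bullet> v - (x i + z) \<bullet> a)^2 = ((v - a) \<bullet> x i - z \<bullet> a)^2" for z
      by (simp add: inner_add_left inner_diff_left inner_commute algebra_simps)
    then show "(\<E> z. (x i \<bullet> v - (x i + z) \<bullet> a)^2) = ((v - a) \<bullet> x i)^2 + (norm a)^2"
      by (simp add: gauss_affine_sq)
  qed
  also have "... = (\<Sum>i\<in>I. w i * ((v - a) \<bullet> x i)^2) + (norm a)^2"
    by (simp add: distrib_left sum.distrib avg_const)
  finally show ?thesis .
qed

lemma Kop_lower:
  "2 * (v \<bullet> q) - (norm q)^2 - (\<Sum>i\<in>I. w i * (q \<bullet> x i)^2) <= Kop x v \<bullet> v"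
proof -
  have "(norm v)^2 - (norm (v - q))^2 = 2 * (v \<bullet> q) - (norm q)^2"
    by (simp add: power2_norm_eq_inner inner_diff_left inner_diff_right inner_commute)
  then show ?thesis using Bform_upper[of x v "v - q"] by (simp add: Kop_inner power2_norm_eq_inner)
qed

lemma DD_expand:
  fixes x :: "'i => 'a::euclidean_space"
  assumes R: "\<And>i. i \<in> I ==> norm (x i) <= R"
  shows "\<bar>DD I w x v - (Kop x v \<bullet> v) / 2\<bar> <= 2 * (2 * R * norm v) ^ 3"
proof -
  define S where "S y = (\<Sum>i\<in>I. pp x i y * exp ((x i - mm x y) \<bullet> v))" for y
  have [measurable]: "borel_fun S" unfolding S_def[abs_def] by measurable
  have Spos: "0 < S y" for y
  proof -
    have "\<exists>i\<in>I. pp x i y \<noteq> 0" using pp_sum[of x y] by (metis sum.neutral zero_neq_one)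
    then obtain i where i: "i \<in> I" "pp x i y \<noteq> 0" by auto
    then have "0 < pp x i y" using pp_nonneg[OF i(1), of x y] by simp
    then show ?thesis unfolding S_def using i fin pp_nonneg by (intro sum_pos2[of I i]) (auto intro!: mult_nonneg_nonneg)
  qed
  have z: "(\<Sum>i\<in>I. pp x i y * ((x i - mm x y) \<bullet> v)) = 0" for y
  proof -
    have "(\<Sum>i\<in>I. pp x i y * ((x i - mm x y) \<bullet> v)) = (\<Sum>i\<in>I. pp x i y * (x i \<bullet> v)) - (\<Sum>i\<in>I. pp x i y) * (mm x y \<bullet> v)"
      by (simp add: inner_diff_left right_diff_distrib sum_subtractf sum_distrib_right)
    also have "(\<Sum>i\<in>I. pp x i y * (x i \<bullet> v)) = mm x y \<bullet> v" by (simp add: mm_def inner_sum_left)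
    finally show ?thesis by (simp add: pp_sum)
  qed
  have cb: "\<bar>ln (S y) - BV x v v y / 2\<bar> <= 2 * (2 * R * norm v) ^ 3" for y
  proof -
    have "\<bar>ln (S y) - (\<Sum>i\<in>I. pp x i y * ((x i - mm x y) \<bullet> v)^2) / 2\<bar> <= 2 * (2 * R * norm v) ^ 3"
      unfolding S_def
    proof (rule cumulant_bound[OF fin pp_nonneg pp_sum z])
      fix i assume i: "i \<in> I"
      have "norm (x i - mm x y) <= 2 * R"
        using norm_triangle_ineq4[of "x i" "mm x y"] R[OF i] mm_norm[of x R y, OF R] by simp
      then show "\<bar>(x i - mm x y) \<bullet> v\<bar> <= 2 * R * norm v"
        using Cauchy_Schwarz_ineq2[of "x i - mm x y" v] mult_right_mono[of _ "2 * R" "norm v"]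
        by (meson norm_ge_zero order_trans)
    qed
    then show ?thesis by (simp add: BV_def power2_eq_square)
  qed
  have q1: "qg (\<lambda>y. ln (S y) - BV x v v y / 2)" by (rule qg_bounded[OF _ cb]) measurable
  have id: "ln (uu I w x y) - ln (uu I w x (y + v)) = (\<Sum>i\<in>I. pp x i y * ((y - x i) \<bullet> v)) + (norm v)^2 / 2 - ln (S y)" for y
  proof -
    have m: "(\<Sum>i\<in>I. pp x i y * ((y - x i) \<bullet> v)) = (y - mm x y) \<bullet> v"
    proof -
      have "(\<Sum>i\<in>I. pp x i y * ((y - x i) \<bullet> v)) = (\<Sum>i\<in>I. pp x i y) * (y \<bullet> v) - (\<Sum>i\<in>I. pp x i y * (x i \<bullet> v))"
        by (simp add: inner_diff_left right_diff_distrib sum_subtractf sum_distrib_right)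
      also have "(\<Sum>i\<in>I. pp x i y * (x i \<bullet> v)) = mm x y \<bullet> v" by (simp add: mm_def inner_sum_left)
      finally show ?thesis by (simp add: pp_sum inner_diff_left)
    qed
    have gs: "gd (y + v - x i) = gd (y - x i) * exp (- ((y - x i) \<bullet> v) - (norm v)^2 / 2)" for i
      using gd_shift[of "y - x i" v] by (simp add: algebra_simps)
    have "uu I w x (y + v) = uu I w x y * (\<Sum>i\<in>I. pp x i y * exp (- ((y - x i) \<bullet> v) - (norm v)^2 / 2))"
      unfolding sum_distrib_left pp_def uu_def[of I w x "y + v"] gs
      using uu_pos[of x y] by (intro sum.cong) auto
    also have "(\<Sum>i\<in>I. pp x i y * exp (- ((y - x i) \<bullet> v) - (norm v)^2 / 2)) = exp (- ((y - mm x y) \<bullet> v) - (norm v)^2 / 2) * S y"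
      unfolding S_def sum_distrib_left
    proof (intro sum.cong refl)
      fix i
      have "- ((y - x i) \<bullet> v) - (norm v)^2 / 2 = (- ((y - mm x y) \<bullet> v) - (norm v)^2 / 2) + (x i - mm x y) \<bullet> v"
        by (simp add: inner_diff_left)
      then show "pp x i y * exp (- ((y - x i) \<bullet> v) - (norm v)^2 / 2) = exp (- ((y - mm x y) \<bullet> v) - (norm v)^2 / 2) * (pp x i y * exp ((x i - mm x y) \<bullet> v))"
        by (simp only: exp_add ac_simps)
    qed
    finally have "ln (uu I w x (y + v)) = ln (uu I w x y) + (- ((y - mm x y) \<bullet> v) - (norm v)^2 / 2 + ln (S y))"
      using uu_pos[of x y] Spos[of y] by (simp add: ln_mult_pos)
    then show ?thesis by (simp add: m)
  qed
  let ?G = "\<lambda>y. \<Sum>i\<in>I. pp x i y * ((y - x i) \<bullet> v)"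
  have qi: "qg (\<lambda>y. (y - x i) \<bullet> v)" for i using qg_shift[OF qg_inner, of "- x i" v] by simp
  have qG: "qg ?G" by (rule qg_tower) (rule qi)
  have G0: "(\<Sum>l\<in>I. w l * (\<E> z. ?G (x l + z))) = 0"
    unfolding tower[OF qi qG] by (simp add: gauss_mean)
  have "DD I w x v = (\<Sum>l\<in>I. w l * (\<E> z. ?G (x l + z) + (norm v)^2 / 2 - BV x v v (x l + z) / 2 - (ln (S (x l + z)) - BV x v v (x l + z) / 2)))"
    unfolding DD_def id by (simp add: algebra_simps)
  also have "... = (\<Sum>l\<in>I. w l * ((\<E> z. ?G (x l + z)) + (norm v)^2 / 2 - (\<E> z. BV x v v (x l + z)) / 2 - (\<E> z. ln (S (x l + z)) - BV x v v (x l + z) / 2)))"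
  proof (intro sum.cong refl arg_cong2[where f="(*)"])
    fix l
    have i1: "integrable gauss (\<lambda>z. ?G (x l + z))" by (intro qg_integrable qg_shift[OF qG])
    have i2: "integrable gauss (\<lambda>z. BV x v v (x l + z) / 2)" by (intro integrable_divide qg_integrable qg_shift[OF qg_BV])
    have i3: "integrable gauss (\<lambda>z. ln (S (x l + z)) - BV x v v (x l + z) / 2)" by (intro qg_integrable qg_shift[OF q1])
    have i4: "integrable gauss (\<lambda>z::'a. (norm v)^2 / 2)" by simp
    show "(\<E> z. ?G (x l + z) + (norm v)^2 / 2 - BV x v v (x l + z) / 2 - (ln (S (x l + z)) - BV x v v (x l + z) / 2)) =
      (\<E> z. ?G (x l + z)) + (norm v)^2 / 2 - (\<E> z. BV x v v (x l + z)) / 2 - (\<E> z. ln (S (x l + z)) - BV x v v (x l + z) / 2)"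
      apply (subst Bochner_Integration.integral_diff[OF Bochner_Integration.integrable_diff[OF Bochner_Integration.integrable_add[OF i1 i4] i2] i3])
      apply (subst Bochner_Integration.integral_diff[OF Bochner_Integration.integrable_add[OF i1 i4] i2])
      apply (subst Bochner_Integration.integral_add[OF i1 i4])
      apply simp
      done
  qed
  also have "... = (\<Sum>l\<in>I. w l * (\<E> z. ?G (x l + z))) + (norm v)^2 / 2 - Bform x v v / 2 - (\<Sum>l\<in>I. w l * (\<E> z. ln (S (x l + z)) - BV x v v (x l + z) / 2))"
  proof -
    have "(\<Sum>l\<in>I. w l * ((\<E> z. BV x v v (x l + z)) / 2)) = Bform x v v / 2"
      unfolding Bform_def by (simp add: sum_divide_distrib)
    then show ?thesis
      by (simp only: right_diff_distrib distrib_left sum.distrib sum_subtractf avg_const)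
  qed
  finally have "DD I w x v - (Kop x v \<bullet> v) / 2 = - (\<Sum>l\<in>I. w l * (\<E> z. ln (S (x l + z)) - BV x v v (x l + z) / 2))"
    unfolding G0 Kop_inner by (simp add: power2_norm_eq_inner diff_divide_distrib)
  also have "\<bar>...\<bar> <= 2 * (2 * R * norm v) ^ 3"
  proof -
    let ?J = "\<lambda>l. (\<E> z. ln (S (x l + z)) - BV x v v (x l + z) / 2)"
    have "\<bar>?J l\<bar> <= 2 * (2 * R * norm v) ^ 3" for l
    proof -
      have "\<bar>?J l\<bar> <= (\<E> z. \<bar>ln (S (x l + z)) - BV x v v (x l + z) / 2\<bar>)" by (rule integral_abs_bound)
      also have "... <= (\<integral>z. 2 * (2 * R * norm v) ^ 3 \<partial>(gauss::'a measure))"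
        using qg_integrable[OF qg_shift[OF q1]] by (intro integral_mono cb) auto
      finally show ?thesis by simp
    qed
    then have "(\<Sum>l\<in>I. w l * \<bar>?J l\<bar>) <= 2 * (2 * R * norm v) ^ 3" by (intro avg_le)
    moreover have "\<bar>- (\<Sum>l\<in>I. w l * ?J l)\<bar> <= (\<Sum>l\<in>I. w l * \<bar>?J l\<bar>)"
      unfolding abs_minus_cancel using wpos
      by (intro order_trans[OF sum_abs] sum_mono) (auto simp: abs_mult less_imp_le)
    ultimately show ?thesis by linarith
  qed
  finally show ?thesis .
qed

end

lemma gauss_add_integral:
  fixes e :: "nat => 'a::euclidean_space"
  assumes e: "onb e" and d: "\<And>i. i < DIM('a) ==> 0 < d i" and cd: "\<And>i. i < DIM('a) ==> (d i)\<^sup>2 = 1 + (c i)^2"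
    and f: "qg f"
  shows "(\<E> z. f (a + dg e d z)) = (\<E> z'. (\<E> z. f (a + z + dg e c z')))"
    and "integrable gauss (\<lambda>z'. (\<E> z. f (a + z + dg e c z')))"
proof -
  note [measurable] = qg_measurable[OF f]
  interpret pair_sigma_finite "gauss :: 'a measure" "gauss :: 'a measure" ..
  have GA: "distr gauss borel (dg e d) = distr (gauss \<Otimes>\<^sub>M gauss) borel (\<lambda>(z, z'). z + dg e c z')"
    by (rule gauss_add[OF e d cd])
  have l: "linear (\<lambda>p. fst p + dg e c (snd p))"
    by (intro linearI) (simp_all add: linear_add[OF linear_dg] linear_scale[OF linear_dg] algebra_simps)
  have "integrable gauss (\<lambda>p. f (a + (fst p + dg e c (snd p))))"
    by (intro qg_integrable qg_affine[OF f l])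
  then have i: "integrable (gauss \<Otimes>\<^sub>M gauss) (\<lambda>(z, z'). f (a + z + dg e c z'))"
    unfolding gauss_pair by (simp add: case_prod_beta' add.assoc)
  have "(\<E> z. f (a + dg e d z)) = (\<integral>y. f (a + y) \<partial>distr gauss borel (dg e d))"
    by (simp add: integral_distr)
  also have "... = (\<integral>p. f (a + (case p of (z, z') => z + dg e c z')) \<partial>(gauss \<Otimes>\<^sub>M gauss))"
    unfolding GA by (subst integral_distr) simp_all
  also have "... = (\<integral>p. (case p of (z, z') => f (a + z + dg e c z')) \<partial>(gauss \<Otimes>\<^sub>M gauss))"
    by (intro Bochner_Integration.integral_cong) (auto simp: add.assoc)
  also have "... = (\<E> z'. (\<E> z. f (a + z + dg e c z')))"
    by (rule integral_snd[OF i, symmetric])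
  finally show "(\<E> z. f (a + dg e d z)) = (\<E> z'. (\<E> z. f (a + z + dg e c z')))" .
  show "integrable gauss (\<lambda>z'. (\<E> z. f (a + z + dg e c z')))"
    by (rule integrable_snd[OF i])
qed

lemma rank_projection:
  fixes B :: "'a::euclidean_space => 'b::euclidean_space"
  assumes B: "linear B"
  obtains f \<eta> where "onb f" "\<And>i. \<eta> i = 0 \<or> \<eta> i = (1::real)" "\<And>z. B (dg f \<eta> z) = B z" "(\<Sum>i<DIM('a). \<eta> i) <= dim (range B)"
proof -
  let ?A = "adjoint B"
  have A: "linear ?A" by (rule adjoint_linear[OF B])
  have AT: "x \<bullet> ?A y = B x \<bullet> y" for x y by (rule adjoint_works[OF B])
  have KL: "linear (?A \<circ> B)" by (rule linear_compose[OF B A])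
  have Ks: "(?A \<circ> B) x \<bullet> y = x \<bullet> (?A \<circ> B) y" for x y
    by (metis AT inner_commute comp_apply)
  obtain f l where f: "onb f" and l: "\<And>i. i < DIM('a) ==> (?A \<circ> B) (f i) = l i *\<^sub>R f i"
    and "\<And>i j. i <= j ==> j < DIM('a) ==> l j <= (l i :: real)"
    by (rule spectral[OF KL Ks], rule that)
  have BB: "B (f i) \<bullet> B (f j) = (if i = j then l i else 0)" if "i < DIM('a)" "j < DIM('a)" for i j
    using AT[of "f i" "B (f j)", symmetric] l[OF that(2)] onb_inner[OF f that] by simp
  define \<eta> :: "nat => real" where "\<eta> i = (if l i = 0 then 0 else 1)" for i
  have Bd: "B (dg f \<eta> z) = B z" for z
  proof -
    have z: "B z = (\<Sum>i<DIM('a). (z \<bullet> f i) *\<^sub>R B (f i))"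
      by (subst onb_expand[OF f, of z, symmetric]) (simp add: linear_sum[OF B] linear_scale[OF B])
    have "B (dg f \<eta> z) = (\<Sum>i<DIM('a). (\<eta> i * (z \<bullet> f i)) *\<^sub>R B (f i))"
      unfolding dg_def by (simp add: linear_sum[OF B] linear_scale[OF B])
    also have "... = B z" unfolding z
    proof (intro sum.cong refl)
      fix i assume "i \<in> {..<DIM('a)}"
      then have "B (f i) = 0" if "l i = 0" using BB[of i i] that by simp
      then show "(\<eta> i * (z \<bullet> f i)) *\<^sub>R B (f i) = (z \<bullet> f i) *\<^sub>R B (f i)" by (auto simp: \<eta>_def)
    qed
    finally show ?thesis .
  qed
  define J where "J = {i. i < DIM('a) \<and> l i \<noteq> 0}"
  have fJ: "finite J" unfolding J_def by simp
  have nz: "B (f i) \<noteq> 0" if "i \<in> J" for i using BB[of i i] that by (auto simp: J_def)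
  have inj: "inj_on (\<lambda>i. B (f i)) J"
  proof (rule inj_onI)
    fix i j assume ij: "i \<in> J" "j \<in> J" "B (f i) = B (f j)"
    then have "B (f i) \<bullet> B (f j) \<noteq> 0" using nz by auto
    then show "i = j" using BB[of i j] ij by (auto simp: J_def split: if_splits)
  qed
  have "pairwise orthogonal ((\<lambda>i. B (f i)) ` J)"
    unfolding pairwise_def orthogonal_def using BB by (auto simp: J_def split: if_splits)
  then have ind: "independent ((\<lambda>i. B (f i)) ` J)"
    by (rule pairwise_orthogonal_independent) (use nz in auto)
  have "(\<Sum>i<DIM('a). \<eta> i) = (\<Sum>i\<in>J. 1)"
    unfolding \<eta>_def J_def by (simp add: sum.If_cases Collect_conj_eq Int_commute) (auto intro!: arg_cong[where f=card])
  also have "... = card ((\<lambda>i. B (f i)) ` J)" by (simp add: card_image[OF inj])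
  also have "... <= dim (range B)"
    using independent_card_le_dim[OF _ ind, of "range B"] by auto
  finally show ?thesis using that[OF f _ Bd] by (auto simp: \<eta>_def)
qed

context mixture begin

lemma DD_ge:
  assumes "\<And>i. i \<in> I ==> norm (x i) <= R"
  shows "(Kop x v \<bullet> v) / 2 - 2 * (2 * R * norm v) ^ 3 <= DD I w x v" "DD I w x v <= (Kop x v \<bullet> v) / 2 + 2 * (2 * R * norm v) ^ 3"
proof -
  have "\<bar>DD I w x v - (Kop x v \<bullet> v) / 2\<bar> <= 2 * (2 * R * norm v) ^ 3" by (rule DD_expand[OF assms])
  from abs_le_D1[OF this] abs_le_D2[OF this]
  show "(Kop x v \<bullet> v) / 2 - 2 * (2 * R * norm v) ^ 3 <= DD I w x v" "DD I w x v <= (Kop x v \<bullet> v) / 2 + 2 * (2 * R * norm v) ^ 3" by linarith+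
qed

lemma data_processing:
  fixes x :: "'i => 'a::euclidean_space" and A :: "'a => 'b::euclidean_space"
  assumes A: "linear A" and \<delta>: "0 < \<delta>"
  shows "DDb \<delta> A I w (\<lambda>i. A (x i)) (A v) <= DD I w x v"
proof -
  let ?u = "uu I w x" and ?v = "vv \<delta> A I w (\<lambda>i. A (x i))"
  note [measurable] = vv_measurable[OF A] measurable_linear[OF linear_BB[OF A]] measurable_linear[OF A]
  note up = uu_pos[of x] and vp = vv_pos[OF A \<delta>, of "\<lambda>i. A (x i)"]
  define Y where "Y i \<zeta> = A (x i) + BB \<delta> A \<zeta>" for i and \<zeta> :: "'a \<times> 'b"
  have [measurable]: "borel_fun (Y i)" for i unfolding Y_def[abs_def] by measurable
  define t where "t i \<zeta> = (?v (Y i \<zeta>) / ?v (Y i \<zeta> + A v)) * (?u (x i + fst \<zeta> + v) / ?u (x i + fst \<zeta>))" for i \<zeta>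
  have lt: "ln (t i \<zeta>) = (ln (?v (Y i \<zeta>)) - ln (?v (Y i \<zeta> + A v))) - (ln (?u (x i + fst \<zeta>)) - ln (?u (x i + fst \<zeta> + v)))" for i \<zeta>
    unfolding t_def using up vp by (simp add: ln_mult_pos ln_divide_pos)
  note qv = qg_ln_vv[OF A \<delta>, of "\<lambda>i. A (x i)"] and qu = qg_ln_uu[of x]
  have i1: "integrable gauss (\<lambda>\<zeta>. ln (?v (Y i \<zeta>)) - ln (?v (Y i \<zeta> + A v)))" for i
  proof -
    have "qg (\<lambda>y. ln (?v y) - ln (?v (A v + y)))" by (intro qg_diff qv qg_shift[OF qv])
    from qg_integrable[OF qg_affine[OF this linear_BB[OF A], of "A (x i)"]]
    show ?thesis by (simp add: Y_def add.commute)
  qed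
  have q2: "qg (\<lambda>z. ln (?u (x i + z)) - ln (?u (x i + z + v)))" for i
    using qg_shift[OF qg_diff[OF qu qg_shift[OF qu, of v]], of "x i"] by (simp add: add.commute)
  have i2: "integrable (gauss :: ('a \<times> 'b) measure) (\<lambda>\<zeta>. ln (?u (x i + fst \<zeta>)) - ln (?u (x i + fst \<zeta> + v)))" for i
    using integrable_gauss_fst[OF _ qg_integrable[OF q2]] by simp
  define \<Phi> where "\<Phi> s y m = ennreal (?v (A y + \<delta> *\<^sub>R m) / ?v (A y + \<delta> *\<^sub>R m + A s))" for s y and m :: 'b
  have m\<Phi>: "(\<lambda>(y, m). \<Phi> s y m) \<in> borel_measurable (borel \<Otimes>\<^sub>M gauss)" for s
    unfolding \<Phi>_def by measurable
  have m\<Phi>2: "borel_fun (\<lambda>y. \<integral>\<^sup>+m. \<Phi> s y m \<partial>gauss)" for s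
    using gauss.borel_measurable_nn_integral[OF m\<Phi>] .
  have m3: "borel_fun (\<lambda>y. \<integral>\<^sup>+m. \<Phi> v (- v + y) m \<partial>gauss)"
    by (rule measurable_compose[where f="\<lambda>y. - v + y", OF _ m\<Phi>2]) measurable
  have "(\<Sum>i\<in>I. ennreal (w i) * (\<integral>\<^sup>+\<zeta>. ennreal (t i \<zeta>) \<partial>gauss)) = (\<Sum>i\<in>I. ennreal (w i) * (\<integral>\<^sup>+z. (\<integral>\<^sup>+m. \<Phi> v (x i + z) m \<partial>gauss) * ennreal (?u (x i + z + v) / ?u (x i + z)) \<partial>gauss))"
  proof (intro sum.cong refl arg_cong2[where f="(*)"])
    fix i
    have [measurable]: "borel_fun (t i)" unfolding t_def[abs_def] by measurable
    have "(\<integral>\<^sup>+\<zeta>. ennreal (t i \<zeta>) \<partial>gauss) = (\<integral>\<^sup>+z. \<integral>\<^sup>+m. \<Phi> v (x i + z) m * ennreal (?u (x i + z + v) / ?u (x i + z)) \<partial>gauss \<partial>gauss)"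
      unfolding \<Phi>_def using up vp
      by (subst nn_gauss_pair) (simp_all add: t_def Y_def BB_def linear_add[OF A] add.assoc ennreal_mult[symmetric] less_imp_le)
    also have "... = (\<integral>\<^sup>+z. (\<integral>\<^sup>+m. \<Phi> v (x i + z) m \<partial>gauss) * ennreal (?u (x i + z + v) / ?u (x i + z)) \<partial>gauss)"
      by (intro nn_integral_cong nn_integral_multc) (simp add: \<Phi>_def)
    finally show "(\<integral>\<^sup>+\<zeta>. ennreal (t i \<zeta>) \<partial>gauss) = ..." .
  qed
  also have "... = (\<L> y. ennreal (?u y) * ((\<integral>\<^sup>+m. \<Phi> v y m \<partial>gauss) * ennreal (?u (y + v) / ?u y)))"
    by (rule nn_uu) (intro borel_measurable_times_ennreal m\<Phi>2, measurable)
  also have "... = (\<L> y. (\<integral>\<^sup>+m. \<Phi> v y m \<partial>gauss) * ennreal (?u (v + y)))"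
  proof (intro nn_integral_cong)
    fix y
    have "ennreal (?u y) * ennreal (?u (y + v) / ?u y) = ennreal (?u (v + y))"
      using up[of y] up[of "y + v"] by (simp add: ennreal_mult[symmetric] less_imp_le add.commute)
    then show "ennreal (?u y) * ((\<integral>\<^sup>+m. \<Phi> v y m \<partial>gauss) * ennreal (?u (y + v) / ?u y)) = (\<integral>\<^sup>+m. \<Phi> v y m \<partial>gauss) * ennreal (?u (v + y))"
      by (metis mult.left_commute)
  qed
  also have "... = (\<L> y. (\<integral>\<^sup>+m. \<Phi> v (- v + y) m \<partial>gauss) * ennreal (?u y))"
  proof -
    have "borel_fun (\<lambda>y. (\<integral>\<^sup>+m. \<Phi> v (- v + y) m \<partial>gauss) * ennreal (?u y))"
      by (intro borel_measurable_times_ennreal m3) measurable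
    from nn_lborel_shift[OF this, of v] show ?thesis by simp
  qed
  also have "... = (\<L> y. ennreal (?u y) * (\<integral>\<^sup>+m. \<Phi> v (- v + y) m \<partial>gauss))"
    by (simp add: mult.commute)
  also have "... = (\<Sum>i\<in>I. ennreal (w i) * (\<integral>\<^sup>+z. (\<integral>\<^sup>+m. \<Phi> v (- v + (x i + z)) m \<partial>gauss) \<partial>gauss))"
    by (rule nn_uu[symmetric, OF m3])
  also have "... = (\<Sum>i\<in>I. ennreal (w i) * (\<integral>\<^sup>+\<zeta>. ennreal (?v (Y i \<zeta> - A v) / ?v (Y i \<zeta>)) \<partial>gauss))"
  proof (intro sum.cong refl arg_cong2[where f="(*)"])
    fix i
    have a1: "A (- v + (x i + z)) + \<delta> *\<^sub>R m = Y i (z, m) - A v" for z m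
      by (simp add: Y_def BB_def linear_add[OF A] linear_diff[OF A])
    show "(\<integral>\<^sup>+z. (\<integral>\<^sup>+m. \<Phi> v (- v + (x i + z)) m \<partial>gauss) \<partial>gauss) = (\<integral>\<^sup>+\<zeta>. ennreal (?v (Y i \<zeta> - A v) / ?v (Y i \<zeta>)) \<partial>gauss)"
      unfolding \<Phi>_def a1 by (subst nn_gauss_pair) simp_all
  qed
  also have "... = (\<L> y. ennreal (?v y) * ennreal (?v (y - A v) / ?v y))"
    unfolding Y_def by (rule nn_vv[OF A \<delta>]) simp
  also have "... = (\<L> y. ennreal (?v (- A v + y)))"
    using vp by (intro nn_integral_cong) (simp add: ennreal_mult[symmetric] less_imp_le less_imp_neq[symmetric])
  also have "... = 1" by (subst nn_lborel_shift) (simp_all add: nn_vv1[OF A \<delta>])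
  finally have le: "(\<Sum>i\<in>I. ennreal (w i) * (\<integral>\<^sup>+\<zeta>. ennreal (t i \<zeta>) \<partial>gauss)) <= 1" by simp
  have "(\<Sum>i\<in>I. w i * (\<E> \<zeta>. ln (t i \<zeta>))) <= 0"
  proof (rule gibbs[OF _ _ _ le])
    show "borel_fun (t i)" for i unfolding t_def[abs_def] by measurable
    show "0 < t i z" for i z unfolding t_def using up vp by simp
    show "integrable gauss (\<lambda>z. ln (t i z))" for i unfolding lt by (rule Bochner_Integration.integrable_diff[OF i1 i2])
  qed
  moreover have "(\<E> \<zeta>. ln (t i \<zeta>)) = (\<E> \<zeta>. ln (?v (Y i \<zeta>)) - ln (?v (Y i \<zeta> + A v))) - (\<E> z. ln (?u (x i + z)) - ln (?u (x i + z + v)))" for i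
  proof -
    have "(\<integral>\<zeta>. ln (?u (x i + fst \<zeta>)) - ln (?u (x i + fst \<zeta> + v)) \<partial>(gauss :: ('a \<times> 'b) measure)) = (\<E> z. ln (?u (x i + z)) - ln (?u (x i + z + v)))"
      by (rule integral_gauss_fst) (rule qg_measurable[OF q2])
    then show ?thesis unfolding lt by (simp only: Bochner_Integration.integral_diff[OF i1 i2])
  qed
  ultimately show ?thesis
    unfolding DDb_def DD_def by (simp add: Y_def right_diff_distrib sum_subtractf)
qed

lemma ha_step:
  fixes x :: "'i => 'a::euclidean_space"
  assumes e: "onb e" and d: "\<And>i. i < DIM('a) ==> 0 < d i" and cd: "\<And>i. i < DIM('a) ==> (d i)\<^sup>2 = 1 + (c i)^2"
  shows "ha I w x + (\<E> z'. DD I w x (dg e c z')) - (\<Sum>i<DIM('a). (c i) ^ 4) / 2 <= ha I w (\<lambda>i. dg e (\<lambda>k. 1 / d k) (x i)) + (\<Sum>i<DIM('a). ln (d i))"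
    and "integrable gauss (\<lambda>z'. DD I w x (dg e c z'))"
proof -
  let ?D = "dg e d" and ?Di = "dg e (\<lambda>k. 1 / d k)"
  define x' where "x' i = ?Di (x i)" for i
  let ?u = "uu I w x" and ?u' = "uu I w x'"
  note up = uu_pos[of x] and up' = uu_pos[of x']
  note qu = qg_ln_uu[of x] and qu' = qg_ln_uu[of x']
  have DiD: "?Di (?D z) = z" "?D (?Di z) = z" for z
    using d by (simp_all add: dg_dg[OF e] dg_one[OF e] less_imp_neq[symmetric])
  define t where "t i z = ?u' (x' i + z) * gd (?D z) / (?u (x i + ?D z) * gd z)" for i z
  have lt: "ln (t i z) = ln (?u' (x' i + z)) - ln (?u (x i + ?D z)) - ((norm (?D z))^2 - (norm z)^2) / 2" for i z
    unfolding t_def using up up' by (simp add: ln_mult_pos ln_divide_pos ln_gd diff_divide_distrib)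
  have i1: "integrable gauss (\<lambda>z. ln (?u' (x' i + z)))" for i by (intro qg_integrable qg_shift[OF qu'])
  have i2: "integrable gauss (\<lambda>z. ln (?u (x i + ?D z)))" for i by (intro qg_integrable qg_affine[OF qu] linear_dg)
  have i3: "integrable gauss (\<lambda>z. ((norm (?D z))^2 - (norm z)^2) / 2)"
    using qg_affine[OF qg_norm2 linear_dg, of 0 e d] by (intro integrable_divide Bochner_Integration.integrable_diff qg_integrable qg_norm2) simp
  let ?P = "\<Prod>i<DIM('a). d i"
  have P: "0 < ?P" using d by (intro prod_pos) auto
  have nt: "ennreal ?P * (\<integral>\<^sup>+z. ennreal (t i z) \<partial>gauss) = (\<integral>\<^sup>+y. ennreal (?u' (?Di (x i + y)) / ?u (x i + y)) \<partial>gauss)" for i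
  proof -
    have "(\<integral>\<^sup>+y. ennreal (?u' (?Di (x i + y)) / ?u (x i + y)) \<partial>gauss) = (\<L> y. ennreal (gd y) * ennreal (?u' (?Di (x i + y)) / ?u (x i + y)))"
      by (simp add: nn_gauss)
    also have "... = ennreal ?P * (\<L> z. ennreal (gd (?D z)) * ennreal (?u' (?Di (x i + ?D z)) / ?u (x i + ?D z)))"
      by (rule nn_dg[OF e d]) simp_all
    also have "(\<L> z. ennreal (gd (?D z)) * ennreal (?u' (?Di (x i + ?D z)) / ?u (x i + ?D z))) = (\<L> z. ennreal (gd z) * ennreal (t i z))"
    proof (intro nn_integral_cong)
      fix z
      have "gd (?D z) * (?u' (?Di (x i + ?D z)) / ?u (x i + ?D z)) = gd z * t i z"
        using gd_pos[of z] by (simp add: t_def x'_def linear_add[OF linear_dg] DiD less_imp_neq[symmetric])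
      then show "ennreal (gd (?D z)) * ennreal (?u' (?Di (x i + ?D z)) / ?u (x i + ?D z)) = ennreal (gd z) * ennreal (t i z)"
        using up[of "x i + ?D z"] up'[of "?Di (x i + ?D z)"] up'[of "x' i + z"]
        by (subst (1 2) ennreal_mult[symmetric]) (auto simp: less_imp_le t_def)
    qed
    also have "... = (\<integral>\<^sup>+z. ennreal (t i z) \<partial>gauss)"
      by (rule nn_gauss[symmetric]) (simp add: t_def)
    finally show ?thesis ..
  qed
  have "ennreal ?P * (\<Sum>i\<in>I. ennreal (w i) * (\<integral>\<^sup>+z. ennreal (t i z) \<partial>gauss)) = (\<Sum>i\<in>I. ennreal (w i) * (\<integral>\<^sup>+y. ennreal (?u' (?Di (x i + y)) / ?u (x i + y)) \<partial>gauss))"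
    unfolding sum_distrib_left nt[symmetric] by (simp add: mult.left_commute)
  also have "... = (\<L> y. ennreal (?u y) * ennreal (?u' (?Di y) / ?u y))"
    by (rule nn_uu) simp
  also have "... = (\<L> y. ennreal (?u' (?Di y)))"
    using up up' by (intro nn_integral_cong) (simp add: ennreal_mult[symmetric] less_imp_le less_imp_neq[symmetric])
  also have "... = ennreal ?P * (\<L> y. ennreal (?u' (?Di (?D y))))"
    by (rule nn_dg[OF e d]) simp_all
  also have "... = ennreal ?P * 1" by (simp add: DiD nn_uu1)
  finally have "ennreal ?P = top \<or> ennreal ?P = 0 \<or> (\<Sum>i\<in>I. ennreal (w i) * (\<integral>\<^sup>+z. ennreal (t i z) \<partial>gauss)) = 1"
    unfolding ennreal_mult_cancel_left by blast
  moreover have "ennreal ?P \<noteq> 0" using P by (metis ennreal_eq_0_iff not_le)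
  ultimately have le: "(\<Sum>i\<in>I. ennreal (w i) * (\<integral>\<^sup>+z. ennreal (t i z) \<partial>gauss)) <= 1"
    by auto
  have "(\<Sum>i\<in>I. w i * (\<E> z. ln (t i z))) <= 0"
  proof (rule gibbs[OF _ _ _ le])
    show "borel_fun (t i)" for i unfolding t_def[abs_def] by measurable
    show "0 < t i z" for i z unfolding t_def using up up' by simp
    show "integrable gauss (\<lambda>z. ln (t i z))" for i unfolding lt by (intro Bochner_Integration.integrable_diff i1 i2 i3)
  qed
  moreover have "(\<E> z. ((norm (?D z))^2 - (norm z)^2) / 2) = (\<Sum>i<DIM('a). (c i)^2) / 2"
  proof -
    have q: "qg (\<lambda>z. (norm (?D z))^2)" using qg_affine[OF qg_norm2 linear_dg, of 0 e d] by simp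
    have "(\<E> z. ((norm (?D z))^2 - (norm z)^2) / 2) = ((\<Sum>i<DIM('a). (d i)^2) - DIM('a)) / 2"
      by (simp add: qg_integrable q qg_norm2 gauss_dg2[OF e] gauss_norm2)
    also have "(\<Sum>i<DIM('a). (d i)^2) = DIM('a) + (\<Sum>i<DIM('a). (c i)^2)" by (simp add: cd sum.distrib)
    finally show ?thesis by simp
  qed
  moreover have "(\<E> z. ln (t i z)) = (\<E> z. ln (?u' (x' i + z))) - (\<E> z. ln (?u (x i + ?D z))) - (\<E> z. ((norm (?D z))^2 - (norm z)^2) / 2)" for i
    unfolding lt by (simp only: Bochner_Integration.integral_diff[OF Bochner_Integration.integrable_diff[OF i1 i2] i3] Bochner_Integration.integral_diff[OF i1 i2])
  ultimately have "(\<Sum>i\<in>I. w i * (\<E> z. ln (?u' (x' i + z)))) - (\<Sum>i\<in>I. w i * (\<E> z. ln (?u (x i + ?D z)))) - (\<Sum>i<DIM('a). (c i)^2) / 2 <= 0"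
    by (simp only: right_diff_distrib sum_subtractf avg_const)
  then have A: "- (\<Sum>i\<in>I. w i * (\<E> z. ln (?u (x i + ?D z)))) - (\<Sum>i<DIM('a). (c i)^2) / 2 <= ha I w x'"
    unfolding ha_def by linarith
  have DDi: "DD I w x (dg e c z') = - ha I w x - (\<Sum>i\<in>I. w i * (\<E> z. ln (?u (x i + z + dg e c z'))))" for z'
  proof -
    have "integrable gauss (\<lambda>z. ln (?u (x i + z + dg e c z')))" for i
      using qg_integrable[OF qg_shift[OF qu, of "x i + dg e c z'"]] by (simp add: add.assoc add.left_commute add.commute)
    moreover have "integrable gauss (\<lambda>z. ln (?u (x i + z)))" for i by (intro qg_integrable qg_shift[OF qu])
    ultimately show ?thesis unfolding DD_def ha_def by (simp add: right_diff_distrib sum_subtractf)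
  qed
  have ga: "(\<E> z. ln (?u (x i + dg e d z))) = (\<E> z'. (\<E> z. ln (?u (x i + z + dg e c z'))))"
    "integrable gauss (\<lambda>z'. (\<E> z. ln (?u (x i + z + dg e c z'))))" for i
    using gauss_add_integral[of e d c "\<lambda>y. ln (?u y)" "x i"] e d cd qu by blast+
  have int: "integrable gauss (\<lambda>z'. (\<Sum>i\<in>I. w i * (\<E> z. ln (?u (x i + z + dg e c z')))))"
    by (intro Bochner_Integration.integrable_sum integrable_mult_right ga(2))
  then show "integrable gauss (\<lambda>z'. DD I w x (dg e c z'))" unfolding DDi by simp
  have "(\<E> z'. (\<Sum>i\<in>I. w i * (\<E> z. ln (?u (x i + z + dg e c z'))))) = (\<Sum>i\<in>I. w i * (\<E> z. ln (?u (x i + ?D z))))"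
    by (subst Bochner_Integration.integral_sum) (auto intro!: integrable_mult_right ga(2) simp: ga(1))
  then have B: "(\<E> z'. DD I w x (dg e c z')) = - ha I w x - (\<Sum>i\<in>I. w i * (\<E> z. ln (?u (x i + ?D z))))"
    unfolding DDi using int by simp
  have C: "(\<Sum>i<DIM('a). (c i)^2) / 2 - (\<Sum>i<DIM('a). (c i) ^ 4) / 2 <= (\<Sum>i<DIM('a). ln (d i))"
    unfolding sum_divide_distrib sum_subtractf[symmetric]
  proof (intro sum_mono)
    fix i assume "i \<in> {..<DIM('a)}"
    then have i: "0 < d i" "(d i)^2 = 1 + (c i)^2" using d cd by auto
    have "(c i)^2 - ((c i)^2)^2 <= ln (1 + (c i)^2)"
    proof (cases "(c i)^2 <= 1")
      case True then show ?thesis by (intro ln_one_plus_pos_lower_bound) auto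
    next
      case False
      then have "(c i)^2 * 1 <= (c i)^2 * (c i)^2" by (intro mult_left_mono) auto
      moreover have "0 <= ln (1 + (c i)^2)" by simp
      ultimately show ?thesis unfolding power2_eq_square[of "(c i)^2"] by linarith
    qed
    moreover have "ln (1 + (c i)^2) = 2 * ln (d i)" unfolding i(2)[symmetric] using i(1) by (simp add: ln_realpow)
    ultimately show "(c i)^2 / 2 - (c i) ^ 4 / 2 <= ln (d i)" by (simp flip: power_mult)
  qed
  show "ha I w x + (\<E> z'. DD I w x (dg e c z')) - (\<Sum>i<DIM('a). (c i) ^ 4) / 2 <= ha I w (\<lambda>i. ?Di (x i)) + (\<Sum>i<DIM('a). ln (d i))"
    using A B C unfolding x'_def[abs_def, symmetric] by (simp add: x'_def[abs_def])
qed

lemma hb_step: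
  fixes A :: "'a::euclidean_space => 'b::euclidean_space"
  assumes e: "onb e" and d: "\<And>i. i < DIM('a) ==> 0 < d i" and cd: "\<And>i. i < DIM('a) ==> (d i)\<^sup>2 = 1 + (c i)^2"
    and A: "linear A" and \<delta>: "0 < \<delta>"
  shows "hb \<delta> (A \<circ> dg e d) I w a <= hb \<delta> A I w a + (\<E> z'. DDb \<delta> A I w a (A (dg e c z')))"
    and "integrable gauss (\<lambda>z'. DDb \<delta> A I w a (A (dg e c z')))"
proof -
  let ?v = "vv \<delta> A I w a" and ?D = "dg e d"
  note qv = qg_ln_vv[OF A \<delta>, of a]
  note [measurable] = vv_measurable[OF A] measurable_linear[OF linear_BB[OF A]] measurable_linear[OF A]
  have AD: "linear (A \<circ> ?D)" by (rule linear_compose[OF linear_dg A])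
  define f where "f i y = (\<E> m. ln (?v (a i + A y + \<delta> *\<^sub>R m)))" for i y
  interpret pair_sigma_finite "gauss :: 'a measure" "gauss :: 'b measure" ..
  have int: "integrable gauss (\<lambda>\<zeta>. ln (?v (a i + c + BB \<delta> (A \<circ> U) \<zeta>)))" if "linear U" for i c and U :: "'a => 'a"
    by (intro qg_integrable qg_affine[OF qv] linear_BB linear_compose[OF that A])
  have fub: "(\<E> \<zeta>. ln (?v (a i + c + BB \<delta> (A \<circ> U) \<zeta>))) = (\<E> z. (\<E> m. ln (?v (a i + c + A (U z) + \<delta> *\<^sub>R m))))" if U: "linear U" for i c and U :: "'a => 'a"
  proof -
    have "integrable (gauss \<Otimes>\<^sub>M gauss) (\<lambda>(z, m). ln (?v (a i + c + A (U z) + \<delta> *\<^sub>R m)))"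
      using int[OF U, of i c] unfolding gauss_pair BB_def by (simp add: case_prod_beta' add.assoc)
    from integral_fst[OF this] show ?thesis unfolding gauss_pair BB_def by (simp add: case_prod_beta' add.assoc)
  qed
  have qf: "qg (f i)" for i
  proof -
    obtain C where C: "0 <= C" "\<And>\<zeta>. \<bar>ln (?v (a i + BB \<delta> A \<zeta>))\<bar> <= C * (1 + (norm \<zeta>)^2)"
      using qgE[OF qg_affine[OF qv linear_BB[OF A], of "a i" \<delta>]] by metis
    show ?thesis
    proof (rule qgI)
      have "(\<lambda>(y, m). ln (?v (a i + A y + \<delta> *\<^sub>R m))) \<in> borel_measurable (borel \<Otimes>\<^sub>M gauss)" by measurable
      from gauss.borel_measurable_lebesgue_integral[OF this] show "borel_fun (f i)" unfolding f_def[abs_def] .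
      fix y
      have b: "\<bar>ln (?v (a i + A y + \<delta> *\<^sub>R m))\<bar> <= C * (1 + (norm y)^2) + C * (norm m)^2" for m
        using C(2)[of "(y, m)"] by (simp add: BB_def norm_Pair add.assoc algebra_simps)
      have ib: "integrable gauss (\<lambda>m::'b. C * (1 + (norm y)^2) + C * (norm m)^2)"
        by (intro qg_integrable qg_add qg_const qg_cmult qg_norm2)
      have "\<bar>f i y\<bar> <= (\<E> m. \<bar>ln (?v (a i + A y + \<delta> *\<^sub>R m))\<bar>)"
        unfolding f_def by (rule integral_abs_bound)
      also have "... <= (\<E> m. C * (1 + (norm y)^2) + C * (norm (m::'b))^2)"
      proof (rule integral_mono[OF _ ib b])
        show "integrable gauss (\<lambda>m. \<bar>ln (?v (a i + A y + \<delta> *\<^sub>R m))\<bar>)"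
          by (rule Bochner_Integration.integrable_bound[OF ib]) (use b C(1) in \<open>auto intro!: AE_I2 intro: order_trans\<close>)
      qed
      also have "... = C * (1 + (norm y)^2) + C * DIM('b)"
        by (simp add: qg_integrable qg_norm2 gauss_norm2)
      also have "... <= (C + C * DIM('b)) * (1 + (norm y)^2)"
        using C(1) by (simp add: algebra_simps)
      finally show "\<bar>f i y\<bar> <= (C + C * DIM('b)) * (1 + (norm y)^2)" .
    qed
  qed
  have idl: "linear (\<lambda>z::'a. z)" by (intro linearI) auto
  have g: "hb \<delta> (A \<circ> ?D) I w a <= - (\<Sum>i\<in>I. w i * (\<E> \<zeta>. ln (?v (a i + BB \<delta> (A \<circ> ?D) \<zeta>))))"
    by (rule hb_gibbs[OF AD \<delta>]) (auto simp: qv vv_pos[OF A \<delta>] nn_vv1[OF A \<delta>])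
  have e1: "(\<E> \<zeta>. ln (?v (a i + BB \<delta> (A \<circ> ?D) \<zeta>))) = (\<E> z. f i (0 + ?D z))" for i
    using fub[OF linear_dg, of i 0 e d] by (simp add: f_def)
  have e2: "DDb \<delta> A I w a (A y) = - hb \<delta> A I w a - (\<Sum>i\<in>I. w i * (\<E> z. f i (0 + z + y)))" for y
  proof -
    have ii: "integrable gauss (\<lambda>\<zeta>. ln (?v (a i + BB \<delta> A \<zeta> + A y)))" for i
      using int[OF idl, of i "A y"] by (simp add: o_def add.assoc add.left_commute add.commute)
    have jj: "integrable gauss (\<lambda>\<zeta>. ln (?v (a i + BB \<delta> A \<zeta>)))" for i
      using int[OF idl, of i 0] by (simp add: o_def)
    have "(\<E> \<zeta>. ln (?v (a i + BB \<delta> A \<zeta> + A y))) = (\<E> z. f i (0 + z + y))" for i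
      using fub[OF idl, of i "A y"] by (simp add: f_def o_def linear_add[OF A] algebra_simps)
    then show ?thesis unfolding DDb_def hb_def using ii jj by (simp add: right_diff_distrib sum_subtractf)
  qed
  have ga: "(\<E> z. f i (0 + dg e d z)) = (\<E> z'. (\<E> z. f i (0 + z + dg e c z')))"
    "integrable gauss (\<lambda>z'. (\<E> z. f i (0 + z + dg e c z')))" for i
    using gauss_add_integral[of e d c "f i" 0] e d cd qf by blast+
  have int2: "integrable gauss (\<lambda>z'. (\<Sum>i\<in>I. w i * (\<E> z. f i (0 + z + dg e c z'))))"
    by (intro Bochner_Integration.integrable_sum integrable_mult_right ga(2))
  then show "integrable gauss (\<lambda>z'. DDb \<delta> A I w a (A (dg e c z')))" unfolding e2 by simp
  have "(\<E> z'. (\<Sum>i\<in>I. w i * (\<E> z. f i (0 + z + dg e c z')))) = (\<Sum>i\<in>I. w i * (\<E> z. f i (0 + ?D z)))"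
    by (subst Bochner_Integration.integral_sum) (auto intro!: integrable_mult_right ga(2) simp: ga(1) simp del: add_0)
  then have "(\<E> z'. DDb \<delta> A I w a (A (dg e c z'))) = - hb \<delta> A I w a - (\<Sum>i\<in>I. w i * (\<E> z. f i (0 + ?D z)))"
    unfolding e2 using int2 by simp
  then show "hb \<delta> (A \<circ> ?D) I w a <= hb \<delta> A I w a + (\<E> z'. DDb \<delta> A I w a (A (dg e c z')))"
    using g unfolding e1 by simp
qed

end

lemma cube_le_exp: "t ^ 3 <= 6 * exp (t::real)" if "0 <= t"
proof -
  obtain s where s: "exp t = (\<Sum>m<4. t ^ m / fact m) + (exp s / fact 4) * t ^ 4"
    using Maclaurin_exp_le[of t 4] by blast
  have "0 <= (exp s / fact 4) * t ^ 4" using that by simp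
  moreover have "(\<Sum>m<4. t ^ m / fact m) = 1 + t + t\<^sup>2 / 2 + t ^ 3 / 6" by (simp add: eval_nat_numeral fact_numeral)
  ultimately have "t ^ 3 / 6 <= exp t" using s that zero_le_power2[of t] by linarith
  then show ?thesis by simp
qed

lemma gauss_norm3: "integrable gauss (\<lambda>z::'a::euclidean_space. norm z ^ 3)"
  by (rule gauss_integrable[where C=6]) (auto intro: cube_le_exp)

definition M3 :: "'a::euclidean_space itself => real" where "M3 _ = (\<E> z. norm (z::'a) ^ 3)"

lemma M3_nonneg: "0 <= M3 TYPE('a::euclidean_space)" unfolding M3_def by (rule integral_nonneg_AE) simp

definition stepC :: "'a::euclidean_space itself => real => real => real" where
  "stepC _ P R = DIM('a) / 2 * (1 + R\<^sup>2)^2 + (1 + P) * (16 * R ^ 3 * sqrt (1 + R\<^sup>2) ^ 3 * M3 TYPE('a))"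

context mixture begin

lemma step:
  fixes x :: "'i => 'a::euclidean_space" and A :: "'j::finite => 'a => 'b::euclidean_space"
    and p :: "'j => real"
  assumes R: "\<And>i. i \<in> I ==> norm (x i) <= R" and A: "\<And>j. linear (A j)" and \<delta>: "0 < \<delta>"
    and p: "\<And>j. 0 <= p j" and eps: "0 < \<epsilon>" "\<epsilon> <= 1"
  obtains e d where "onb e" "\<And>i. i < DIM('a) ==> 0 < d i" "\<And>i. i < DIM('a) ==> 1 + \<epsilon> <= (d i)^2"
    "\<And>q. (norm (dg e d q))^2 + (\<Sum>i\<in>I. w i * (q \<bullet> x i)^2) <= (1 + \<epsilon>) * ((norm q)^2 + (\<Sum>i\<in>I. w i * (q \<bullet> x i)^2))"
    "ha I w x - (\<Sum>j\<in>UNIV. p j * hb \<delta> (A j) I w (\<lambda>i. A j (x i))) + \<epsilon> / 2 * (DIM('a) - (\<Sum>j\<in>UNIV. p j * dim (range (A j))))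
       - stepC TYPE('a) (\<Sum>j\<in>UNIV. p j) R * (\<epsilon> * sqrt \<epsilon>)
     <= ha I w (\<lambda>i. dg e (\<lambda>k. 1 / d k) (x i)) + (\<Sum>i<DIM('a). ln (d i)) - (\<Sum>j\<in>UNIV. p j * hb \<delta> (A j \<circ> dg e d) I w (\<lambda>i. A j (x i)))"
proof -
  obtain i0 where "i0 \<in> I" using nonempty by auto
  then have R0: "0 <= R" using R norm_ge_zero order_trans by blast
  let ?K = "Kop x"
  obtain e \<kappa> where e: "onb e" and \<kappa>: "\<And>i. i < DIM('a) ==> ?K (e i) = \<kappa> i *\<^sub>R e i"
    and "\<And>i j. i <= j ==> j < DIM('a) ==> \<kappa> j <= (\<kappa> i :: real)"
    by (rule spectral[OF linear_Kop[of x] Kop_sym[of x]], rule that)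
  have Kdg: "?K v = dg e \<kappa> v" for v
  proof (rule onb_eqI[OF e])
    fix k assume k: "k < DIM('a)"
    show "?K v \<bullet> e k = dg e \<kappa> v \<bullet> e k" using k by (simp add: Kop_sym \<kappa> dg_inner[OF e])
  qed
  have Kvv: "?K v \<bullet> v = (\<Sum>i<DIM('a). \<kappa> i * (v \<bullet> e i)^2)" for v
    unfolding onb_parseval[OF e, of "?K v" v] by (intro sum.cong) (auto simp: Kdg dg_inner[OF e] power2_eq_square)
  have sR: "(\<Sum>i\<in>I. w i * (q \<bullet> x i)^2) <= R\<^sup>2 * (norm q)^2" for q
  proof (rule avg_le)
    fix i assume i: "i \<in> I"
    have "\<bar>q \<bullet> x i\<bar> <= norm q * R"
      using Cauchy_Schwarz_ineq2[of q "x i"] mult_left_mono[OF R[OF i], of "norm q"] by simp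
    then have "\<bar>q \<bullet> x i\<bar>\<^sup>2 <= (norm q * R)^2" by (intro power_mono) auto
    then show "(q \<bullet> x i)^2 <= R\<^sup>2 * (norm q)^2" by (simp add: power_mult_distrib mult.commute)
  qed
  have klow: "1 / (1 + R\<^sup>2) <= \<kappa> i" if i: "i < DIM('a)" for i
  proof -
    define t where "t = 1 / (1 + R\<^sup>2)"
    have pos: "0 < 1 + R\<^sup>2" by (simp add: add_pos_nonneg)
    have "2 * (e i \<bullet> (t *\<^sub>R e i)) - (norm (t *\<^sub>R e i))^2 - (\<Sum>l\<in>I. w l * ((t *\<^sub>R e i) \<bullet> x l)^2) <= ?K (e i) \<bullet> e i"
      by (rule Kop_lower)
    moreover have "?K (e i) \<bullet> e i = \<kappa> i" using \<kappa>[OF i] onb_inner[OF e i i] by simp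
    moreover have "(norm (t *\<^sub>R e i))^2 = t\<^sup>2" using onb_norm[OF e i] by simp
    moreover have "e i \<bullet> (t *\<^sub>R e i) = t" using onb_inner[OF e i i] by simp
    ultimately have "2 * t - t\<^sup>2 - R\<^sup>2 * t\<^sup>2 <= \<kappa> i" using sR[of "t *\<^sub>R e i"] onb_inner[OF e i i] by simp
    moreover have "2 * t - t\<^sup>2 - R\<^sup>2 * t\<^sup>2 = t"
    proof -
      have "t\<^sup>2 + R\<^sup>2 * t\<^sup>2 = t * ((1 + R\<^sup>2) * t)" by (simp add: power2_eq_square algebra_simps)
      also have "... = t" using pos by (simp add: t_def)
      finally show ?thesis by simp
    qed
    ultimately show ?thesis by (simp add: t_def)
  qed
  have kpos: "0 < \<kappa> i" if i: "i < DIM('a)" for i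
    using klow[OF i] by (rule less_le_trans[rotated]) (simp add: add_pos_nonneg)
  have kup: "\<kappa> i <= 1" if i: "i < DIM('a)" for i
    using Kop_inner[of x "e i" "e i"] Bform_nonneg[of x "e i"] \<kappa>[OF i] onb_inner[OF e i i] by simp
  define c where "c i = sqrt (\<epsilon> / \<kappa> i)" for i
  define d where "d i = sqrt (1 + \<epsilon> / \<kappa> i)" for i
  have c2: "(c i)^2 = \<epsilon> / \<kappa> i" if "i < DIM('a)" for i using kpos[OF that] eps by (simp add: c_def)
  have d2: "(d i)^2 = 1 + \<epsilon> / \<kappa> i" if "i < DIM('a)" for i using kpos[OF that] eps by (simp add: d_def)
  have dpos: "0 < d i" if "i < DIM('a)" for i using kpos[OF that] eps by (simp add: d_def add_pos_pos)
  have cd: "(d i)^2 = 1 + (c i)^2" if "i < DIM('a)" for i using c2 d2 that by simp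
  have d1: "1 + \<epsilon> <= (d i)^2" if i: "i < DIM('a)" for i
    using d2[OF i] kpos[OF i] kup[OF i] eps by (simp add: le_divide_eq mult_left_le)
  have ck: "c i <= sqrt \<epsilon> * sqrt (1 + R\<^sup>2)" "0 <= c i" if i: "i < DIM('a)" for i
  proof -
    have "1 / \<kappa> i <= 1 + R\<^sup>2" using klow[OF i] kpos[OF i] by (simp add: field_simps add_pos_nonneg)
    then have "\<epsilon> * (1 / \<kappa> i) <= \<epsilon> * (1 + R\<^sup>2)" using eps by (intro mult_left_mono) auto
    then show "c i <= sqrt \<epsilon> * sqrt (1 + R\<^sup>2)" unfolding c_def real_sqrt_mult[symmetric] by (intro real_sqrt_le_mono) simp
    show "0 <= c i" unfolding c_def using kpos[OF i] eps by simp
  qed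
  have cn: "norm (dg e c z) <= (sqrt \<epsilon> * sqrt (1 + R\<^sup>2)) * norm z" for z
    by (rule dg_norm_le[OF e]) (use ck in \<open>auto simp: abs_of_nonneg\<close>)
  have Kc: "?K (dg e c z) \<bullet> dg e c z = \<epsilon> * (norm z)^2" for z
    unfolding Kvv onb_norm2[OF e, of z] sum_distrib_left
  proof (intro sum.cong refl)
    fix i assume "i \<in> {..<DIM('a)}"
    then have i: "i < DIM('a)" by simp
    show "\<kappa> i * (dg e c z \<bullet> e i)^2 = \<epsilon> * (z \<bullet> e i)^2"
      using kpos[OF i] by (simp add: dg_inner[OF e i] power_mult_distrib c2[OF i])
  qed
  define g where "g = 16 * R ^ 3 * sqrt (1 + R\<^sup>2) ^ 3"
  have g0: "0 <= g" unfolding g_def using R0 by simp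
  have cube: "2 * (2 * R * norm (dg e c z)) ^ 3 <= g * (\<epsilon> * sqrt \<epsilon>) * norm z ^ 3" for z
  proof -
    have "2 * (2 * R * norm (dg e c z)) ^ 3 = 16 * R ^ 3 * norm (dg e c z) ^ 3" by (simp add: power_mult_distrib)
    also have "... <= 16 * R ^ 3 * ((sqrt \<epsilon> * sqrt (1 + R\<^sup>2)) * norm z) ^ 3"
      using R0 cn[of z] by (intro mult_left_mono power_mono) auto
    also have "... = g * (sqrt \<epsilon> ^ 3) * norm z ^ 3" by (simp add: g_def power_mult_distrib)
    also have "sqrt \<epsilon> ^ 3 = \<epsilon> * sqrt \<epsilon>" using eps by (simp add: power3_eq_cube)
    finally show ?thesis .
  qed
  let ?M = "M3 TYPE('a)" and ?h = "\<epsilon> * sqrt \<epsilon>"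
  have h0: "0 <= ?h" using eps by simp
  have ih: "integrable gauss (\<lambda>z::'a. g * ?h * norm z ^ 3)" by (intro integrable_mult_right gauss_norm3)
  have int3: "(\<E> z. g * ?h * norm (z::'a) ^ 3) = g * ?h * ?M" by (simp add: M3_def)
  have iDD: "integrable gauss (\<lambda>z'. DD I w x (dg e c z'))" by (rule ha_step(2)[OF e dpos cd])
  have low: "\<epsilon> / 2 * DIM('a) - g * ?h * ?M <= (\<E> z'. DD I w x (dg e c z'))"
  proof -
    have i2: "integrable gauss (\<lambda>z::'a. \<epsilon> / 2 * (norm z)^2)" by (intro integrable_mult_right qg_integrable qg_norm2)
    have "(\<E> z. \<epsilon> / 2 * (norm (z::'a))^2 - g * ?h * norm z ^ 3) <= (\<E> z'. DD I w x (dg e c z'))"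
    proof (rule integral_mono[OF Bochner_Integration.integrable_diff[OF i2 ih] iDD])
      fix z
      have "(?K (dg e c z) \<bullet> dg e c z) / 2 - 2 * (2 * R * norm (dg e c z)) ^ 3 <= DD I w x (dg e c z)"
        by (rule DD_ge(1)[OF R])
      then show "\<epsilon> / 2 * (norm z)^2 - g * ?h * norm z ^ 3 <= DD I w x (dg e c z)"
        using cube[of z] by (simp add: Kc)
    qed
    then show ?thesis by (simp only: Bochner_Integration.integral_diff[OF i2 ih] int3) (simp add: gauss_norm2)
  qed
  have c4: "(\<Sum>i<DIM('a). (c i) ^ 4) / 2 <= DIM('a) / 2 * (1 + R\<^sup>2)^2 * ?h"
  proof -
    have s4: "t ^ 4 = (t\<^sup>2)^2" for t :: real by (simp flip: power_mult)
    have "(c i) ^ 4 <= (1 + R\<^sup>2)^2 * ?h" if i: "i < DIM('a)" for i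
    proof -
      have "(c i) ^ 4 <= (sqrt \<epsilon> * sqrt (1 + R\<^sup>2)) ^ 4" using ck[OF i] by (intro power_mono) auto
      also have "... = ((sqrt \<epsilon>)^2)^2 * ((sqrt (1 + R\<^sup>2))^2)^2" unfolding power_mult_distrib s4 ..
      also have "... = \<epsilon>\<^sup>2 * (1 + R\<^sup>2)^2" using eps by (simp add: add_nonneg_nonneg)
      also have "... <= ?h * (1 + R\<^sup>2)^2"
      proof (intro mult_right_mono)
        have "\<epsilon> <= sqrt \<epsilon>" using eps by (intro real_le_rsqrt) (simp add: power2_eq_square mult_left_le)
        then show "\<epsilon>\<^sup>2 <= ?h" using eps by (simp add: power2_eq_square mult_left_mono)
      qed simp
      finally show ?thesis by (simp add: mult.commute)
    qed
    then have "(\<Sum>i<DIM('a). (c i) ^ 4) <= (\<Sum>i<DIM('a). (1 + R\<^sup>2)^2 * ?h)" by (intro sum_mono) auto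
    then show ?thesis by simp
  qed
  have hbj: "hb \<delta> (A j \<circ> dg e d) I w (\<lambda>i. A j (x i)) <= hb \<delta> (A j) I w (\<lambda>i. A j (x i)) + \<epsilon> / 2 * dim (range (A j)) + g * ?h * ?M" for j
  proof -
    have AB: "linear (A j \<circ> dg e c)" by (rule linear_compose[OF linear_dg A])
    obtain f \<eta> where f: "onb f" and \<eta>: "\<And>i. \<eta> i = 0 \<or> \<eta> i = (1::real)" and pr: "\<And>z. (A j \<circ> dg e c) (dg f \<eta> z) = (A j \<circ> dg e c) z"
      and rk: "(\<Sum>i<DIM('a). \<eta> i) <= dim (range (A j \<circ> dg e c))"
      by (rule rank_projection[OF AB], rule that)
    have "dim (range (A j \<circ> dg e c)) <= dim (range (A j))" by (rule dim_subset) auto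
    then have rk2: "(\<Sum>i<DIM('a). \<eta> i) <= dim (range (A j))" using rk by simp
    have \<eta>2: "(\<eta> i)^2 = \<eta> i" "\<bar>\<eta> i\<bar> <= 1" for i using \<eta>[of i] by auto
    have nf: "norm (dg f \<eta> z) <= 1 * norm z" for z by (rule dg_norm_le[OF f]) (rule \<eta>2)
    have qf: "qg (\<lambda>z. (norm (dg f \<eta> z))^2)" using qg_affine[OF qg_norm2 linear_dg, of 0 f \<eta>] by simp
    have i2: "integrable gauss (\<lambda>z. \<epsilon> / 2 * (norm (dg f \<eta> z))^2)" by (intro integrable_mult_right qg_integrable qf)
    have "hb \<delta> (A j \<circ> dg e d) I w (\<lambda>i. A j (x i)) <= hb \<delta> (A j) I w (\<lambda>i. A j (x i)) + (\<E> z'. DDb \<delta> (A j) I w (\<lambda>i. A j (x i)) (A j (dg e c z')))"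
      by (rule hb_step(1)[OF e dpos cd A \<delta>])
    also have "(\<E> z'. DDb \<delta> (A j) I w (\<lambda>i. A j (x i)) (A j (dg e c z'))) <= (\<E> z. \<epsilon> / 2 * (norm (dg f \<eta> z))^2 + g * ?h * norm z ^ 3)"
    proof (rule integral_mono[OF _ Bochner_Integration.integrable_add[OF i2 ih]])
      show "integrable gauss (\<lambda>z'. DDb \<delta> (A j) I w (\<lambda>i. A j (x i)) (A j (dg e c z')))"
        by (rule hb_step(2)[OF e dpos cd A \<delta>])
      fix z
      have "DDb \<delta> (A j) I w (\<lambda>i. A j (x i)) (A j (dg e c z)) = DDb \<delta> (A j) I w (\<lambda>i. A j (x i)) (A j (dg e c (dg f \<eta> z)))"
        using pr[of z] by simp
      also have "... <= DD I w x (dg e c (dg f \<eta> z))" by (rule data_processing[OF A \<delta>])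
      also have "... <= (?K (dg e c (dg f \<eta> z)) \<bullet> dg e c (dg f \<eta> z)) / 2 + 2 * (2 * R * norm (dg e c (dg f \<eta> z))) ^ 3"
        by (rule DD_ge(2)[OF R])
      also have "... <= \<epsilon> / 2 * (norm (dg f \<eta> z))^2 + g * ?h * norm (dg f \<eta> z) ^ 3"
        using cube[of "dg f \<eta> z"] by (simp add: Kc)
      also have "... <= \<epsilon> / 2 * (norm (dg f \<eta> z))^2 + g * ?h * norm z ^ 3"
        using nf[of z] g0 h0 by (intro add_left_mono mult_left_mono power_mono) auto
      finally show "DDb \<delta> (A j) I w (\<lambda>i. A j (x i)) (A j (dg e c z)) <= \<epsilon> / 2 * (norm (dg f \<eta> z))^2 + g * ?h * norm z ^ 3" .
    qed
    also have "... = \<epsilon> / 2 * (\<Sum>i<DIM('a). \<eta> i) + g * ?h * ?M"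
      by (simp only: Bochner_Integration.integral_add[OF i2 ih] int3) (simp add: gauss_dg2[OF f] \<eta>2)
    also have "\<epsilon> / 2 * (\<Sum>i<DIM('a). \<eta> i) <= \<epsilon> / 2 * dim (range (A j))"
      using rk2 eps by (intro mult_left_mono) auto
    finally show ?thesis by linarith
  qed
  have "(\<Sum>j\<in>UNIV. p j * hb \<delta> (A j \<circ> dg e d) I w (\<lambda>i. A j (x i))) <= (\<Sum>j\<in>UNIV. p j * (hb \<delta> (A j) I w (\<lambda>i. A j (x i)) + \<epsilon> / 2 * dim (range (A j)) + g * ?h * ?M))"
    by (intro sum_mono mult_left_mono hbj p)
  also have "... = (\<Sum>j\<in>UNIV. p j * hb \<delta> (A j) I w (\<lambda>i. A j (x i))) + \<epsilon> / 2 * (\<Sum>j\<in>UNIV. p j * dim (range (A j))) + (\<Sum>j\<in>UNIV. p j) * (g * ?h * ?M)"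
  proof -
    have "p j * (hb \<delta> (A j) I w (\<lambda>i. A j (x i)) + \<epsilon> / 2 * dim (range (A j)) + g * ?h * ?M) = p j * hb \<delta> (A j) I w (\<lambda>i. A j (x i)) + \<epsilon> / 2 * (p j * dim (range (A j))) + p j * (g * ?h * ?M)" for j
      by (simp add: algebra_simps)
    then show ?thesis by (simp only: sum.distrib sum_distrib_left sum_distrib_right)
  qed
  finally have HB: "(\<Sum>j\<in>UNIV. p j * hb \<delta> (A j \<circ> dg e d) I w (\<lambda>i. A j (x i))) <= ..." .
  have HA: "ha I w x + (\<E> z'. DD I w x (dg e c z')) - (\<Sum>i<DIM('a). (c i) ^ 4) / 2 <= ha I w (\<lambda>i. dg e (\<lambda>k. 1 / d k) (x i)) + (\<Sum>i<DIM('a). ln (d i))"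
    by (rule ha_step(1)[OF e dpos cd])
  have sC: "stepC TYPE('a) (\<Sum>j\<in>UNIV. p j) R * ?h = DIM('a) / 2 * (1 + R\<^sup>2)^2 * ?h + g * ?h * ?M + (\<Sum>j\<in>UNIV. p j) * (g * ?h * ?M)"
    unfolding stepC_def g_def by (simp add: algebra_simps)
  have dr: "\<epsilon> / 2 * (DIM('a) - (\<Sum>j\<in>UNIV. p j * dim (range (A j)))) = \<epsilon> / 2 * DIM('a) - \<epsilon> / 2 * (\<Sum>j\<in>UNIV. p j * dim (range (A j)))"
    by (rule right_diff_distrib)
  show ?thesis
  proof (rule that[OF e dpos d1])
    show "ha I w x - (\<Sum>j\<in>UNIV. p j * hb \<delta> (A j) I w (\<lambda>i. A j (x i))) + \<epsilon> / 2 * (DIM('a) - (\<Sum>j\<in>UNIV. p j * dim (range (A j))))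
       - stepC TYPE('a) (\<Sum>j\<in>UNIV. p j) R * (\<epsilon> * sqrt \<epsilon>)
     <= ha I w (\<lambda>i. dg e (\<lambda>k. 1 / d k) (x i)) + (\<Sum>i<DIM('a). ln (d i)) - (\<Sum>j\<in>UNIV. p j * hb \<delta> (A j \<circ> dg e d) I w (\<lambda>i. A j (x i)))"
      using HA HB low c4 unfolding sC dr by linarith
    fix q
    have "(norm (dg e d q))^2 = (norm q)^2 + \<epsilon> * (\<Sum>i<DIM('a). (q \<bullet> e i)^2 / \<kappa> i)"
      unfolding dg_norm2[OF e] onb_norm2[OF e, of q] sum_distrib_left sum.distrib[symmetric]
      by (intro sum.cong) (auto simp: d2 algebra_simps)
    moreover have "(\<Sum>i<DIM('a). (q \<bullet> e i)^2 / \<kappa> i) <= (norm q)^2 + (\<Sum>i\<in>I. w i * (q \<bullet> x i)^2)"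
    proof -
      let ?v = "dg e (\<lambda>i. 1 / \<kappa> i) q"
      have Kv: "?K ?v = q" unfolding Kdg dg_dg[OF e]
        by (rule dg_one[OF e]) (use kpos in \<open>simp add: less_imp_neq[symmetric]\<close>)
      have vq: "?v \<bullet> q = (\<Sum>i<DIM('a). (q \<bullet> e i)^2 / \<kappa> i)"
        unfolding onb_parseval[OF e, of ?v q] by (intro sum.cong) (auto simp: dg_inner[OF e] power2_eq_square)
      have "2 * (?v \<bullet> q) - (norm q)^2 - (\<Sum>i\<in>I. w i * (q \<bullet> x i)^2) <= ?K ?v \<bullet> ?v" by (rule Kop_lower)
      then show ?thesis unfolding Kv by (simp add: vq inner_commute[of q])
    qed
    ultimately have "(norm (dg e d q))^2 <= (norm q)^2 + \<epsilon> * ((norm q)^2 + (\<Sum>i\<in>I. w i * (q \<bullet> x i)^2))"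
      using eps by (simp add: mult_left_mono)
    then show "(norm (dg e d q))^2 + (\<Sum>i\<in>I. w i * (q \<bullet> x i)^2) <= (1 + \<epsilon>) * ((norm q)^2 + (\<Sum>i\<in>I. w i * (q \<bullet> x i)^2))"
      by (simp add: algebra_simps)
  qed
qed

lemma iterate:
  fixes x :: "'i => 'a::euclidean_space" and A :: "'j::finite => 'a => 'b::euclidean_space"
    and p :: "'j => real"
  assumes R: "\<And>i. i \<in> I ==> norm (x i) <= R" and A: "\<And>j. linear (A j)" and \<delta>: "0 < \<delta>"
    and p: "\<And>j. 0 <= p j" and eps: "0 < \<epsilon>" "\<epsilon> <= 1"
  shows "\<exists>(T :: 'a => 'a) y l. linear T \<and> inj T \<and> (\<forall>i\<in>I. T (y i) = x i \<and> (norm (y i))\<^sup>2 <= R\<^sup>2 / (1 + \<epsilon>) ^ k)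
    \<and> (\<forall>q. (norm (adjoint T q))^2 + (\<Sum>i\<in>I. w i * (q \<bullet> x i)^2) <= (1 + \<epsilon>) ^ k * ((norm q)^2 + (\<Sum>i\<in>I. w i * (q \<bullet> x i)^2)))
    \<and> (\<forall>\<phi>\<in>borel_measurable borel. (\<L> v. \<phi> v) = ennreal (exp l) * (\<L> v. \<phi> (T v)))
    \<and> ha I w x - (\<Sum>j\<in>UNIV. p j * hb \<delta> (A j) I w (\<lambda>i. A j (x i))) + k * (\<epsilon> / 2 * (DIM('a) - (\<Sum>j\<in>UNIV. p j * dim (range (A j))))
       - stepC TYPE('a) (\<Sum>j\<in>UNIV. p j) R * (\<epsilon> * sqrt \<epsilon>))
     <= ha I w y + l - (\<Sum>j\<in>UNIV. p j * hb \<delta> (A j \<circ> T) I w (\<lambda>i. A j (x i)))"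
proof (induction k)
  case 0
  have "adjoint (\<lambda>v::'a. v) = (\<lambda>v. v)" by (rule adjoint_unique) simp
  moreover have "(norm (x i))^2 <= R\<^sup>2" if "i \<in> I" for i using R[OF that] by (intro power_mono) auto
  ultimately show ?case
    apply -
    apply (rule exI[of _ "\<lambda>v. v"], rule exI[of _ x], rule exI[of _ "0::real"])
    apply (auto simp: o_def linear_iff)
    done
next
  case (Suc k)
  let ?s = "\<epsilon> / 2 * (DIM('a) - (\<Sum>j\<in>UNIV. p j * dim (range (A j)))) - stepC TYPE('a) (\<Sum>j\<in>UNIV. p j) R * (\<epsilon> * sqrt \<epsilon>)"
  from Suc.IH obtain T :: "'a => 'a" and y l where T: "linear T" "inj T" and y: "\<And>i. i \<in> I ==> T (y i) = x i" "\<And>i. i \<in> I ==> (norm (y i))\<^sup>2 <= R\<^sup>2 / (1 + \<epsilon>) ^ k"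
    and up: "\<And>q. (norm (adjoint T q))^2 + (\<Sum>i\<in>I. w i * (q \<bullet> x i)^2) <= (1 + \<epsilon>) ^ k * ((norm q)^2 + (\<Sum>i\<in>I. w i * (q \<bullet> x i)^2))"
    and l: "\<And>\<phi>. \<phi> \<in> borel_measurable borel ==> (\<L> v. \<phi> v) = ennreal (exp l) * (\<L> v. \<phi> (T v))"
    and H: "ha I w x - (\<Sum>j\<in>UNIV. p j * hb \<delta> (A j) I w (\<lambda>i. A j (x i))) + k * ?s
     <= ha I w y + l - (\<Sum>j\<in>UNIV. p j * hb \<delta> (A j \<circ> T) I w (\<lambda>i. A j (x i)))"
    by blast
  obtain i0 where "i0 \<in> I" using nonempty by auto
  then have R0: "0 <= R" using R norm_ge_zero order_trans by blast
  have yR: "norm (y i) <= R" if i: "i \<in> I" for i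
  proof -
    have "R\<^sup>2 / (1 + \<epsilon>) ^ k <= R\<^sup>2 / 1" using eps by (intro divide_left_mono one_le_power) auto
    then have "(norm (y i))^2 <= R\<^sup>2" using y(2)[OF i] by simp
    then show ?thesis using R0 by (rule power2_le_imp_le)
  qed
  have AT: "linear (A j \<circ> T)" for j by (rule linear_compose[OF T(1) A])
  obtain e d where e: "onb e" and d: "\<And>i. i < DIM('a) ==> 0 < d i" and d1: "\<And>i. i < DIM('a) ==> 1 + \<epsilon> <= (d i)^2"
    and up2: "\<And>q. (norm (dg e d q))^2 + (\<Sum>i\<in>I. w i * (q \<bullet> y i)^2) <= (1 + \<epsilon>) * ((norm q)^2 + (\<Sum>i\<in>I. w i * (q \<bullet> y i)^2))"
    and H2: "ha I w y - (\<Sum>j\<in>UNIV. p j * hb \<delta> (A j \<circ> T) I w (\<lambda>i. (A j \<circ> T) (y i))) + \<epsilon> / 2 * (DIM('a) - (\<Sum>j\<in>UNIV. p j * dim (range (A j \<circ> T))))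
       - stepC TYPE('a) (\<Sum>j\<in>UNIV. p j) R * (\<epsilon> * sqrt \<epsilon>)
     <= ha I w (\<lambda>i. dg e (\<lambda>k. 1 / d k) (y i)) + (\<Sum>i<DIM('a). ln (d i)) - (\<Sum>j\<in>UNIV. p j * hb \<delta> ((A j \<circ> T) \<circ> dg e d) I w (\<lambda>i. (A j \<circ> T) (y i)))"
    by (rule step[of y R "\<lambda>j. A j \<circ> T" \<delta> p \<epsilon>, OF yR AT \<delta> p eps], assumption, rule that)
  let ?T = "T \<circ> dg e d" and ?y = "\<lambda>i. dg e (\<lambda>k. 1 / d k) (y i)" and ?l = "l + (\<Sum>i<DIM('a). ln (d i))"
  have DD: "dg e d (dg e (\<lambda>k. 1 / d k) z) = z" "dg e (\<lambda>k. 1 / d k) (dg e d z) = z" for z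
    using d by (simp_all add: dg_dg[OF e] dg_one[OF e] less_imp_neq[symmetric])
  have lT: "linear ?T" by (rule linear_compose[OF linear_dg T(1)])
  have iD: "inj (dg e d)" by (rule inj_on_inverseI[of _ "dg e (\<lambda>k. 1 / d k)"]) (simp add: DD)
  have iT: "inj ?T" using T(2) iD by (rule inj_compose)
  have adj: "adjoint ?T = dg e d \<circ> adjoint T"
    by (rule adjoint_unique) (simp add: adjoint_works[OF T(1)] dg_self_adjoint[OF e, symmetric])
  have hbeq: "hb \<delta> U I w (\<lambda>i. (A j \<circ> T) (y i)) = hb \<delta> U I w (\<lambda>i. A j (x i))" for j and U :: "'a => 'b"
    unfolding hb_def vv_def using y(1) by simp
  have dimle: "(\<Sum>j\<in>UNIV. p j * dim (range (A j \<circ> T))) <= (\<Sum>j\<in>UNIV. p j * dim (range (A j)))"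
  proof (intro sum_mono mult_left_mono p)
    fix j have "dim (range (A j \<circ> T)) <= dim (range (A j))" by (rule dim_subset) auto
    then show "real (dim (range (A j \<circ> T))) <= real (dim (range (A j)))" by simp
  qed
  show ?case
  proof (intro exI conjI ballI allI)
    show "linear ?T" "inj ?T" by fact+
    fix i assume i: "i \<in> I"
    show "?T (?y i) = x i" using y(1)[OF i] by (simp add: DD)
    have "(norm (?y i))^2 <= (\<Sum>k<DIM('a). (1 / (1 + \<epsilon>)) * (y i \<bullet> e k)^2)"
      unfolding dg_norm2[OF e]
    proof (intro sum_mono mult_right_mono)
      fix k assume "k \<in> {..<DIM('a)}"
      then show "(1 / d k)^2 <= 1 / (1 + \<epsilon>)" using d1[of k] eps by (simp add: power_divide frac_le)
    qed simp
    also have "... = (norm (y i))^2 / (1 + \<epsilon>)" unfolding onb_norm2[OF e, of "y i"] by (simp add: sum_divide_distrib)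
    also have "... <= (R\<^sup>2 / (1 + \<epsilon>) ^ k) / (1 + \<epsilon>)" using y(2)[OF i] eps by (intro divide_right_mono) auto
    finally show "(norm (?y i))^2 <= R\<^sup>2 / (1 + \<epsilon>) ^ Suc k" by (simp add: mult.commute)
  next
    fix q
    have qy: "(\<Sum>i\<in>I. w i * (adjoint T q \<bullet> y i)^2) = (\<Sum>i\<in>I. w i * (q \<bullet> x i)^2)"
      using y(1) by (intro sum.cong refl) (simp add: adjoint_works[OF T(1)] inner_commute[of "adjoint T q"] inner_commute[of q])
    have "(norm (adjoint ?T q))^2 + (\<Sum>i\<in>I. w i * (q \<bullet> x i)^2) <= (1 + \<epsilon>) * ((norm (adjoint T q))^2 + (\<Sum>i\<in>I. w i * (q \<bullet> x i)^2))"
      using up2[of "adjoint T q"] by (simp add: adj qy)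
    also have "... <= (1 + \<epsilon>) * ((1 + \<epsilon>) ^ k * ((norm q)^2 + (\<Sum>i\<in>I. w i * (q \<bullet> x i)^2)))"
      using up[of q] eps by (intro mult_left_mono) auto
    finally show "(norm (adjoint ?T q))^2 + (\<Sum>i\<in>I. w i * (q \<bullet> x i)^2) <= (1 + \<epsilon>) ^ Suc k * ((norm q)^2 + (\<Sum>i\<in>I. w i * (q \<bullet> x i)^2))"
      by (simp only: power_Suc mult.assoc)
  next
    fix \<phi> :: "'a => ennreal" assume [measurable]: "borel_fun \<phi>"
    have [measurable]: "borel_fun T" by (rule measurable_linear[OF T(1)])
    have "exp (\<Sum>i<DIM('a). ln (d i)) = (\<Prod>i<DIM('a). d i)" using d by (simp add: exp_sum)
    moreover have "(\<L> v. \<phi> (T v)) = ennreal (\<Prod>i<DIM('a). d i) * (\<L> v. \<phi> (T (dg e d v)))"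
      by (rule nn_dg[OF e d]) simp_all
    ultimately show "(\<L> v. \<phi> v) = ennreal (exp ?l) * (\<L> v. \<phi> (?T v))"
      using l[of \<phi>] by (simp add: exp_add ennreal_mult' mult.assoc)
  next
    have "\<epsilon> / 2 * (DIM('a) - (\<Sum>j\<in>UNIV. p j * dim (range (A j)))) <= \<epsilon> / 2 * (DIM('a) - (\<Sum>j\<in>UNIV. p j * dim (range (A j \<circ> T))))"
      using dimle eps by (intro mult_left_mono) auto
    then show "ha I w x - (\<Sum>j\<in>UNIV. p j * hb \<delta> (A j) I w (\<lambda>i. A j (x i))) + Suc k * ?s
     <= ha I w ?y + ?l - (\<Sum>j\<in>UNIV. p j * hb \<delta> (A j \<circ> ?T) I w (\<lambda>i. A j (x i)))"
      using H H2 unfolding hbeq o_assoc of_nat_Suc distrib_right[of _ _ ?s] mult_1 by linarith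
  qed
qed

end

lemma gauss_emeasure_UNIV[simp]: "emeasure gauss UNIV = 1" using gauss.emeasure_space_1 by simp

lemma svd_jacobian:
  fixes T :: "'a::euclidean_space => 'a"
  assumes T: "linear T" and e: "onb e" and f: "onb f" and Tf: "\<And>i. i < DIM('a) ==> T (f i) = s i *\<^sub>R e i"
    and s: "\<And>i. i < DIM('a) ==> 0 < s i"
    and l: "\<And>\<phi>. \<phi> \<in> borel_measurable borel ==> (\<L> v. \<phi> v) = ennreal (exp l) * (\<L> v. \<phi> (T v))"
  shows "l = (\<Sum>i<DIM('a). ln (s i))"
proof -
  have [measurable]: "borel_fun T" by (rule measurable_linear[OF T])
  have Tr: "T (rot f v) = dg e s (rot e v)" for v
  proof -
    have "T (rot f v) = (\<Sum>i<DIM('a). ((v \<bullet> bas i) * s i) *\<^sub>R e i)"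
      unfolding rot_def by (simp add: linear_sum[OF T] linear_scale[OF T] Tf)
    also have "... = dg e s (rot e v)" unfolding dg_def by (intro sum.cong) (auto simp: rot_inner[OF e] mult.commute)
    finally show ?thesis .
  qed
  let ?g = "\<lambda>v::'a. ennreal (gd v)"
  let ?X = "(\<L> v. ?g (T v))"
  have "?X = (\<L> v. ?g (T (rot f v)))"
    by (rule lborel_isometry[symmetric, of "rot f" "\<lambda>v. ?g (T v)"]) (auto simp: linear_rot rot_norm[OF f])
  also have "... = (\<L> v. ?g (dg e s v))"
    unfolding Tr by (rule lborel_isometry[of "rot e" "\<lambda>v. ?g (dg e s v)"]) (auto simp: linear_rot rot_norm[OF e])
  finally have X: "?X = (\<L> v. ?g (dg e s v))" .
  have 1: "1 = ennreal (\<Prod>i<DIM('a). s i) * ?X"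
    unfolding X nn_gd[symmetric, where 'a='a] by (rule nn_dg[OF e s]) simp_all
  have 2: "1 = ennreal (exp l) * ?X" using l[of ?g] by (simp add: nn_gd)
  have P: "0 < (\<Prod>i<DIM('a). s i)" using s by (intro prod_pos) auto
  have Xt: "?X \<noteq> top" using 2 by (metis ennreal_mult_top ennreal_one_neq_top exp_gt_zero ennreal_eq_0_iff not_le)
  then obtain r where r: "?X = ennreal r" "0 <= r" by (cases ?X) auto
  have "1 = (\<Prod>i<DIM('a). s i) * r" "1 = exp l * r"
    using 1 2 P r by (simp_all add: ennreal_mult'[symmetric] less_imp_le flip: ennreal_1)
  then have "(\<Prod>i<DIM('a). s i) = exp l" by (metis mult_cancel_right mult_zero_right zero_neq_one)
  then have "l = ln (\<Prod>i<DIM('a). s i)" by simp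
  also have "... = (\<Sum>i<DIM('a). ln (s i))" using s by (subst ln_prod) (auto simp: less_imp_neq[symmetric])
  finally show ?thesis .
qed

lemma kk_sup:
  fixes L :: "'a::euclidean_space => 'b::euclidean_space" and T :: "'a => 'a"
  assumes L: "linear L" and T: "linear T" and e: "onb e" and f: "onb f" and Tf: "\<And>i. i < DIM('a) ==> T (f i) = s i *\<^sub>R e i"
    and s: "\<And>i. i < DIM('a) ==> 0 < s i" and J: "J \<subseteq> {..<DIM('a)}" and \<theta>: "0 < \<theta>"
    and low: "\<And>y. y \<in> span (e ` J) ==> \<theta> * norm y <= norm (L y)" and \<delta>: "0 < \<delta>"
  shows "kk \<delta> (L \<circ> T) c <= gd0 TYPE('b) / \<delta> ^ DIM('b) * (\<Prod>i\<in>J. \<delta> / (\<theta> * s i))"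
proof -
  have [measurable]: "borel_fun L" "borel_fun T" by (rule measurable_linear, fact)+
  define h where "h i = (if i \<in> J then 1 else (0::real))" for i
  define h' where "h' i = (if i \<in> J then 0 else (1::real))" for i
  let ?P = "dg f h" and ?Q = "dg f h'"
  let ?g = "gd0 TYPE('b) / \<delta> ^ DIM('b)"
  have LT: "linear (L \<circ> T)" by (rule linear_compose[OF T L])
  define Kf where "Kf z = gd ((c - (L \<circ> T) z) /\<^sub>R \<delta>) / \<delta> ^ DIM('b)" for z
  let ?K = Kf
  have Keq: "gd ((u /\<^sub>R \<delta>) :: 'b) / \<delta> ^ DIM('b) = ?g * exp (- (norm u)\<^sup>2 / (2 * \<delta>\<^sup>2))" for u
  proof -
    have "(norm (u /\<^sub>R \<delta>))^2 = (norm u)^2 / \<delta>\<^sup>2" by (simp add: power_mult_distrib power_inverse divide_inverse mult.commute)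
    then show ?thesis by (simp add: gd_def gd0_def mult.commute)
  qed
  define lam where "lam i = (if i \<in> J then \<theta> * s i / \<delta> else 1)" for i
  have lampos: "0 < lam i" if "i < DIM('a)" for i using s[OF that] \<theta> \<delta> by (simp add: lam_def)
  have inner: "(\<integral>\<^sup>+z. ennreal (?g * exp (- (norm (c' - L (T (?P z))))\<^sup>2 / (2 * \<delta>\<^sup>2))) \<partial>gauss) <= ennreal (?g * (\<Prod>i\<in>J. \<delta> / (\<theta> * s i)))" for c'
  proof -
    let ?S = "L ` span (e ` J)"
    have subS: "subspace ?S" by (rule linear_subspace_image[OF L subspace_span])
    obtain y q where yq: "y \<in> span ?S" "\<And>v. v \<in> span ?S ==> orthogonal q v" "c' = y + q"
      using orthogonal_subspace_decomp_exists[of ?S c'] by metis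
    have "span ?S = ?S" by (rule span_eq_iff[THEN iffD2, OF subS])
    then have "y \<in> ?S" using yq(1) by (simp only:)
    then obtain a where a: "a \<in> span (e ` J)" "y = L a" by blast
    define \<tau> where "\<tau> = (\<Sum>i<DIM('a). (h i * (\<theta> / \<delta>) * (a \<bullet> e i)) *\<^sub>R f i)"
    have TP: "T (?P z) \<bullet> e i = h i * (s i * (z \<bullet> f i))" if i: "i < DIM('a)" for z i
    proof -
      have "T (?P z) = (\<Sum>i<DIM('a). (h i * (z \<bullet> f i) * s i) *\<^sub>R e i)"
        unfolding dg_def by (simp add: linear_sum[OF T] linear_scale[OF T] Tf)
      then show ?thesis using sum_onb_inner[OF e i] by (simp add: mult.commute mult.left_commute)
    qed
    have TPs: "T (?P z) \<in> span (e ` J)" for z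
    proof -
      have "T (?P z) = (\<Sum>i<DIM('a). (h i * (z \<bullet> f i) * s i) *\<^sub>R e i)"
        unfolding dg_def by (simp add: linear_sum[OF T] linear_scale[OF T] Tf)
      also have "... \<in> span (e ` J)"
      proof (intro span_sum)
        fix i show "(h i * (z \<bullet> f i) * s i) *\<^sub>R e i \<in> span (e ` J)"
          by (cases "i \<in> J") (simp_all add: h_def span_zero span_scale span_base)
      qed
      finally show ?thesis .
    qed
    have main: "gd z * exp (- (norm (c' - L (T (?P z))))\<^sup>2 / (2 * \<delta>\<^sup>2)) <= gd (dg f lam z - \<tau>)" for z
    proof -
      let ?d = "a - T (?P z)"
      have ds: "?d \<in> span (e ` J)" by (intro span_diff a TPs)
      have "norm (L ?d) ^ 2 <= (norm (c' - L (T (?P z))))^2"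
      proof -
        have eq: "c' - L (T (?P z)) = L ?d + q" using yq(3) a(2) by (simp add: linear_diff[OF L])
        have "L ?d \<in> span ?S" using ds by (intro span_base) auto
        then have "orthogonal q (L ?d)" by (rule yq(2))
        then have "orthogonal (L ?d) q" by (rule orthogonal_commute[THEN iffD1])
        then show ?thesis unfolding eq by (subst norm_add_Pythagorean) auto
      qed
      moreover have "(\<theta> * norm ?d)^2 <= (norm (L ?d))^2" using low[OF ds] \<theta> by (intro power_mono) auto
      ultimately have 1: "\<theta>\<^sup>2 * (norm ?d)^2 <= (norm (c' - L (T (?P z))))^2" unfolding power_mult_distrib by linarith
      have 2: "(norm (dg f lam z - \<tau>))^2 <= (norm z)^2 + (\<theta>\<^sup>2 * (norm ?d)^2) / \<delta>\<^sup>2"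
        unfolding onb_norm2[OF f, of "dg f lam z - \<tau>"] onb_norm2[OF f, of z] onb_norm2[OF e, of ?d] sum_distrib_left sum_divide_distrib sum.distrib[symmetric]
      proof (intro sum_mono)
        fix i assume "i \<in> {..<DIM('a)}"
        then have i: "i < DIM('a)" by simp
        have ti: "\<tau> \<bullet> f i = h i * (\<theta> / \<delta>) * (a \<bullet> e i)" unfolding \<tau>_def by (rule sum_onb_inner[OF f i])
        show "((dg f lam z - \<tau>) \<bullet> f i)^2 <= (z \<bullet> f i)^2 + \<theta>\<^sup>2 * (?d \<bullet> e i)^2 / \<delta>\<^sup>2"
        proof (cases "i \<in> J")
          case True
          have "(dg f lam z - \<tau>) \<bullet> f i = (\<theta> / \<delta>) * - (?d \<bullet> e i)"
            using True \<delta> by (simp add: inner_diff_left dg_inner[OF f i] ti TP[OF i] lam_def h_def field_simps)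
          then show ?thesis by (simp add: power_mult_distrib power_divide)
        next
          case False
          then show ?thesis by (simp add: inner_diff_left dg_inner[OF f i] ti lam_def h_def)
        qed
      qed
      have "(\<theta>\<^sup>2 * (norm ?d)^2) / \<delta>\<^sup>2 <= (norm (c' - L (T (?P z))))^2 / \<delta>\<^sup>2" by (rule divide_right_mono[OF 1]) simp
      with 2 have "- (norm z)\<^sup>2 / 2 + - (norm (c' - L (T (?P z))))\<^sup>2 / (2 * \<delta>\<^sup>2) <= - (norm (dg f lam z - \<tau>))\<^sup>2 / 2" by simp
      then have "exp (- (norm z)\<^sup>2 / 2) * exp (- (norm (c' - L (T (?P z))))\<^sup>2 / (2 * \<delta>\<^sup>2)) <= exp (- (norm (dg f lam z - \<tau>))\<^sup>2 / 2)"
        by (simp only: exp_add[symmetric] exp_le_cancel_iff)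
      then show ?thesis unfolding gd_def mult.assoc by (intro mult_left_mono) auto
    qed
    have "(\<integral>\<^sup>+z. ennreal (?g * exp (- (norm (c' - L (T (?P z))))\<^sup>2 / (2 * \<delta>\<^sup>2))) \<partial>gauss) <= (\<L> z. ennreal ?g * ennreal (gd (dg f lam z - \<tau>)))"
    proof (subst nn_gauss, measurable, intro nn_integral_mono)
      fix z
      have "gd z * (?g * exp (- (norm (c' - L (T (?P z))))\<^sup>2 / (2 * \<delta>\<^sup>2))) <= ?g * gd (dg f lam z - \<tau>)"
        using mult_left_mono[OF main[of z], of ?g] \<delta> by (simp add: ac_simps less_imp_le)
      then show "ennreal (gd z) * ennreal (?g * exp (- (norm (c' - L (T (?P z))))\<^sup>2 / (2 * \<delta>\<^sup>2))) <= ennreal ?g * ennreal (gd (dg f lam z - \<tau>))"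
        using \<delta> by (simp add: ennreal_mult[symmetric] less_imp_le ennreal_leI)
    qed
    also have "... = ennreal ?g * (\<L> z. ennreal (gd (dg f lam z - \<tau>)))" by (rule nn_integral_cmult) simp
    also have "(\<L> z. ennreal (gd (dg f lam z - \<tau>))) = ennreal (\<Prod>i\<in>J. \<delta> / (\<theta> * s i))" (is "?X = ennreal ?A")
    proof -
      let ?B = "\<Prod>i\<in>J. \<theta> * s i / \<delta>"
      have "(\<L> z. ennreal (gd (z - \<tau>))) = ennreal (\<Prod>i<DIM('a). lam i) * ?X"
        by (rule nn_dg[OF f lampos]) simp_all
      moreover have "(\<L> z. ennreal (gd (z - \<tau>))) = 1"
        using nn_lborel_shift[of "\<lambda>z. ennreal (gd z)" "- \<tau>"] by (simp add: nn_gd)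
      moreover have "(\<Prod>i<DIM('a). lam i) = ?B"
        unfolding lam_def using J by (subst prod.inter_filter[symmetric]) (auto intro!: prod.cong)
      ultimately have X: "ennreal ?B * ?X = 1" by simp
      have AB: "?A * ?B = 1"
        unfolding prod.distrib[symmetric] using s J \<theta> \<delta> by (intro prod.neutral) (auto simp: less_imp_neq[symmetric])
      have "0 <= ?A" using s J \<theta> \<delta> by (auto intro!: prod_nonneg simp: subset_iff less_imp_le)
      have "?X = ennreal (?A * ?B) * ?X" by (simp only: AB ennreal_1 mult_1)
      also have "... = ennreal ?A * (ennreal ?B * ?X)" by (simp only: ennreal_mult'[OF \<open>0 <= ?A\<close>] mult.assoc)
      finally show ?thesis by (simp only: X mult_1_right)
    qed
    finally show ?thesis using \<delta> s J \<theta> by (subst ennreal_mult) (auto intro!: prod_nonneg simp: less_imp_le subset_iff)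
  qed
  have G: "distr (gauss \<Otimes>\<^sub>M gauss) borel (\<lambda>(z, z'). ?P z + ?Q z') = gauss"
    by (rule gauss_mix[OF f]) (simp add: h_def h'_def)
  have [measurable]: "L \<circ> T \<in> borel_measurable borel" by (rule measurable_linear[OF LT])
  have [measurable]: "?K \<in> borel_measurable borel" unfolding Kf_def[abs_def] by measurable
  interpret pair_sigma_finite "gauss :: 'a measure" "gauss :: 'a measure" ..
  have "ennreal (kk \<delta> (L \<circ> T) c) = (\<integral>\<^sup>+z. ennreal (?K z) \<partial>gauss)"
    unfolding kk_def Kf_def using \<delta> by (intro nn_integral_eq_integral[symmetric] kk_integrable[OF LT \<delta>]) (simp add: less_imp_le)
  also have "... = (\<integral>\<^sup>+z. ennreal (?K z) \<partial>distr (gauss \<Otimes>\<^sub>M gauss) borel (\<lambda>(z, z'). ?P z + ?Q z'))" by (simp only: G)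
  also have "... = (\<integral>\<^sup>+p. ennreal (?K (case p of (z, z') => ?P z + ?Q z')) \<partial>(gauss \<Otimes>\<^sub>M gauss))"
    by (rule nn_integral_distr) measurable
  also have "... = (\<integral>\<^sup>+(z, z'). ennreal (?K (?P z + ?Q z')) \<partial>(gauss \<Otimes>\<^sub>M gauss))"
    by (simp add: case_prod_beta')
  also have "... = (\<integral>\<^sup>+z'. \<integral>\<^sup>+z. ennreal (?K (?P z + ?Q z')) \<partial>gauss \<partial>gauss)"
    by (subst nn_integral_snd[symmetric]) simp_all
  also have "... <= (\<integral>\<^sup>+z'. ennreal (?g * (\<Prod>i\<in>J. \<delta> / (\<theta> * s i))) \<partial>(gauss :: 'a measure))"
  proof (rule nn_integral_mono)
    fix z'
    have "c - (L \<circ> T) (?P z + ?Q z') = (c - L (T (?Q z'))) - L (T (?P z))" for z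
      by (simp add: linear_add[OF L] linear_add[OF T])
    then have "?K (?P z + ?Q z') = ?g * exp (- (norm ((c - L (T (?Q z'))) - L (T (?P z))))\<^sup>2 / (2 * \<delta>\<^sup>2))" for z
      by (simp only: Kf_def Keq)
    then show "(\<integral>\<^sup>+z. ennreal (?K (?P z + ?Q z')) \<partial>gauss) <= ennreal (?g * (\<Prod>i\<in>J. \<delta> / (\<theta> * s i)))"
      using inner[of "c - L (T (?Q z'))"] by simp
  qed
  also have "... = ennreal (?g * (\<Prod>i\<in>J. \<delta> / (\<theta> * s i)))" using gauss.emeasure_space_1 by simp
  finally have le: "ennreal (kk \<delta> (L \<circ> T) c) <= ennreal (?g * (\<Prod>i\<in>J. \<delta> / (\<theta> * s i)))" .
  have "0 <= (\<Prod>i\<in>J. \<delta> / (\<theta> * s i))" using s J \<theta> \<delta> by (auto intro!: prod_nonneg simp: subset_iff less_imp_le)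
  moreover have "0 <= ?g" using \<delta> by (simp add: less_imp_le)
  ultimately have "0 <= ?g * (\<Prod>i\<in>J. \<delta> / (\<theta> * s i))" by (rule mult_nonneg_nonneg[rotated])
  then show ?thesis using le by (simp only: ennreal_le_iff)
qed

definition gauss_cond :: "('j::finite => 'a::euclidean_space => 'b::euclidean_space) => ('j => real) => ('a => 'a) => ('j => nat) => real => real => bool" where
  "gauss_cond L p G n \<theta> C \<longleftrightarrow> (\<forall>e s. onb e \<and> (\<forall>i<DIM('a). 0 < s i) \<and> (\<forall>i j. i <= j \<longrightarrow> j < DIM('a) \<longrightarrow> s j <= s i)
      \<and> (\<Sum>i<DIM('a). (s i)^2 * (G (e i) \<bullet> e i)) <= 2 \<longrightarrow>
     (\<exists>J. (\<forall>j. J j \<subseteq> {..<DIM('a)} \<and> card (J j) = n j \<and> (\<forall>y\<in>span (e ` J j). \<theta> * norm y <= norm (L j y)))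
        \<and> (\<Sum>i<DIM('a). ln (s i)) <= (\<Sum>j\<in>UNIV. p j * (\<Sum>i\<in>J j. ln (s i))) + C))"

context mixture begin

lemma ha_le:
  fixes y :: "'i => 'a::euclidean_space"
  assumes "\<And>i. i \<in> I ==> norm (y i) <= 1"
  shows "ha I w y <= - ln (gd0 TYPE('a)) + (1 + DIM('a)) / 2"
proof -
  have "ha I w y <= - (\<Sum>i\<in>I. w i * (\<E> z. ln (gd (y i + z))))"
    by (rule ha_gibbs) (auto simp: qg_ln_gd nn_gd)
  also have "... = (\<Sum>i\<in>I. w i * (- (\<E> z. ln (gd (y i + z)))))" by (simp add: sum_negf)
  also have "... <= - ln (gd0 TYPE('a)) + (1 + DIM('a)) / 2"
  proof (rule avg_le)
    fix i assume i: "i \<in> I"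
    have q: "qg (\<lambda>z. (norm (y i + z))^2)" by (rule qg_shift[OF qg_norm2])
    have "(norm (y i + z))^2 = (norm (y i))^2 + 2 * (z \<bullet> y i) + (norm z)^2" for z
      by (simp add: power2_norm_eq_inner inner_add_left inner_add_right inner_commute)
    then have "(\<E> z. (norm (y i + z))^2) = (norm (y i))^2 + DIM('a)"
      by (simp add: qg_integrable qg_inner qg_norm2 gauss_mean gauss_norm2)
    also have "... <= 1 + DIM('a)" using assms[OF i] by (simp add: power_le_one)
    finally have "(\<E> z. (norm (y i + z))^2) <= 1 + DIM('a)" .
    moreover have "(\<E> z. ln (gd (y i + z))) = ln (gd0 TYPE('a)) - (\<E> z. (norm (y i + z))^2) / 2"
      unfolding ln_gd using qg_integrable[OF q] by simp
    ultimately show "- (\<E> z. ln (gd (y i + z))) <= - ln (gd0 TYPE('a)) + (1 + DIM('a)) / 2" by simp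
  qed
  finally show ?thesis .
qed

lemma hb_ge:
  fixes A :: "'a::euclidean_space => 'b::euclidean_space"
  assumes A: "linear A" and \<delta>: "0 < \<delta>" and b: "\<And>c. kk \<delta> A c <= B"
  shows "- ln B <= hb \<delta> A I w a"
proof -
  have v: "vv \<delta> A I w a y <= B" for y unfolding vv_def by (rule avg_le) (rule b)
  have B: "0 < B" using kk_pos[OF A \<delta>, of 0] b[of 0] by linarith
  have "(\<E> \<zeta>. ln (vv \<delta> A I w a (a i + BB \<delta> A \<zeta>))) <= ln B" for i
  proof -
    have "(\<E> \<zeta>. ln (vv \<delta> A I w a (a i + BB \<delta> A \<zeta>))) <= (\<integral>\<zeta>. ln B \<partial>(gauss :: ('a \<times> 'b) measure))"
    proof (rule integral_mono)
      show "integrable gauss (\<lambda>\<zeta>. ln (vv \<delta> A I w a (a i + BB \<delta> A \<zeta>)))"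
        by (intro qg_integrable qg_affine[OF qg_ln_vv] linear_BB A \<delta>)
      fix \<zeta> show "ln (vv \<delta> A I w a (a i + BB \<delta> A \<zeta>)) <= ln B"
        using vv_pos[OF A \<delta>] v B by (subst ln_le_cancel_iff) auto
    qed simp
    then show ?thesis by simp
  qed
  then have "(\<Sum>i\<in>I. w i * (\<E> \<zeta>. ln (vv \<delta> A I w a (a i + BB \<delta> A \<zeta>)))) <= ln B" by (intro avg_le)
  then show ?thesis unfolding hb_def by simp
qed

theorem entropy_bound:
  fixes x :: "'i => 'a::euclidean_space" and L :: "'j::finite => 'a => 'b::euclidean_space" and p :: "'j => real"
    and \<delta> B \<theta> C0 :: real and n :: "'j => nat" and G :: "'a => 'a"
  assumes L: "\<And>j. linear (L j)" and n: "\<And>j. dim (range (L j)) = n j" and \<delta>: "0 < \<delta>" and p: "\<And>j. 0 <= p j"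
    and G: "linear G" "\<And>u v. G u \<bullet> v = u \<bullet> G v" "\<And>v. 0 <= G v \<bullet> v" "\<And>v. G v \<bullet> v <= B * (norm v)^2"
    and d1: "\<delta>\<^sup>2 * (DIM('a) * B) <= 1" and gx: "\<And>i. i \<in> I ==> G (\<delta> *\<^sub>R x i) \<bullet> (\<delta> *\<^sub>R x i) <= 1"
    and gc: "gauss_cond L p G n \<theta> C0" and \<theta>: "0 < \<theta>"
  shows "ha I w x - (\<Sum>j\<in>UNIV. p j * hb \<delta> (\<lambda>v. \<delta> *\<^sub>R L j v) I w (\<lambda>i. \<delta> *\<^sub>R L j (x i))) + DIM('a) * ln \<delta>
    <= - ln (gd0 TYPE('a)) + (1 + DIM('a)) / 2 + (\<Sum>j\<in>UNIV. p j * (ln (gd0 TYPE('b)) - n j * ln \<theta>)) + C0 + 2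
      - (\<Sum>j\<in>UNIV. p j * (real DIM('b) - n j)) * ln \<delta>"
proof -
  define R where "R = (\<Sum>i\<in>I. norm (x i))"
  have R: "norm (x i) <= R" if "i \<in> I" for i unfolding R_def by (rule member_le_sum[OF that _ fin]) simp
  define A where "A j v = \<delta> *\<^sub>R L j v" for j v
  have A: "linear (A j)" for j unfolding A_def[abs_def] by (intro linear_compose_scale_right L)
  have "dim (range (A j)) <= n j" for j
  proof -
    have "range (A j) \<subseteq> range (L j)"
    proof
      fix v assume "v \<in> range (A j)"
      then obtain u where "v = \<delta> *\<^sub>R L j u" by (auto simp: A_def)
      then have "v = L j (\<delta> *\<^sub>R u)" by (simp add: linear_scale[OF L])
      then show "v \<in> range (L j)" by auto
    qed
    then show ?thesis using dim_subset n by metis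
  qed
  then have dimA: "(\<Sum>j\<in>UNIV. p j * dim (range (A j))) <= (\<Sum>j\<in>UNIV. p j * n j)"
    by (intro sum_mono mult_left_mono p) simp
  define s0 where "s0 = DIM('a) - (\<Sum>j\<in>UNIV. p j * n j)"
  define E where "E = stepC TYPE('a) (\<Sum>j\<in>UNIV. p j) R"
  define \<Lambda> where "\<Lambda> = ln (R\<^sup>2 + 2)"
  have "1 < R\<^sup>2 + 2" using zero_le_power2[of R] by linarith
  then have \<Lambda>: "exp \<Lambda> = R\<^sup>2 + 2" "0 < \<Lambda>" unfolding \<Lambda>_def by auto
  have lim: "(\<lambda>k. (1 + \<Lambda> / real k) ^ k) \<longlonglongrightarrow> exp \<Lambda>" by (rule tendsto_exp_limit_sequentially)
  have lim_ln: "(\<lambda>k. ln ((1 + \<Lambda> / real k) ^ k)) \<longlonglongrightarrow> \<Lambda>" using tendsto_ln[OF lim] by simp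
  have lim0: "(\<lambda>k. \<Lambda> / real k) \<longlonglongrightarrow> 0" by (rule lim_const_over_n)
  have ev1: "\<forall>\<^sub>F k in sequentially. R\<^sup>2 + 1 < (1 + \<Lambda> / real k) ^ k"
    by (rule order_tendstoD(1)[OF lim]) (simp add: \<Lambda>)
  have "(\<lambda>k. s0 / 2 * (\<Lambda> - ln ((1 + \<Lambda> / real k) ^ k))) \<longlonglongrightarrow> s0 / 2 * (\<Lambda> - \<Lambda>)" by (intro tendsto_intros lim_ln)
  then have ev2: "\<forall>\<^sub>F k in sequentially. - 1 < s0 / 2 * (\<Lambda> - ln ((1 + \<Lambda> / real k) ^ k))"
    by (rule order_tendstoD(1)) simp
  have "(\<lambda>k. E * \<Lambda> * sqrt (\<Lambda> / real k)) \<longlonglongrightarrow> E * \<Lambda> * sqrt 0" by (intro tendsto_intros lim0)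
  then have ev3: "\<forall>\<^sub>F k in sequentially. E * \<Lambda> * sqrt (\<Lambda> / real k) < 1" by (rule order_tendstoD(2)) simp
  have ev4: "\<forall>\<^sub>F k in sequentially. \<Lambda> / real k < 1" by (rule order_tendstoD(2)[OF lim0]) simp
  have "\<forall>\<^sub>F k in sequentially. (0::nat) < k" by (rule eventually_gt_at_top)
  with ev1 ev2 ev3 ev4 have "\<forall>\<^sub>F k in sequentially. R\<^sup>2 + 1 < (1 + \<Lambda> / real k) ^ k \<and> - 1 < s0 / 2 * (\<Lambda> - ln ((1 + \<Lambda> / real k) ^ k))
    \<and> E * \<Lambda> * sqrt (\<Lambda> / real k) < 1 \<and> \<Lambda> / real k < 1 \<and> 0 < k" by eventually_elim auto
  then obtain k where k: "R\<^sup>2 + 1 < (1 + \<Lambda> / real k) ^ k" "- 1 < s0 / 2 * (\<Lambda> - ln ((1 + \<Lambda> / real k) ^ k))"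
    "E * \<Lambda> * sqrt (\<Lambda> / real k) < 1" "\<Lambda> / real k < 1" "0 < k" using eventually_happens'[OF sequentially_bot] by blast
  define \<epsilon> where "\<epsilon> = \<Lambda> / real k"
  have eps: "0 < \<epsilon>" "\<epsilon> <= 1" using \<Lambda> k by (auto simp: \<epsilon>_def)
  have k\<epsilon>: "real k * \<epsilon> = \<Lambda>" using k(5) by (simp add: \<epsilon>_def)
  define a where "a = (1 + \<epsilon>) ^ k"
  have a: "R\<^sup>2 + 1 < a" using k(1) by (simp add: a_def \<epsilon>_def)
  have a1: "1 <= a" "0 < a" using a zero_le_power2[of R] by linarith+
  obtain T :: "'a => 'a" and y l where T: "linear T" "inj T" and y: "\<And>i. i \<in> I ==> T (y i) = x i" "\<And>i. i \<in> I ==> (norm (y i))\<^sup>2 <= R\<^sup>2 / (1 + \<epsilon>) ^ k"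
    and up: "\<And>q. (norm (adjoint T q))^2 + (\<Sum>i\<in>I. w i * (q \<bullet> x i)^2) <= (1 + \<epsilon>) ^ k * ((norm q)^2 + (\<Sum>i\<in>I. w i * (q \<bullet> x i)^2))"
    and l: "\<And>\<phi>. \<phi> \<in> borel_measurable borel ==> (\<L> v. \<phi> v) = ennreal (exp l) * (\<L> v. \<phi> (T v))"
    and H: "ha I w x - (\<Sum>j\<in>UNIV. p j * hb \<delta> (A j) I w (\<lambda>i. A j (x i))) + k * (\<epsilon> / 2 * (DIM('a) - (\<Sum>j\<in>UNIV. p j * dim (range (A j)))) - E * (\<epsilon> * sqrt \<epsilon>))
     <= ha I w y + l - (\<Sum>j\<in>UNIV. p j * hb \<delta> (A j \<circ> T) I w (\<lambda>i. A j (x i)))"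
    using iterate[of x R A \<delta> p \<epsilon> k, OF R A \<delta> p eps] unfolding E_def by blast
  obtain e f s where e: "onb e" and f: "onb f" and Tf: "\<And>i. i < DIM('a) ==> T (f i) = s i *\<^sub>R e i"
    and s: "\<And>i. i < DIM('a) ==> 0 < s i" and smono: "\<And>i j. i <= j ==> j < DIM('a) ==> s j <= (s i :: real)"
    and "\<And>i. i < DIM('a) ==> s i = norm (adjoint T (e i))"
    by (rule svd[OF T], rule that)
  have ls: "l = (\<Sum>i<DIM('a). ln (s i))" by (rule svd_jacobian[OF T(1) e f Tf s l])
  define \<sigma> where "\<sigma> i = \<delta> * s i / sqrt a" for i
  have \<sigma>pos: "0 < \<sigma> i" if "i < DIM('a)" for i using s[OF that] \<delta> a1 by (simp add: \<sigma>_def)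
  have \<sigma>mono: "\<sigma> j <= \<sigma> i" if "i <= j" "j < DIM('a)" for i j
    unfolding \<sigma>_def using smono[OF that] \<delta> a1 by (intro divide_right_mono mult_left_mono) auto
  have tr: "(\<Sum>i<DIM('a). (\<sigma> i)^2 * (G (e i) \<bullet> e i)) <= 2"
  proof -
    obtain h g where h: "onb h" and g: "\<And>i. i < DIM('a) ==> G (h i) = g i *\<^sub>R h i"
      and "\<And>i j. i <= j ==> j < DIM('a) ==> g j <= (g i :: real)"
      by (rule spectral[OF G(1,2)], rule that)
    have gi: "G (h i) \<bullet> h i = g i" if "i < DIM('a)" for i using g[OF that] onb_inner[OF h that that] by simp
    have g0: "0 <= g i" "g i <= B" if "i < DIM('a)" for i using gi[OF that] G(3,4)[of "h i"] onb_norm[OF h that] by auto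
    have Gv: "G v \<bullet> v = (\<Sum>m<DIM('a). g m * (v \<bullet> h m)^2)" for v
      unfolding onb_parseval[OF h, of "G v" v] by (intro sum.cong) (auto simp: G(2) g power2_eq_square)
    have Th: "(norm (adjoint T q))^2 = (\<Sum>i<DIM('a). (s i)^2 * (e i \<bullet> q)^2)" for q
      unfolding onb_norm2[OF f] using Tf adjoint_works[OF T(1), of _ q]
      by (intro sum.cong) (auto simp: inner_commute[of "adjoint T q"] power_mult_distrib)
    have "(\<Sum>i<DIM('a). (s i)^2 * (G (e i) \<bullet> e i)) = (\<Sum>m<DIM('a). g m * (norm (adjoint T (h m)))^2)"
      unfolding Gv Th sum_distrib_left by (subst sum.swap) (simp add: ac_simps)
    also have "... <= (\<Sum>m<DIM('a). g m * (a * (1 + (\<Sum>i\<in>I. w i * (h m \<bullet> x i)^2))))"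
    proof (intro sum_mono mult_left_mono)
      fix m assume "m \<in> {..<DIM('a)}"
      then have m: "m < DIM('a)" by simp
      have "0 <= (\<Sum>i\<in>I. w i * (h m \<bullet> x i)^2)" using wpos by (intro sum_nonneg) (auto simp: less_imp_le)
      then show "(norm (adjoint T (h m)))^2 <= a * (1 + (\<Sum>i\<in>I. w i * (h m \<bullet> x i)^2))"
        using up[of "h m"] onb_norm[OF h m] by (simp add: a_def)
      show "0 <= g m" using g0[OF m] by simp
    qed
    also have "... = a * ((\<Sum>m<DIM('a). g m) + (\<Sum>i\<in>I. w i * (G (x i) \<bullet> x i)))"
    proof -
      have "(\<Sum>i\<in>I. w i * (G (x i) \<bullet> x i)) = (\<Sum>m<DIM('a). g m * (\<Sum>i\<in>I. w i * (h m \<bullet> x i)^2))"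
        unfolding Gv sum_distrib_left by (subst sum.swap) (simp add: ac_simps inner_commute)
      then show ?thesis by (simp add: sum.distrib sum_distrib_left distrib_left algebra_simps)
    qed
    finally have 1: "(\<Sum>i<DIM('a). (s i)^2 * (G (e i) \<bullet> e i)) <= a * ((\<Sum>m<DIM('a). g m) + (\<Sum>i\<in>I. w i * (G (x i) \<bullet> x i)))" .
    have 2: "(\<Sum>m<DIM('a). g m) <= DIM('a) * B" using sum_mono[of "{..<DIM('a)}" g "\<lambda>_. B"] g0(2) by simp
    have 3: "\<delta>\<^sup>2 * (\<Sum>i\<in>I. w i * (G (x i) \<bullet> x i)) <= 1"
    proof -
      have "\<delta>\<^sup>2 * (\<Sum>i\<in>I. w i * (G (x i) \<bullet> x i)) = (\<Sum>i\<in>I. w i * (G (\<delta> *\<^sub>R x i) \<bullet> (\<delta> *\<^sub>R x i)))"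
        unfolding sum_distrib_left by (simp add: linear_scale[OF G(1)] power2_eq_square ac_simps)
      also have "... <= 1" by (rule avg_le) (rule gx)
      finally show ?thesis .
    qed
    have "(\<Sum>i<DIM('a). (\<sigma> i)^2 * (G (e i) \<bullet> e i)) = (\<delta>\<^sup>2 / a) * (\<Sum>i<DIM('a). (s i)^2 * (G (e i) \<bullet> e i))"
      unfolding sum_distrib_left \<sigma>_def using a1 by (simp add: power_divide power_mult_distrib mult.assoc)
    also have "... <= (\<delta>\<^sup>2 / a) * (a * ((\<Sum>m<DIM('a). g m) + (\<Sum>i\<in>I. w i * (G (x i) \<bullet> x i))))"
      using a1 by (intro mult_left_mono 1) auto
    also have "... = \<delta>\<^sup>2 * (\<Sum>m<DIM('a). g m) + \<delta>\<^sup>2 * (\<Sum>i\<in>I. w i * (G (x i) \<bullet> x i))"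
      using a1 by (simp add: distrib_left)
    also have "... <= \<delta>\<^sup>2 * (DIM('a) * B) + 1" by (intro add_mono mult_left_mono 2 3) simp
    finally show ?thesis using d1 by simp
  qed
  obtain J where J: "\<And>j. J j \<subseteq> {..<DIM('a)}" "\<And>j. card (J j) = n j" "\<And>j y. y \<in> span (e ` J j) ==> \<theta> * norm y <= norm (L j y)"
    and JC: "(\<Sum>i<DIM('a). ln (\<sigma> i)) <= (\<Sum>j\<in>UNIV. p j * (\<Sum>i\<in>J j. ln (\<sigma> i))) + C0"
    using gc[unfolded gauss_cond_def, rule_format, of e \<sigma>] e \<sigma>pos \<sigma>mono tr by blast
  have hbj: "(\<Sum>i\<in>J j. ln (\<sigma> i)) + n j * (ln a / 2) + n j * ln \<theta> + (real DIM('b) - n j) * ln \<delta> - ln (gd0 TYPE('b)) <= hb \<delta> (A j \<circ> T) I w (\<lambda>i. A j (x i))" for j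
  proof -
    let ?T = "\<lambda>v. \<delta> *\<^sub>R T v" and ?s = "\<lambda>i. \<delta> * s i"
    have lT: "linear ?T" by (rule linear_compose_scale_right[OF T(1)])
    have eq: "A j \<circ> T = L j \<circ> ?T" by (auto simp: fun_eq_iff A_def linear_scale[OF L])
    let ?B = "gd0 TYPE('b) / \<delta> ^ DIM('b) * (\<Prod>i\<in>J j. \<delta> / (\<theta> * (\<delta> * s i)))"
    have spJ: "0 < s i" if "i \<in> J j" for i using J(1)[of j] s that by auto
    have "kk \<delta> (L j \<circ> ?T) c <= ?B" for c
      by (rule kk_sup[OF L lT e f, where s="?s"]) (use Tf s \<delta> J \<theta> in auto)
    then have "- ln ?B <= hb \<delta> (A j \<circ> T) I w (\<lambda>i. A j (x i))"
      unfolding eq[symmetric] by (intro hb_ge linear_compose[OF T(1) A] \<delta>)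
    moreover have "ln ?B = ln (gd0 TYPE('b)) - DIM('b) * ln \<delta> + (\<Sum>i\<in>J j. ln (\<delta> / (\<theta> * (\<delta> * s i))))"
    proof -
      have P: "0 < (\<Prod>i\<in>J j. \<delta> / (\<theta> * (\<delta> * s i)))" using spJ \<delta> \<theta> by (intro prod_pos) auto
      have "ln (\<Prod>i\<in>J j. \<delta> / (\<theta> * (\<delta> * s i))) = (\<Sum>i\<in>J j. ln (\<delta> / (\<theta> * (\<delta> * s i))))"
        using spJ \<delta> \<theta> finite_subset[OF J(1)[of j]] by (intro ln_prod) (auto simp: less_imp_neq[symmetric])
      then show ?thesis using P \<delta> by (simp add: ln_mult_pos ln_divide_pos ln_realpow)
    qed
    moreover have "(\<Sum>i\<in>J j. ln (\<delta> / (\<theta> * (\<delta> * s i)))) = (\<Sum>i\<in>J j. ln \<delta> - ln \<theta> - ln (\<sigma> i) - ln a / 2)"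
    proof (intro sum.cong refl)
      fix i assume i: "i \<in> J j"
      have "ln (\<sigma> i) = ln (\<delta> * s i) - ln a / 2"
        unfolding \<sigma>_def using spJ[OF i] \<delta> a1 by (simp add: ln_divide_pos ln_sqrt)
      then show "ln (\<delta> / (\<theta> * (\<delta> * s i))) = ln \<delta> - ln \<theta> - ln (\<sigma> i) - ln a / 2"
        using spJ[OF i] \<delta> \<theta> by (simp add: ln_divide_pos ln_mult_pos)
    qed
    moreover have "(\<Sum>i\<in>J j. ln \<delta> - ln \<theta> - ln (\<sigma> i) - ln a / 2) = n j * ln \<delta> - n j * ln \<theta> - (\<Sum>i\<in>J j. ln (\<sigma> i)) - n j * (ln a / 2)"
      by (simp only: sum_subtractf sum_constant J(2))
    ultimately show ?thesis by (simp add: left_diff_distrib)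
  qed
  have l\<sigma>: "l = (\<Sum>i<DIM('a). ln (\<sigma> i)) + DIM('a) * (ln a / 2) - DIM('a) * ln \<delta>"
  proof -
    have "(\<Sum>i<DIM('a). ln (s i)) = (\<Sum>i<DIM('a). ln (\<sigma> i) + ln a / 2 - ln \<delta>)"
      using s \<delta> a1 by (intro sum.cong refl) (simp add: \<sigma>_def ln_divide_pos ln_mult_pos ln_sqrt)
    also have "... = (\<Sum>i<DIM('a). ln (\<sigma> i)) + DIM('a) * (ln a / 2) - DIM('a) * ln \<delta>"
      by (simp only: sum_subtractf sum.distrib sum_constant card_lessThan)
    finally show ?thesis using ls by simp
  qed
  have y1: "norm (y i) <= 1" if "i \<in> I" for i
  proof -
    have "R\<^sup>2 / a <= 1" using a a1 by (simp add: divide_le_eq)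
    then have "(norm (y i))^2 <= 1\<^sup>2" using y(2)[OF that] unfolding a_def by simp
    then show ?thesis by (rule power2_le_imp_le) simp
  qed
  have HB: "(\<Sum>j\<in>UNIV. p j * (\<Sum>i\<in>J j. ln (\<sigma> i))) + (\<Sum>j\<in>UNIV. p j * n j) * (ln a / 2) - (\<Sum>j\<in>UNIV. p j * (ln (gd0 TYPE('b)) - n j * ln \<theta>)) + (\<Sum>j\<in>UNIV. p j * (real DIM('b) - n j)) * ln \<delta>
    <= (\<Sum>j\<in>UNIV. p j * hb \<delta> (A j \<circ> T) I w (\<lambda>i. A j (x i)))"
  proof -
    have "(\<Sum>j\<in>UNIV. p j * (\<Sum>i\<in>J j. ln (\<sigma> i))) + (\<Sum>j\<in>UNIV. p j * n j) * (ln a / 2) - (\<Sum>j\<in>UNIV. p j * (ln (gd0 TYPE('b)) - n j * ln \<theta>)) + (\<Sum>j\<in>UNIV. p j * (real DIM('b) - n j)) * ln \<delta>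
      = (\<Sum>j\<in>UNIV. p j * ((\<Sum>i\<in>J j. ln (\<sigma> i)) + n j * (ln a / 2) + n j * ln \<theta> + (real DIM('b) - n j) * ln \<delta> - ln (gd0 TYPE('b))))"
      unfolding sum_distrib_right sum.distrib[symmetric] sum_subtractf[symmetric]
      by (intro sum.cong refl) (simp add: algebra_simps)
    also have "... <= (\<Sum>j\<in>UNIV. p j * hb \<delta> (A j \<circ> T) I w (\<lambda>i. A j (x i)))"
      by (intro sum_mono mult_left_mono hbj p)
    finally show ?thesis .
  qed
  have gain: "s0 / 2 * \<Lambda> - 1 <= k * (\<epsilon> / 2 * (DIM('a) - (\<Sum>j\<in>UNIV. p j * dim (range (A j)))) - E * (\<epsilon> * sqrt \<epsilon>))"
  proof -
    have "k * (\<epsilon> / 2 * (DIM('a) - (\<Sum>j\<in>UNIV. p j * dim (range (A j)))) - E * (\<epsilon> * sqrt \<epsilon>))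
      = (k * \<epsilon>) / 2 * (DIM('a) - (\<Sum>j\<in>UNIV. p j * dim (range (A j)))) - E * (k * \<epsilon>) * sqrt \<epsilon>"
      by (simp add: algebra_simps)
    also have "... = \<Lambda> / 2 * (DIM('a) - (\<Sum>j\<in>UNIV. p j * dim (range (A j)))) - E * \<Lambda> * sqrt \<epsilon>" by (simp only: k\<epsilon>)
    also have "... \<ge> \<Lambda> / 2 * s0 - 1"
    proof -
      have "\<Lambda> / 2 * s0 <= \<Lambda> / 2 * (DIM('a) - (\<Sum>j\<in>UNIV. p j * dim (range (A j))))"
        unfolding s0_def using dimA \<Lambda>(2) by (intro mult_left_mono) auto
      then show ?thesis using k(3) unfolding \<epsilon>_def by linarith
    qed
    finally show ?thesis by (simp add: mult.commute)
  qed
  have ga: "s0 / 2 * ln a - 1 <= s0 / 2 * \<Lambda>" using k(2) unfolding a_def \<epsilon>_def by (simp add: right_diff_distrib)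
  have s0a: "DIM('a) * (ln a / 2) - (\<Sum>j\<in>UNIV. p j * n j) * (ln a / 2) = s0 / 2 * ln a" unfolding s0_def by (simp add: algebra_simps)
  have hay: "ha I w y <= - ln (gd0 TYPE('a)) + (1 + DIM('a)) / 2" by (rule ha_le[OF y1])
  have goal: "ha I w x - (\<Sum>j\<in>UNIV. p j * hb \<delta> (A j) I w (\<lambda>i. A j (x i))) + DIM('a) * ln \<delta>
    <= - ln (gd0 TYPE('a)) + (1 + DIM('a)) / 2 + (\<Sum>j\<in>UNIV. p j * (ln (gd0 TYPE('b)) - n j * ln \<theta>)) + C0 + 2
      - (\<Sum>j\<in>UNIV. p j * (real DIM('b) - n j)) * ln \<delta>"
    using H HB gain ga s0a hay l\<sigma> JC by linarith
  then show ?thesis unfolding A_def[abs_def] .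
qed

end

section \<open>projections\<close>

definition prj :: "'a::euclidean_space set => 'a => 'a" where
  "prj V x = (SOME y. y \<in> V \<and> (\<forall>v\<in>V. orthogonal (x - y) v))"

lemma prj: assumes "subspace V" shows "prj V x \<in> V" "v \<in> V ==> (x - prj V x) \<bullet> v = 0"
proof -
  obtain y z where "y \<in> span V" "\<And>w. w \<in> span V ==> orthogonal z w" "x = y + z"
    using orthogonal_subspace_decomp_exists[of V x] by metis
  moreover have "span V = V" using assms by (simp add: span_eq_iff)
  ultimately have "\<exists>y. y \<in> V \<and> (\<forall>v\<in>V. orthogonal (x - y) v)"
    by (intro exI[of _ y]) auto
  then have "prj V x \<in> V \<and> (\<forall>v\<in>V. orthogonal (x - prj V x) v)" unfolding prj_def by (rule someI_ex)
  then show "prj V x \<in> V" "v \<in> V ==> (x - prj V x) \<bullet> v = 0" by (auto simp: orthogonal_def)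
qed

lemma prj_unique: assumes V: "subspace V" and "y \<in> V" "\<And>v. v \<in> V ==> (x - y) \<bullet> v = 0" shows "prj V x = y"
proof -
  let ?d = "prj V x - y"
  have d: "?d \<in> V" using V prj(1)[OF V] assms(2) by (simp add: subspace_diff)
  have "?d \<bullet> ?d = (x - y) \<bullet> ?d - (x - prj V x) \<bullet> ?d" by (simp add: inner_diff_left)
  also have "... = 0" using assms(3)[OF d] prj(2)[OF V d] by simp
  finally show ?thesis by simp
qed

lemma prj_id: "subspace V ==> x \<in> V ==> prj V x = x" by (rule prj_unique) auto

lemma linear_prj: assumes V: "subspace V" shows "linear (prj V)"
proof (rule linearI)
  fix x y show "prj V (x + y) = prj V x + prj V y"
  proof (rule prj_unique[OF V])
    show "prj V x + prj V y \<in> V" using prj(1)[OF V] V by (simp add: subspace_add)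
    fix v assume v: "v \<in> V"
    have "x + y - (prj V x + prj V y) = (x - prj V x) + (y - prj V y)" by simp
    then show "(x + y - (prj V x + prj V y)) \<bullet> v = 0"
      using prj(2)[OF V v, of x] prj(2)[OF V v, of y] by (simp only: inner_add_left)
  qed
next
  fix c x show "prj V (c *\<^sub>R x) = c *\<^sub>R prj V x"
  proof (rule prj_unique[OF V])
    show "c *\<^sub>R prj V x \<in> V" using prj(1)[OF V] V by (simp add: subspace_scale)
    fix v assume "v \<in> V"
    then have "c * ((x - prj V x) \<bullet> v) = 0" using prj(2)[OF V] by simp
    then show "(c *\<^sub>R x - c *\<^sub>R prj V x) \<bullet> v = 0" by (simp add: inner_diff_left algebra_simps)
  qed
qed

lemma prj_sym: assumes V: "subspace V" shows "prj V x \<bullet> y = x \<bullet> prj V y"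
proof -
  have "x \<bullet> prj V y = prj V x \<bullet> prj V y"
    using prj(2)[OF V prj(1)[OF V, of y], of x] by (simp add: inner_diff_left)
  moreover have "y \<bullet> prj V x = prj V y \<bullet> prj V x"
    using prj(2)[OF V prj(1)[OF V, of x], of y] by (simp add: inner_diff_left)
  ultimately show ?thesis by (simp only: inner_commute)
qed

lemma prj_norm2: assumes V: "subspace V" shows "(norm x)^2 = (norm (prj V x))^2 + (norm (x - prj V x))^2"
  using prj(2)[OF V prj(1)[OF V, of x], of x]
  by (simp add: power2_norm_eq_inner inner_diff_left inner_diff_right inner_commute)

lemma prj_norm_le: assumes V: "subspace V" shows "norm (prj V x) <= norm x" "norm (x - prj V x) <= norm x"
  using prj_norm2[OF V, of x] by (auto intro!: power2_le_imp_le[OF _ norm_ge_zero])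

lemma prj_onb:
  fixes V :: "'a::euclidean_space set"
  assumes V: "subspace V"
  obtains e c where "onb e" "\<And>i. c i = 0 \<or> c i = (1::real)" "\<And>x. prj V x = dg e c x" "(\<Sum>i<DIM('a). c i) = dim V"
proof -
  obtain e l where e: "onb e" and l: "\<And>i. i < DIM('a) ==> prj V (e i) = l i *\<^sub>R e i"
    and "\<And>i j. i <= j ==> j < DIM('a) ==> l j <= (l i :: real)"
    by (rule spectral[OF linear_prj[OF V] prj_sym[OF V]], rule that)
  have l01: "l i = 0 \<or> l i = 1" if i: "i < DIM('a)" for i
  proof -
    have "prj V (prj V (e i)) = prj V (e i)" by (rule prj_id[OF V prj(1)[OF V]])
    then have "(l i * l i) *\<^sub>R e i = l i *\<^sub>R e i" using l[OF i] by (simp add: linear_scale[OF linear_prj[OF V]])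
    moreover have "e i \<noteq> 0" using onb_norm[OF e i] by auto
    ultimately show ?thesis by (auto simp: scaleR_right_imp_eq)
  qed
  define c where "c i = (if i < DIM('a) \<and> l i = 1 then 1 else (0::real))" for i
  have pd: "prj V x = dg e c x" for x
  proof (rule onb_eqI[OF e])
    fix k assume k: "k < DIM('a)"
    have "prj V x \<bullet> e k = x \<bullet> (l k *\<^sub>R e k)" by (simp add: prj_sym[OF V] l[OF k])
    then show "prj V x \<bullet> e k = dg e c x \<bullet> e k" using l01[OF k] k by (auto simp: dg_inner[OF e k] c_def)
  qed
  define J where "J = {i. i < DIM('a) \<and> l i = 1}"
  have "V = span (e ` J)"
  proof
    show "V \<subseteq> span (e ` J)"
    proof
      fix v assume "v \<in> V"
      then have "v = dg e c v" using pd prj_id[OF V] by metis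
      also have "... \<in> span (e ` J)" unfolding dg_def
      proof (intro span_sum)
        fix i show "(c i * (v \<bullet> e i)) *\<^sub>R e i \<in> span (e ` J)"
          by (cases "i \<in> J") (auto simp: c_def J_def span_zero span_scale span_base)
      qed
      finally show "v \<in> span (e ` J)" .
    qed
    have "e i \<in> V" if "i \<in> J" for i using l[of i] that prj(1)[OF V, of "e i"] by (simp add: J_def)
    then show "span (e ` J) \<subseteq> V" by (intro span_minimal V) auto
  qed
  then have "dim V = dim (e ` J)" by simp
  also have "... = card (e ` J)"
    by (rule dim_eq_card_independent) (rule independent_mono[OF onb_span(2)[OF e]], auto simp: J_def)
  also have "... = card J" by (rule card_image) (rule inj_on_subset[OF onb_inj[OF e]], auto simp: J_def)
  also have "real (card J) = (\<Sum>i<DIM('a). c i)"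
  proof -
    have "(\<Sum>i<DIM('a). c i) = (\<Sum>i\<in>J. 1)"
      unfolding J_def c_def by (simp add: sum.If_cases) (auto intro!: arg_cong[where f=card])
    then show ?thesis by simp
  qed
  finally have "(\<Sum>i<DIM('a). c i) = dim V" by simp
  then show ?thesis using that[OF e _ pd] by (auto simp: c_def)
qed

lemma nn_prj_scale:
  fixes V :: "'a::euclidean_space set" and \<phi> :: "'a => ennreal"
  assumes V: "subspace V" and a: "0 < a" and b: "0 < b" and [measurable]: "borel_fun \<phi>"
  shows "(\<L> x. \<phi> x) = ennreal (a ^ dim V * b ^ (DIM('a) - dim V)) * (\<L> x. \<phi> (a *\<^sub>R prj V x + b *\<^sub>R (x - prj V x)))"
proof -
  obtain e c where e: "onb e" and c: "\<And>i. c i = 0 \<or> c i = (1::real)" and pd: "\<And>x. prj V x = dg e c x" and cs: "(\<Sum>i<DIM('a). c i) = dim V"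
    by (rule prj_onb[OF V], rule that)
  define d where "d i = (if c i = 1 then a else b)" for i
  have dx: "dg e d x = a *\<^sub>R prj V x + b *\<^sub>R (x - prj V x)" for x
  proof (rule onb_eqI[OF e])
    fix k assume "k < DIM('a)"
    then show "dg e d x \<bullet> e k = (a *\<^sub>R prj V x + b *\<^sub>R (x - prj V x)) \<bullet> e k"
      unfolding pd using c[of k] by (auto simp: dg_inner[OF e] inner_add_left inner_diff_left d_def)
  qed
  let ?J = "{i. i < DIM('a) \<and> c i = 1}"
  have "(\<Sum>i<DIM('a). c i) = (\<Sum>i<DIM('a). if c i = 1 then 1 else 0)" using c by (intro sum.cong) auto
  also have "... = card ?J" by (simp add: sum.If_cases) (auto intro!: arg_cong[where f=card])
  finally have cJ: "card ?J = dim V" using cs by simp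
  have "(\<Prod>i<DIM('a). d i) = a ^ card ?J * b ^ card ({..<DIM('a)} - ?J)"
    unfolding d_def by (simp add: prod.If_cases) (auto intro!: arg_cong2[where f="\<lambda>m n. a ^ m * b ^ n"] arg_cong[where f=card])
  also have "card ({..<DIM('a)} - ?J) = DIM('a) - dim V" using cJ by (subst card_Diff_subset) auto
  finally have P: "(\<Prod>i<DIM('a). d i) = a ^ dim V * b ^ (DIM('a) - dim V)" using cJ by simp
  have "(\<L> x. \<phi> x) = ennreal (\<Prod>i<DIM('a). d i) * (\<L> x. \<phi> (dg e d x))"
    by (rule nn_dg[OF e]) (use a b in \<open>auto simp: d_def\<close>)
  then show ?thesis unfolding P dx .
qed

section \<open>cubes\<close>

definition fl :: "'a::euclidean_space => 'a" where "fl x = (\<Sum>b\<in>Basis. real_of_int \<lfloor>x \<bullet> b\<rfloor> *\<^sub>R b)"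

lemma fl_inner: "b \<in> Basis ==> fl x \<bullet> b = real_of_int \<lfloor>x \<bullet> b\<rfloor>"
  unfolding fl_def by (simp add: inner_sum_left inner_Basis if_distrib cong: if_cong)

lemma fl_eq_iff: "fl x = fl r \<longleftrightarrow> (\<forall>b\<in>Basis. fl r \<bullet> b <= x \<bullet> b \<and> x \<bullet> b < fl r \<bullet> b + 1)"
proof -
  have "fl x = fl r \<longleftrightarrow> (\<forall>b\<in>Basis. \<lfloor>x \<bullet> b\<rfloor> = \<lfloor>r \<bullet> b\<rfloor>)"
    by (subst euclidean_eq_iff) (simp add: fl_inner)
  also have "... \<longleftrightarrow> (\<forall>b\<in>Basis. fl r \<bullet> b <= x \<bullet> b \<and> x \<bullet> b < fl r \<bullet> b + 1)"
    by (intro ball_cong refl) (simp add: fl_inner floor_eq_iff)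
  finally show ?thesis .
qed

lemma cube_measurable[measurable]: "{x. fl x = fl r} \<in> sets (borel :: 'a::euclidean_space measure)"
proof -
  have "{x \<in> space borel. \<forall>b\<in>Basis. fl r \<bullet> b <= x \<bullet> b \<and> x \<bullet> b < fl r \<bullet> b + 1} \<in> sets (borel :: 'a measure)" by measurable
  then show ?thesis unfolding fl_eq_iff by simp
qed

lemma cube_measure: "emeasure lborel {x. fl x = fl (r::'a::euclidean_space)} = 1"
proof (rule antisym)
  have "{x. fl x = fl r} \<subseteq> cbox (fl r) (fl r + One)" unfolding fl_eq_iff by (auto simp: mem_box inner_add_left) (blast intro: less_imp_le)
  then have "emeasure lborel {x. fl x = fl r} <= emeasure lborel (cbox (fl r) (fl r + One))" by (intro emeasure_mono) auto
  also have "... = 1" by (subst emeasure_lborel_cbox) (simp_all add: inner_add_left)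
  finally show "emeasure lborel {x. fl x = fl r} <= 1" .
  have "box (fl r) (fl r + One) \<subseteq> {x. fl x = fl r}" unfolding fl_eq_iff by (auto simp: mem_box inner_add_left less_imp_le)
  then have "emeasure lborel (box (fl r) (fl r + One)) <= emeasure lborel {x. fl x = fl r}" by (intro emeasure_mono) auto
  moreover have "emeasure lborel (box (fl r) (fl r + One)) = 1" by (subst emeasure_lborel_box) (simp_all add: inner_add_left)
  ultimately show "1 <= emeasure lborel {x. fl x = fl r}" by simp
qed

lemma cube_diam: assumes "fl x = fl (r::'a::euclidean_space)" shows "norm (x - r) <= DIM('a)"
proof -
  have "norm (x - r) <= (\<Sum>b\<in>Basis. \<bar>(x - r) \<bullet> b\<bar>)" by (rule norm_le_l1)
  also have "... <= (\<Sum>b\<in>(Basis::'a set). 1)"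
  proof (rule sum_mono)
    fix b :: 'a assume b: "b \<in> Basis"
    have "\<lfloor>x \<bullet> b\<rfloor> = \<lfloor>r \<bullet> b\<rfloor>" using arg_cong[OF assms, of "\<lambda>v. v \<bullet> b"] b by (simp add: fl_inner)
    then show "\<bar>(x - r) \<bullet> b\<bar> <= 1" unfolding inner_diff_left by linarith
  qed
  finally show ?thesis by simp
qed

lemma finite_fl: assumes "bounded (A :: 'a::euclidean_space set)" shows "finite (fl ` A)"
proof -
  obtain M where M: "\<And>x. x \<in> A ==> norm x <= M" using assms by (auto simp: bounded_iff)
  let ?S = "PiE (Basis::'a set) (\<lambda>_. {\<lfloor>- M\<rfloor>..\<lfloor>M\<rfloor>})"
  have sub: "fl ` A \<subseteq> (\<lambda>h. \<Sum>b\<in>Basis. real_of_int (h b) *\<^sub>R b) ` ?S"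
  proof
    fix v assume "v \<in> fl ` A"
    then obtain x where x: "x \<in> A" "v = fl x" by auto
    show "v \<in> (\<lambda>h. \<Sum>b\<in>Basis. real_of_int (h b) *\<^sub>R b) ` ?S"
    proof (rule image_eqI[of _ _ "\<lambda>b\<in>Basis. \<lfloor>x \<bullet> b\<rfloor>"])
      show "v = (\<Sum>b\<in>Basis. real_of_int ((\<lambda>b\<in>Basis. \<lfloor>x \<bullet> b\<rfloor>) b) *\<^sub>R b)" unfolding x fl_def by (intro sum.cong) auto
      have "\<lfloor>- M\<rfloor> <= \<lfloor>x \<bullet> b\<rfloor> \<and> \<lfloor>x \<bullet> b\<rfloor> <= \<lfloor>M\<rfloor>" if "b \<in> Basis" for b
        using Basis_le_norm[OF that, of x] M[OF x(1)] by (intro conjI floor_mono) auto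
      then show "(\<lambda>b\<in>Basis. \<lfloor>x \<bullet> b\<rfloor>) \<in> ?S" by (auto simp: PiE_def)
    qed
  qed
  have "finite ?S" by (intro finite_PiE) auto
  then show ?thesis by (intro finite_subset[OF sub] finite_imageI)
qed

lemma grid_sum:
  fixes r :: "'a::euclidean_space => 'a"
  assumes I: "finite I" and r: "\<And>l. l \<in> I ==> fl (r l) = l"
  shows "(\<Sum>l\<in>I. gd (y - r l) * exp (norm (y - r l))) <= exp (1 + (real DIM('a))^2 / 2) * 2 ^ DIM('a)"
proof -
  let ?n = "real DIM('a)" and ?C = "exp (1 + (real DIM('a))^2 / 2)"
  let ?h = "\<lambda>q. gd ((1 / 2) *\<^sub>R (q - y))"
  have pt: "gd (y - r l) * exp (norm (y - r l)) <= ?C * ?h q" if q: "fl q = fl (r l)" for l q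
  proof -
    define t where "t = norm (y - r l)"
    have "norm (q - y) <= norm (q - r l) + t" unfolding t_def using norm_triangle_ineq4[of "q - r l" "y - r l"] by simp
    then have "norm (q - y) <= ?n + t" using cube_diam[OF q] by linarith
    then have "(norm (q - y))^2 <= (?n + t)^2" by (rule power_mono) simp
    also have "... <= 2 * ?n\<^sup>2 + 2 * t\<^sup>2" using sum_squares_bound[of ?n t] by (simp add: power2_eq_square algebra_simps)
    finally have 1: "(norm (q - y))^2 / 8 <= ?n\<^sup>2 / 4 + t\<^sup>2 / 4" by simp
    have "0 <= (t / 2 - 1)^2" by simp
    then have "- t\<^sup>2 / 2 + t <= 1 - t\<^sup>2 / 4" by (simp add: power2_eq_square algebra_simps)
    moreover have "(norm ((1 / 2) *\<^sub>R (q - y)))^2 / 2 = (norm (q - y))^2 / 8" by (simp add: power_divide)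
    ultimately have "- t\<^sup>2 / 2 + t <= (1 + ?n\<^sup>2 / 2) + (- (norm ((1 / 2) *\<^sub>R (q - y)))\<^sup>2 / 2)"
      using 1 zero_le_power2[of ?n] by linarith
    then have "exp (- t\<^sup>2 / 2) * exp t <= ?C * exp (- (norm ((1 / 2) *\<^sub>R (q - y)))\<^sup>2 / 2)"
      by (simp only: exp_add[symmetric] exp_le_cancel_iff)
    then have "gd0 TYPE('a) * (exp (- t\<^sup>2 / 2) * exp t) <= gd0 TYPE('a) * (?C * exp (- (norm ((1 / 2) *\<^sub>R (q - y)))\<^sup>2 / 2))"
      by (intro mult_left_mono) (simp_all add: less_imp_le)
    then show ?thesis unfolding gd_def gd0_def t_def by (simp only: ac_simps)
  qed
  have "ennreal (\<Sum>l\<in>I. gd (y - r l) * exp (norm (y - r l))) = (\<Sum>l\<in>I. ennreal (gd (y - r l) * exp (norm (y - r l))))"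
    by (intro sum_ennreal[symmetric]) (simp add: less_imp_le)
  also have "... <= (\<Sum>l\<in>I. (\<L> q. ennreal (?C * ?h q) * indicator {q. fl q = l} q))"
  proof (rule sum_mono)
    fix l assume l: "l \<in> I"
    note m = cube_measurable[of "r l", unfolded r[OF l]]
    have "ennreal (gd (y - r l) * exp (norm (y - r l))) = (\<L> q. ennreal (gd (y - r l) * exp (norm (y - r l))) * indicator {q. fl q = l} q)"
      using cube_measure[of "r l"] m by (subst nn_integral_cmult_indicator) (simp_all add: r[OF l])
    also have "... <= (\<L> q. ennreal (?C * ?h q) * indicator {q. fl q = l} q)"
      using pt[of _ l] by (intro nn_integral_mono) (auto simp: r[OF l] split: split_indicator intro!: ennreal_leI)
    finally show "ennreal (gd (y - r l) * exp (norm (y - r l))) <= (\<L> q. ennreal (?C * ?h q) * indicator {q. fl q = l} q)" .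
  qed
  also have "... = (\<L> q. (\<Sum>l\<in>I. ennreal (?C * ?h q) * indicator {q. fl q = l} q))"
  proof (rule nn_integral_sum[symmetric])
    fix l assume l: "l \<in> I"
    note [measurable] = cube_measurable[of "r l", unfolded r[OF l]]
    show "(\<lambda>q. ennreal (?C * ?h q) * indicator {q. fl q = l} q) \<in> borel_measurable lborel" by measurable
  qed
  also have "... <= (\<L> q. ennreal (?C) * ennreal (?h q))"
  proof (rule nn_integral_mono)
    fix q
    have "(\<Sum>l\<in>I. (indicator {q. fl q = l} q :: ennreal)) <= 1"
    proof -
      have "(\<Sum>l\<in>I. (indicator {q. fl q = l} q :: ennreal)) = (\<Sum>l\<in>I. if l = fl q then 1 else 0)"
        by (intro sum.cong refl) (auto simp: indicator_def)
      also have "... <= 1" using I by (simp add: sum.delta)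
      finally show ?thesis .
    qed
    then have "ennreal (?C * ?h q) * (\<Sum>l\<in>I. (indicator {q. fl q = l} q :: ennreal)) <= ennreal (?C * ?h q) * 1" by (rule mult_left_mono) simp
    then show "(\<Sum>l\<in>I. ennreal (?C * ?h q) * indicator {q. fl q = l} q) <= ennreal ?C * ennreal (?h q)"
      by (simp add: sum_distrib_left ennreal_mult less_imp_le)
  qed
  also have "... = ennreal ?C * (\<L> q. ennreal (?h q))" by (rule nn_integral_cmult) simp
  also have "(\<L> q. ennreal (?h q)) = (\<L> q. ennreal (gd ((1 / 2) *\<^sub>R (q :: 'a))))"
    using nn_lborel_shift[of "\<lambda>q. ennreal (gd ((1 / 2) *\<^sub>R q))" "- y"] by simp
  also have "... = ennreal (2 ^ DIM('a)) * (\<integral>\<^sup>+q. ennreal (gd q) \<partial>(lborel :: 'a measure))"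
    by (subst nn_scale[of 2]) simp_all
  finally have "ennreal (\<Sum>l\<in>I. gd (y - r l) * exp (norm (y - r l))) <= ennreal (?C * 2 ^ DIM('a))"
    by (simp add: nn_gd ennreal_mult)
  then show ?thesis by (subst (asm) ennreal_le_iff) auto
qed

definition M1 :: "'a::euclidean_space itself => real" where "M1 _ = (\<E> z. norm (z::'a))"

lemma lipschitz_qg:
  fixes f :: "'a::euclidean_space => real"
  assumes [measurable]: "borel_fun f" and f: "\<And>x y. f x <= f y + \<Lambda> * norm (x - y)" and \<Lambda>: "0 <= \<Lambda>"
  shows "qg f"
proof (rule qg_between[where l="\<lambda>x. f 0 - \<Lambda> * norm x" and h="\<lambda>x. f 0 + \<Lambda> * norm x"])
  show "qg (\<lambda>x. f 0 - \<Lambda> * norm x)" "qg (\<lambda>x. f 0 + \<Lambda> * norm x)"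
    by (intro qg_diff qg_add qg_const qg_cmult qg_norm)+
  fix x show "f 0 - \<Lambda> * norm x <= f x" using f[of 0 x] by simp
  show "f x <= f 0 + \<Lambda> * norm x" using f[of x 0] by simp
qed simp

definition blC :: "'a::euclidean_space itself => 'b::euclidean_space itself => ('j::finite => real) => ('j => nat) => real => real => real => real" where
  "blC _ _ p n \<theta> C0 c = - ln (gd0 TYPE('a)) + (1 + DIM('a)) / 2 + (\<Sum>j\<in>UNIV. p j * (ln (gd0 TYPE('b)) - n j * ln \<theta>)) + C0 + 2
     + (M1 TYPE('a) + (1 + (real DIM('a))^2 / 2 + DIM('a) * ln 2)) + (\<Sum>j\<in>UNIV. p j * (c * M1 TYPE('a) + M1 TYPE('b) + DIM('b) / 2)) + DIM('a)"

lemma ha_start: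
  fixes I and w and x :: "'a => 'a::euclidean_space"
  assumes mix: "mixture I w" and x: "\<And>i. i \<in> I ==> fl (x i) = i"
    and wx: "\<And>i l. i \<in> I ==> l \<in> I ==> w l <= w i * exp (norm (x l - x i))"
  shows "- (\<Sum>i\<in>I. w i * ln (w i)) - M1 TYPE('a) - (1 + (real DIM('a))^2 / 2 + DIM('a) * ln 2) <= ha I w x"
proof -
  interpret mixture I w by (rule mix)
  let ?c = "1 + (real DIM('a))^2 / 2 + DIM('a) * ln 2"
  have "(\<E> z. ln (uu I w x (x i + z))) <= ln (w i) + M1 TYPE('a) + ?c" if i: "i \<in> I" for i
  proof -
    have b: "ln (uu I w x (x i + z)) <= (ln (w i) + ?c) + norm z" for z
    proof -
      let ?y = "x i + z"
      have "uu I w x ?y <= (\<Sum>l\<in>I. (w i * exp (norm z)) * (gd (?y - x l) * exp (norm (?y - x l))))"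
        unfolding uu_def
      proof (rule sum_mono)
        fix l assume l: "l \<in> I"
        have "norm (x l - x i) <= norm z + norm (?y - x l)"
          using norm_triangle_ineq4[of z "?y - x l"] by simp
        then have "exp (norm (x l - x i)) <= exp (norm z) * exp (norm (?y - x l))" by (simp add: exp_add[symmetric])
        then have "w i * exp (norm (x l - x i)) <= w i * (exp (norm z) * exp (norm (?y - x l)))"
          using wpos[OF i] by (intro mult_left_mono) auto
        then have "w l <= w i * (exp (norm z) * exp (norm (?y - x l)))" using wx[OF i l] by linarith
        then have "w l * gd (?y - x l) <= w i * (exp (norm z) * exp (norm (?y - x l))) * gd (?y - x l)"
          by (rule mult_right_mono) (rule less_imp_le[OF gd_pos])
        then show "w l * gd (?y - x l) <= (w i * exp (norm z)) * (gd (?y - x l) * exp (norm (?y - x l)))" by (simp only: ac_simps)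
      qed
      also have "... = (w i * exp (norm z)) * (\<Sum>l\<in>I. gd (?y - x l) * exp (norm (?y - x l)))" by (rule sum_distrib_left[symmetric])
      also have "... <= (w i * exp (norm z)) * (exp (1 + (real DIM('a))^2 / 2) * 2 ^ DIM('a))"
        using wpos[OF i] by (intro mult_left_mono grid_sum fin x) auto
      also have "... = exp (ln (w i) + ?c + norm z)"
        using wpos[OF i] by (simp add: exp_add exp_of_nat_mult mult.commute mult.left_commute)
      finally have "ln (uu I w x ?y) <= ln (exp (ln (w i) + ?c + norm z))" using uu_pos[of x ?y] by (subst ln_le_cancel_iff) auto
      then show ?thesis by simp
    qed
    have ib: "integrable gauss (\<lambda>z::'a. (ln (w i) + ?c) + norm z)" by (intro qg_integrable qg_add qg_const qg_norm)
    have "(\<E> z. ln (uu I w x (x i + z))) <= (\<E> z. (ln (w i) + ?c) + norm (z::'a))"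
      by (intro integral_mono ib b qg_integrable qg_shift[OF qg_ln_uu])
    also have "... = (ln (w i) + ?c) + M1 TYPE('a)" by (simp add: M1_def qg_integrable qg_norm)
    finally show ?thesis by simp
  qed
  then have "(\<Sum>i\<in>I. w i * (\<E> z. ln (uu I w x (x i + z)))) <= (\<Sum>i\<in>I. w i * (ln (w i) + (M1 TYPE('a) + ?c)))"
    using wpos by (intro sum_mono mult_left_mono) (auto simp: less_imp_le add.assoc)
  also have "... = (\<Sum>i\<in>I. w i * ln (w i)) + (M1 TYPE('a) + ?c)"
    by (simp only: distrib_left sum.distrib avg_const)
  finally show ?thesis unfolding ha_def by simp
qed

context mixture begin

lemma hb_start:
  fixes L :: "'a::euclidean_space => 'b::euclidean_space"
  assumes L: "linear L" and \<delta>: "0 < \<delta>" and Lc: "\<And>v. norm (L v) <= c * norm v"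
    and F[measurable]: "borel_fun F" and Fpos: "\<And>y. 0 < F y"
    and FL: "\<And>y y'. ln (F y) <= ln (F y') + \<Lambda> * norm (y - y')" and \<Lambda>: "0 <= \<Lambda>" "\<Lambda> * \<delta> <= 1"
    and N: "(\<L> y. ennreal (F (prj (range L) y) * exp (- (norm (y - prj (range L) y))\<^sup>2 / 2))) = ennreal N" "0 < N"
  shows "hb \<delta> (\<lambda>v. \<delta> *\<^sub>R L v) I w (\<lambda>i. \<delta> *\<^sub>R L (x i)) <= - (\<Sum>i\<in>I. w i * ln (F (L (\<delta> *\<^sub>R x i))))
     + (c * M1 TYPE('a) + M1 TYPE('b) + DIM('b) / 2) + (real DIM('b) - dim (range L)) * ln \<delta> + ln N"
proof -
  let ?V = "range L" and ?A = "\<lambda>v. \<delta> *\<^sub>R L v"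
  have V: "subspace ?V" using linear_subspace_image[OF L subspace_UNIV] .
  have A: "linear ?A" by (rule linear_compose_scale_right[OF L])
  have P: "linear (prj ?V)" by (rule linear_prj[OF V])
  have [measurable]: "prj ?V \<in> borel_measurable borel" "borel_fun L" by (rule measurable_linear, fact)+
  let ?k = "DIM('b) - dim ?V"
  have dV: "dim ?V <= DIM('b)" using dim_subset_UNIV[of ?V] by simp
  define q where "q y = y - prj ?V y" for y
  have lq: "linear q" unfolding q_def by (intro linear_compose_sub linear_ident P)
  have [measurable]: "borel_fun q" by (rule measurable_linear[OF lq])
  define D where "D = \<delta> ^ ?k * N"
  have D: "0 < D" unfolding D_def using \<delta> N by simp
  define r where "r y = F (prj ?V y) * exp (- (norm (q y))\<^sup>2 / (2 * \<delta>\<^sup>2)) / D" for y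
  have rm[measurable]: "borel_fun r" unfolding r_def[abs_def] by measurable
  have rpos: "0 < r y" for y unfolding r_def using Fpos D by simp
  have lnr: "ln (r y) = ln (F (prj ?V y)) - (norm (q y))^2 / (2 * \<delta>\<^sup>2) - ln D" for y
    unfolding r_def using Fpos[of "prj ?V y"] D by (simp add: ln_divide_pos ln_mult_pos)
  have qr: "qg (\<lambda>y. ln (r y))"
  proof -
    have "qg (\<lambda>y. ln (F y))" by (rule lipschitz_qg[OF _ FL \<Lambda>(1)]) measurable
    from qg_affine[OF this P, of 0] have 1: "qg (\<lambda>y. ln (F (prj ?V y)))" by simp
    from qg_cmult[OF qg_affine[OF qg_norm2 lq, of 0], of "1 / (2 * \<delta>\<^sup>2)"] have 2: "qg (\<lambda>y. (norm (q y))^2 / (2 * \<delta>\<^sup>2))" by simp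
    show ?thesis unfolding lnr by (intro qg_diff 1 2 qg_const)
  qed
  have "(\<L> y. ennreal (r y)) = ennreal (1 ^ dim ?V * \<delta> ^ ?k) * (\<L> y. ennreal (r (1 *\<^sub>R prj ?V y + \<delta> *\<^sub>R (y - prj ?V y))))"
    by (rule nn_prj_scale[OF V]) (use \<delta> in auto)
  also have "(\<L> y. ennreal (r (1 *\<^sub>R prj ?V y + \<delta> *\<^sub>R (y - prj ?V y)))) = (\<L> y. ennreal (F (prj ?V y) * exp (- (norm (y - prj ?V y))\<^sup>2 / 2)) * ennreal (1 / D))"
  proof (rule nn_integral_cong)
    fix y
    have p0: "prj ?V (y - prj ?V y) = 0" by (simp add: linear_diff[OF P] prj_id[OF V prj(1)[OF V]])
    have p: "prj ?V (1 *\<^sub>R prj ?V y + \<delta> *\<^sub>R (y - prj ?V y)) = prj ?V y"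
      using p0 by (simp add: linear_add[OF P] linear_scale[OF P] prj_id[OF V prj(1)[OF V]])
    then have "q (1 *\<^sub>R prj ?V y + \<delta> *\<^sub>R (y - prj ?V y)) = \<delta> *\<^sub>R (y - prj ?V y)" by (simp add: q_def)
    then have "r (1 *\<^sub>R prj ?V y + \<delta> *\<^sub>R (y - prj ?V y)) = F (prj ?V y) * exp (- (norm (y - prj ?V y))\<^sup>2 / 2) * (1 / D)"
      unfolding r_def p using \<delta> by (simp add: power_mult_distrib)
    then show "ennreal (r (1 *\<^sub>R prj ?V y + \<delta> *\<^sub>R (y - prj ?V y))) = ennreal (F (prj ?V y) * exp (- (norm (y - prj ?V y))\<^sup>2 / 2)) * ennreal (1 / D)"
      using Fpos[of "prj ?V y"] D by (simp only: ennreal_mult'' divide_nonneg_pos zero_le_one)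
  qed
  also have "... = (\<L> y. ennreal (F (prj ?V y) * exp (- (norm (y - prj ?V y))\<^sup>2 / 2))) * ennreal (1 / D)"
    by (rule nn_integral_multc) measurable
  also have "... = ennreal N * ennreal (1 / D)" by (simp only: N)
  finally have "(\<L> y. ennreal (r y)) = ennreal (\<delta> ^ ?k) * (ennreal N * ennreal (1 / D))" by simp
  also have "... = ennreal (\<delta> ^ ?k * (N * (1 / D)))" using \<delta> N D by (simp only: ennreal_mult'' less_imp_le zero_less_divide_1_iff mult_nonneg_nonneg)
  also have "... = 1" unfolding D_def using \<delta> N(2) by simp
  finally have r1: "(\<L> y. ennreal (r y)) <= 1" by simp
  have "hb \<delta> ?A I w (\<lambda>i. \<delta> *\<^sub>R L (x i)) <= - (\<Sum>i\<in>I. w i * (\<E> \<zeta>. ln (r (\<delta> *\<^sub>R L (x i) + BB \<delta> ?A \<zeta>))))"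
    by (rule hb_gibbs[OF A \<delta> rm rpos qr r1])
  also have "... <= - (\<Sum>i\<in>I. w i * (ln (F (L (\<delta> *\<^sub>R x i))) - (c * M1 TYPE('a) + M1 TYPE('b) + DIM('b) / 2 + ln D)))"
  proof (intro le_imp_neg_le sum_mono mult_left_mono)
    fix i assume i: "i \<in> I"
    show "0 <= w i" using wpos[OF i] by simp
    have b: "ln (F (L (\<delta> *\<^sub>R x i))) - (c * norm (fst \<zeta>) + norm (snd \<zeta>) + (norm (snd \<zeta>))^2 / 2 + ln D) <= ln (r (\<delta> *\<^sub>R L (x i) + BB \<delta> ?A \<zeta>))" for \<zeta> :: "'a \<times> 'b"
    proof -
      let ?Y = "\<delta> *\<^sub>R L (x i) + BB \<delta> ?A \<zeta>"
      have pL: "prj ?V (L v) = L v" for v by (rule prj_id[OF V]) simp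
      have pY: "prj ?V ?Y = L (\<delta> *\<^sub>R x i) + (\<delta> *\<^sub>R L (fst \<zeta>) + \<delta> *\<^sub>R prj ?V (snd \<zeta>))"
        by (simp add: BB_def linear_add[OF P] linear_scale[OF P] pL linear_scale[OF L])
      have qY: "q ?Y = \<delta> *\<^sub>R (snd \<zeta> - prj ?V (snd \<zeta>))"
        unfolding q_def pY by (simp add: BB_def linear_scale[OF L] scaleR_diff_right)
      have a: "norm (\<delta> *\<^sub>R L (fst \<zeta>) + \<delta> *\<^sub>R prj ?V (snd \<zeta>)) <= \<delta> * (c * norm (fst \<zeta>)) + \<delta> * norm (snd \<zeta>)"
        using \<delta> Lc[of "fst \<zeta>"] prj_norm_le(1)[OF V, of "snd \<zeta>"]
        by (intro order_trans[OF norm_triangle_ineq] add_mono) (auto simp: mult_left_mono)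
      have "\<Lambda> * norm (L (\<delta> *\<^sub>R x i) - prj ?V ?Y) <= \<Lambda> * (\<delta> * (c * norm (fst \<zeta>)) + \<delta> * norm (snd \<zeta>))"
      proof (intro mult_left_mono \<Lambda>(1))
        show "norm (L (\<delta> *\<^sub>R x i) - prj ?V ?Y) <= \<delta> * (c * norm (fst \<zeta>)) + \<delta> * norm (snd \<zeta>)"
          unfolding pY by (subst norm_minus_cancel[symmetric]) (use a in \<open>simp add: add.commute\<close>)
      qed
      also have "... = (\<Lambda> * \<delta>) * (c * norm (fst \<zeta>) + norm (snd \<zeta>))" by (simp add: algebra_simps)
      also have "... <= 1 * (c * norm (fst \<zeta>) + norm (snd \<zeta>))"
        using order_trans[OF norm_ge_zero Lc[of "fst \<zeta>"]] by (intro mult_right_mono \<Lambda>) auto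
      finally have 1: "ln (F (L (\<delta> *\<^sub>R x i))) - (c * norm (fst \<zeta>) + norm (snd \<zeta>)) <= ln (F (prj ?V ?Y))"
        using FL[of "L (\<delta> *\<^sub>R x i)" "prj ?V ?Y"] by simp
      have "(norm (q ?Y))^2 / (2 * \<delta>\<^sup>2) = (norm (snd \<zeta> - prj ?V (snd \<zeta>)))^2 / 2"
        unfolding qY using \<delta> by (simp add: power_mult_distrib)
      also have "... <= (norm (snd \<zeta>))^2 / 2" using prj_norm_le(2)[OF V, of "snd \<zeta>"] by (intro divide_right_mono power_mono) auto
      finally show ?thesis unfolding lnr using 1 by simp
    qed
    have q1: "qg (\<lambda>z::'a. c * norm z)" by (intro qg_cmult qg_norm)
    have q2: "qg (\<lambda>m::'b. norm m + (norm m)^2 / 2)" using qg_add[OF qg_norm qg_cmult[OF qg_norm2, of "1/2"]] by simp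
    have snd_int: "integrable (gauss :: ('a \<times> 'b) measure) (\<lambda>\<zeta>. f (snd \<zeta>))" "(\<integral>\<zeta>. f (snd \<zeta>) \<partial>(gauss :: ('a \<times> 'b) measure)) = (\<E> m. f m)"
      if f: "qg f" for f :: "'b => real"
    proof -
      have ls: "linear (snd :: 'a \<times> 'b => 'b)" by (intro linearI) auto
      show i: "integrable (gauss :: ('a \<times> 'b) measure) (\<lambda>\<zeta>. f (snd \<zeta>))"
        using qg_integrable[OF qg_affine[OF f ls, of 0]] by simp
      interpret pair_sigma_finite "gauss :: 'a measure" "gauss :: 'b measure" ..
      have "integrable ((gauss :: 'a measure) \<Otimes>\<^sub>M (gauss :: 'b measure)) (\<lambda>(z, m). f m)" using i unfolding gauss_pair by (simp add: case_prod_beta')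
      from integral_fst[OF this] show "(\<integral>\<zeta>. f (snd \<zeta>) \<partial>(gauss :: ('a \<times> 'b) measure)) = (\<E> m. f m)"
        unfolding gauss_pair by (simp add: case_prod_beta')
    qed
    have i1: "integrable (gauss :: ('a \<times> 'b) measure) (\<lambda>\<zeta>. c * norm (fst \<zeta>))"
      using integrable_gauss_fst[OF _ qg_integrable[OF q1]] by simp
    have e1: "(\<integral>\<zeta>. c * norm (fst \<zeta>) \<partial>(gauss :: ('a \<times> 'b) measure)) = c * M1 TYPE('a)"
      using integral_gauss_fst[of "\<lambda>z::'a. c * norm z", where 'b='b] by (simp add: M1_def)
    have e2: "(\<integral>m. norm m + (norm m)^2 / 2 \<partial>(gauss :: 'b measure)) = M1 TYPE('b) + DIM('b) / 2"
      by (simp add: qg_integrable qg_norm qg_norm2 M1_def gauss_norm2)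
    let ?f = "\<lambda>\<zeta>::'a \<times> 'b. ln (F (L (\<delta> *\<^sub>R x i))) - ln D - c * norm (fst \<zeta>) - (norm (snd \<zeta>) + (norm (snd \<zeta>))^2 / 2)"
    have if0: "integrable (gauss :: ('a \<times> 'b) measure) (\<lambda>\<zeta>. ln (F (L (\<delta> *\<^sub>R x i))) - ln D)" by simp
    have iF: "integrable gauss ?f" by (intro Bochner_Integration.integrable_diff if0 i1 snd_int(1)[OF q2])
    have "ln (F (L (\<delta> *\<^sub>R x i))) - (c * M1 TYPE('a) + M1 TYPE('b) + DIM('b) / 2 + ln D) = integral\<^sup>L gauss ?f"
      by (subst Bochner_Integration.integral_diff[OF Bochner_Integration.integrable_diff[OF if0 i1] snd_int(1)[OF q2]],
          subst Bochner_Integration.integral_diff[OF if0 i1]) (simp only: e1 snd_int(2)[OF q2] e2, simp)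
    also have "... <= (\<E> \<zeta>. ln (r (\<delta> *\<^sub>R L (x i) + BB \<delta> ?A \<zeta>)))"
    proof (rule integral_mono[OF iF])
      show "integrable gauss (\<lambda>\<zeta>. ln (r (\<delta> *\<^sub>R L (x i) + BB \<delta> ?A \<zeta>)))" by (intro qg_integrable qg_affine[OF qr] linear_BB A)
      fix \<zeta> show "?f \<zeta> <= ln (r (\<delta> *\<^sub>R L (x i) + BB \<delta> ?A \<zeta>))" using b[of \<zeta>] by simp
    qed
    finally show "ln (F (L (\<delta> *\<^sub>R x i))) - (c * M1 TYPE('a) + M1 TYPE('b) + DIM('b) / 2 + ln D) <= (\<E> \<zeta>. ln (r (\<delta> *\<^sub>R L (x i) + BB \<delta> ?A \<zeta>)))" .
  qed
  also have "... = - (\<Sum>i\<in>I. w i * ln (F (L (\<delta> *\<^sub>R x i)))) + (c * M1 TYPE('a) + M1 TYPE('b) + DIM('b) / 2 + ln D)"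
    by (simp only: right_diff_distrib sum_subtractf avg_const)
  also have "ln D = (real DIM('b) - dim ?V) * ln \<delta> + ln N"
    unfolding D_def using \<delta> N(2) dV by (simp add: ln_mult_pos ln_realpow of_nat_diff)
  finally show ?thesis by simp
qed

end

lemma wsum_prod_ln:
  fixes F :: "'j::finite => real"
  assumes "\<And>j. 0 < F j" shows "ln (\<Prod>j\<in>UNIV. F j powr p j) = (\<Sum>j\<in>UNIV. p j * ln (F j))"
  using assms by (subst ln_prod) (auto simp: ln_powr less_imp_neq[symmetric])

theorem bl_loglip:
  fixes L :: "'j::finite => 'a::euclidean_space => 'b::euclidean_space" and p :: "'j => real"
    and F :: "'j => 'b => real" and n :: "'j => nat" and G :: "'a => 'a"
  assumes L: "\<And>j. linear (L j)" and n: "\<And>j. dim (range (L j)) = n j" and p: "\<And>j. 0 <= p j"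
    and Lc: "\<And>j v. norm (L j v) <= c * norm v"
    and G: "linear G" "\<And>u v. G u \<bullet> v = u \<bullet> G v" "\<And>v. 0 <= G v \<bullet> v" "\<And>v. G v \<bullet> v <= B * (norm v)^2"
    and gc: "gauss_cond L p G n \<theta> C0" and \<theta>: "0 < \<theta>"
    and \<Omega>[measurable]: "\<Omega> \<in> sets borel" and b\<Omega>: "bounded \<Omega>" and G\<Omega>: "\<And>x. x \<in> \<Omega> ==> G x \<bullet> x <= 1"
    and Fm[measurable]: "\<And>j. F j \<in> borel_measurable borel" and Fpos: "\<And>j y. 0 < F j y"
    and FL: "\<And>j y y'. ln (F j y) <= ln (F j y') + \<Lambda> * norm (y - y')" and \<Lambda>: "0 <= \<Lambda>"
    and N: "\<And>j. (\<L> y. ennreal (F j (prj (range (L j)) y) * exp (- (norm (y - prj (range (L j)) y))\<^sup>2 / 2))) = ennreal (N j)" "\<And>j. 0 < N j"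
  shows "(\<integral>\<^sup>+x\<in>\<Omega>. ennreal (\<Prod>j\<in>UNIV. F j (L j x) powr p j) \<partial>lborel)
     <= ennreal (exp (blC TYPE('a) TYPE('b) p n \<theta> C0 c) * (\<Prod>j\<in>UNIV. N j powr p j))"
proof (cases "\<Omega> = {}")
  case True then show ?thesis by simp
next
  case False
  have [measurable]: "borel_fun (L j)" for j by (rule measurable_linear[OF L])
  define g where "g x = (\<Prod>j\<in>UNIV. F j (L j x) powr p j)" for x
  have gpos: "0 < g x" for x unfolding g_def by (intro prod_pos) (use Fpos in \<open>auto simp: less_imp_neq[symmetric]\<close>)
  have [measurable]: "borel_fun g" unfolding g_def[abs_def] by measurable
  have lng: "ln (g x) = (\<Sum>j\<in>UNIV. p j * ln (F j (L j x)))" for x unfolding g_def by (rule wsum_prod_ln[OF Fpos])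
  have c0: "0 <= c" 
  proof -
    obtain b :: 'a where "b \<in> Basis" using SOME_Basis by blast
    then show ?thesis using order_trans[OF norm_ge_zero Lc[of undefined b]] by (simp add: norm_Basis)
  qed
  define \<Lambda>' where "\<Lambda>' = (\<Sum>j\<in>UNIV. p j * (\<Lambda> * c))"
  have \<Lambda>'0: "0 <= \<Lambda>'" unfolding \<Lambda>'_def using p \<Lambda> c0 by (intro sum_nonneg) auto
  have gL: "ln (g x) <= ln (g x') + \<Lambda>' * norm (x - x')" for x x'
  proof -
    have "ln (g x) <= (\<Sum>j\<in>UNIV. p j * (ln (F j (L j x')) + \<Lambda> * c * norm (x - x')))" unfolding lng
    proof (intro sum_mono mult_left_mono p)
      fix j
      have "\<Lambda> * norm (L j x - L j x') <= \<Lambda> * (c * norm (x - x'))"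
        using Lc[of j "x - x'"] \<Lambda> by (intro mult_left_mono) (simp_all add: linear_diff[OF L])
      then show "ln (F j (L j x)) <= ln (F j (L j x')) + \<Lambda> * c * norm (x - x')"
        using FL[of j "L j x" "L j x'"] by (simp add: mult.assoc)
    qed
    also have "... = ln (g x') + \<Lambda>' * norm (x - x')"
      unfolding lng \<Lambda>'_def by (simp add: distrib_left sum.distrib sum_distrib_right mult.assoc)
    finally show ?thesis .
  qed
  have B0: "0 <= B"
  proof -
    obtain b :: 'a where "b \<in> Basis" using SOME_Basis by blast
    then show ?thesis using order_trans[OF G(3) G(4)[of b]] by simp
  qed
  have DB: "0 <= DIM('a) * B" using B0 by simp
  define Q where "Q = 1 + \<Lambda> + \<Lambda>' + DIM('a) * B"
  define \<delta> where "\<delta> = 1 / Q"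
  have Q: "1 <= Q" unfolding Q_def using \<Lambda> \<Lambda>'0 DB by linarith
  have \<delta>: "0 < \<delta>" "\<delta> <= 1" unfolding \<delta>_def using Q by auto
  have \<delta>1: "\<Lambda> * \<delta> <= 1" "\<Lambda>' * \<delta> <= 1" "DIM('a) * B * \<delta> <= 1"
    unfolding \<delta>_def using Q \<Lambda> \<Lambda>'0 DB by (auto simp: divide_le_eq) (auto simp: Q_def)
  have \<delta>2: "\<delta>\<^sup>2 * (DIM('a) * B) <= 1"
  proof -
    have "\<delta>\<^sup>2 * (DIM('a) * B) = \<delta> * (DIM('a) * B * \<delta>)" by (simp add: power2_eq_square)
    also have "... <= 1 * 1" using \<delta> \<delta>1(3) B0 by (intro mult_mono) auto
    finally show ?thesis by simp
  qed
  define A where "A = (\<lambda>x. x /\<^sub>R \<delta>) ` \<Omega>"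
  have bA: "bounded A" unfolding A_def using b\<Omega> by (rule bounded_scaling)
  define I where "I = fl ` A"
  have finI: "finite I" unfolding I_def by (rule finite_fl[OF bA])
  define r where "r l = (SOME x. x \<in> A \<and> fl x = l)" for l
  have r: "r l \<in> A" "fl (r l) = l" if "l \<in> I" for l
  proof -
    have "\<exists>x. x \<in> A \<and> fl x = l" using that by (auto simp: I_def)
    then have "r l \<in> A \<and> fl (r l) = l" unfolding r_def by (rule someI_ex)
    then show "r l \<in> A" "fl (r l) = l" by auto
  qed
  have rO: "\<delta> *\<^sub>R r l \<in> \<Omega>" if "l \<in> I" for l using r(1)[OF that] \<delta> by (auto simp: A_def)
  have In: "I \<noteq> {}" using False by (auto simp: I_def A_def)
  define S where "S = (\<Sum>l\<in>I. g (\<delta> *\<^sub>R r l))"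
  have S: "0 < S" unfolding S_def using finI In gpos by (intro sum_pos) auto
  define w where "w l = g (\<delta> *\<^sub>R r l) / S" for l
  have mix: "mixture I w"
  proof
    show "finite I" by fact
    show "0 < w l" for l unfolding w_def using gpos S by simp
    show "(\<Sum>i\<in>I. w i) = 1" unfolding w_def using S by (simp add: sum_divide_distrib[symmetric] S_def)
  qed
  interpret mixture I w by (rule mix)
  have glx: "g (\<delta> *\<^sub>R x) <= g (\<delta> *\<^sub>R x') * exp (norm (x - x'))" for x x'
  proof -
    have "ln (g (\<delta> *\<^sub>R x)) <= ln (g (\<delta> *\<^sub>R x')) + \<Lambda>' * norm (\<delta> *\<^sub>R x - \<delta> *\<^sub>R x')" by (rule gL)
    also have "norm (\<delta> *\<^sub>R x - \<delta> *\<^sub>R x') = \<delta> * norm (x - x')" using \<delta> by (simp flip: scaleR_diff_right)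
    also have "\<Lambda>' * (\<delta> * norm (x - x')) <= 1 * norm (x - x')" unfolding mult.assoc[symmetric] by (rule mult_right_mono[OF \<delta>1(2)]) simp
    finally have "exp (ln (g (\<delta> *\<^sub>R x))) <= exp (ln (g (\<delta> *\<^sub>R x')) + norm (x - x'))" by simp
    then show ?thesis using gpos by (simp add: exp_add)
  qed
  have wx: "w l <= w i * exp (norm (r l - r i))" for i l
    unfolding w_def using glx[of "r l" "r i"] S by (simp add: divide_right_mono)
  have HA: "- (\<Sum>i\<in>I. w i * ln (w i)) - M1 TYPE('a) - (1 + (real DIM('a))^2 / 2 + DIM('a) * ln 2) <= ha I w r"
    by (rule ha_start[OF mix]) (auto simp: r wx)
  have lw: "(\<Sum>i\<in>I. w i * ln (w i)) = (\<Sum>j\<in>UNIV. p j * (\<Sum>i\<in>I. w i * ln (F j (L j (\<delta> *\<^sub>R r i))))) - ln S"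
  proof -
    have "(\<Sum>i\<in>I. w i * ln (w i)) = (\<Sum>i\<in>I. w i * (ln (g (\<delta> *\<^sub>R r i)) - ln S))"
      using gpos S unfolding w_def by (intro sum.cong) (auto simp: ln_divide_pos)
    also have "... = (\<Sum>i\<in>I. w i * ln (g (\<delta> *\<^sub>R r i))) - ln S" by (simp only: right_diff_distrib sum_subtractf avg_const)
    also have "(\<Sum>i\<in>I. w i * ln (g (\<delta> *\<^sub>R r i))) = (\<Sum>j\<in>UNIV. p j * (\<Sum>i\<in>I. w i * ln (F j (L j (\<delta> *\<^sub>R r i)))))"
      unfolding lng sum_distrib_left by (subst sum.swap) (simp add: mult.left_commute)
    finally show ?thesis .
  qed
  have HBj: "hb \<delta> (\<lambda>v. \<delta> *\<^sub>R L j v) I w (\<lambda>i. \<delta> *\<^sub>R L j (r i)) <= - (\<Sum>i\<in>I. w i * ln (F j (L j (\<delta> *\<^sub>R r i))))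
     + (c * M1 TYPE('a) + M1 TYPE('b) + DIM('b) / 2) + (real DIM('b) - n j) * ln \<delta> + ln (N j)" for j
    unfolding n[symmetric] by (rule hb_start[OF L \<delta>(1) Lc Fm Fpos FL \<Lambda> \<delta>1(1) N])
  have HB: "(\<Sum>j\<in>UNIV. p j * hb \<delta> (\<lambda>v. \<delta> *\<^sub>R L j v) I w (\<lambda>i. \<delta> *\<^sub>R L j (r i))) <= - (\<Sum>j\<in>UNIV. p j * (\<Sum>i\<in>I. w i * ln (F j (L j (\<delta> *\<^sub>R r i)))))
     + (\<Sum>j\<in>UNIV. p j * (c * M1 TYPE('a) + M1 TYPE('b) + DIM('b) / 2)) + (\<Sum>j\<in>UNIV. p j * (real DIM('b) - n j)) * ln \<delta> + (\<Sum>j\<in>UNIV. p j * ln (N j))"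
  proof -
    have "(\<Sum>j\<in>UNIV. p j * hb \<delta> (\<lambda>v. \<delta> *\<^sub>R L j v) I w (\<lambda>i. \<delta> *\<^sub>R L j (r i))) <= (\<Sum>j\<in>UNIV. p j * (- (\<Sum>i\<in>I. w i * ln (F j (L j (\<delta> *\<^sub>R r i))))
     + (c * M1 TYPE('a) + M1 TYPE('b) + DIM('b) / 2) + (real DIM('b) - n j) * ln \<delta> + ln (N j)))"
      by (intro sum_mono mult_left_mono HBj p)
    also have "... = - (\<Sum>j\<in>UNIV. p j * (\<Sum>i\<in>I. w i * ln (F j (L j (\<delta> *\<^sub>R r i)))))
     + (\<Sum>j\<in>UNIV. p j * (c * M1 TYPE('a) + M1 TYPE('b) + DIM('b) / 2)) + (\<Sum>j\<in>UNIV. p j * (real DIM('b) - n j)) * ln \<delta> + (\<Sum>j\<in>UNIV. p j * ln (N j))"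
      unfolding sum_distrib_right[of _ _ "ln \<delta>"] sum_negf[symmetric] sum.distrib[symmetric]
      by (intro sum.cong refl) (simp add: algebra_simps sum_negf)
    finally show ?thesis .
  qed
  have EB: "ha I w r - (\<Sum>j\<in>UNIV. p j * hb \<delta> (\<lambda>v. \<delta> *\<^sub>R L j v) I w (\<lambda>i. \<delta> *\<^sub>R L j (r i))) + DIM('a) * ln \<delta>
    <= - ln (gd0 TYPE('a)) + (1 + DIM('a)) / 2 + (\<Sum>j\<in>UNIV. p j * (ln (gd0 TYPE('b)) - n j * ln \<theta>)) + C0 + 2
      - (\<Sum>j\<in>UNIV. p j * (real DIM('b) - n j)) * ln \<delta>"
    by (rule entropy_bound[OF L n \<delta>(1) p G \<delta>2 _ gc \<theta>]) (rule G\<Omega>[OF rO])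
  have fin: "ln S + DIM('a) * ln \<delta> + DIM('a) <= blC TYPE('a) TYPE('b) p n \<theta> C0 c + (\<Sum>j\<in>UNIV. p j * ln (N j))"
    using HA HB EB lw unfolding blC_def by linarith
  have "(\<integral>\<^sup>+x\<in>\<Omega>. ennreal (g x) \<partial>lborel) = ennreal (\<delta> ^ DIM('a)) * (\<L> x. ennreal (g (\<delta> *\<^sub>R x)) * indicator \<Omega> (\<delta> *\<^sub>R x))"
    by (rule nn_scale[OF \<delta>(1)]) simp
  also have "(\<L> x. ennreal (g (\<delta> *\<^sub>R x)) * indicator \<Omega> (\<delta> *\<^sub>R x)) <= (\<L> x. (\<Sum>l\<in>I. ennreal (g (\<delta> *\<^sub>R r l) * exp DIM('a)) * indicator {x. fl x = l} x))"
  proof (rule nn_integral_mono)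
    fix x
    show "ennreal (g (\<delta> *\<^sub>R x)) * indicator \<Omega> (\<delta> *\<^sub>R x) <= (\<Sum>l\<in>I. ennreal (g (\<delta> *\<^sub>R r l) * exp DIM('a)) * indicator {x. fl x = l} x)"
    proof (cases "\<delta> *\<^sub>R x \<in> \<Omega>")
      case True
      then have "x \<in> A" using \<delta> unfolding A_def by (intro image_eqI[of _ _ "\<delta> *\<^sub>R x"]) auto
      then have l: "fl x \<in> I" by (auto simp: I_def)
      have "g (\<delta> *\<^sub>R x) <= g (\<delta> *\<^sub>R r (fl x)) * exp (norm (x - r (fl x)))" by (rule glx)
      also have "... <= g (\<delta> *\<^sub>R r (fl x)) * exp DIM('a)"
        using gpos cube_diam[of x "r (fl x)"] r(2)[OF l] by (intro mult_left_mono) (auto simp: less_imp_le)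
      finally have "ennreal (g (\<delta> *\<^sub>R x)) <= ennreal (g (\<delta> *\<^sub>R r (fl x)) * exp DIM('a)) * indicator {y. fl y = fl x} x"
        by (simp add: ennreal_leI)
      also have "... <= (\<Sum>l\<in>I. ennreal (g (\<delta> *\<^sub>R r l) * exp DIM('a)) * indicator {x. fl x = l} x)"
        by (rule member_le_sum[OF l _ finI]) simp
      finally show ?thesis using True by simp
    qed simp
  qed
  also have "... = (\<Sum>l\<in>I. (\<L> x. ennreal (g (\<delta> *\<^sub>R r l) * exp DIM('a)) * indicator {x. fl x = l} x))"
  proof (rule nn_integral_sum)
    fix l assume l: "l \<in> I"
    note [measurable] = cube_measurable[of "r l", unfolded r(2)[OF l]]
    show "(\<lambda>x. ennreal (g (\<delta> *\<^sub>R r l) * exp DIM('a)) * indicator {x. fl x = l} x) \<in> borel_measurable lborel" by measurable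
  qed
  also have "... = (\<Sum>l\<in>I. ennreal (g (\<delta> *\<^sub>R r l) * exp DIM('a)))"
  proof (rule sum.cong[OF refl])
    fix l assume l: "l \<in> I"
    show "(\<L> x. ennreal (g (\<delta> *\<^sub>R r l) * exp DIM('a)) * indicator {x. fl x = l} x) = ennreal (g (\<delta> *\<^sub>R r l) * exp DIM('a))"
      using cube_measure[of "r l"] cube_measurable[of "r l"] by (subst nn_integral_cmult_indicator) (simp_all add: r(2)[OF l])
  qed
  also have "... = ennreal (\<Sum>l\<in>I. g (\<delta> *\<^sub>R r l) * exp DIM('a))" using gpos by (intro sum_ennreal) (simp add: less_imp_le)
  also have "(\<Sum>l\<in>I. g (\<delta> *\<^sub>R r l) * exp DIM('a)) = S * exp DIM('a)" unfolding S_def by (rule sum_distrib_right[symmetric])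
  also have "ennreal (\<delta> ^ DIM('a)) * ennreal (S * exp DIM('a)) = ennreal (\<delta> ^ DIM('a) * (S * exp DIM('a)))"
    using \<delta> by (simp add: ennreal_mult')
  also have "... <= ennreal (exp (blC TYPE('a) TYPE('b) p n \<theta> C0 c) * (\<Prod>j\<in>UNIV. N j powr p j))"
  proof (rule ennreal_leI)
    have "\<delta> ^ DIM('a) * (S * exp DIM('a)) = exp (ln S + DIM('a) * ln \<delta> + DIM('a))"
      using \<delta> S by (simp add: exp_add exp_of_nat_mult)
    also have "... <= exp (blC TYPE('a) TYPE('b) p n \<theta> C0 c + (\<Sum>j\<in>UNIV. p j * ln (N j)))" using fin by simp
    also have "... = exp (blC TYPE('a) TYPE('b) p n \<theta> C0 c) * (\<Prod>j\<in>UNIV. N j powr p j)"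
      using N(2) by (simp add: exp_add exp_sum powr_def less_imp_neq[symmetric])
    finally show "\<delta> ^ DIM('a) * (S * exp DIM('a)) <= exp (blC TYPE('a) TYPE('b) p n \<theta> C0 c) * (\<Prod>j\<in>UNIV. N j powr p j)" .
  qed
  finally show ?thesis unfolding g_def by (simp add: mult_left_mono)
qed

lemma subspace_lborel_obtain:
  fixes V :: "'a::euclidean_space set"
  assumes V: "subspace V"
  obtains B where "finite B" "B \<subseteq> V" "\<And>b b'. b \<in> B ==> b' \<in> B ==> b \<bullet> b' = (if b = b' then 1 else 0)" "span B = V"
    "subspace_lborel V = distr (\<Pi>\<^sub>M b\<in>B. (lborel :: real measure)) (restrict_space borel V) (\<lambda>f. \<Sum>b\<in>B. f b *\<^sub>R b)"
proof -
  obtain B0 where "pairwise orthogonal B0" "\<And>x. x \<in> B0 ==> norm x = 1" "span B0 = V"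
    using orthonormal_basis_subspace[OF V] by metis
  then have "\<exists>B. orthonormal_basis_of V B" by (auto simp: orthonormal_basis_of_def)
  define B where "B = (SOME B. orthonormal_basis_of V B)"
  have B: "orthonormal_basis_of V B" unfolding B_def by (rule someI_ex) fact
  have po: "pairwise orthogonal B" and n1: "\<forall>b\<in>B. norm b = 1" and sp: "span B = V" using B by (auto simp: orthonormal_basis_of_def)
  have "independent B" using po n1 by (intro pairwise_orthogonal_independent) force+
  then have "finite B" by (rule independent_imp_finite)
  moreover have "b \<bullet> b' = (if b = b' then 1 else 0)" if "b \<in> B" "b' \<in> B" for b b'
    using po n1 that by (auto simp: pairwise_def orthogonal_def norm_eq_1)
  moreover have "B \<subseteq> V" using sp span_superset by auto
  ultimately show ?thesis using that[of B] sp unfolding subspace_lborel_def Let_def B_def[symmetric] by auto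
qed

lemma emeasure_lborel_affine:
  fixes E :: "real set"
  assumes [measurable]: "E \<in> sets borel" and s: "s = 1 \<or> s = -1"
  shows "emeasure lborel {t. c + s * t \<in> E} = emeasure lborel E"
proof -
  have "emeasure lborel {t. c + s * t \<in> E} = (\<L> t. indicator {t. c + s * t \<in> E} t)" by (subst nn_integral_indicator) simp_all
  also have "... = (\<L> t. indicator E (c + s * t))" by (intro nn_integral_cong) (simp add: indicator_def)
  also have "... = (\<L> t. indicator E (c + t))"
    using s nn_lborel_neg[of "\<lambda>t. indicator E (c + t)"] by auto
  also have "... = (\<L> t. indicator E t)" by (rule nn_lborel_shift) simp
  also have "... = emeasure lborel E" by (subst nn_integral_indicator) simp_all
  finally show ?thesis .
qed

lemma PiM_affine:
  fixes v :: "'k => real"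
  assumes B: "finite B" and s: "s = 1 \<or> s = (-1::real)"
  shows "distr (\<Pi>\<^sub>M b\<in>B. lborel) (\<Pi>\<^sub>M b\<in>B. lborel) (\<lambda>f. \<lambda>b\<in>B. v b + s * f b) = (\<Pi>\<^sub>M b\<in>B. lborel)"
proof -
  interpret product_sigma_finite "\<lambda>_::'k. lborel :: real measure" ..
  show ?thesis
  proof (rule PiM_eqI[OF B])
    fix A :: "'k => real set" assume A: "\<And>i. i \<in> B ==> A i \<in> sets lborel"
    let ?T = "\<lambda>f. \<lambda>b\<in>B. v b + s * f b"
    have m: "?T \<in> measurable (\<Pi>\<^sub>M b\<in>B. lborel) (\<Pi>\<^sub>M b\<in>B. lborel)" by measurable
    have "emeasure (distr (\<Pi>\<^sub>M b\<in>B. lborel) (\<Pi>\<^sub>M b\<in>B. lborel) ?T) (Pi\<^sub>E B A) = emeasure (\<Pi>\<^sub>M b\<in>B. lborel) (?T -` Pi\<^sub>E B A \<inter> space (\<Pi>\<^sub>M b\<in>B. lborel))"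
      using A B by (intro emeasure_distr m sets_PiM_I_finite) auto
    also have "?T -` Pi\<^sub>E B A \<inter> space (\<Pi>\<^sub>M b\<in>B. lborel) = Pi\<^sub>E B (\<lambda>b. {t. v b + s * t \<in> A b})"
      by (auto simp: space_PiM PiE_iff)
    also have "emeasure (\<Pi>\<^sub>M b\<in>B. lborel) ... = (\<Prod>b\<in>B. emeasure lborel {t. v b + s * t \<in> A b})"
    proof (rule emeasure_PiM[OF B])
      fix b assume "b \<in> B"
      then have [measurable]: "A b \<in> sets borel" using A by simp
      show "{t. v b + s * t \<in> A b} \<in> sets lborel" by simp
    qed
    also have "... = (\<Prod>b\<in>B. emeasure lborel (A b))"
      using A s by (intro prod.cong refl emeasure_lborel_affine) auto
    finally show "emeasure (distr (\<Pi>\<^sub>M b\<in>B. lborel) (\<Pi>\<^sub>M b\<in>B. lborel) ?T) (Pi\<^sub>E B A) = (\<Prod>b\<in>B. emeasure lborel (A b))" .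
  qed simp
qed

lemma sets_subspace_lborel: "subspace V ==> sets (subspace_lborel V) = sets (restrict_space borel V)"
  by (rule subspace_lborel_obtain) auto

lemma space_subspace_lborel: "subspace V ==> space (subspace_lborel V) = V"
  using sets_eq_imp_space_eq[OF sets_subspace_lborel] by (simp add: space_restrict_space)

lemma id_subspace_measurable: "subspace V ==> (\<lambda>x. x) \<in> measurable (subspace_lborel V) borel"
  unfolding measurable_cong_sets[OF sets_subspace_lborel refl] by (intro measurable_restrict_space1) simp

lemma prj_subspace_measurable: "subspace V ==> prj V \<in> measurable borel (subspace_lborel V)"
  unfolding measurable_cong_sets[OF refl sets_subspace_lborel]
  by (intro measurable_restrict_space2 measurable_linear linear_prj) (auto simp: prj)

lemma subspace_lborel_props:
  fixes V :: "'a::euclidean_space set"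
  assumes V: "subspace V"
  shows "\<And>v \<phi>. v \<in> V ==> \<phi> \<in> borel_measurable borel ==> (\<integral>\<^sup>+x. \<phi> (v + x) \<partial>subspace_lborel V) = (\<integral>\<^sup>+x. \<phi> x \<partial>subspace_lborel V)"
    and "\<And>\<phi>. \<phi> \<in> borel_measurable borel ==> (\<integral>\<^sup>+x. \<phi> (- x) \<partial>subspace_lborel V) = (\<integral>\<^sup>+x. \<phi> x \<partial>subspace_lborel V)"
    and "\<And>R. emeasure (subspace_lborel V) (V \<inter> cball 0 R) \<noteq> \<infinity>"
    and "emeasure (subspace_lborel V) (V \<inter> cball 0 1) \<noteq> 0"
    and "sigma_finite_measure (subspace_lborel V)"
proof -
  obtain B where B: "finite B" "B \<subseteq> V" and on: "\<And>b b'. b \<in> B ==> b' \<in> B ==> b \<bullet> b' = (if b = b' then 1 else 0)" and sp: "span B = V"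
    and S: "subspace_lborel V = distr (\<Pi>\<^sub>M b\<in>B. (lborel :: real measure)) (restrict_space borel V) (\<lambda>f. \<Sum>b\<in>B. f b *\<^sub>R b)"
    by (rule subspace_lborel_obtain[OF V], rule that)
  let ?P = "\<Pi>\<^sub>M b\<in>B. (lborel :: real measure)" and ?T = "\<lambda>f. \<Sum>b\<in>B. f b *\<^sub>R b"
  interpret product_sigma_finite "\<lambda>_::'a. lborel :: real measure" ..
  have Tb[measurable]: "?T \<in> borel_measurable ?P" by measurable
  have TV: "?T f \<in> V" for f using B V by (intro subspace_sum subspace_scale) auto
  have Tm: "?T \<in> measurable ?P (restrict_space borel V)" by (intro measurable_restrict_space2 Tb) (auto simp: TV)
  have nn: "(\<integral>\<^sup>+x. \<phi> x \<partial>subspace_lborel V) = (\<integral>\<^sup>+f. \<phi> (?T f) \<partial>?P)" if "borel_fun \<phi>" for \<phi>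
    unfolding S by (rule nn_integral_distr[OF Tm]) (simp add: measurable_restrict_space1[OF that])
  have aff: "(\<integral>\<^sup>+f. \<phi> (?T (\<lambda>b\<in>B. u b + s * f b)) \<partial>?P) = (\<integral>\<^sup>+f. \<phi> (?T f) \<partial>?P)" if [measurable]: "borel_fun \<phi>" and s: "s = 1 \<or> s = -1" for \<phi> :: "'a => ennreal" and u s
  proof -
    have "(\<integral>\<^sup>+f. \<phi> (?T f) \<partial>?P) = (\<integral>\<^sup>+f. \<phi> (?T f) \<partial>distr ?P ?P (\<lambda>f. \<lambda>b\<in>B. u b + s * f b))" by (simp only: PiM_affine[OF B(1) s])
    also have "... = (\<integral>\<^sup>+f. \<phi> (?T (\<lambda>b\<in>B. u b + s * f b)) \<partial>?P)" by (rule nn_integral_distr) measurable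
    finally show ?thesis ..
  qed
  have rep: "(\<Sum>b\<in>B. (v \<bullet> b) *\<^sub>R b) = v" if "v \<in> V" for v
  proof -
    from that obtain c where c: "v = (\<Sum>b\<in>B. c b *\<^sub>R b)" using sp B(1) by (auto simp: span_finite)
    have "v \<bullet> b' = c b'" if "b' \<in> B" for b'
    proof -
      have "v \<bullet> b' = (\<Sum>b\<in>B. if b = b' then c b else 0)" unfolding c inner_sum_left using on that by (intro sum.cong) auto
      then show ?thesis using that B(1) by simp
    qed
    then show ?thesis unfolding c by (intro sum.cong) auto
  qed
  show "(\<integral>\<^sup>+x. \<phi> (v + x) \<partial>subspace_lborel V) = (\<integral>\<^sup>+x. \<phi> x \<partial>subspace_lborel V)" if v: "v \<in> V" and [measurable]: "borel_fun \<phi>" for v and \<phi> :: "'a => ennreal"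
  proof -
    have "?T (\<lambda>b\<in>B. (v \<bullet> b) + 1 * f b) = v + ?T f" for f
    proof -
      have "?T (\<lambda>b\<in>B. (v \<bullet> b) + 1 * f b) = (\<Sum>b\<in>B. (v \<bullet> b) *\<^sub>R b + f b *\<^sub>R b)" by (intro sum.cong) (auto simp: scaleR_add_left)
      then show ?thesis by (simp add: sum.distrib rep[OF v])
    qed
    then show ?thesis using aff[of \<phi> 1 "\<lambda>b. v \<bullet> b"] by (simp add: nn)
  qed
  show "(\<integral>\<^sup>+x. \<phi> (- x) \<partial>subspace_lborel V) = (\<integral>\<^sup>+x. \<phi> x \<partial>subspace_lborel V)" if [measurable]: "borel_fun \<phi>" for \<phi> :: "'a => ennreal"
  proof -
    have "?T (\<lambda>b\<in>B. 0 + (- 1) * f b) = - ?T f" for f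
      unfolding sum_negf[symmetric] by (intro sum.cong) auto
    then show ?thesis using aff[of \<phi> "-1" "\<lambda>_. 0"] by (simp add: nn)
  qed
  have em: "emeasure (subspace_lborel V) (V \<inter> cball 0 R) = emeasure ?P (?T -` (V \<inter> cball 0 R) \<inter> space ?P)" for R
    unfolding S by (intro emeasure_distr Tm) (auto simp: sets_restrict_space)
  have Tin: "?T f \<bullet> b = f b" if "b \<in> B" for f b
  proof -
    have "?T f \<bullet> b = (\<Sum>b'\<in>B. if b' = b then f b' else 0)" unfolding inner_sum_left using on that by (intro sum.cong) auto
    then show ?thesis using that B(1) by simp
  qed
  have nb: "norm b = 1" if "b \<in> B" for b using on[OF that that] by (simp add: norm_eq_1)
  show fin: "emeasure (subspace_lborel V) (V \<inter> cball 0 R) \<noteq> \<infinity>" for R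
  proof -
    have "?T -` (V \<inter> cball 0 R) \<inter> space ?P \<subseteq> Pi\<^sub>E B (\<lambda>_. {-R..R})"
    proof
      fix f assume f: "f \<in> ?T -` (V \<inter> cball 0 R) \<inter> space ?P"
      have "\<bar>f b\<bar> <= R" if b: "b \<in> B" for b
        using Cauchy_Schwarz_ineq2[of "?T f" b] Tin[OF b, of f] nb[OF b] f by simp
      then have "- R <= f b \<and> f b <= R" if b: "b \<in> B" for b using that by (auto simp: abs_le_iff minus_le_iff)
      then show "f \<in> Pi\<^sub>E B (\<lambda>_. {-R..R})" using f by (auto simp: space_PiM PiE_iff)
    qed
    then have "emeasure ?P (?T -` (V \<inter> cball 0 R) \<inter> space ?P) <= emeasure ?P (Pi\<^sub>E B (\<lambda>_. {-R..R}))"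
      using B(1) by (intro emeasure_mono sets_PiM_I_finite) auto
    also have "... = (\<Prod>b\<in>B. emeasure lborel {-R..R})" using B(1) by (intro emeasure_PiM) auto
    also have "... < \<infinity>" by (simp add: emeasure_lborel_Icc_eq ennreal_power[symmetric] less_top[symmetric] power_eq_top_ennreal)
    finally show ?thesis unfolding em by simp
  qed
  show "emeasure (subspace_lborel V) (V \<inter> cball 0 1) \<noteq> 0"
  proof -
    define t where "t = 1 / (1 + real (card B))"
    have t: "0 < t" "real (card B) * t <= 1" unfolding t_def by (auto simp: divide_le_eq)
    have "Pi\<^sub>E B (\<lambda>_. {-t..t}) \<subseteq> ?T -` (V \<inter> cball 0 1) \<inter> space ?P"
    proof
      fix f assume f: "f \<in> Pi\<^sub>E B (\<lambda>_. {-t..t})"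
      have "norm (?T f) <= (\<Sum>b\<in>B. t)"
        using f nb by (intro order_trans[OF norm_sum] sum_mono) (auto simp: PiE_iff abs_le_iff minus_le_iff)
      then show "f \<in> ?T -` (V \<inter> cball 0 1) \<inter> space ?P" using f t TV by (auto simp: space_PiM PiE_iff)
    qed
    then have "emeasure ?P (Pi\<^sub>E B (\<lambda>_. {-t..t})) <= emeasure ?P (?T -` (V \<inter> cball 0 1) \<inter> space ?P)"
      by (intro emeasure_mono measurable_sets[OF Tm]) (auto simp: sets_restrict_space)
    moreover have "emeasure ?P (Pi\<^sub>E B (\<lambda>_. {-t..t})) = (\<Prod>b\<in>B. emeasure lborel {-t..t})" using B(1) by (intro emeasure_PiM) auto
    moreover have "(\<Prod>b\<in>B. emeasure lborel {-t..t}) \<noteq> 0" using t by (simp add: B(1))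
    ultimately show ?thesis unfolding em by auto
  qed
  show "sigma_finite_measure (subspace_lborel V)"
  proof
    let ?A = "range (\<lambda>n::nat. V \<inter> cball (0::'a) n)"
    have "x \<in> \<Union>?A" if "x \<in> V" for x using real_arch_simple[of "norm x"] that by auto
    then have "\<Union>?A = space (subspace_lborel V)" by (auto simp: space_subspace_lborel[OF V])
    moreover have "?A \<subseteq> sets (subspace_lborel V)" by (auto simp: sets_subspace_lborel[OF V] sets_restrict_space intro!: imageI)
    ultimately show "\<exists>A. countable A \<and> A \<subseteq> sets (subspace_lborel V) \<and> \<Union> A = space (subspace_lborel V) \<and> (\<forall>a\<in>A. emeasure (subspace_lborel V) a \<noteq> \<infinity>)"
      using fin by (intro exI[of _ ?A]) auto
  qed
qed

theorem subspace_haar: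
  fixes V :: "'a::euclidean_space set" and \<psi> :: "'a => ennreal"
  assumes V: "subspace V" and [measurable]: "borel_fun \<psi>"
    and up: "\<And>u. \<psi> u <= ennreal (K * exp (- (norm u)\<^sup>2 / 2))" and low: "\<And>u. norm u <= 1 ==> ennreal k <= \<psi> u" and k: "0 < k"
  obtains \<kappa> where "0 < \<kappa>" "\<And>\<phi>. \<phi> \<in> borel_measurable borel ==> (\<integral>\<^sup>+x. \<phi> x \<partial>subspace_lborel V) = ennreal \<kappa> * (\<L> x. \<phi> (prj V x) * \<psi> (x - prj V x))"
proof -
  note Sp = subspace_lborel_props[OF V]
  have P: "linear (prj V)" by (rule linear_prj[OF V])
  have [measurable]: "borel_fun (prj V)" by (rule measurable_linear[OF P])
  have PV: "prj V \<in> measurable (density lborel (\<lambda>x. \<psi> (x - prj V x))) (restrict_space borel V)"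
    by (intro measurable_restrict_space2) (auto simp: prj(1)[OF V])
  define N where "N = distr (density lborel (\<lambda>x. \<psi> (x - prj V x))) (restrict_space borel V) (prj V)"
  have nnN: "(\<integral>\<^sup>+x. \<phi> x \<partial>N) = (\<L> x. \<phi> (prj V x) * \<psi> (x - prj V x))" if [measurable]: "borel_fun \<phi>" for \<phi>
    unfolding N_def by (subst nn_integral_distr[OF PV]) (auto intro!: measurable_restrict_space1 simp: nn_integral_density mult.commute)
  have eN: "emeasure N (V \<inter> cball 0 R) = (\<L> x. indicator (cball 0 R) (prj V x) * \<psi> (x - prj V x))" for R
  proof -
    have "emeasure N (V \<inter> cball 0 R) = (\<integral>\<^sup>+x. indicator (V \<inter> cball 0 R) x \<partial>N)" by (subst nn_integral_indicator) (auto simp: N_def sets_restrict_space)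
    also have "... = (\<integral>\<^sup>+x. indicator (cball 0 R) x \<partial>N)" by (intro nn_integral_cong) (auto simp: N_def space_restrict_space split: split_indicator)
    also have "... = (\<L> x. indicator (cball 0 R) (prj V x) * \<psi> (x - prj V x))" by (rule nnN) (auto intro!: borel_measurable_indicator)
    finally show ?thesis .
  qed
  have K0: "0 <= K" using order_trans[OF low[of 0] up[of 0]] k by (simp add: ennreal_le_iff2)
  have Nfin: "emeasure N (V \<inter> cball 0 R) \<noteq> \<infinity>" for R
  proof -
    have "emeasure N (V \<inter> cball 0 R) <= (\<L> x. ennreal (K * exp (R\<^sup>2 / 2) / gd0 TYPE('a)) * ennreal (gd (x::'a)))"
      unfolding eN
    proof (rule nn_integral_mono)
      fix x :: 'a
      show "indicator (cball 0 R) (prj V x) * \<psi> (x - prj V x) <= ennreal (K * exp (R\<^sup>2 / 2) / gd0 TYPE('a)) * ennreal (gd x)"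
      proof (cases "prj V x \<in> cball 0 R")
        case True
        then have "(norm (prj V x))^2 <= R\<^sup>2" by (intro power_mono) auto
        then have "- (norm (x - prj V x))\<^sup>2 / 2 <= R\<^sup>2 / 2 + - (norm x)\<^sup>2 / 2" using prj_norm2[OF V, of x] by (simp add: field_simps)
        then have "exp (- (norm (x - prj V x))\<^sup>2 / 2) <= exp (R\<^sup>2 / 2) * exp (- (norm x)\<^sup>2 / 2)" by (simp only: exp_add[symmetric] exp_le_cancel_iff)
        then have "K * exp (- (norm (x - prj V x))\<^sup>2 / 2) <= K * (exp (R\<^sup>2 / 2) * exp (- (norm x)\<^sup>2 / 2))" by (intro mult_left_mono K0)
        also have "... = (K * exp (R\<^sup>2 / 2) / gd0 TYPE('a)) * gd x" by (simp add: gd_def gd0_def)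
        finally have "\<psi> (x - prj V x) <= ennreal ((K * exp (R\<^sup>2 / 2) / gd0 TYPE('a)) * gd x)"
          by (intro order_trans[OF up] ennreal_leI)
        also have "... = ennreal (K * exp (R\<^sup>2 / 2) / gd0 TYPE('a)) * ennreal (gd x)"
          by (rule ennreal_mult'') (simp add: gd_pos less_imp_le)
        finally show ?thesis using True by simp
      qed simp
    qed
    also have "... = ennreal (K * exp (R\<^sup>2 / 2) / gd0 TYPE('a))" by (subst nn_integral_cmult) (simp_all add: nn_gd)
    finally show ?thesis by (auto simp: top_unique)
  qed
  have Npos: "emeasure N (V \<inter> cball 0 1) \<noteq> 0"
  proof -
    have "ennreal k * emeasure lborel (ball (0::'a) 1) = (\<L> x. ennreal k * indicator (ball (0::'a) 1) x)" by (subst nn_integral_cmult_indicator) simp_all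
    also have "... <= emeasure N (V \<inter> cball 0 1)" unfolding eN
    proof (rule nn_integral_mono)
      fix x :: 'a
      show "ennreal k * indicator (ball 0 1) x <= indicator (cball 0 1) (prj V x) * \<psi> (x - prj V x)"
        using prj_norm_le[OF V, of x] low[of "x - prj V x"] by (auto split: split_indicator)
    qed
    finally have "ennreal k * emeasure lborel (ball (0::'a) 1) <= emeasure N (V \<inter> cball 0 1)" .
    moreover have "emeasure lborel (ball (0::'a) 1) \<noteq> 0"
    proof -
      have "\<not> negligible (ball (0::'a) 1)" by (rule open_not_negligible[OF open_ball]) auto
      then have "ball (0::'a) 1 \<notin> null_sets lborel"
        unfolding negligible_iff_null_sets using null_sets_completionI by blast
      then show ?thesis by (auto simp: null_sets_def)
    qed
    ultimately show ?thesis using k by (auto simp: ennreal_mult_eq_top_iff)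
  qed
  have sfN: "sigma_finite_measure N"
  proof
    let ?A = "range (\<lambda>n::nat. V \<inter> cball (0::'a) n)"
    have "x \<in> \<Union>?A" if "x \<in> V" for x using real_arch_simple[of "norm x"] that by auto
    then have "\<Union>?A = space N" by (auto simp: N_def space_restrict_space)
    moreover have "?A \<subseteq> sets N" by (auto simp: N_def sets_restrict_space intro!: imageI)
    ultimately show "\<exists>A. countable A \<and> A \<subseteq> sets N \<and> \<Union> A = space N \<and> (\<forall>a\<in>A. emeasure N a \<noteq> \<infinity>)"
      using Nfin by (intro exI[of _ ?A]) auto
  qed
  have N1: "(\<integral>\<^sup>+x. \<phi> (v + x) \<partial>N) = (\<integral>\<^sup>+x. \<phi> x \<partial>N)" if v: "v \<in> V" and [measurable]: "borel_fun \<phi>" for v and \<phi> :: "'a => ennreal"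
  proof -
    have "prj V (v + x) = v + prj V x" for x using v by (simp add: linear_add[OF P] prj_id[OF V])
    then show ?thesis
      using nn_lborel_shift[of "\<lambda>x. \<phi> (prj V x) * \<psi> (x - prj V x)" v] by (simp add: nnN)
  qed
  let ?W = "\<lambda>x. indicator (V \<inter> cball 0 1) x :: ennreal"
  let ?W' = "\<lambda>x. indicator (cball 0 1) x :: ennreal"
  let ?S = "subspace_lborel V"
  have WS: "(\<integral>\<^sup>+x. ?W' x \<partial>?S) = emeasure ?S (V \<inter> cball 0 1)"
  proof -
    have "(\<integral>\<^sup>+x. ?W' x \<partial>?S) = (\<integral>\<^sup>+x. ?W x \<partial>?S)" by (intro nn_integral_cong) (auto simp: space_subspace_lborel[OF V] split: split_indicator)
    also have "... = emeasure ?S (V \<inter> cball 0 1)" by (rule nn_integral_indicator) (auto simp: sets_subspace_lborel[OF V] sets_restrict_space)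
    finally show ?thesis .
  qed
  have WN: "(\<integral>\<^sup>+x. ?W' x \<partial>N) = emeasure N (V \<inter> cball 0 1)" by (subst nnN) (auto intro!: borel_measurable_indicator simp: eN)
  have ex: "(\<integral>\<^sup>+x. \<phi> x \<partial>?S) * (\<integral>\<^sup>+x. ?W' x \<partial>N) = (\<integral>\<^sup>+x. ?W' x \<partial>?S) * (\<integral>\<^sup>+x. \<phi> x \<partial>N)" if "borel_fun \<phi>" for \<phi>
    by (rule haar_exchange[OF V Sp(5) sets_subspace_lborel[OF V] sfN _ Sp(1,2) N1 that]) (auto simp: N_def intro!: borel_measurable_indicator)
  obtain s where s: "emeasure ?S (V \<inter> cball 0 1) = ennreal s" "0 < s"
    using Sp(3)[of 1] Sp(4) by (cases "emeasure ?S (V \<inter> cball 0 1)") (auto simp: ennreal_eq_0_iff order_le_less)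
  obtain t where t: "emeasure N (V \<inter> cball 0 1) = ennreal t" "0 < t"
    using Nfin[of 1] Npos by (cases "emeasure N (V \<inter> cball 0 1)") (auto simp: ennreal_eq_0_iff order_le_less)
  show ?thesis
  proof (rule that[of "s / t"])
    show "0 < s / t" using s t by simp
    fix \<phi> :: "'a => ennreal" assume \<phi>: "borel_fun \<phi>"
    have "(\<integral>\<^sup>+x. \<phi> x \<partial>?S) * ennreal t = ennreal s * (\<integral>\<^sup>+x. \<phi> x \<partial>N)" using ex[OF \<phi>] by (simp add: WS WN s t)
    then have "ennreal (1 / t) * ((\<integral>\<^sup>+x. \<phi> x \<partial>?S) * ennreal t) = ennreal (1 / t) * (ennreal s * (\<integral>\<^sup>+x. \<phi> x \<partial>N))" by simp
    moreover have "ennreal (1 / t) * ((\<integral>\<^sup>+x. \<phi> x \<partial>?S) * ennreal t) = (\<integral>\<^sup>+x. \<phi> x \<partial>?S)"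
    proof -
      have "ennreal (1 / t) * ennreal t = 1" using t by (simp add: ennreal_mult'[symmetric])
      then show ?thesis by (metis mult.left_commute mult.right_neutral)
    qed
    moreover have "ennreal (1 / t) * (ennreal s * (\<integral>\<^sup>+x. \<phi> x \<partial>N)) = ennreal (s / t) * (\<integral>\<^sup>+x. \<phi> x \<partial>N)"
      using s t by (simp add: mult.assoc[symmetric] ennreal_mult'[symmetric])
    ultimately show "(\<integral>\<^sup>+x. \<phi> x \<partial>?S) = ennreal (s / t) * (\<L> x. \<phi> (prj V x) * \<psi> (x - prj V x))"
      by (simp add: nnN[OF \<phi>])
  qed
qed

lemma nn_exp_norm_finite: "(\<L> y. ennreal (exp (- (real DIM('b) * norm (y::'b::euclidean_space))))) < \<infinity>"
proof -
  have e1: "(\<L> t. ennreal (exponential_density 1 t)) = 1"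
    using prob_space.emeasure_space_1[OF prob_space_exponential_density[of 1]] by (simp add: emeasure_density)
  have "(\<L> t. ennreal (exp (- \<bar>t::real\<bar>))) <= (\<L> t. ennreal (exponential_density 1 t) + ennreal (exponential_density 1 (- t)))"
    by (intro nn_integral_mono) (auto simp: exponential_density_def)
  also have "... = (\<L> t. ennreal (exponential_density 1 t)) + (\<L> t. ennreal (exponential_density 1 (- t)))"
    by (rule nn_integral_add) simp_all
  also have "... = 2" using nn_lborel_neg[of "\<lambda>t::real. ennreal (exponential_density 1 t)"] by (simp add: e1)
  finally have 1: "(\<L> t. ennreal (exp (- \<bar>t::real\<bar>))) < \<infinity>" by (simp add: order_le_less_trans)
  have "(\<L> y. ennreal (exp (- (real DIM('b) * norm (y::'b))))) <= (\<L> y. (\<Prod>b\<in>(Basis::'b set). ennreal (exp (- \<bar>y \<bullet> b\<bar>))))"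
  proof (rule nn_integral_mono)
    fix y :: 'b
    have "(\<Sum>b\<in>(Basis::'b set). \<bar>y \<bullet> b\<bar>) <= (\<Sum>b\<in>(Basis::'b set). norm y)" by (intro sum_mono) (rule Basis_le_norm)
    then show "ennreal (exp (- (real DIM('b) * norm y))) <= (\<Prod>b\<in>(Basis::'b set). ennreal (exp (- \<bar>y \<bullet> b\<bar>)))"
      by (subst prod_ennreal) (auto simp: exp_sum[symmetric] sum_negf intro!: ennreal_leI)
  qed
  also have "... = (\<Prod>b\<in>(Basis::'b set). (\<L> t. ennreal (exp (- \<bar>t\<bar>))))" by (rule nn_integral_lborel_prod) simp_all
  also have "... < \<infinity>" using 1 by (simp add: power_less_top_ennreal)
  finally show ?thesis .
qed

definition wt :: "'b::euclidean_space set => 'b => real" where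
  "wt V y = exp (- (norm (y - prj V y))\<^sup>2 / 2)"

definition mm :: "'b::euclidean_space set => 'b measure" where
  "mm V = distr (density lborel (\<lambda>y. ennreal (wt V y))) borel (prj V)"

lemma sets_mm[simp, measurable_cong]: "sets (mm V) = sets borel" by (simp add: mm_def)

lemma wt_measurable: "subspace V ==> wt V \<in> borel_measurable borel"
  unfolding wt_def[abs_def] using measurable_linear[OF linear_prj] by measurable

lemma nn_mm:
  assumes V: "subspace V" and [measurable]: "borel_fun \<phi>"
  shows "(\<integral>\<^sup>+y. \<phi> y \<partial>mm V) = (\<L> y. \<phi> (prj V y) * ennreal (wt V y))"
proof -
  note [measurable] = measurable_linear[OF linear_prj[OF V]] wt_measurable[OF V]
  show ?thesis unfolding mm_def by (subst nn_integral_distr) (simp_all add: nn_integral_density mult.commute)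
qed

lemma mm_subspace_lborel:
  fixes V :: "'b::euclidean_space set"
  assumes V: "subspace V"
  obtains \<kappa> where "0 < \<kappa>" "\<And>\<phi>. \<phi> \<in> borel_measurable borel ==> (\<integral>\<^sup>+x. \<phi> x \<partial>subspace_lborel V) = ennreal \<kappa> * (\<integral>\<^sup>+x. \<phi> x \<partial>mm V)"
proof -
  have "\<exists>\<kappa>>0. \<forall>\<phi>\<in>borel_measurable borel. (\<integral>\<^sup>+x. \<phi> x \<partial>subspace_lborel V) = ennreal \<kappa> * (\<L> x. \<phi> (prj V x) * ennreal (exp (- (norm (x - prj V x))\<^sup>2 / 2)))"
  proof (rule subspace_haar[OF V, where \<psi>="\<lambda>u. ennreal (exp (- (norm u)\<^sup>2 / 2))" and K=1 and k="exp (- 1 / 2)"])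
    show "ennreal (exp (- 1 / 2)) <= ennreal (exp (- (norm u)\<^sup>2 / 2))" if "norm u <= 1" for u :: 'b
      using that by (intro ennreal_leI) (simp add: power_le_one)
  qed (auto intro!: exI)
  then show ?thesis using that by (auto simp: nn_mm[OF V] wt_def)
qed

lemma mm_ball_finite: assumes V: "subspace V" shows "emeasure (mm V) (ball (0::'b::euclidean_space) R) < \<infinity>"
proof -
  obtain \<kappa> where k: "0 < \<kappa>" "\<And>\<phi>. \<phi> \<in> borel_measurable borel ==> (\<integral>\<^sup>+x. \<phi> x \<partial>subspace_lborel V) = ennreal \<kappa> * (\<integral>\<^sup>+x. \<phi> x \<partial>mm V)"
    by (rule mm_subspace_lborel[OF V], rule that)
  have "ennreal \<kappa> * emeasure (mm V) (ball 0 R) = ennreal \<kappa> * (\<integral>\<^sup>+x. indicator (ball 0 R) x \<partial>mm V)" by simp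
  also have "... = (\<integral>\<^sup>+x. indicator (ball 0 R) x \<partial>subspace_lborel V)" by (rule k(2)[symmetric]) (auto intro!: borel_measurable_indicator)
  also have "... <= (\<integral>\<^sup>+x. indicator (V \<inter> cball 0 R) x \<partial>subspace_lborel V)"
    by (intro nn_integral_mono) (auto simp: space_subspace_lborel[OF V] split: split_indicator)
  also have "... = emeasure (subspace_lborel V) (V \<inter> cball 0 R)" by (rule nn_integral_indicator) (auto simp: sets_subspace_lborel[OF V] sets_restrict_space intro!: imageI)
  also have "... < \<infinity>" using subspace_lborel_props(3)[OF V] by (simp add: less_top)
  finally show ?thesis using k(1) by (auto simp: ennreal_mult_less_top)
qed

lemma mm_exp_finite: assumes V: "subspace V" shows "(\<integral>\<^sup>+y. ennreal (exp (- (real DIM('b) * norm (y::'b::euclidean_space)))) \<partial>mm V) < \<infinity>"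
proof -
  let ?d = "real DIM('b)"
  have "(\<integral>\<^sup>+y. ennreal (exp (- (?d * norm (y::'b)))) \<partial>mm V) = (\<L> y. ennreal (exp (- (?d * norm (prj V y)))) * ennreal (wt V y))"
    by (rule nn_mm[OF V]) measurable
  also have "... <= (\<L> y. ennreal (exp (?d\<^sup>2 / 2)) * ennreal (exp (- (?d * norm (y::'b)))))"
  proof (rule nn_integral_mono)
    fix y :: 'b
    let ?u = "norm (y - prj V y)"
    have "norm (prj V y + (y - prj V y)) <= norm (prj V y) + ?u" by (rule norm_triangle_ineq)
    then have "?d * norm y <= ?d * (norm (prj V y) + ?u)" by (intro mult_left_mono) simp_all
    moreover have "0 <= (?u - ?d)^2" by simp
    ultimately have "- (?d * norm (prj V y)) + - ?u\<^sup>2 / 2 <= ?d\<^sup>2 / 2 + - (?d * norm y)"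
      by (simp add: power2_eq_square algebra_simps)
    then have "exp (- (?d * norm (prj V y))) * exp (- ?u\<^sup>2 / 2) <= exp (?d\<^sup>2 / 2) * exp (- (?d * norm y))"
      by (simp only: exp_add[symmetric] exp_le_cancel_iff)
    then show "ennreal (exp (- (?d * norm (prj V y)))) * ennreal (wt V y) <= ennreal (exp (?d\<^sup>2 / 2)) * ennreal (exp (- (?d * norm y)))"
      by (simp add: wt_def ennreal_mult'[symmetric] ennreal_leI)
  qed
  also have "... = ennreal (exp (?d\<^sup>2 / 2)) * (\<L> y. ennreal (exp (- (?d * norm (y::'b)))))" by (rule nn_integral_cmult) measurable
  also have "... < \<infinity>" using nn_exp_norm_finite[where 'b='b] by (simp add: ennreal_mult_less_top)
  finally show ?thesis .
qed

text \<open>Layers\<close>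

lemma layer_sum:
  assumes t: "0 < (t::real)" and a: "0 <= a" "a <= real K * t"
  shows "a <= (\<Sum>k<K. if real k * t < a then t else 0)" "(\<Sum>k<K. if real k * t < a then t else 0) <= (if a = 0 then 0 else a + t)"
proof -
  let ?g = "\<lambda>K. \<Sum>k<K. if real k * t < a then t else (0::real)"
  have lo: "min a (real K * t) <= ?g K" for K
  proof (induction K)
    case (Suc K)
    show ?case
    proof (cases "real K * t < a")
      case True then show ?thesis using Suc t by (simp add: algebra_simps)
    next
      case False then show ?thesis using Suc t by (simp add: algebra_simps)
    qed
  qed (use a in simp)
  have tr: "?g K <= real K * t" for K
  proof -
    have "?g K <= (\<Sum>k<K. t)" using t by (intro sum_mono) auto
    then show ?thesis by simp
  qed
  have up: "?g K <= a + t" for K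
  proof (induction K)
    case (Suc K)
    show ?case
    proof (cases "real K * t < a")
      case True then show ?thesis using tr[of K] by simp
    qed (use Suc in simp)
  qed (use a t in simp)
  show "a <= ?g K" using lo[of K] a by simp
  have "?g K = 0" if "a = 0" using that t by (intro sum.neutral) (auto simp: not_less)
  then show "?g K <= (if a = 0 then 0 else a + t)" using up by simp
qed

lemma open_superset_ball:
  fixes \<mu> :: "'b::euclidean_space measure"
  assumes s: "sets \<mu> = sets borel" and fin: "emeasure \<mu> (ball 0 R) < \<infinity>" and A: "A \<in> sets borel" "A \<subseteq> ball 0 R" and e: "0 < e"
  obtains U where "open U" "A \<subseteq> U" "emeasure \<mu> U <= emeasure \<mu> A + ennreal e"
proof -
  let ?B = "ball (0::'b) R"
  let ?m = "density \<mu> (indicator ?B)"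
  have [measurable]: "indicator ?B \<in> borel_measurable \<mu>" by (rule borel_measurable_indicator) (simp add: s)
  have em: "emeasure ?m X = emeasure \<mu> (X \<inter> ?B)" if "X \<in> sets borel" for X
    using that by (subst emeasure_density) (auto simp: s indicator_inter_arith[symmetric] nn_integral_indicator Int_commute)
  have fm: "emeasure ?m (space ?m) \<noteq> \<infinity>" using em[of UNIV] fin sets_eq_imp_space_eq[OF s] by simp
  have "emeasure ?m A = (INF U \<in> {U. A \<subseteq> U \<and> open U}. emeasure ?m U)"
    by (rule outer_regular) (use fm A s in auto)
  moreover have Af: "emeasure ?m A < emeasure ?m A + ennreal e"
  proof -
    have "emeasure ?m A <= emeasure ?m (space ?m)" by (rule emeasure_space)
    then have "emeasure ?m A \<noteq> top" using fm by (auto simp: top_unique)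
    then show ?thesis using e by (simp add: ennreal_add_left_cancel_less[of _ 0, simplified] less_top)
  qed
  ultimately obtain U where U: "A \<subseteq> U" "open U" "emeasure ?m U < emeasure ?m A + ennreal e" by (auto simp: INF_less_iff)
  have "A \<inter> ?B = A" using A by auto
  then show ?thesis using U A by (intro that[of "U \<inter> ?B"]) (auto simp: em)
qed

lemma lsc_majorant:
  fixes \<mu> :: "'b::euclidean_space measure" and f :: "'b => real"
  assumes s: "sets \<mu> = sets borel" and fin: "\<And>R. emeasure \<mu> (ball 0 R) < \<infinity>" and [measurable]: "borel_fun f"
    and f0: "\<And>y. 0 <= f y" and fM: "\<And>y. f y <= M" and fR: "\<And>y. R <= norm y ==> f y = 0" and e: "0 < e"
  obtains h where "borel_fun h" "\<And>y. f y <= h y" "\<And>x. \<exists>r>0. \<forall>y\<in>ball x r. h x <= h y"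
    "(\<integral>\<^sup>+y. ennreal (h y) \<partial>\<mu>) <= (\<integral>\<^sup>+y. ennreal (f y) \<partial>\<mu>) + ennreal e"
proof -
  note [measurable_cong] = s
  let ?B = "ball (0::'b) R"
  have [measurable]: "?B \<in> sets borel" by simp
  obtain m where m: "emeasure \<mu> ?B = ennreal m" "0 <= m" using fin[of R] by (cases "emeasure \<mu> ?B") auto
  define t where "t = e / (2 * (m + 1))"
  have t: "0 < t" "t * m <= e / 2" unfolding t_def using e m by (auto simp: field_simps)
  obtain K :: nat where K: "M < real K * t" using reals_Archimedean3[OF t(1)] by blast
  have fK: "f y <= real K * t" for y using fM[of y] K by linarith
  define A where "A k = {y. real k * t < f y}" for k :: nat
  have Am[measurable]: "A k \<in> sets borel" for k unfolding A_def by measurable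
  have AB: "A k \<subseteq> ?B" for k
  proof
    fix y assume "y \<in> A k"
    then have "real k * t < f y" unfolding A_def by simp
    moreover have "0 <= real k * t" using t by simp
    ultimately have "f y \<noteq> 0" by linarith
    then show "y \<in> ?B" using fR[of y] by (auto simp: not_le[symmetric])
  qed
  define q where "q = (real K + 1) * t"
  have q: "0 < q" "real K * t <= q" unfolding q_def using t(1) by (auto intro!: mult_pos_pos add_nonneg_pos simp: distrib_right[of _ 1])
  define e' where "e' = e / (2 * q)"
  have e'0: "0 < e'" unfolding e'_def using e q by simp
  have "real K * t * e' <= q * e'" using q(2) e'0 by (intro mult_right_mono) auto
  also have "q * e' = e / 2" unfolding e'_def using q by simp
  finally have e': "0 < e'" "real K * t * e' <= e / 2" using e'0 by auto
  have "\<forall>k. \<exists>U. open U \<and> A k \<subseteq> U \<and> emeasure \<mu> U <= emeasure \<mu> (A k) + ennreal e'"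
    using open_superset_ball[OF s fin[of R] Am AB e'(1)] by metis
  then obtain U where U: "\<And>k. open (U k)" "\<And>k. A k \<subseteq> U k" "\<And>k. emeasure \<mu> (U k) <= emeasure \<mu> (A k) + ennreal e'" by metis
  have [measurable]: "U k \<in> sets borel" for k using U(1) by simp
  define h where "h y = (\<Sum>k<K. if y \<in> U k then t else 0)" for y
  have hm[measurable]: "borel_fun h" unfolding h_def[abs_def] by measurable
  have fs: "f y <= (\<Sum>k<K. if y \<in> A k then t else 0)" "(\<Sum>k<K. if y \<in> A k then t else 0) <= (if f y = 0 then 0 else f y + t)" for y
    using layer_sum[OF t(1) f0 fK, of y] unfolding A_def by simp_all
  have fh: "f y <= h y" for y
  proof -
    have "(\<Sum>k<K. if y \<in> A k then t else 0) <= h y" unfolding h_def using U(2) t by (intro sum_mono) auto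
    then show ?thesis using fs(1)[of y] by linarith
  qed
  have lsc: "\<exists>r>0. \<forall>y\<in>ball x r. h x <= h y" for x
  proof -
    let ?S = "\<Inter>k\<in>{k\<in>{..<K}. x \<in> U k}. U k"
    have "open ?S" using U(1) by (intro open_INT) auto
    moreover have "x \<in> ?S" by auto
    ultimately obtain r where r: "0 < r" "ball x r \<subseteq> ?S" using open_contains_ball by metis
    have "h x <= h y" if "y \<in> ball x r" for y
      unfolding h_def using r(2) that t by (intro sum_mono) auto
    then show ?thesis using r(1) by blast
  qed
  have nnI: "(\<integral>\<^sup>+y. (\<Sum>k<K. ennreal t * indicator (X k) y) \<partial>\<mu>) = (\<Sum>k<K. ennreal t * emeasure \<mu> (X k))" if [measurable]: "\<And>k. X k \<in> sets borel" for X
    by (subst nn_integral_sum) (auto intro!: sum.cong nn_integral_cmult_indicator simp: s)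
  have ei: "ennreal (\<Sum>k<K. if y \<in> X k then t else 0) = (\<Sum>k<K. ennreal t * indicator (X k) y)" for y X
  proof -
    have "(\<Sum>k<K. ennreal t * indicator (X k) y) = (\<Sum>k<K. ennreal (if y \<in> X k then t else 0))" by (intro sum.cong) auto
    also have "... = ennreal (\<Sum>k<K. if y \<in> X k then t else 0)" using t(1) by (intro sum_ennreal) auto
    finally show ?thesis ..
  qed
  have "(\<integral>\<^sup>+y. ennreal (h y) \<partial>\<mu>) = (\<Sum>k<K. ennreal t * emeasure \<mu> (U k))" unfolding h_def ei by (rule nnI) measurable
  also have "... <= (\<Sum>k<K. ennreal t * (emeasure \<mu> (A k) + ennreal e'))" by (intro sum_mono mult_left_mono U(3)) simp
  also have "... = (\<Sum>k<K. ennreal t * emeasure \<mu> (A k)) + ennreal (real K * t * e')"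
    using t e' by (simp add: distrib_left sum.distrib ennreal_mult'[symmetric] ennreal_of_nat_eq_real_of_nat mult.assoc)
  also have "(\<Sum>k<K. ennreal t * emeasure \<mu> (A k)) = (\<integral>\<^sup>+y. ennreal (\<Sum>k<K. if y \<in> A k then t else 0) \<partial>\<mu>)" unfolding ei by (rule nnI[symmetric]) measurable
  also have "... <= (\<integral>\<^sup>+y. ennreal (f y) + ennreal t * indicator ?B y \<partial>\<mu>)"
  proof (rule nn_integral_mono)
    fix y
    show "ennreal (\<Sum>k<K. if y \<in> A k then t else 0) <= ennreal (f y) + ennreal t * indicator ?B y"
    proof (cases "f y = 0")
      case True then show ?thesis using fs(2)[of y] by (simp add: ennreal_neg)
    next
      case False
      then have "y \<in> ?B" using fR[of y] by (auto simp: not_le[symmetric])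
      then show ?thesis using fs(2)[of y] False f0[of y] t by (auto simp: ennreal_plus[symmetric] simp del: ennreal_plus intro!: ennreal_leI)
    qed
  qed
  also have "... = (\<integral>\<^sup>+y. ennreal (f y) \<partial>\<mu>) + (\<integral>\<^sup>+y. ennreal t * indicator ?B y \<partial>\<mu>)"
    by (rule nn_integral_add) measurable
  also have "(\<integral>\<^sup>+y. ennreal t * indicator ?B y \<partial>\<mu>) = ennreal (t * m)"
    using t m by (subst nn_integral_cmult_indicator) (simp_all add: s ennreal_mult')
  finally have "(\<integral>\<^sup>+y. ennreal (h y) \<partial>\<mu>) <= (\<integral>\<^sup>+y. ennreal (f y) \<partial>\<mu>) + ennreal (t * m) + ennreal (real K * t * e')" by (simp add: add_right_mono)
  also have "... = (\<integral>\<^sup>+y. ennreal (f y) \<partial>\<mu>) + ennreal (t * m + real K * t * e')"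
    using t m e' by (simp add: add.assoc ennreal_plus)
  also have "... <= (\<integral>\<^sup>+y. ennreal (f y) \<partial>\<mu>) + ennreal e"
    using t(2) e'(2) by (intro add_left_mono ennreal_leI) linarith
  finally show ?thesis by (rule that[OF hm fh lsc])
qed

text \<open>log-Lipschitz regularisation\<close>

definition llr :: "real => ('b::euclidean_space => real) => 'b => real" where
  "llr n h x = (INF y. h y * exp (n * norm (x - y)))"

locale llr_ctx =
  fixes h :: "'b::euclidean_space => real" and \<eta> a n :: real
  assumes low: "\<And>y. \<eta> * exp (- (a * norm y)) <= h y" and eta: "0 < \<eta>" and a: "0 <= a" and n: "a <= n"
begin

lemma h0: "0 < h y" using low[of y] eta by (smt (verit) exp_gt_zero mult_pos_pos)

lemma bdd: "bdd_below (range (\<lambda>y. h y * exp (n * norm (x - y))))"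
  by (rule bdd_belowI[of _ 0]) (auto simp: h0 less_imp_le)

lemma llr_le': "llr n h x <= h y * exp (n * norm (x - y))" unfolding llr_def by (rule cINF_lower[OF bdd]) simp

lemma llr_le: "llr n h x <= h x" using llr_le'[of x x] by simp

lemma low': "\<eta> * exp (- (a * norm x)) * exp ((n - a) * norm (x - y)) <= h y * exp (n * norm (x - y))"
proof -
  have "norm y <= norm x + norm (x - y)" by (metis add_diff_cancel_right' add_left_mono diff_add_cancel norm_minus_commute norm_triangle_sub)
  then have "a * norm y <= a * (norm x + norm (x - y))" using a by (rule mult_left_mono)
  then have "- (a * norm x) + (n - a) * norm (x - y) <= - (a * norm y) + n * norm (x - y)" by (simp add: algebra_simps)
  then have "exp (- (a * norm x)) * exp ((n - a) * norm (x - y)) <= exp (- (a * norm y)) * exp (n * norm (x - y))"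
    by (simp only: exp_add[symmetric] exp_le_cancel_iff)
  then have "\<eta> * (exp (- (a * norm x)) * exp ((n - a) * norm (x - y))) <= \<eta> * (exp (- (a * norm y)) * exp (n * norm (x - y)))"
    using eta by (intro mult_left_mono) auto
  also have "... <= h y * exp (n * norm (x - y))" unfolding mult.assoc[symmetric] by (intro mult_right_mono low) simp
  finally show ?thesis by (simp add: mult.assoc)
qed

lemma llr_pos: "0 < llr n h x"
proof -
  have "\<eta> * exp (- (a * norm x)) <= llr n h x" unfolding llr_def
  proof (rule cINF_greatest)
    fix y
    have "\<eta> * exp (- (a * norm x)) * 1 <= \<eta> * exp (- (a * norm x)) * exp ((n - a) * norm (x - y))"
      using eta n by (intro mult_left_mono) auto
    then show "\<eta> * exp (- (a * norm x)) <= h y * exp (n * norm (x - y))" using low'[of x y] by simp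
  qed simp
  moreover have "0 < \<eta> * exp (- (a * norm x))" using eta by simp
  ultimately show ?thesis by linarith
qed

lemma ln_llr: "ln (llr n h x) <= ln (llr n h x') + n * norm (x - x')"
proof -
  have "llr n h x * exp (- (n * norm (x - x'))) <= llr n h x'" unfolding llr_def[of n h x']
  proof (rule cINF_greatest)
    fix y
    have "norm (x - y) <= norm (x - x') + norm (x' - y)" using norm_triangle_ineq[of "x - x'" "x' - y"] by simp
    then have "n * norm (x - y) <= n * (norm (x - x') + norm (x' - y))" using a n by (intro mult_left_mono) auto
    then have "h y * exp (n * norm (x - y)) <= h y * exp (n * norm (x - x') + n * norm (x' - y))"
      using h0[of y] by (intro mult_left_mono) (auto simp: algebra_simps)
    with llr_le'[of x y] have "llr n h x <= h y * exp (n * norm (x' - y)) * exp (n * norm (x - x'))"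
      by (simp add: exp_add mult_ac)
    then have "llr n h x * exp (- (n * norm (x - x'))) <= h y * exp (n * norm (x' - y)) * exp (n * norm (x - x')) * exp (- (n * norm (x - x')))"
      by (intro mult_right_mono) auto
    also have "... = h y * exp (n * norm (x' - y))" by (simp add: mult.assoc exp_minus_inverse)
    finally show "llr n h x * exp (- (n * norm (x - x'))) <= h y * exp (n * norm (x' - y))" .
  qed simp
  then have "ln (llr n h x * exp (- (n * norm (x - x')))) <= ln (llr n h x')" using llr_pos by (subst ln_le_cancel_iff) auto
  then show ?thesis using llr_pos by (simp add: ln_mult_pos)
qed

lemma llr_measurable: "borel_fun (llr n h)"
proof -
  have n0: "0 <= n" using a n by simp
  have "n-lipschitz_on UNIV (\<lambda>x. ln (llr n h x))"
  proof (rule lipschitz_onI[OF _ n0])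
    fix x y :: 'b
    show "dist (ln (llr n h x)) (ln (llr n h y)) <= n * dist x y"
      using ln_llr[of x y] ln_llr[of y x] by (simp add: dist_norm norm_minus_commute abs_le_iff)
  qed
  then have "continuous_on UNIV (\<lambda>x. ln (llr n h x))" by (rule lipschitz_on_continuous_on)
  then have "continuous_on UNIV (\<lambda>x. exp (ln (llr n h x)))" by (rule continuous_on_exp)
  then have "borel_fun (\<lambda>x. exp (ln (llr n h x)))" by (rule borel_measurable_continuous_onI)
  then show ?thesis using llr_pos by simp
qed

end

lemma llr_eventually:
  fixes h :: "'b::euclidean_space => real"
  assumes low: "\<And>y. \<eta> * exp (- (a * norm y)) <= h y" and eta: "0 < \<eta>" and a: "0 <= a"
    and r: "0 < r" "\<And>y. y \<in> ball x r ==> H <= h y" and H: "0 <= H"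
  shows "eventually (\<lambda>k::nat. H <= llr (a + real k) h x) sequentially"
proof -
  let ?q = "\<eta> * exp (- (a * norm x))"
  have q: "0 < ?q" using eta by simp
  obtain K :: nat where K: "ln (H / ?q + 1) < real K * r" using reals_Archimedean3[OF r(1)] by blast
  have "H <= llr (a + real k) h x" if k: "K <= k" for k
  proof -
    interpret llr_ctx h \<eta> a "a + real k" by unfold_locales (use low eta a in auto)
    show ?thesis unfolding llr_def
    proof (rule cINF_greatest)
      fix y
      show "H <= h y * exp ((a + real k) * norm (x - y))"
      proof (cases "y \<in> ball x r")
        case True
        have "1 <= exp ((a + real k) * norm (x - y))" using a by simp
        then have "h y * 1 <= h y * exp ((a + real k) * norm (x - y))" using h0[of y] by (intro mult_left_mono) auto
        then show ?thesis using r(2)[OF True] by simp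
      next
        case False
        then have "r <= norm (x - y)" by (simp add: dist_norm)
        then have "real K * r <= (a + real k - a) * norm (x - y)" using k r(1) by (auto intro!: mult_mono)
        then have "ln (H / ?q + 1) <= (a + real k - a) * norm (x - y)" using K by linarith
        then have "exp (ln (H / ?q + 1)) <= exp ((a + real k - a) * norm (x - y))" by simp
        moreover have "0 < H / ?q + 1" using H q by (smt (verit) divide_nonneg_pos)
        ultimately have "H / ?q <= exp ((a + real k - a) * norm (x - y))" by simp
        then have "H <= ?q * exp ((a + real k - a) * norm (x - y))" using q by (simp add: field_simps)
        then show ?thesis using low'[of x y] by linarith
      qed
    qed simp
  qed
  then show ?thesis by (auto simp: eventually_sequentially)
qed

lemma fatou_dominated:
  fixes \<phi> :: "'a => ennreal"
  assumes "\<And>k. \<phi>s k \<in> borel_measurable M" and "\<And>x. x \<in> space M ==> eventually (\<lambda>k. \<phi> x <= \<phi>s k x) sequentially"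
    and "\<And>k. (\<integral>\<^sup>+x. \<phi>s k x \<partial>M) <= C"
  shows "(\<integral>\<^sup>+x. \<phi> x \<partial>M) <= C"
proof -
  have "(\<integral>\<^sup>+x. \<phi> x \<partial>M) <= (\<integral>\<^sup>+x. liminf (\<lambda>k. \<phi>s k x) \<partial>M)"
    by (intro nn_integral_mono Liminf_bounded assms(2))
  also have "... <= liminf (\<lambda>k. \<integral>\<^sup>+x. \<phi>s k x \<partial>M)" by (rule nn_integral_liminf[OF assms(1)])
  also have "... <= C" by (rule Liminf_le) (auto simp: assms(3))
  finally show ?thesis .
qed

lemma rpow_nonneg: "0 <= rpow x a" by (simp add: rpow_def)

lemma rpow_mono: "0 <= x ==> x <= y ==> 0 <= a ==> rpow x a <= rpow y a"
  by (simp add: rpow_def powr_mono2)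

lemma rpow_le_powr: "0 <= x ==> x <= y ==> 0 < y ==> 0 <= a ==> rpow x a <= y powr a"
  by (simp add: rpow_def powr_mono2)

lemma rpow_measurable[measurable]: "f \<in> borel_measurable M ==> (\<lambda>x. rpow (f x) a) \<in> borel_measurable M"
  by (cases "a = 0") (simp_all add: rpow_def)

locale bl_data =
  fixes L :: "'a::finite => 'b::euclidean_space => 'c::euclidean_space" and p :: "'a => real"
    and n :: "'a => nat" and G :: "'b => 'b" and c B \<theta> C0 :: real
  assumes L: "\<And>j. linear (L j)" and n: "\<And>j. dim (range (L j)) = n j" and p: "\<And>j. 0 <= p j"
    and Lc: "\<And>j v. norm (L j v) <= c * norm v"
    and G: "linear G" "\<And>u v. G u \<bullet> v = u \<bullet> G v" "\<And>v. 0 <= G v \<bullet> v" "\<And>v. G v \<bullet> v <= B * (norm v)^2"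
    and gc: "gauss_cond L p G n \<theta> C0" and \<theta>: "0 < \<theta>"
begin

abbreviation "\<mu> j \<equiv> mm (range (L j))"

lemma V: "subspace (range (L j))" by (rule linear_subspace_image[OF L subspace_UNIV])

lemma Lm[measurable]: "borel_fun (L j)" by (rule measurable_linear[OF L])

lemma log_lipschitz:
  assumes \<Omega>: "\<Omega> \<in> sets borel" "bounded \<Omega>" "\<And>x. x \<in> \<Omega> ==> G x \<bullet> x <= 1"
    and Fm: "\<And>j. F j \<in> borel_measurable borel" and Fpos: "\<And>j y. 0 < F j y"
    and FL: "\<And>j y y'. ln (F j y) <= ln (F j y') + \<Lambda> * norm (y - y')" and \<Lambda>: "0 <= \<Lambda>"
    and N: "\<And>j. (\<integral>\<^sup>+y. ennreal (F j y) \<partial>\<mu> j) <= ennreal (N j)" "\<And>j. 0 < N j"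
  shows "(\<integral>\<^sup>+x\<in>\<Omega>. ennreal (\<Prod>j\<in>UNIV. F j (L j x) powr p j) \<partial>lborel) <= ennreal (exp (blC TYPE('b) TYPE('c) p n \<theta> C0 c) * (\<Prod>j\<in>UNIV. N j powr p j))"
proof -
  define N' where "N' j = enn2real (\<integral>\<^sup>+y. ennreal (F j y) \<partial>\<mu> j)" for j
  have eN': "(\<integral>\<^sup>+y. ennreal (F j y) \<partial>\<mu> j) = ennreal (N' j)" for j
    using N(1)[of j] unfolding N'_def by (cases "\<integral>\<^sup>+y. ennreal (F j y) \<partial>\<mu> j") (auto simp: top_unique)
  have N'0: "0 <= N' j" for j unfolding N'_def by simp
  have N'N: "N' j <= N j" for j using N[of j] N'0[of j] unfolding eN' by simp
  have e: "(\<L> y. ennreal (F j (prj (range (L j)) y) * exp (- (norm (y - prj (range (L j)) y))\<^sup>2 / 2))) = ennreal (N' j)" for j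
    unfolding eN'[symmetric] using Fm[of j] Fpos by (subst nn_mm[OF V]) (auto intro!: nn_integral_cong simp: wt_def ennreal_mult' less_imp_le)
  have "N' j \<noteq> 0" for j
  proof
    assume "N' j = 0"
    then have "(\<L> y. ennreal (F j (prj (range (L j)) y) * exp (- (norm (y - prj (range (L j)) y))\<^sup>2 / 2))) = 0" using e[of j] by simp
    moreover have [measurable]: "borel_fun (F j)" "prj (range (L j)) \<in> borel_measurable borel"
      by (rule Fm, rule measurable_linear[OF linear_prj[OF V]])
    have "0 < F j (prj (range (L j)) y) * exp (- (norm (y - prj (range (L j)) y))\<^sup>2 / 2)" for y using Fpos by simp
    then have "ennreal (F j (prj (range (L j)) y) * exp (- (norm (y - prj (range (L j)) y))\<^sup>2 / 2)) \<noteq> 0" for y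
      by (simp only: ennreal_eq_0_iff not_le)
    ultimately have "AE y in (lborel :: 'c measure). False" by (subst (asm) nn_integral_0_iff_AE) simp_all
    then show False by (simp add: eventually_False ae_filter_eq_bot_iff)
  qed
  then have N'p: "0 < N' j" for j using N'0[of j] by (simp add: order_le_less)
  have "(\<integral>\<^sup>+x\<in>\<Omega>. ennreal (\<Prod>j\<in>UNIV. F j (L j x) powr p j) \<partial>lborel) <= ennreal (exp (blC TYPE('b) TYPE('c) p n \<theta> C0 c) * (\<Prod>j\<in>UNIV. N' j powr p j))"
    by (rule bl_loglip[OF L n p Lc G gc \<theta> \<Omega> Fm Fpos FL \<Lambda> e N'p])
  also have "... <= ennreal (exp (blC TYPE('b) TYPE('c) p n \<theta> C0 c) * (\<Prod>j\<in>UNIV. N j powr p j))"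
    using N'0 N'N p by (intro ennreal_leI mult_left_mono prod_mono conjI powr_mono2) auto
  finally show ?thesis .
qed

lemma bounded_case:
  assumes \<Omega>[measurable]: "\<Omega> \<in> sets borel" and b\<Omega>: "bounded \<Omega>" "\<And>x. x \<in> \<Omega> ==> G x \<bullet> x <= 1"
    and f[measurable]: "\<And>j. f j \<in> borel_measurable borel" and f0: "\<And>j y. 0 <= f j y" and fM: "\<And>j y. f j y <= M"
    and fR: "\<And>j y. R <= norm y ==> f j y = 0"
    and I: "\<And>j. (\<integral>\<^sup>+y. ennreal (f j y) \<partial>\<mu> j) = ennreal (I j)" "\<And>j. 0 <= I j" and e: "0 < \<epsilon>"
  shows "(\<integral>\<^sup>+x\<in>\<Omega>. ennreal (\<Prod>j\<in>UNIV. rpow (f j (L j x)) (p j)) \<partial>lborel) <= ennreal (exp (blC TYPE('b) TYPE('c) p n \<theta> C0 c) * (\<Prod>j\<in>UNIV. (I j + \<epsilon>) powr p j))"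
proof -
  let ?d = "real DIM('c)"
  have "\<forall>j. \<exists>h. h \<in> borel_measurable borel \<and> (\<forall>y. f j y <= h y) \<and> (\<forall>x. \<exists>r>0. \<forall>y\<in>ball x r. h x <= h y) \<and>
    (\<integral>\<^sup>+y. ennreal (h y) \<partial>\<mu> j) <= (\<integral>\<^sup>+y. ennreal (f j y) \<partial>\<mu> j) + ennreal (\<epsilon> / 2)"
  proof
    fix j
    obtain h where "borel_fun h" "\<And>y. f j y <= h y" "\<And>x. \<exists>r>0. \<forall>y\<in>ball x r. h x <= h y"
      "(\<integral>\<^sup>+y. ennreal (h y) \<partial>\<mu> j) <= (\<integral>\<^sup>+y. ennreal (f j y) \<partial>\<mu> j) + ennreal (\<epsilon> / 2)"
      by (rule lsc_majorant[OF sets_mm mm_ball_finite[OF V] f f0 fM fR, where e="\<epsilon> / 2"]) (use e in auto)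
    then show "\<exists>h. h \<in> borel_measurable borel \<and> (\<forall>y. f j y <= h y) \<and> (\<forall>x. \<exists>r>0. \<forall>y\<in>ball x r. h x <= h y) \<and>
      (\<integral>\<^sup>+y. ennreal (h y) \<partial>\<mu> j) <= (\<integral>\<^sup>+y. ennreal (f j y) \<partial>\<mu> j) + ennreal (\<epsilon> / 2)" by blast
  qed
  then obtain h where hm[measurable]: "\<And>j. h j \<in> borel_measurable borel" and fh: "\<And>j y. f j y <= h j y"
    and hl: "\<And>j x. \<exists>r>0. \<forall>y\<in>ball x r. h j x <= h j y"
    and hI: "\<And>j. (\<integral>\<^sup>+y. ennreal (h j y) \<partial>\<mu> j) <= (\<integral>\<^sup>+y. ennreal (f j y) \<partial>\<mu> j) + ennreal (\<epsilon> / 2)" by metis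
  have "\<forall>j. \<exists>E\<ge>0. (\<integral>\<^sup>+y. ennreal (exp (- (?d * norm (y::'c)))) \<partial>\<mu> j) = ennreal E"
  proof
    fix j show "\<exists>E\<ge>0. (\<integral>\<^sup>+y. ennreal (exp (- (?d * norm (y::'c)))) \<partial>\<mu> j) = ennreal E"
      using mm_exp_finite[OF V, of j] by (cases "\<integral>\<^sup>+y. ennreal (exp (- (?d * norm (y::'c)))) \<partial>\<mu> j") auto
  qed
  then obtain E where E: "\<And>j. 0 <= E j" "\<And>j. (\<integral>\<^sup>+y. ennreal (exp (- (?d * norm (y::'c)))) \<partial>\<mu> j) = ennreal (E j)" by metis
  define \<eta> where "\<eta> j = \<epsilon> / (2 * (E j + 1))" for j
  have eta: "0 < \<eta> j" for j unfolding \<eta>_def using e E(1)[of j] by simp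
  have etaE: "\<eta> j * E j <= \<epsilon> / 2" for j
  proof -
    have "\<eta> j * E j <= \<eta> j * (E j + 1)" using eta[of j] by simp
    also have "... = \<epsilon> / 2" unfolding \<eta>_def using E(1)[of j] by (simp add: field_simps)
    finally show ?thesis .
  qed
  have h0: "0 <= h j y" for j y using f0[of j y] fh[of j y] by linarith
  define H where "H j y = h j y + \<eta> j * exp (- (?d * norm y))" for j y
  have Hm[measurable]: "borel_fun (H j)" for j unfolding H_def[abs_def] by measurable
  have low: "\<eta> j * exp (- (?d * norm y)) <= H j y" for j y unfolding H_def using h0 by simp
  have hH: "h j y <= H j y" for j y unfolding H_def using eta[of j] by simp
  have ctx: "llr_ctx (H j) (\<eta> j) ?d (?d + real k)" for j k
    by unfold_locales (use low eta in auto)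
  define F where "F k j = llr (?d + real k) (H j)" for k j
  have NF: "(\<integral>\<^sup>+y. ennreal (F k j y) \<partial>\<mu> j) <= ennreal (I j + \<epsilon>)" for k j
  proof -
    have "(\<integral>\<^sup>+y. ennreal (F k j y) \<partial>\<mu> j) <= (\<integral>\<^sup>+y. ennreal (h j y) + ennreal (\<eta> j) * ennreal (exp (- (?d * norm y))) \<partial>\<mu> j)"
    proof (rule nn_integral_mono)
      fix y
      have "F k j y <= h j y + \<eta> j * exp (- (?d * norm y))" unfolding F_def using llr_ctx.llr_le[OF ctx] by (simp add: H_def)
      then show "ennreal (F k j y) <= ennreal (h j y) + ennreal (\<eta> j) * ennreal (exp (- (?d * norm y)))"
        using h0 eta[of j] by (simp add: ennreal_mult'[symmetric] ennreal_plus[symmetric] ennreal_leI del: ennreal_plus)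
    qed
    also have "... = (\<integral>\<^sup>+y. ennreal (h j y) \<partial>\<mu> j) + ennreal (\<eta> j) * ennreal (E j)"
      by (subst nn_integral_add, measurable, subst nn_integral_cmult, measurable, simp add: E)
    also have "... <= (ennreal (I j) + ennreal (\<epsilon> / 2)) + ennreal (\<epsilon> / 2)"
      using hI[of j] etaE[of j] eta[of j] unfolding I(1) by (intro add_mono) (auto simp: ennreal_mult'[symmetric] ennreal_leI)
    also have "... = ennreal (I j + \<epsilon>)" using I(2)[of j] e by (simp add: ennreal_plus[symmetric] del: ennreal_plus)
    finally show ?thesis .
  qed
  have Fm[measurable]: "borel_fun (F k j)" for k j unfolding F_def by (rule llr_ctx.llr_measurable[OF ctx])
  have Fp: "0 < F k j y" for k j y unfolding F_def by (rule llr_ctx.llr_pos[OF ctx])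
  show ?thesis
  proof (rule fatou_dominated[where \<phi>s="\<lambda>k x. ennreal (\<Prod>j\<in>UNIV. F k j (L j x) powr p j) * indicator \<Omega> x"])
    show "(\<lambda>x. ennreal (\<Prod>j\<in>UNIV. F k j (L j x) powr p j) * indicator \<Omega> x) \<in> borel_measurable lborel" for k by measurable
    show "(\<integral>\<^sup>+x\<in>\<Omega>. ennreal (\<Prod>j\<in>UNIV. F k j (L j x) powr p j) \<partial>lborel) <= ennreal (exp (blC TYPE('b) TYPE('c) p n \<theta> C0 c) * (\<Prod>j\<in>UNIV. (I j + \<epsilon>) powr p j))" for k
    proof (rule log_lipschitz[OF \<Omega> b\<Omega> Fm Fp _ _ NF])
      show "ln (F k j y) <= ln (F k j y') + (?d + real k) * norm (y - y')" for j y y' unfolding F_def by (rule llr_ctx.ln_llr[OF ctx])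
      show "0 < I j + \<epsilon>" for j using I(2)[of j] e by simp
    qed simp_all
    fix x
    have "\<forall>j. eventually (\<lambda>k. h j (L j x) <= F k j (L j x)) sequentially"
    proof
      fix j
      obtain r where r: "0 < r" "\<And>y. y \<in> ball (L j x) r ==> h j (L j x) <= h j y" using hl by blast
      show "eventually (\<lambda>k. h j (L j x) <= F k j (L j x)) sequentially" unfolding F_def
      proof (rule llr_eventually[OF low eta _ r(1) _ h0])
        show "h j (L j x) <= H j y" if "y \<in> ball (L j x) r" for y using r(2)[OF that] hH[of j y] by linarith
      qed simp
    qed
    then have "eventually (\<lambda>k. \<forall>j. h j (L j x) <= F k j (L j x)) sequentially" by (simp add: eventually_all_finite)
    then show "eventually (\<lambda>k. ennreal (\<Prod>j\<in>UNIV. rpow (f j (L j x)) (p j)) * indicator \<Omega> x <= ennreal (\<Prod>j\<in>UNIV. F k j (L j x) powr p j) * indicator \<Omega> x) sequentially"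
    proof eventually_elim
      case (elim k)
      have "rpow (f j (L j x)) (p j) <= F k j (L j x) powr p j" for j
        using elim fh[of j "L j x"] order_trans by (intro rpow_le_powr f0 Fp p) blast
      then show ?case by (intro mult_right_mono ennreal_leI prod_mono) (auto simp: rpow_nonneg)
    qed
  qed
qed

lemma bounded_case':
  assumes \<Omega>: "\<Omega> \<in> sets borel" "bounded \<Omega>" "\<And>x. x \<in> \<Omega> ==> G x \<bullet> x <= 1"
    and f: "\<And>j. f j \<in> borel_measurable borel" and f0: "\<And>j y. 0 <= f j y" and fM: "\<And>j y. f j y <= M"
    and fR: "\<And>j y. R <= norm y ==> f j y = 0"
    and I: "\<And>j. (\<integral>\<^sup>+y. ennreal (f j y) \<partial>\<mu> j) = ennreal (I j)" "\<And>j. 0 <= I j"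
  shows "(\<integral>\<^sup>+x\<in>\<Omega>. ennreal (\<Prod>j\<in>UNIV. rpow (f j (L j x)) (p j)) \<partial>lborel) <= ennreal (exp (blC TYPE('b) TYPE('c) p n \<theta> C0 c) * (\<Prod>j\<in>UNIV. rpow (I j) (p j)))"
proof (rule LIMSEQ_le_const)
  let ?e = "\<lambda>k::nat. 1 / real (Suc k)"
  have t: "(\<lambda>k. (I j + ?e k) powr p j) \<longlonglongrightarrow> rpow (I j) (p j)" for j
  proof (cases "p j = 0")
    case True
    have "I j + ?e k > 0" for k using I(2)[of j] by (simp add: add_nonneg_pos)
    then show ?thesis using True by (simp add: rpow_def less_imp_neq[symmetric])
  next
    case False
    then have pj: "0 < p j" using p[of j] by simp
    have "(\<lambda>k. I j + ?e k) \<longlonglongrightarrow> I j + 0" by (intro tendsto_add tendsto_const lim_1_over_n[THEN LIMSEQ_Suc])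
    then have "(\<lambda>k. (I j + ?e k) powr p j) \<longlonglongrightarrow> I j powr p j"
      using pj I(2)[of j] by (intro tendsto_powr') (auto intro!: always_eventually)
    then show ?thesis using False by (simp add: rpow_def)
  qed
  show "(\<lambda>k. ennreal (exp (blC TYPE('b) TYPE('c) p n \<theta> C0 c) * (\<Prod>j\<in>UNIV. (I j + ?e k) powr p j))) \<longlonglongrightarrow> ennreal (exp (blC TYPE('b) TYPE('c) p n \<theta> C0 c) * (\<Prod>j\<in>UNIV. rpow (I j) (p j)))"
    by (intro tendsto_ennrealI tendsto_mult tendsto_const tendsto_prod t)
  show "\<exists>N. \<forall>k\<ge>N. (\<integral>\<^sup>+x\<in>\<Omega>. ennreal (\<Prod>j\<in>UNIV. rpow (f j (L j x)) (p j)) \<partial>lborel) <= ennreal (exp (blC TYPE('b) TYPE('c) p n \<theta> C0 c) * (\<Prod>j\<in>UNIV. (I j + ?e k) powr p j))"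
  proof (intro exI allI impI)
    fix k show "(\<integral>\<^sup>+x\<in>\<Omega>. ennreal (\<Prod>j\<in>UNIV. rpow (f j (L j x)) (p j)) \<partial>lborel) <= ennreal (exp (blC TYPE('b) TYPE('c) p n \<theta> C0 c) * (\<Prod>j\<in>UNIV. (I j + ?e k) powr p j))"
      by (rule bounded_case[OF \<Omega> f f0 fM fR I]) simp_all
  qed
qed

theorem bl_general:
  assumes \<Omega>[measurable]: "\<Omega> \<in> sets borel" and G\<Omega>: "\<And>x. x \<in> \<Omega> ==> G x \<bullet> x <= 1"
    and f[measurable]: "\<And>j. f j \<in> borel_measurable borel" and f0: "\<And>j y. 0 <= f j y"
    and I: "\<And>j. (\<integral>\<^sup>+y. ennreal (f j y) \<partial>\<mu> j) = ennreal (I j)" "\<And>j. 0 <= I j"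
  shows "(\<integral>\<^sup>+x\<in>\<Omega>. ennreal (\<Prod>j\<in>UNIV. rpow (f j (L j x)) (p j)) \<partial>lborel) <= ennreal (exp (blC TYPE('b) TYPE('c) p n \<theta> C0 c) * (\<Prod>j\<in>UNIV. rpow (I j) (p j)))"
proof -
  define g where "g k j y = (if norm y < real k then min (f j y) (real k) else 0)" for k j y
  have gm[measurable]: "borel_fun (g k j)" for k j unfolding g_def[abs_def] by measurable
  have g0: "0 <= g k j y" and gf: "g k j y <= f j y" and gk: "g k j y <= real k" and gR: "real k <= norm y ==> g k j y = 0" for k j y
    unfolding g_def using f0[of j y] by auto
  define J where "J k j = enn2real (\<integral>\<^sup>+y. ennreal (g k j y) \<partial>\<mu> j)" for k j
  have le: "(\<integral>\<^sup>+y. ennreal (g k j y) \<partial>\<mu> j) <= ennreal (I j)" for k j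
    unfolding I(1)[symmetric] by (intro nn_integral_mono ennreal_leI gf)
  have J: "(\<integral>\<^sup>+y. ennreal (g k j y) \<partial>\<mu> j) = ennreal (J k j)" for k j
    using le[where k=k and j=j] unfolding J_def by (cases "\<integral>\<^sup>+y. ennreal (g k j y) \<partial>\<mu> j") (auto simp: top_unique)
  have J0: "0 <= J k j" for k j unfolding J_def by simp
  have JI: "J k j <= I j" for k j using le[where k=k and j=j] I(2)[of j] unfolding J by simp
  show ?thesis
  proof (rule fatou_dominated[where \<phi>s="\<lambda>k x. ennreal (\<Prod>j\<in>UNIV. rpow (g k j (L j x)) (p j)) * indicator (\<Omega> \<inter> ball 0 (real k)) x"])
    show "(\<lambda>x. ennreal (\<Prod>j\<in>UNIV. rpow (g k j (L j x)) (p j)) * indicator (\<Omega> \<inter> ball 0 (real k)) x) \<in> borel_measurable lborel" for k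
    proof -
      have [measurable]: "\<Omega> \<inter> ball 0 (real k) \<in> sets borel" by simp
      show ?thesis by measurable
    qed
    fix k
    have "(\<integral>\<^sup>+x\<in>\<Omega> \<inter> ball 0 (real k). ennreal (\<Prod>j\<in>UNIV. rpow (g k j (L j x)) (p j)) \<partial>lborel) <= ennreal (exp (blC TYPE('b) TYPE('c) p n \<theta> C0 c) * (\<Prod>j\<in>UNIV. rpow (J k j) (p j)))"
      by (rule bounded_case'[OF _ _ _ gm g0 gk gR J J0]) (use \<Omega> G\<Omega> in auto)
    also have "... <= ennreal (exp (blC TYPE('b) TYPE('c) p n \<theta> C0 c) * (\<Prod>j\<in>UNIV. rpow (I j) (p j)))"
      using J0 JI p by (intro ennreal_leI mult_left_mono prod_mono conjI rpow_mono rpow_nonneg) auto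
    finally show "(\<integral>\<^sup>+x\<in>\<Omega> \<inter> ball 0 (real k). ennreal (\<Prod>j\<in>UNIV. rpow (g k j (L j x)) (p j)) \<partial>lborel) <= ennreal (exp (blC TYPE('b) TYPE('c) p n \<theta> C0 c) * (\<Prod>j\<in>UNIV. rpow (I j) (p j)))" .
  next
    fix x
    obtain k0 :: nat where k0: "norm x + (\<Sum>j\<in>UNIV. norm (L j x) + f j (L j x)) < real k0" using reals_Archimedean2 by blast
    have "ennreal (\<Prod>j\<in>UNIV. rpow (f j (L j x)) (p j)) * indicator \<Omega> x <= ennreal (\<Prod>j\<in>UNIV. rpow (g k j (L j x)) (p j)) * indicator (\<Omega> \<inter> ball 0 (real k)) x" if k: "k0 <= k" for k
    proof -
      have kk: "norm x + (\<Sum>j\<in>UNIV. norm (L j x) + f j (L j x)) < real k" using k0 k by linarith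
      have s0: "0 <= (\<Sum>j\<in>UNIV. norm (L j x) + f j (L j x))" using f0 by (intro sum_nonneg) auto
      have "norm (L j x) + f j (L j x) <= (\<Sum>j\<in>UNIV. norm (L j x) + f j (L j x))" for j
        using f0 by (intro member_le_sum) auto
      then have "norm (L j x) + f j (L j x) < real k" for j using kk norm_ge_zero[of x] by (smt (verit))
      then have "norm (L j x) < real k \<and> f j (L j x) <= real k" for j using f0[of j "L j x"] norm_ge_zero[of "L j x"] by (smt (verit))
      then have "g k j (L j x) = f j (L j x)" for j unfolding g_def by simp
      moreover have "norm x < real k" using kk s0 by linarith
      ultimately show ?thesis by (simp split: split_indicator)
    qed
    then show "eventually (\<lambda>k. ennreal (\<Prod>j\<in>UNIV. rpow (f j (L j x)) (p j)) * indicator \<Omega> x <= ennreal (\<Prod>j\<in>UNIV. rpow (g k j (L j x)) (p j)) * indicator (\<Omega> \<inter> ball 0 (real k)) x) sequentially"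
      by (auto simp: eventually_sequentially)
  qed
qed

end

definition bx :: "'a::euclidean_space set => real => real => 'a set" where
  "bx V \<alpha> \<beta> = {x. norm (prj V x) <= \<alpha> \<and> norm (x - prj V x) <= \<beta>}"

lemma bx_measurable: "subspace V ==> bx V \<alpha> \<beta> \<in> sets borel"
  unfolding bx_def using measurable_linear[OF linear_prj[of V]] by measurable

lemma bx_scale_iff:
  assumes V: "subspace V" and a: "0 < a" and b: "0 < b"
  shows "a *\<^sub>R prj V x + b *\<^sub>R (x - prj V x) \<in> bx V a b \<longleftrightarrow> x \<in> bx V 1 1"
proof -
  let ?y = "a *\<^sub>R prj V x + b *\<^sub>R (x - prj V x)"
  have "prj V ?y = a *\<^sub>R prj V x"
  proof (rule prj_unique[OF V])
    show "a *\<^sub>R prj V x \<in> V" using V prj(1)[OF V] by (simp add: subspace_scale)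
    fix v assume "v \<in> V" then show "(?y - a *\<^sub>R prj V x) \<bullet> v = 0" using prj(2)[OF V] by simp
  qed
  then show ?thesis using a b by (simp add: bx_def)
qed

lemma bx_emeasure:
  fixes V :: "'a::euclidean_space set"
  assumes V: "subspace V" and a: "0 < a" and b: "0 < b"
  shows "emeasure lborel (bx V a b) = ennreal (a ^ dim V * b ^ (DIM('a) - dim V)) * emeasure lborel (bx V 1 1)"
proof -
  note [measurable] = bx_measurable[OF V]
  have "emeasure lborel (bx V a b) = (\<L> x. indicator (bx V a b) x)" by (rule nn_integral_indicator[symmetric]) simp
  also have "... = ennreal (a ^ dim V * b ^ (DIM('a) - dim V)) * (\<L> x. indicator (bx V a b) (a *\<^sub>R prj V x + b *\<^sub>R (x - prj V x)))"
    by (rule nn_prj_scale[OF V a b]) measurable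
  also have "(\<lambda>x. indicator (bx V a b) (a *\<^sub>R prj V x + b *\<^sub>R (x - prj V x)) :: ennreal) = indicator (bx V 1 1)"
    using bx_scale_iff[OF V a b] by (auto simp: indicator_def)
  finally show ?thesis by simp
qed

lemma bx_emeasure_pos: assumes V: "subspace V" shows "emeasure lborel (bx V 1 1) \<noteq> 0"
proof -
  have "\<not> negligible (ball (0::'a) 1)" by (rule open_not_negligible[OF open_ball]) auto
  then have "ball (0::'a) 1 \<notin> null_sets lborel"
    unfolding negligible_iff_null_sets using null_sets_completionI by blast
  moreover have "ball 0 1 \<subseteq> bx V 1 1"
  proof
    fix x :: 'a assume "x \<in> ball 0 1" then show "x \<in> bx V 1 1" using prj_norm_le[OF V, of x] by (simp add: bx_def)
  qed
  then have "emeasure lborel (ball (0::'a) 1) <= emeasure lborel (bx V 1 1)" using bx_measurable[OF V] by (intro emeasure_mono) simp_all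
  ultimately show ?thesis by (auto simp: null_sets_def)
qed

lemma prj_prj: assumes V: "subspace V" and W: "subspace W" and WV: "W \<subseteq> V" shows "prj W (prj V y) = prj W y"
proof (rule prj_unique[OF W])
  show "prj W y \<in> W" by (rule prj(1)[OF W])
  fix w assume w: "w \<in> W"
  have "(prj V y - prj W y) \<bullet> w = (y - prj W y) \<bullet> w - (y - prj V y) \<bullet> w" by (simp add: inner_diff_left)
  then show "(prj V y - prj W y) \<bullet> w = 0" using prj(2)[OF W w] prj(2)[OF V] w WV by auto
qed

lemma mm_bx:
  fixes V W :: "'b::euclidean_space set"
  assumes V: "subspace V" and W: "subspace W" and WV: "W \<subseteq> V" and a: "0 < a" and b: "0 < b"
  shows "emeasure (mm V) (bx W a b) = ennreal (a ^ dim W * b ^ (dim V - dim W)) * emeasure (mm V) (bx W 1 1)"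
proof -
  note [measurable] = bx_measurable[OF W] measurable_linear[OF linear_prj[OF V]] measurable_linear[OF linear_prj[OF W]] wt_measurable[OF V]
  note PV = linear_prj[OF V] note PW = linear_prj[OF W]
  have em: "emeasure (mm V) (bx W s t) = (\<L> y. indicator (bx W s t) (prj V y) * ennreal (wt V y))" for s t
    by (subst nn_mm[OF V, symmetric]) (simp_all add: nn_integral_indicator)
  let ?T = "\<lambda>y. a *\<^sub>R prj W y + b *\<^sub>R (y - prj W y)" and ?S = "\<lambda>y. 1 *\<^sub>R prj V y + (1 / b) *\<^sub>R (y - prj V y)"
  let ?f = "\<lambda>y. indicator (bx W a b) (prj V y) * ennreal (wt V y)"
  have dW: "dim W <= dim V" using WV by (rule dim_subset)
  have dV: "dim V <= DIM('b)" by (rule dim_subset_UNIV)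
  have Vi: "prj V (prj W y) = prj W y" for y using prj(1)[OF W, of y] WV by (intro prj_id[OF V]) auto
  have Vj: "prj V (prj V y) = prj V y" for y using prj(1)[OF V, of y] by (intro prj_id[OF V]) auto
  have TS1: "prj V (?T (?S y)) = a *\<^sub>R prj W (prj V y) + b *\<^sub>R (prj V y - prj W (prj V y))" for y
    by (simp add: linear_add[OF PV] linear_add[OF PW] linear_diff[OF PV] linear_diff[OF PW] linear_scale[OF PV] linear_scale[OF PW] Vi Vj prj_prj[OF V W WV])
  have TS2: "?T (?S y) - prj V (?T (?S y)) = y - prj V y" for y
    unfolding TS1 using b by (simp add: linear_add[OF PW] linear_diff[OF PW] linear_scale[OF PW] prj_prj[OF V W WV] algebra_simps)
  have "emeasure (mm V) (bx W a b) = (\<L> y. ?f y)" by (rule em)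
  also have "... = ennreal (a ^ dim W * b ^ (DIM('b) - dim W)) * (\<L> y. ?f (?T y))"
    by (rule nn_prj_scale[OF W a b]) measurable
  also have "(\<L> y. ?f (?T y)) = ennreal (1 ^ dim V * (1 / b) ^ (DIM('b) - dim V)) * (\<L> y. ?f (?T (?S y)))"
    by (rule nn_prj_scale[OF V, where \<phi>="\<lambda>y. ?f (?T y)"]) (use b in simp_all, measurable)
  also have "(\<L> y. ?f (?T (?S y))) = emeasure (mm V) (bx W 1 1)"
    unfolding em
  proof (rule nn_integral_cong)
    fix y :: 'b
    have "wt V (?T (?S y)) = wt V y" unfolding wt_def TS2 ..
    moreover have "prj V (?T (?S y)) \<in> bx W a b \<longleftrightarrow> prj V y \<in> bx W 1 1" unfolding TS1 by (rule bx_scale_iff[OF W a b])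
    ultimately show "?f (?T (?S y)) = indicator (bx W 1 1) (prj V y) * ennreal (wt V y)" by (simp split: split_indicator)
  qed
  also have "ennreal (a ^ dim W * b ^ (DIM('b) - dim W)) * (ennreal (1 ^ dim V * (1 / b) ^ (DIM('b) - dim V)) * emeasure (mm V) (bx W 1 1))
     = ennreal (a ^ dim W * b ^ (DIM('b) - dim W) * (1 / b) ^ (DIM('b) - dim V)) * emeasure (mm V) (bx W 1 1)"
    using a b by (simp add: ennreal_mult'[symmetric] mult.assoc[symmetric])
  also have "DIM('b) - dim W = (dim V - dim W) + (DIM('b) - dim V)" using dW dV by simp
  also have "a ^ dim W * b ^ ((dim V - dim W) + (DIM('b) - dim V)) * (1 / b) ^ (DIM('b) - dim V) = a ^ dim W * b ^ (dim V - dim W)"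
    using b by (simp add: power_add power_one_over)
  finally show ?thesis .
qed

lemma mm_bx_finite: assumes V: "subspace V" and W: "subspace W" shows "emeasure (mm V) (bx W 1 1) < \<infinity>"
proof -
  have "norm x <= norm (prj W x) + norm (x - prj W x)" for x by (metis add.commute diff_add_cancel norm_triangle_ineq)
  then have "bx W 1 1 \<subseteq> ball 0 3" unfolding bx_def by (auto intro: le_less_trans) (smt (verit))
  then have "emeasure (mm V) (bx W 1 1) <= emeasure (mm V) (ball 0 3)" by (intro emeasure_mono) simp_all
  also have "... < \<infinity>" by (rule mm_ball_finite[OF V])
  finally show ?thesis .
qed

lemma growth_exponent_le:
  assumes b: "0 < (b::real)" and le: "\<And>R. 1 <= R ==> b * R powr d <= K * R powr s"
  shows "d <= s"
proof (rule ccontr)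
  assume "\<not> d <= s"
  then have ds: "0 < d - s" by simp
  define R where "R = (1 + \<bar>K\<bar> / b) powr (1 / (d - s))"
  have pos: "1 <= 1 + \<bar>K\<bar> / b" using b by simp
  have R1: "1 <= R" unfolding R_def by (rule ge_one_powr_ge_zero[OF pos]) (use ds in simp)
  have "R powr (d - s) = 1 + \<bar>K\<bar> / b" unfolding R_def powr_powr using ds pos by simp
  then have "b * R powr (d - s) = b + \<bar>K\<bar>" using b by (simp add: field_simps)
  moreover have "b * R powr (d - s) <= K"
    using le[OF R1] R1 by (simp add: powr_diff field_simps)
  ultimately show False using b by linarith
qed

locale padded_bound =
  fixes L :: "'a::finite => 'b::euclidean_space => 'c::euclidean_space" and p :: "'a => real"
    and G :: "'b => 'b" and Hs :: "'a => 'c set" and c B C :: real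
  assumes L: "\<And>j. linear (L j)" and p: "\<And>j. 0 <= p j"
    and Hs: "\<And>j. subspace (Hs j)" "\<And>j. range (L j) \<subseteq> Hs j"
    and Lc: "\<And>j v. norm (L j v) <= c * norm v" and c: "1 <= c"
    and G: "linear G" "\<And>u v. G u \<bullet> v = u \<bullet> G v" "\<And>v. G v \<bullet> v <= B * (norm v)^2" and B: "1 <= B"
    and test: "\<And>A a. (\<And>j. A j \<in> sets borel) ==> (\<And>j. bounded (A j)) ==> (\<And>j. emeasure (mm (Hs j)) (A j) <= ennreal (a j)) ==> (\<And>j. 0 < a j)
      ==> emeasure lborel {x. G x \<bullet> x < 1 / 2 \<and> (\<forall>j. L j x \<in> A j)} <= ennreal (C * (\<Prod>j\<in>UNIV. a j powr p j))"
begin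

lemma bx_image:
  assumes V: "subspace V" and x: "x \<in> bx V \<alpha> \<beta>"
  shows "L j x \<in> bx (L j ` V) (c * (\<alpha> + \<beta>)) (c * \<beta>)"
proof -
  have W: "subspace (L j ` V)" by (rule linear_subspace_image[OF L V])
  let ?W = "L j ` V" and ?v = "prj V x"
  have nx: "norm x <= \<alpha> + \<beta>" using x norm_triangle_ineq[of ?v "x - ?v"] by (simp add: bx_def)
  have "norm (prj ?W (L j x)) <= norm (L j x)" by (rule prj_norm_le[OF W])
  also have "... <= c * norm x" by (rule Lc)
  also have "... <= c * (\<alpha> + \<beta>)" using nx c by (intro mult_left_mono) auto
  finally have 1: "norm (prj ?W (L j x)) <= c * (\<alpha> + \<beta>)" .
  have "prj ?W (L j ?v) = L j ?v" using prj(1)[OF V, of x] by (intro prj_id[OF W]) auto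
  then have "L j x - prj ?W (L j x) = L j (x - ?v) - prj ?W (L j (x - ?v))"
    by (simp add: linear_diff[OF L] linear_diff[OF linear_prj[OF W]])
  then have "norm (L j x - prj ?W (L j x)) <= norm (L j (x - ?v))" using prj_norm_le(2)[OF W] by simp
  also have "... <= c * norm (x - ?v)" by (rule Lc)
  also have "... <= c * \<beta>" using x c by (intro mult_left_mono) (auto simp: bx_def)
  finally show ?thesis using 1 by (simp add: bx_def)
qed

lemma bx_mono: "\<alpha> <= \<alpha>' ==> \<beta> <= \<beta>' ==> bx V \<alpha> \<beta> \<subseteq> bx V \<alpha>' \<beta>'" by (auto simp: bx_def)

lemma bx_bounded: "bounded (bx V \<alpha> \<beta>)"
  unfolding bounded_iff
proof (intro exI[of _ "\<alpha> + \<beta>"] ballI)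
  fix x assume "x \<in> bx V \<alpha> \<beta>"
  then show "norm x <= \<alpha> + \<beta>" using norm_triangle_ineq[of "prj V x" "x - prj V x"] by (simp add: bx_def)
qed

lemma box_test:
  assumes V: "subspace V" and ab: "0 < \<alpha>" "0 < \<beta>" and sub: "\<And>x. x \<in> bx V \<alpha> \<beta> ==> G x \<bullet> x < 1 / 2"
    and a': "\<And>j. c * (\<alpha> + \<beta>) <= \<alpha>'" and b': "c * \<beta> <= \<beta>'"
    and m: "\<And>j. emeasure (mm (Hs j)) (bx (L j ` V) 1 1) <= ennreal (m j)" "\<And>j. 0 < m j"
  shows "ennreal (\<alpha> ^ dim V * \<beta> ^ (DIM('b) - dim V)) * emeasure lborel (bx V 1 1)
     <= ennreal (C * (\<Prod>j\<in>UNIV. (\<alpha>' ^ dim (L j ` V) * \<beta>' ^ (dim (Hs j) - dim (L j ` V)) * m j) powr p j))"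
proof -
  have W: "subspace (L j ` V)" for j by (rule linear_subspace_image[OF L V])
  have WH: "L j ` V \<subseteq> Hs j" for j using Hs(2)[of j] by auto
  have "0 < c * (\<alpha> + \<beta>)" "0 < c * \<beta>" using c ab by auto
  then have pos: "0 < \<alpha>'" "0 < \<beta>'" using a' b' by linarith+
  note [measurable] = measurable_linear[OF L] measurable_linear[OF G(1)] bx_measurable[OF W]
  have "ennreal (\<alpha> ^ dim V * \<beta> ^ (DIM('b) - dim V)) * emeasure lborel (bx V 1 1) = emeasure lborel (bx V \<alpha> \<beta>)"
    by (rule bx_emeasure[OF V ab, symmetric])
  also have "... <= emeasure lborel {x. G x \<bullet> x < 1 / 2 \<and> (\<forall>j. L j x \<in> bx (L j ` V) \<alpha>' \<beta>')}"
  proof (rule emeasure_mono)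
    show "bx V \<alpha> \<beta> \<subseteq> {x. G x \<bullet> x < 1 / 2 \<and> (\<forall>j. L j x \<in> bx (L j ` V) \<alpha>' \<beta>')}"
      using sub bx_image[OF V] bx_mono[OF a' b'] by blast
    have "{x \<in> space borel. G x \<bullet> x < 1 / 2 \<and> (\<forall>j. L j x \<in> bx (L j ` V) \<alpha>' \<beta>')} \<in> sets borel" by measurable
    then show "{x. G x \<bullet> x < 1 / 2 \<and> (\<forall>j. L j x \<in> bx (L j ` V) \<alpha>' \<beta>')} \<in> sets lborel" by simp
  qed
  also have "... <= ennreal (C * (\<Prod>j\<in>UNIV. (\<alpha>' ^ dim (L j ` V) * \<beta>' ^ (dim (Hs j) - dim (L j ` V)) * m j) powr p j))"
  proof (rule test)
    fix j
    show "bx (L j ` V) \<alpha>' \<beta>' \<in> sets borel" by (rule bx_measurable[OF W])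
    show "bounded (bx (L j ` V) \<alpha>' \<beta>')" by (rule bx_bounded)
    show "0 < \<alpha>' ^ dim (L j ` V) * \<beta>' ^ (dim (Hs j) - dim (L j ` V)) * m j" using pos m(2) by simp
    have "emeasure (mm (Hs j)) (bx (L j ` V) \<alpha>' \<beta>') = ennreal (\<alpha>' ^ dim (L j ` V) * \<beta>' ^ (dim (Hs j) - dim (L j ` V))) * emeasure (mm (Hs j)) (bx (L j ` V) 1 1)"
      by (rule mm_bx[OF Hs(1) W WH pos])
    also have "... <= ennreal (\<alpha>' ^ dim (L j ` V) * \<beta>' ^ (dim (Hs j) - dim (L j ` V))) * ennreal (m j)" by (intro mult_left_mono m) simp
    also have "... = ennreal (\<alpha>' ^ dim (L j ` V) * \<beta>' ^ (dim (Hs j) - dim (L j ` V)) * m j)" using pos m(2)[of j] by (simp add: ennreal_mult'[symmetric])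
    finally show "emeasure (mm (Hs j)) (bx (L j ` V) \<alpha>' \<beta>') <= ennreal (\<alpha>' ^ dim (L j ` V) * \<beta>' ^ (dim (Hs j) - dim (L j ` V)) * m j)" .
  qed
  finally show ?thesis .
qed

lemma box_consts:
  assumes V: "subspace V"
  obtains b m where "0 < b" "ennreal b <= emeasure lborel (bx V 1 1)" "\<And>j. emeasure (mm (Hs j)) (bx (L j ` V) 1 1) <= ennreal (m j)" "\<And>j. 0 < m j"
proof -
  have "\<exists>b>0. ennreal b <= emeasure lborel (bx V 1 1)"
  proof (cases "emeasure lborel (bx V 1 1)")
    case (real r) then show ?thesis using bx_emeasure_pos[OF V] by (intro exI[of _ r]) (auto simp: order_le_less)
  qed (intro exI[of _ 1], simp)
  then obtain b where b: "0 < b" "ennreal b <= emeasure lborel (bx V 1 1)" by blast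
  have "\<forall>j. \<exists>m>0. emeasure (mm (Hs j)) (bx (L j ` V) 1 1) <= ennreal m"
  proof
    fix j show "\<exists>m>0. emeasure (mm (Hs j)) (bx (L j ` V) 1 1) <= ennreal m"
    proof (cases "emeasure (mm (Hs j)) (bx (L j ` V) 1 1)")
      case (real r) then show ?thesis by (intro exI[of _ "r + 1"]) (auto simp: ennreal_leI)
    next
      case top then show ?thesis using mm_bx_finite[OF Hs(1)[of j] linear_subspace_image[OF L V, of j]] by simp
    qed
  qed
  then obtain m where "\<And>j. 0 < m j" "\<And>j. emeasure (mm (Hs j)) (bx (L j ` V) 1 1) <= ennreal (m j)" by metis
  then show ?thesis using that[OF b] by blast
qed

lemma prod_growth:
  assumes R: "0 < R" and M: "\<And>j. 0 < M j"
  shows "(\<Prod>j\<in>UNIV. (R ^ e j * M j) powr p j) = (\<Prod>j\<in>UNIV. M j powr p j) * R powr (\<Sum>j\<in>UNIV. p j * real (e j))"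
proof -
  have "(\<Prod>j\<in>UNIV. (R ^ e j * M j) powr p j) = (\<Prod>j\<in>UNIV. R powr (p j * real (e j)) * M j powr p j)"
    using R M by (intro prod.cong refl) (simp add: powr_mult less_imp_le powr_realpow[symmetric] powr_powr mult.commute)
  also have "... = (\<Prod>j\<in>UNIV. M j powr p j) * R powr (\<Sum>j\<in>UNIV. p j * real (e j))"
    using R by (simp add: prod.distrib powr_sum mult.commute)
  finally show ?thesis .
qed


theorem dim_ker_le:
  assumes V: "subspace V" and VG: "\<And>v. v \<in> V ==> G v = 0"
  shows "real (dim V) <= (\<Sum>j\<in>UNIV. p j * real (dim (L j ` V)))"
proof -
  obtain b m where bm: "0 < b" "ennreal b <= emeasure lborel (bx V 1 1)" "\<And>j. emeasure (mm (Hs j)) (bx (L j ` V) 1 1) <= ennreal (m j)" "\<And>j. 0 < m j"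
    by (rule box_consts[OF V], rule that)
  define \<tau> where "\<tau> = 1 / (2 * B)"
  have \<tau>: "0 < \<tau>" "\<tau> <= 1" unfolding \<tau>_def using B by auto
  have \<tau>2: "B * \<tau>\<^sup>2 < 1 / 2"
  proof -
    have "B * \<tau>\<^sup>2 = \<tau> * (B * \<tau>)" by (simp add: power2_eq_square)
    also have "B * \<tau> = 1 / 2" unfolding \<tau>_def using B by simp
    finally show ?thesis using B unfolding \<tau>_def by (simp add: field_simps)
  qed
  define M where "M j = (2 * c) ^ dim (L j ` V) * c ^ (dim (Hs j) - dim (L j ` V)) * m j" for j
  have M0: "0 < M j" for j unfolding M_def using c bm(4) by simp
  define k where "k = \<tau> ^ (DIM('b) - dim V) * b"
  have k0: "0 < k" unfolding k_def using \<tau> bm(1) by simp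
  show ?thesis
  proof (rule growth_exponent_le[OF k0])
    fix R :: real assume R: "1 <= R"
    have sub: "G x \<bullet> x < 1 / 2" if x: "x \<in> bx V R \<tau>" for x
    proof -
      let ?v = "prj V x"
      have Gv: "G ?v = 0" by (rule VG[OF prj(1)[OF V]])
      have "G x \<bullet> x = G (x - ?v) \<bullet> (x - ?v)"
        using Gv G(2)[of x ?v] by (simp add: linear_diff[OF G(1)] inner_diff_right)
      also have "... <= B * (norm (x - ?v))^2" by (rule G(3))
      also have "... <= B * \<tau>\<^sup>2" using x B by (intro mult_left_mono power_mono) (auto simp: bx_def)
      finally show ?thesis using \<tau>2 by linarith
    qed
    have Rp: "0 < R" using R by simp
    have a': "c * (R + \<tau>) <= 2 * c * R" using mult_left_mono[of "R + \<tau>" "2 * R" c] R \<tau> c by simp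
    have b': "c * \<tau> <= c" using c \<tau> by simp
    have "ennreal (k * R powr real (dim V)) = ennreal (R ^ dim V * \<tau> ^ (DIM('b) - dim V)) * ennreal b"
      using R \<tau> bm(1) by (simp add: k_def powr_realpow ennreal_mult'[symmetric] mult_ac)
    also have "... <= ennreal (R ^ dim V * \<tau> ^ (DIM('b) - dim V)) * emeasure lborel (bx V 1 1)" by (intro mult_left_mono bm) simp
    also have "... <= ennreal (C * (\<Prod>j\<in>UNIV. ((2 * c * R) ^ dim (L j ` V) * c ^ (dim (Hs j) - dim (L j ` V)) * m j) powr p j))"
      by (rule box_test[OF V Rp \<tau>(1) sub a' b' bm(3,4)])
    also have "(\<Prod>j\<in>UNIV. ((2 * c * R) ^ dim (L j ` V) * c ^ (dim (Hs j) - dim (L j ` V)) * m j) powr p j) = (\<Prod>j\<in>UNIV. (R ^ dim (L j ` V) * M j) powr p j)"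
      unfolding M_def by (simp add: power_mult_distrib mult_ac)
    also have "... = (\<Prod>j\<in>UNIV. M j powr p j) * R powr (\<Sum>j\<in>UNIV. p j * real (dim (L j ` V)))" by (rule prod_growth[OF Rp M0])
    finally have le: "ennreal (k * R powr real (dim V)) <= ennreal ((C * (\<Prod>j\<in>UNIV. M j powr p j)) * R powr (\<Sum>j\<in>UNIV. p j * real (dim (L j ` V))))" by (simp add: mult.assoc)
    have "0 < k * R powr real (dim V)" using k0 Rp by simp
    then show "k * R powr real (dim V) <= (C * (\<Prod>j\<in>UNIV. M j powr p j)) * R powr (\<Sum>j\<in>UNIV. p j * real (dim (L j ` V)))"
      using le by (simp add: ennreal_le_iff2)
  qed
qed

theorem codim_ge:
  assumes V: "subspace V"
  shows "(\<Sum>j\<in>UNIV. p j * real (dim (Hs j) - dim (L j ` V))) <= real (DIM('b) - dim V)"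
proof -
  obtain b m where bm: "0 < b" "ennreal b <= emeasure lborel (bx V 1 1)" "\<And>j. emeasure (mm (Hs j)) (bx (L j ` V) 1 1) <= ennreal (m j)" "\<And>j. 0 < m j"
    by (rule box_consts[OF V], rule that)
  define \<tau> where "\<tau> = 1 / (4 * B)"
  have \<tau>: "0 < \<tau>" "\<tau> <= 1" unfolding \<tau>_def using B by auto
  have \<tau>2: "B * (2 * \<tau>)^2 < 1 / 2"
  proof -
    have "B * (2 * \<tau>)^2 = 4 * \<tau> * (B * \<tau>)" by (simp add: power2_eq_square)
    also have "B * \<tau> = 1 / 4" unfolding \<tau>_def using B by simp
    finally show ?thesis using B unfolding \<tau>_def by (simp add: field_simps)
  qed
  define M where "M j = (2 * c) ^ dim (L j ` V) * c ^ (dim (Hs j) - dim (L j ` V)) * m j" for j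
  have M0: "0 < M j" for j unfolding M_def using c bm(4) by simp
  define k where "k = \<tau> ^ dim V * \<tau> ^ (DIM('b) - dim V) * b"
  have k0: "0 < k" unfolding k_def using \<tau> bm(1) by simp
  let ?s = "\<Sum>j\<in>UNIV. p j * real (dim (Hs j) - dim (L j ` V))"
  have "- real (DIM('b) - dim V) <= - ?s"
  proof (rule growth_exponent_le[OF k0])
    fix R :: real assume R: "1 <= R"
    define e where "e = 1 / R"
    have e: "0 < e" "e <= 1" unfolding e_def using R by auto
    have ep: "e powr t = R powr (- t)" for t unfolding e_def using R by (simp add: powr_minus powr_divide inverse_eq_divide)
    have \<tau>e: "0 < \<tau> * e" "\<tau> * e <= \<tau>" using \<tau> e by simp_all
    have sub: "G x \<bullet> x < 1 / 2" if x: "x \<in> bx V \<tau> (\<tau> * e)" for x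
    proof -
      have "norm x <= 2 * \<tau>" using x norm_triangle_ineq[of "prj V x" "x - prj V x"] \<tau>e by (simp add: bx_def)
      then have "B * (norm x)^2 <= B * (2 * \<tau>)^2" using B by (intro mult_left_mono power_mono) auto
      then show ?thesis using G(3)[of x] \<tau>2 by linarith
    qed
    have a': "c * (\<tau> + \<tau> * e) <= 2 * c" using mult_left_mono[of "\<tau> + \<tau> * e" 2 c] \<tau> \<tau>e c by simp
    have b': "c * (\<tau> * e) <= c * e" using c \<tau> e by (intro mult_left_mono mult_left_le_one_le) auto
    have "ennreal (k * e powr real (DIM('b) - dim V)) = ennreal (\<tau> ^ dim V * (\<tau> * e) ^ (DIM('b) - dim V)) * ennreal b"
      using e(1) \<tau> bm(1) by (simp add: k_def powr_realpow ennreal_mult'[symmetric] mult_ac power_mult_distrib)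
    also have "... <= ennreal (\<tau> ^ dim V * (\<tau> * e) ^ (DIM('b) - dim V)) * emeasure lborel (bx V 1 1)" by (intro mult_left_mono bm) simp
    also have "... <= ennreal (C * (\<Prod>j\<in>UNIV. ((2 * c) ^ dim (L j ` V) * (c * e) ^ (dim (Hs j) - dim (L j ` V)) * m j) powr p j))"
      by (rule box_test[OF V \<tau>(1) \<tau>e(1) sub a' b' bm(3,4)])
    also have "(\<Prod>j\<in>UNIV. ((2 * c) ^ dim (L j ` V) * (c * e) ^ (dim (Hs j) - dim (L j ` V)) * m j) powr p j) = (\<Prod>j\<in>UNIV. (e ^ (dim (Hs j) - dim (L j ` V)) * M j) powr p j)"
      unfolding M_def by (simp add: power_mult_distrib mult_ac)
    also have "... = (\<Prod>j\<in>UNIV. M j powr p j) * e powr ?s" by (rule prod_growth[OF e(1) M0])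
    finally have le: "ennreal (k * e powr real (DIM('b) - dim V)) <= ennreal ((C * (\<Prod>j\<in>UNIV. M j powr p j)) * e powr ?s)" by (simp add: mult.assoc)
    have "0 < k * e powr real (DIM('b) - dim V)" using k0 e by simp
    then have "k * e powr real (DIM('b) - dim V) <= (C * (\<Prod>j\<in>UNIV. M j powr p j)) * e powr ?s"
      using le by (simp add: ennreal_le_iff2)
    then show "k * R powr (- real (DIM('b) - dim V)) <= (C * (\<Prod>j\<in>UNIV. M j powr p j)) * R powr (- ?s)" unfolding ep .
  qed
  then show ?thesis by simp
qed

end

definition pad :: "'a::euclidean_space set => ('a => 'b) => 'a => 'b" where "pad V T x = T (prj V x)"

definition padG :: "'a::euclidean_space set => ('a => 'a) => 'a => 'a" where
  "padG V G x = (1 / 2) *\<^sub>R (G (prj V x) + (x - prj V x))"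

lemma linear_pad: assumes V: "subspace V" and T: "linear_map_on V W T" shows "linear (pad V T)"
  by (rule linearI) (use T prj(1)[OF V] in \<open>simp_all add: pad_def linear_map_on_def linear_add[OF linear_prj[OF V]] linear_scale[OF linear_prj[OF V]]\<close>)

lemma padG_props:
  assumes H: "subspace H" and G: "psd_on H G"
  shows "linear (padG H G)" "padG H G u \<bullet> v = u \<bullet> padG H G v" "0 <= padG H G v \<bullet> v"
    "padG H G v \<bullet> v = (G (prj H v) \<bullet> prj H v + (norm (v - prj H v))^2) / 2"
proof -
  have lm: "linear_map_on H H G" using G by (simp add: psd_on_def)
  have "linear (pad H G)" by (rule linear_pad[OF H lm])
  then have "linear (\<lambda>x. (1 / 2) *\<^sub>R (pad H G x + (x - prj H x)))"
    by (intro linear_compose_scale_right linear_compose_add linear_compose_sub linear_ident linear_prj[OF H])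
  then show "linear (padG H G)" by (simp add: padG_def[abs_def] pad_def)
  have GH: "G (prj H x) \<in> H" for x using lm prj(1)[OF H] by (auto simp: linear_map_on_def)
  have e: "padG H G u \<bullet> v = (G (prj H u) \<bullet> prj H v + (u - prj H u) \<bullet> (v - prj H v)) / 2" for u v
  proof -
    have "G (prj H u) \<bullet> v = G (prj H u) \<bullet> prj H v" using prj(2)[OF H GH, of v u] by (simp add: inner_diff_left inner_diff_right inner_commute)
    moreover have "(u - prj H u) \<bullet> v = (u - prj H u) \<bullet> (v - prj H v)" using prj(2)[OF H prj(1)[OF H], of u v] by (simp add: inner_diff_right)
    ultimately show ?thesis by (simp add: padG_def inner_add_left)
  qed
  have sym: "G (prj H u) \<bullet> prj H v = prj H u \<bullet> G (prj H v)" for u v using G prj(1)[OF H] by (auto simp: psd_on_def)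
  show "padG H G u \<bullet> v = u \<bullet> padG H G v"     unfolding inner_commute[of u "padG H G v"] e sym[of u v] inner_commute[of "prj H u"] inner_commute[of "u - prj H u"] ..
  show q: "padG H G v \<bullet> v = (G (prj H v) \<bullet> prj H v + (norm (v - prj H v))^2) / 2" for v by (simp add: e power2_norm_eq_inner)
  show "0 <= padG H G v \<bullet> v" unfolding q using G prj(1)[OF H] by (auto simp: psd_on_def)
qed

lemma padG_bounded:
  assumes H: "subspace H" and G: "psd_on H G"
  obtains B where "1 <= B" "\<And>v. padG H G v \<bullet> v <= B * (norm v)^2"
proof -
  obtain B where B: "0 < B" "\<And>v. norm (padG H G v) <= B * norm v" by (rule linear_bounded_pos[OF padG_props(1)[OF H G]], rule that)
  have "padG H G v \<bullet> v <= (B + 1) * (norm v)^2" for v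
  proof -
    have "padG H G v \<bullet> v <= norm (padG H G v) * norm v" by (rule norm_cauchy_schwarz)
    also have "... <= (B + 1) * norm v * norm v" using B(2)[of v] by (intro mult_right_mono) (auto simp: distrib_right intro: add_increasing2)
    finally show ?thesis by (simp add: power2_eq_square mult.assoc)
  qed
  then show ?thesis using that[of "B + 1"] B(1) by simp
qed

lemma BL_datum_pad:
  assumes H: "subspace H" and D: "BL_datum H Hs L p"
  shows "linear (pad H (L j))" "range (pad H (L j)) = Hs j" "0 <= p j"
proof -
  have lm: "linear_map_on H (Hs j) (L j)" and im: "L j ` H = Hs j" and "0 <= p j" using D by (auto simp: BL_datum_def)
  then show "linear (pad H (L j))" "0 <= p j" using linear_pad[OF H] by auto
  have "range (prj H) = H"
  proof
    show "range (prj H) \<subseteq> H" using prj(1)[OF H] by auto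
    show "H \<subseteq> range (prj H)" by (metis prj_id[OF H] rangeI subsetI)
  qed
  then show "range (pad H (L j)) = Hs j" using im unfolding pad_def by (metis image_image)
qed

lemma subspace_lborel_ball:
  fixes H :: "'a::euclidean_space set"
  assumes H: "subspace H"
  obtains \<kappa> where "0 < \<kappa>" "\<And>\<phi>. \<phi> \<in> borel_measurable borel ==> (\<integral>\<^sup>+x. \<phi> x \<partial>subspace_lborel H) = ennreal \<kappa> * (\<L> x. \<phi> (prj H x) * indicator (cball 0 1) (x - prj H x))"
proof -
  have "\<exists>\<kappa>>0. \<forall>\<phi>\<in>borel_measurable borel. (\<integral>\<^sup>+x. \<phi> x \<partial>subspace_lborel H) = ennreal \<kappa> * (\<L> x. \<phi> (prj H x) * indicator (cball 0 1) (x - prj H x))"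
  proof (rule subspace_haar[OF H, where \<psi>="indicator (cball 0 1)" and K="exp (1 / 2)" and k=1])
    show "indicator (cball 0 1) u <= ennreal (exp (1 / 2) * exp (- (norm u)\<^sup>2 / 2))" for u :: 'a
      by (auto simp: exp_add[symmetric] power_le_one split: split_indicator)
    show "indicator (cball 0 1) \<in> (borel_measurable borel :: ('a => ennreal) set)" by (rule borel_measurable_indicator) simp
  qed (auto intro!: exI)
  then show ?thesis using that by blast
qed

lemma rpow_mult: "0 <= x ==> 0 <= y ==> rpow (x * y) a = rpow x a * rpow y a"
  by (simp add: rpow_def powr_mult)

theorem BL_bound_of_gauss_cond:
  fixes H :: "'a::euclidean_space set" and Hs :: "'j::finite => 'b::euclidean_space set" and p :: "'j => real"
  assumes H: "subspace H" and Hs: "\<And>j. subspace (Hs j)" and G: "psd_on H G"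
  obtains A :: real where "0 <= A" "\<And>L c \<theta> C0. BL_datum H Hs L p ==> (\<And>j v. norm (pad H (L j) v) <= c * norm v) ==>
    gauss_cond (\<lambda>j. pad H (L j)) p (padG H G) (\<lambda>j. dim (Hs j)) \<theta> C0 ==> 0 < \<theta> ==>
    BL_bound H Hs G L p (ennreal (A * exp (blC TYPE('a) TYPE('b) p (\<lambda>j. dim (Hs j)) \<theta> C0 c)))"
proof -
  obtain \<kappa> where \<kappa>: "0 < \<kappa>" "\<And>\<phi>. \<phi> \<in> borel_measurable borel ==> (\<integral>\<^sup>+x. \<phi> x \<partial>subspace_lborel H) = ennreal \<kappa> * (\<L> x. \<phi> (prj H x) * indicator (cball 0 1) (x - prj H x))"
    by (rule subspace_lborel_ball[OF H], rule that)
  have "\<forall>j. \<exists>k>0. \<forall>\<phi>\<in>borel_measurable borel. (\<integral>\<^sup>+x. \<phi> x \<partial>subspace_lborel (Hs j)) = ennreal k * (\<integral>\<^sup>+x. \<phi> x \<partial>mm (Hs j))"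
    using mm_subspace_lborel[OF Hs] by metis
  then obtain k where k: "\<And>j. 0 < k j" "\<And>j \<phi>. \<phi> \<in> borel_measurable borel ==> (\<integral>\<^sup>+x. \<phi> x \<partial>subspace_lborel (Hs j)) = ennreal (k j) * (\<integral>\<^sup>+x. \<phi> x \<partial>mm (Hs j))"
    by metis
  obtain B where B: "1 <= B" "\<And>v. padG H G v \<bullet> v <= B * (norm v)^2" by (rule padG_bounded[OF H G], rule that)
  define A where "A = \<kappa> * (\<Prod>j\<in>UNIV. rpow (1 / k j) (p j))"
  show ?thesis
  proof (rule that[of A])
    show "0 <= A" unfolding A_def using \<kappa>(1) by (intro mult_nonneg_nonneg prod_nonneg) (auto simp: rpow_nonneg)
    fix L c \<theta> C0
    assume D: "BL_datum H Hs L p" and c: "\<And>j v. norm (pad H (L j) v) <= c * norm v"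
      and gc: "gauss_cond (\<lambda>j. pad H (L j)) p (padG H G) (\<lambda>j. dim (Hs j)) \<theta> C0" and \<theta>: "0 < \<theta>"
    let ?K = "exp (blC TYPE('a) TYPE('b) p (\<lambda>j. dim (Hs j)) \<theta> C0 c)"
    interpret P: bl_data "\<lambda>j. pad H (L j)" p "\<lambda>j. dim (Hs j)" "padG H G" c B \<theta> C0
      by (rule bl_data.intro) (rule BL_datum_pad(1,3)[OF H D] padG_props(1,2,3)[OF H G] B c gc \<theta> | simp only: BL_datum_pad(2)[OF H D])+
    show "BL_bound H Hs G L p (ennreal (A * ?K))"
      unfolding BL_bound_def
    proof (intro allI impI)
      fix f :: "'j => 'b => real"
      assume f: "\<forall>j. integrable (subspace_lborel (Hs j)) (f j) \<and> (\<forall>y\<in>Hs j. 0 <= f j y)"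
      define g where "g j y = f j (prj (Hs j) y)" for j y
      have gm[measurable]: "borel_fun (g j)" for j
        unfolding g_def using f by (intro measurable_compose[OF prj_subspace_measurable[OF Hs]]) auto
      have g0: "0 <= g j y" for j y unfolding g_def using f prj(1)[OF Hs] by auto
      define F where "F j = (\<integral>y. f j y \<partial>subspace_lborel (Hs j))" for j
      have F0: "0 <= F j" for j unfolding F_def using f by (intro integral_nonneg_AE AE_I2) (auto simp: space_subspace_lborel[OF Hs])
      have I: "(\<integral>\<^sup>+y. ennreal (g j y) \<partial>mm (Hs j)) = ennreal (F j * (1 / k j))" for j
      proof -
        have "ennreal (k j) * (\<integral>\<^sup>+y. ennreal (g j y) \<partial>mm (Hs j)) = (\<integral>\<^sup>+y. ennreal (g j y) \<partial>subspace_lborel (Hs j))"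
          by (rule k(2)[symmetric]) measurable
        also have "... = (\<integral>\<^sup>+y. ennreal (f j y) \<partial>subspace_lborel (Hs j))"
          by (intro nn_integral_cong) (simp add: g_def space_subspace_lborel[OF Hs] prj_id[OF Hs])
        also have "... = ennreal (F j)" unfolding F_def using f
          by (intro nn_integral_eq_integral AE_I2) (auto simp: space_subspace_lborel[OF Hs])
        finally have "ennreal (1 / k j) * (ennreal (k j) * (\<integral>\<^sup>+y. ennreal (g j y) \<partial>mm (Hs j))) = ennreal (1 / k j) * ennreal (F j)" by simp
        moreover have "ennreal (1 / k j) * ennreal (k j) = 1" using k(1)[of j] by (simp add: ennreal_mult'[symmetric])
        moreover have "ennreal (1 / k j) * ennreal (F j) = ennreal (F j * (1 / k j))" using k(1)[of j] by (simp add: ennreal_mult'[symmetric])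
        ultimately show ?thesis by (simp add: mult.assoc[symmetric])
      qed
      have rg: "range (pad H (L j)) = Hs j" for j by (rule BL_datum_pad[OF H D])
      let ?\<Omega> = "{x. padG H G x \<bullet> x <= 1}"
      let ?S = "{x. \<bar>pad H G x \<bullet> prj H x\<bar> < 1}"
      have lG: "linear (pad H G)" using G by (intro linear_pad[OF H, where W=H]) (simp add: psd_on_def)
      note [measurable] = measurable_linear[OF linear_prj[OF H]] measurable_linear[OF lG] measurable_linear[OF padG_props(1)[OF H G]]
        measurable_linear[OF BL_datum_pad(1)[OF H D]]
      have Sm[measurable]: "?S \<in> sets borel" by measurable
      have \<Omega>m[measurable]: "?\<Omega> \<in> sets borel" by measurable
      let ?\<Phi> = "\<lambda>x. ennreal (\<Prod>j\<in>UNIV. rpow (g j (pad H (L j) x)) (p j)) * indicator ?S x"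
      have pp: "prj H (prj H x) = prj H x" for x by (intro prj_id[OF H] prj(1)[OF H])
      have "(\<integral>\<^sup>+x\<in>{x\<in>H. \<bar>G x \<bullet> x\<bar> < 1}. ennreal (\<Prod>j\<in>UNIV. rpow (f j (L j x)) (p j)) \<partial>subspace_lborel H) = (\<integral>\<^sup>+x. ?\<Phi> x \<partial>subspace_lborel H)"
      proof (rule nn_integral_cong)
        fix x assume "x \<in> space (subspace_lborel H)"
        then have x: "x \<in> H" by (simp add: space_subspace_lborel[OF H])
        have "L j x \<in> Hs j" for j using D x by (auto simp: BL_datum_def)
        then have "prj (Hs j) (L j x) = L j x" for j by (rule prj_id[OF Hs])
        then show "ennreal (\<Prod>j\<in>UNIV. rpow (f j (L j x)) (p j)) * indicator {x\<in>H. \<bar>G x \<bullet> x\<bar> < 1} x = ?\<Phi> x"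
          using x by (simp add: g_def pad_def prj_id[OF H] split: split_indicator)
      qed
      also have "... = ennreal \<kappa> * (\<L> x. ?\<Phi> (prj H x) * indicator (cball 0 1) (x - prj H x))" by (rule \<kappa>(2)) measurable
      also have "... <= ennreal \<kappa> * (\<integral>\<^sup>+x\<in>?\<Omega>. ennreal (\<Prod>j\<in>UNIV. rpow (g j (pad H (L j) x)) (p j)) \<partial>lborel)"
      proof (intro mult_left_mono nn_integral_mono)
        fix x
        have "padG H G x \<bullet> x <= 1" if "\<bar>G (prj H x) \<bullet> prj H x\<bar> < 1" "norm (x - prj H x) <= 1"
        proof -
          have "(norm (x - prj H x))^2 <= 1" using that(2) by (simp add: power_le_one)
          then show ?thesis unfolding padG_props(4)[OF H G] using that(1) by simp
        qed
        then show "?\<Phi> (prj H x) * indicator (cball 0 1) (x - prj H x) <= ennreal (\<Prod>j\<in>UNIV. rpow (g j (pad H (L j) x)) (p j)) * indicator ?\<Omega> x"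
          by (auto simp: pad_def pp split: split_indicator)
      qed simp
      also have "... <= ennreal \<kappa> * ennreal (?K * (\<Prod>j\<in>UNIV. rpow (F j * (1 / k j)) (p j)))"
      proof (intro mult_left_mono P.bl_general)
        show "(\<integral>\<^sup>+y. ennreal (g j y) \<partial>mm (range (pad H (L j)))) = ennreal (F j * (1 / k j))" for j unfolding rg by (rule I)
        show "0 <= F j * (1 / k j)" for j using F0[of j] k(1)[of j] by simp
      qed (auto intro: g0)
      also have "... = ennreal (A * ?K) * ennreal (\<Prod>j\<in>UNIV. rpow (F j) (p j))"
      proof -
        have "(\<Prod>j\<in>UNIV. rpow (F j * (1 / k j)) (p j)) = (\<Prod>j\<in>UNIV. rpow (F j) (p j)) * (\<Prod>j\<in>UNIV. rpow (1 / k j) (p j))"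
          unfolding prod.distrib[symmetric] using F0 k(1) by (intro prod.cong refl rpow_mult) (auto simp: less_imp_le)
        moreover have "0 <= (\<Prod>j\<in>UNIV. rpow (F j) (p j))" "0 <= (\<Prod>j\<in>UNIV. rpow (1 / k j) (p j))" by (intro prod_nonneg ballI rpow_nonneg)+
        ultimately show ?thesis using \<kappa>(1) unfolding A_def by (simp add: ennreal_mult''[symmetric] ennreal_mult'[symmetric] mult_ac)
      qed
      finally show "(\<integral>\<^sup>+x\<in>{x\<in>H. \<bar>G x \<bullet> x\<bar> < 1}. ennreal (\<Prod>j\<in>UNIV. rpow (f j (L j x)) (p j)) \<partial>subspace_lborel H)
        <= ennreal (A * ?K) * ennreal (\<Prod>j\<in>UNIV. rpow (\<integral>y. f j y \<partial>subspace_lborel (Hs j)) (p j))" unfolding F_def .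
    qed
  qed
qed

theorem padded_bound_of_BL_const:
  fixes H :: "'a::euclidean_space set" and Hs :: "'j::finite => 'b::euclidean_space set" and p :: "'j => real"
  assumes H: "subspace H" and Hs: "\<And>j. subspace (Hs j)" and G: "psd_on H G" and D: "BL_datum H Hs L p"
    and fin: "BL_const H Hs G L p < \<infinity>"
  obtains C :: real where "\<And>A a. (\<And>j. A j \<in> sets borel) ==> (\<And>j. emeasure (mm (Hs j)) (A j) <= ennreal (a j)) ==> (\<And>j. 0 < a j)
      ==> emeasure lborel {x. padG H G x \<bullet> x < 1 / 2 \<and> (\<forall>j. pad H (L j) x \<in> A j)} <= ennreal (C * (\<Prod>j\<in>UNIV. a j powr p j))"
proof -
  obtain \<kappa> where \<kappa>: "0 < \<kappa>" "\<And>\<phi>. \<phi> \<in> borel_measurable borel ==> (\<integral>\<^sup>+x. \<phi> x \<partial>subspace_lborel H) = ennreal \<kappa> * (\<L> x. \<phi> (prj H x) * indicator (cball 0 1) (x - prj H x))"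
    by (rule subspace_lborel_ball[OF H], rule that)
  have "\<forall>j. \<exists>k>0. \<forall>\<phi>\<in>borel_measurable borel. (\<integral>\<^sup>+x. \<phi> x \<partial>subspace_lborel (Hs j)) = ennreal k * (\<integral>\<^sup>+x. \<phi> x \<partial>mm (Hs j))"
    using mm_subspace_lborel[OF Hs] by metis
  then obtain k where k: "\<And>j. 0 < k j" "\<And>j \<phi>. \<phi> \<in> borel_measurable borel ==> (\<integral>\<^sup>+x. \<phi> x \<partial>subspace_lborel (Hs j)) = ennreal (k j) * (\<integral>\<^sup>+x. \<phi> x \<partial>mm (Hs j))"
    by metis
  obtain C where C: "BL_bound H Hs G L p C" "C < \<infinity>" using fin unfolding BL_const_def by (auto simp: Inf_less_iff)
  obtain C' where C': "C = ennreal C'" "0 <= C'" using C(2) by (cases C) auto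
  have p: "0 <= p j" for j by (rule BL_datum_pad[OF H D])
  show ?thesis
  proof (rule that[of "1 / \<kappa> * C' * (\<Prod>j\<in>UNIV. k j powr p j)"])
    fix A :: "'j => 'b set" and a :: "'j => real"
    assume A[measurable]: "\<And>j. A j \<in> sets borel" and aA: "\<And>j. emeasure (mm (Hs j)) (A j) <= ennreal (a j)" and a: "\<And>j. 0 < a j"
    define f where "f j = (indicator (A j) :: 'b => real)" for j
    have fm: "f j \<in> borel_measurable (subspace_lborel (Hs j))" for j
      unfolding f_def by (rule measurable_compose[OF id_subspace_measurable[OF Hs]]) simp
    have nf: "(\<integral>\<^sup>+y. ennreal (f j y) \<partial>subspace_lborel (Hs j)) <= ennreal (k j * a j)" for j
    proof -
      have "(\<integral>\<^sup>+y. ennreal (f j y) \<partial>subspace_lborel (Hs j)) = (\<integral>\<^sup>+y. indicator (A j) y \<partial>subspace_lborel (Hs j))"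
        unfolding f_def by (intro nn_integral_cong) (simp split: split_indicator)
      also have "... = ennreal (k j) * (\<integral>\<^sup>+y. indicator (A j) y \<partial>mm (Hs j))" by (rule k(2)) measurable
      also have "... = ennreal (k j) * emeasure (mm (Hs j)) (A j)" by (simp add: nn_integral_indicator)
      also have "... <= ennreal (k j) * ennreal (a j)" by (intro mult_left_mono aA) simp
      finally show ?thesis using k(1)[of j] by (simp add: ennreal_mult')
    qed
    have fi: "integrable (subspace_lborel (Hs j)) (f j)" for j
    proof (rule integrableI_nonneg[OF fm])
      show "AE y in subspace_lborel (Hs j). 0 <= f j y" by (simp add: f_def)
      show "(\<integral>\<^sup>+y. ennreal (f j y) \<partial>subspace_lborel (Hs j)) < \<infinity>" using nf[of j] by (rule order_le_less_trans) simp
    qed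
    define F where "F j = (\<integral>y. f j y \<partial>subspace_lborel (Hs j))" for j
    have F0: "0 <= F j" for j unfolding F_def f_def by (intro integral_nonneg_AE) simp
    have Fa: "F j <= k j * a j" for j
    proof -
      have "(\<integral>\<^sup>+y. ennreal (f j y) \<partial>subspace_lborel (Hs j)) = ennreal (F j)" unfolding F_def by (rule nn_integral_eq_integral[OF fi]) (simp add: f_def)
      then show ?thesis using nf[of j] k(1)[of j] a[of j] by simp
    qed
    let ?X = "{x. padG H G x \<bullet> x < 1 / 2 \<and> (\<forall>j. pad H (L j) x \<in> A j)}"
    let ?Y = "{x. \<bar>pad H G x \<bullet> prj H x\<bar> < 1 \<and> (\<forall>j. pad H (L j) x \<in> A j)}"
    have lG: "linear (pad H G)" using G by (intro linear_pad[OF H, where W=H]) (simp add: psd_on_def)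
    note [measurable] = measurable_linear[OF linear_prj[OF H]] measurable_linear[OF lG] measurable_linear[OF padG_props(1)[OF H G]]
      measurable_linear[OF BL_datum_pad(1)[OF H D]]
    have X: "?X \<in> sets borel"
    proof -
      have "{x\<in>space borel. padG H G x \<bullet> x < 1 / 2 \<and> (\<forall>j. pad H (L j) x \<in> A j)} \<in> sets borel" by measurable
      then show ?thesis by simp
    qed
    have Y[measurable]: "?Y \<in> sets borel"
    proof -
      have "{x\<in>space borel. \<bar>pad H G x \<bullet> prj H x\<bar> < 1 \<and> (\<forall>j. pad H (L j) x \<in> A j)} \<in> sets borel" by measurable
      then show ?thesis by simp
    qed
    have pp: "prj H (prj H x) = prj H x" for x by (intro prj_id[OF H] prj(1)[OF H])
    have "ennreal \<kappa> * emeasure lborel ?X = ennreal \<kappa> * (\<L> x. indicator ?X x)" using X by (subst nn_integral_indicator) simp_all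
    also have "... <= ennreal \<kappa> * (\<L> x. indicator ?Y (prj H x) * indicator (cball 0 1) (x - prj H x))"
    proof (intro mult_left_mono nn_integral_mono)
      fix x
      have "\<bar>G (prj H x) \<bullet> prj H x\<bar> < 1 \<and> norm (x - prj H x) <= 1" if "padG H G x \<bullet> x < 1 / 2"
      proof -
        have "0 <= G (prj H x) \<bullet> prj H x" using G prj(1)[OF H] by (auto simp: psd_on_def)
        moreover have "G (prj H x) \<bullet> prj H x + (norm (x - prj H x))^2 < 1" using that unfolding padG_props(4)[OF H G] by simp
        moreover have "0 <= (norm (x - prj H x))^2" by simp
        ultimately have "\<bar>G (prj H x) \<bullet> prj H x\<bar> < 1" "(norm (x - prj H x))^2 <= 1" by linarith+
        then show ?thesis using abs_square_le_1[of "norm (x - prj H x)"] by simp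
      qed
      then show "indicator ?X x <= (indicator ?Y (prj H x) * indicator (cball 0 1) (x - prj H x) :: ennreal)"
        by (auto simp: pad_def pp split: split_indicator)
    qed simp
    also have "... = (\<integral>\<^sup>+x. indicator ?Y x \<partial>subspace_lborel H)" by (rule \<kappa>(2)[symmetric]) measurable
    also have "... <= (\<integral>\<^sup>+x\<in>{x\<in>H. \<bar>G x \<bullet> x\<bar> < 1}. ennreal (\<Prod>j\<in>UNIV. rpow (f j (L j x)) (p j)) \<partial>subspace_lborel H)"
    proof (rule nn_integral_mono)
      fix x assume "x \<in> space (subspace_lborel H)"
      then have x: "x \<in> H" by (simp add: space_subspace_lborel[OF H])
      have "rpow 1 (p j) = 1" for j by (simp add: rpow_def)
      then show "indicator ?Y x <= ennreal (\<Prod>j\<in>UNIV. rpow (f j (L j x)) (p j)) * indicator {x\<in>H. \<bar>G x \<bullet> x\<bar> < 1} x"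
        using x by (auto simp: pad_def prj_id[OF H] f_def split: split_indicator)
    qed
    also have "... <= C * ennreal (\<Prod>j\<in>UNIV. rpow (F j) (p j))"
    proof -
      have "\<forall>j. integrable (subspace_lborel (Hs j)) (f j) \<and> (\<forall>y\<in>Hs j. 0 <= f j y)" using fi by (simp add: f_def)
      then show ?thesis using C(1) unfolding BL_bound_def F_def by blast
    qed
    also have "... <= C * ennreal (\<Prod>j\<in>UNIV. (k j * a j) powr p j)"
    proof (intro mult_left_mono ennreal_leI prod_mono conjI)
      fix j
      show "0 <= rpow (F j) (p j)" by (rule rpow_nonneg)
      show "rpow (F j) (p j) <= (k j * a j) powr p j" by (rule rpow_le_powr[OF F0 Fa _ p]) (use k(1)[of j] a[of j] in simp)
    qed simp
    also have "... = ennreal (C' * ((\<Prod>j\<in>UNIV. k j powr p j) * (\<Prod>j\<in>UNIV. a j powr p j)))"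
      using k(1) a C' by (simp add: powr_mult less_imp_le prod.distrib ennreal_mult')
    finally have "ennreal (1 / \<kappa>) * (ennreal \<kappa> * emeasure lborel ?X) <= ennreal (1 / \<kappa>) * ennreal (C' * ((\<Prod>j\<in>UNIV. k j powr p j) * (\<Prod>j\<in>UNIV. a j powr p j)))"
      by (rule mult_left_mono) simp
    moreover have "ennreal (1 / \<kappa>) * ennreal \<kappa> = 1" using \<kappa>(1) by (simp add: ennreal_mult'[symmetric])
    ultimately show "emeasure lborel ?X <= ennreal (1 / \<kappa> * C' * (\<Prod>j\<in>UNIV. k j powr p j) * (\<Prod>j\<in>UNIV. a j powr p j))"
      using \<kappa>(1) by (simp add: mult.assoc[symmetric] ennreal_mult'[symmetric])
  qed
qed

lemma greedy_basis:
  fixes w :: "nat => 'b::euclidean_space"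
  defines "I k \<equiv> {i. i < k \<and> w i \<notin> span (w ` {..<i})}"
  shows "card (I k) = dim (w ` {..<k}) \<and> independent (w ` I k) \<and> inj_on w (I k) \<and> span (w ` I k) = span (w ` {..<k})"
proof (induction k)
  case 0 show ?case by (simp add: I_def independent_empty)
next
  case (Suc k)
  have W: "w ` {..<Suc k} = insert (w k) (w ` {..<k})" by (simp add: lessThan_Suc)
  have fin: "finite (I k)" and kI: "k \<notin> I k" unfolding I_def by auto
  show ?case
  proof (cases "w k \<in> span (w ` {..<k})")
    case True
    then have IS: "I (Suc k) = I k" unfolding I_def by (auto simp: less_Suc_eq)
    have "span (insert (w k) (w ` {..<k})) = span (w ` {..<k})" using True by (rule span_redundant)
    then show ?thesis unfolding IS W dim_insert if_P[OF True] using Suc.IH by presburger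
  next
    case False
    then have IS: "I (Suc k) = insert k (I k)" unfolding I_def by (auto simp: less_Suc_eq)
    have sp: "span (w ` I k) = span (w ` {..<k})" and cI: "card (I k) = dim (w ` {..<k})" and ind: "independent (w ` I k)" and inj: "inj_on w (I k)"
      using Suc.IH by blast+
    have nin: "w k \<notin> span (w ` I k)" unfolding sp by (rule False)
    have nin': "w k \<notin> w ` I k" using nin span_base[of "w k" "w ` I k"] by argo
    have "span (insert (w k) (w ` I k)) = span (insert (w k) (w ` {..<k}))"
      by (simp only: span_insert sp)
    moreover have "card (I (Suc k)) = dim (w ` {..<Suc k})" unfolding IS W dim_insert using cI False fin kI by simp
    moreover have "independent (w ` I (Suc k))" unfolding IS image_insert independent_insert using ind nin nin' by simp
    moreover have "inj_on w (I (Suc k))" unfolding IS inj_on_insert using inj nin' by auto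
    ultimately show ?thesis unfolding IS W image_insert by blast
  qed
qed

lemma abel_lower:
  fixes m t :: "nat => real"
  defines "D k \<equiv> \<Sum>i<k. m i"
  assumes t: "\<And>i j. i <= j ==> j < N ==> t j <= t i" and D: "\<And>k. k <= K ==> 0 <= D k" and K: "K < N"
  shows "D (Suc K) * t K <= (\<Sum>i<Suc K. m i * t i)"
  using D K
proof (induction K)
  case 0 then show ?case by (simp add: D_def)
next
  case (Suc K)
  have "D (Suc K) * t (Suc K) <= D (Suc K) * t K" using Suc.prems by (intro mult_left_mono t) auto
  also have "... <= (\<Sum>i<Suc K. m i * t i)" using Suc by simp
  finally have "D (Suc K) * t (Suc K) + m (Suc K) * t (Suc K) <= (\<Sum>i<Suc (Suc K). m i * t i)" by simp
  moreover have "D (Suc (Suc K)) = D (Suc K) + m (Suc K)" by (simp add: D_def)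
  ultimately show ?case by (simp add: distrib_right)
qed

lemma abel_split:
  fixes m t :: "nat => real"
  defines "D k \<equiv> \<Sum>i<k. m i"
  assumes t: "\<And>i j. i <= j ==> j < N ==> t j <= t i" and D: "\<And>k. k <= K0 ==> 0 <= D k" and DN: "\<And>k. k <= N ==> D N <= D k" and K0: "K0 < N"
  shows "D N * t K0 <= (\<Sum>i<N. m i * t i)"
proof -
  have "D N * t K0 + (D (Suc K) - D N) * t K <= (\<Sum>i<Suc K. m i * t i)" if "K0 <= K" "K < N" for K
    using that
  proof (induction K rule: dec_induct)
    case base
    show ?case using abel_lower[of N t K0 m, OF t D[unfolded D_def] K0] by (simp add: D_def algebra_simps)
  next
    case (step K)
    have "(D (Suc K) - D N) * t (Suc K) <= (D (Suc K) - D N) * t K"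
      using DN[of "Suc K"] step by (intro mult_left_mono t) auto
    then have "D N * t K0 + (D (Suc K) - D N) * t (Suc K) <= (\<Sum>i<Suc K. m i * t i)" using step by simp
    moreover have "D (Suc (Suc K)) = D (Suc K) + m (Suc K)" by (simp add: D_def)
    ultimately show ?case by (simp add: distrib_right left_diff_distrib)
  qed
  from this[of "N - 1"] show ?thesis using K0 by (cases N) auto
qed

lemma psd_null:
  assumes G: "linear G" "\<And>u v. G u \<bullet> v = u \<bullet> G v" "\<And>v. 0 <= G v \<bullet> v" and v: "G v \<bullet> v = 0"
  shows "G v = (0::'a::euclidean_space)"
proof (rule ccontr)
  assume "G v \<noteq> 0"
  let ?w = "G v"
  have w: "0 < ?w \<bullet> ?w" using \<open>G v \<noteq> 0\<close> by simp
  define q where "q = G ?w \<bullet> ?w"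
  have q0: "0 <= q" unfolding q_def by (rule G(3))
  define t where "t = (?w \<bullet> ?w) / (q + 1)"
  have t: "0 < t" unfolding t_def using w q0 by simp
  have "G (v - t *\<^sub>R ?w) \<bullet> (v - t *\<^sub>R ?w) = t\<^sup>2 * q - 2 * t * (?w \<bullet> ?w)"
    using v G(2)[of ?w v] unfolding q_def
    by (simp add: linear_diff[OF G(1)] linear_scale[OF G(1)] inner_diff_left inner_diff_right power2_eq_square algebra_simps)
  also have "... = t * (t * q - 2 * (?w \<bullet> ?w))" by (simp add: power2_eq_square algebra_simps)
  also have "... < 0"
  proof (rule mult_pos_neg[OF t])
    have "t * q <= t * (q + 1)" using t by simp
    also have "... = ?w \<bullet> ?w" unfolding t_def using q0 by simp
    finally show "t * q - 2 * (?w \<bullet> ?w) < 0" using w by linarith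
  qed
  finally show False using G(3)[of "v - t *\<^sub>R ?w"] by simp
qed

lemma rot_bas: "i < DIM('a) ==> onb e ==> rot e (bas i) = (e i :: 'a::euclidean_space)"
proof -
  assume i: "i < DIM('a)" and "onb e"
  have "rot e (bas i) = (\<Sum>k<DIM('a). if k = i then e k else 0)"
    unfolding rot_def by (intro sum.cong) (auto simp: onb_inner[OF onb_bas] i)
  then show ?thesis using i by simp
qed

lemma rot_bas_image: "onb (e :: nat => 'a::euclidean_space) ==> J \<subseteq> {..<DIM('a)} ==> rot e ` bas ` J = e ` J"
  unfolding image_image by (intro image_cong refl rot_bas) auto

lemma span_rot:
  assumes e: "onb (e :: nat => 'a::euclidean_space)" and J: "J \<subseteq> {..<DIM('a)}" and y: "y \<in> span (e ` J)"
  obtains x where "x \<in> span (bas ` J)" "y = rot e x"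
proof -
  have "e ` J = rot e ` bas ` J" by (rule rot_bas_image[OF e J, symmetric])
  then have "y \<in> rot e ` span (bas ` J)" using y by (simp add: linear_span_image[OF linear_rot])
  then show ?thesis using that by auto
qed

locale limit_datum =
  fixes L0 :: "'a::finite => 'b::euclidean_space => 'c::euclidean_space" and p :: "'a => real"
    and G :: "'b => 'b"
  assumes L0: "\<And>j. linear (L0 j)" and p: "\<And>j. 0 <= p j"
    and G: "linear G" "\<And>u v. G u \<bullet> v = u \<bullet> G v" "\<And>v. 0 <= G v \<bullet> v"
    and ker: "\<And>V. subspace V ==> (\<And>v. v \<in> V ==> G v = 0) ==> real (dim V) <= (\<Sum>j\<in>UNIV. p j * real (dim (L0 j ` V)))"
    and codim: "\<And>V. subspace V ==> (\<Sum>j\<in>UNIV. p j * (real (dim (range (L0 j))) - real (dim (L0 j ` V)))) <= real DIM('b) - real (dim V)"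
begin

definition good :: "(nat => 'b) => real => real => ('a => 'b => 'c) => bool" where
  "good e \<theta> C L \<longleftrightarrow> (\<forall>s. (\<forall>i<DIM('b). 0 < s i) \<and> (\<forall>i j. i <= j \<longrightarrow> j < DIM('b) \<longrightarrow> s j <= s i)
      \<and> (\<Sum>i<DIM('b). (s i)^2 * (G (e i) \<bullet> e i)) <= 2 \<longrightarrow>
     (\<exists>J. (\<forall>j. J j \<subseteq> {..<DIM('b)} \<and> card (J j) = dim (range (L0 j)) \<and> (\<forall>y\<in>span (e ` J j). \<theta> * norm y <= norm (L j y)))
        \<and> (\<Sum>i<DIM('b). ln (s i)) <= (\<Sum>j\<in>UNIV. p j * (\<Sum>i\<in>J j. ln (s i))) + C))"

lemma good_mono: assumes "good e \<theta> C L" "\<theta>' <= \<theta>" "C <= C'" shows "good e \<theta>' C' L"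
  unfolding good_def
proof (intro allI impI)
  fix s :: "nat => real"
  assume s: "(\<forall>i<DIM('b). 0 < s i) \<and> (\<forall>i j. i <= j \<longrightarrow> j < DIM('b) \<longrightarrow> s j <= s i) \<and> (\<Sum>i<DIM('b). (s i)^2 * (G (e i) \<bullet> e i)) <= 2"
  from assms(1)[unfolded good_def, THEN spec, THEN mp, OF s]
  obtain J where J': "(\<forall>j. J j \<subseteq> {..<DIM('b)} \<and> card (J j) = dim (range (L0 j)) \<and> (\<forall>y\<in>span (e ` J j). \<theta> * norm y <= norm (L j y))) \<and>
    (\<Sum>i<DIM('b). ln (s i)) <= (\<Sum>j\<in>UNIV. p j * (\<Sum>i\<in>J j. ln (s i))) + C" by (rule exE)
  note J = conjunct1[OF J'] conjunct2[OF J']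
  have "\<theta>' * norm y <= norm (L j y)" if "y \<in> span (e ` J j)" for j y
  proof -
    have "\<theta> * norm y <= norm (L j y)" using J(1) that by blast
    then show ?thesis using mult_right_mono[OF assms(2) norm_ge_zero[of y]] by linarith
  qed
  then show "\<exists>J. (\<forall>j. J j \<subseteq> {..<DIM('b)} \<and> card (J j) = dim (range (L0 j)) \<and> (\<forall>y\<in>span (e ` J j). \<theta>' * norm y <= norm (L j y)))
        \<and> (\<Sum>i<DIM('b). ln (s i)) <= (\<Sum>j\<in>UNIV. p j * (\<Sum>i\<in>J j. ln (s i))) + C'"
    using J assms(3) by (intro exI[of _ J]) auto
qed

context
  fixes e0 :: "nat => 'b"
  assumes e0: "onb e0"
begin

definition I where "I j = {i. i < DIM('b) \<and> L0 j (e0 i) \<notin> span (L0 j ` e0 ` {..<i})}"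

definition V where "V k = span (e0 ` {..<k})"

lemma dim_V: assumes "k <= DIM('b)" shows "dim (V k) = k"
proof -
  have sub: "e0 ` {..<k} \<subseteq> e0 ` {..<DIM('b)}" using assms by auto
  have "independent (e0 ` {..<k})" by (rule independent_mono[OF onb_span(2)[OF e0] sub])
  then have "dim (V k) = card (e0 ` {..<k})" unfolding V_def by (simp add: dim_span dim_eq_card_independent)
  also have "... = k" using card_image[OF inj_on_subset[OF onb_inj[OF e0], of "{..<k}"]] assms by auto
  finally show ?thesis .
qed

lemma I_props:
  assumes k: "k <= DIM('b)"
  shows "card (I j \<inter> {..<k}) = dim (L0 j ` V k)"
proof -
  have "I j \<inter> {..<k} = {i. i < k \<and> L0 j (e0 i) \<notin> span ((\<lambda>i. L0 j (e0 i)) ` {..<i})}"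
    unfolding I_def image_image using k by auto
  moreover have "L0 j ` V k = span ((\<lambda>i. L0 j (e0 i)) ` {..<k})"
    unfolding V_def linear_span_image[OF L0, symmetric] image_image ..
  ultimately show ?thesis using greedy_basis[of k "\<lambda>i. L0 j (e0 i)"] by (simp add: dim_span)
qed

lemma I_sub: "I j \<subseteq> {..<DIM('b)}" by (auto simp: I_def)

lemma card_I: "card (I j) = dim (range (L0 j))"
proof -
  have "V DIM('b) = UNIV" unfolding V_def by (rule onb_span[OF e0])
  moreover have "I j \<inter> {..<DIM('b)} = I j" using I_sub by auto
  ultimately show ?thesis using I_props[of "DIM('b)" j] by simp
qed

lemma I_inj: assumes y: "y \<in> span (e0 ` I j)" and "L0 j y = 0" shows "y = 0"
proof -
  have Ie: "I j = {i. i < DIM('b) \<and> L0 j (e0 i) \<notin> span ((\<lambda>i. L0 j (e0 i)) ` {..<i})}" by (simp add: I_def image_image)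
  have g: "independent ((\<lambda>i. L0 j (e0 i)) ` I j)" "inj_on (\<lambda>i. L0 j (e0 i)) (I j)"
    unfolding Ie using greedy_basis[of "DIM('b)" "\<lambda>i. L0 j (e0 i)"] by auto
  have "independent (L0 j ` e0 ` I j)" using g(1) by (simp add: image_image)
  moreover have "inj_on (L0 j) (e0 ` I j)" using g(2) by (auto simp: inj_on_def)
  ultimately have "inj_on (L0 j) (span (e0 ` I j))"
    by (simp add: linear_inj_on_span_iff_independent_image[OF L0])
  then show ?thesis using y \<open>L0 j y = 0\<close> span_0 linear_0[OF L0, of j] unfolding inj_on_def by metis
qed

lemma I_lower: "\<exists>\<theta>>0. \<forall>j. \<forall>y\<in>span (e0 ` I j). \<theta> * norm y <= norm (L0 j y)"
proof -
  have "\<exists>\<theta>>0. \<forall>y\<in>span (e0 ` I j). \<theta> * norm y <= norm (L0 j y)" for j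
  proof -
    have "\<exists>e>0. \<forall>x\<in>span (e0 ` I j). e * norm x <= norm (L0 j x)"
      by (rule injective_imp_isometric[OF closed_subspace[OF subspace_span] subspace_span])
         (use L0 linear_conv_bounded_linear I_inj in auto)
    then show ?thesis .
  qed
  then obtain \<theta> where \<theta>: "\<And>j. 0 < \<theta> j" "\<And>j y. y \<in> span (e0 ` I j) ==> \<theta> j * norm y <= norm (L0 j y)" by metis
  have "Min (range \<theta>) * norm y <= norm (L0 j y)" if "y \<in> span (e0 ` I j)" for j y
  proof -
    have "Min (range \<theta>) * norm y <= \<theta> j * norm y" by (intro mult_right_mono) auto
    then show ?thesis using \<theta>(2)[OF that] by linarith
  qed
  moreover have "0 < Min (range \<theta>)" using \<theta>(1) by (subst Min_gr_iff) auto
  ultimately show ?thesis by blast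
qed

definition m where "m i = (\<Sum>j\<in>UNIV. p j * (if i \<in> I j then 1 else 0)) - 1"

lemma m_sum: assumes k: "k <= DIM('b)" shows "(\<Sum>i<k. m i) = (\<Sum>j\<in>UNIV. p j * real (dim (L0 j ` V k))) - real k"
proof -
  have "(\<Sum>i<k. m i) = (\<Sum>i<k. \<Sum>j\<in>UNIV. p j * (if i \<in> I j then 1 else 0)) - real k" unfolding m_def by (simp add: sum_subtractf)
  also have "(\<Sum>i<k. \<Sum>j\<in>UNIV. p j * (if i \<in> I j then 1 else 0)) = (\<Sum>j\<in>UNIV. p j * (\<Sum>i<k. if i \<in> I j then 1 else 0))"
    by (subst sum.swap) (simp add: sum_distrib_left)
  also have "... = (\<Sum>j\<in>UNIV. p j * real (dim (L0 j ` V k)))"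
  proof (intro sum.cong refl arg_cong2[where f="(*)"])
    fix j
    have "(\<Sum>i<k. if i \<in> I j then 1 else 0::real) = real (card (I j \<inter> {..<k}))"
      by (simp add: sum.If_cases Int_commute Int_def)
    then show "(\<Sum>i<k. if i \<in> I j then 1 else 0::real) = real (dim (L0 j ` V k))" using I_props[OF k] by simp
  qed
  finally show ?thesis .
qed

lemma m_weighted: "(\<Sum>i<DIM('b). m i * t i) = (\<Sum>j\<in>UNIV. p j * (\<Sum>i\<in>I j. t i)) - (\<Sum>i<DIM('b). t i)"
proof -
  have "(\<Sum>i<DIM('b). m i * t i) = (\<Sum>i<DIM('b). \<Sum>j\<in>UNIV. p j * (if i \<in> I j then t i else 0)) - (\<Sum>i<DIM('b). t i)"
    unfolding m_def left_diff_distrib sum_subtractf sum_distrib_right by (intro arg_cong2[where f="(-)"] sum.cong refl) auto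
  also have "(\<Sum>i<DIM('b). \<Sum>j\<in>UNIV. p j * (if i \<in> I j then t i else 0)) = (\<Sum>j\<in>UNIV. p j * (\<Sum>i<DIM('b). if i \<in> I j then t i else 0))"
    by (subst sum.swap) (simp add: sum_distrib_left)
  also have "... = (\<Sum>j\<in>UNIV. p j * (\<Sum>i\<in>I j. t i))"
    by (simp add: sum.inter_restrict[symmetric] Int_absorb1[OF I_sub])
  finally show ?thesis .
qed

lemma sub_V: "subspace (V k)" unfolding V_def by (rule subspace_span)

lemma D_mono: assumes k: "k <= DIM('b)" shows "(\<Sum>i<DIM('b). m i) <= (\<Sum>i<k. m i)"
proof -
  have VN: "V DIM('b) = UNIV" unfolding V_def by (rule onb_span[OF e0])
  have "(\<Sum>j\<in>UNIV. p j * (real (dim (range (L0 j))) - real (dim (L0 j ` V k)))) <= real DIM('b) - real (dim (V k))" by (rule codim[OF sub_V])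
  then show ?thesis unfolding m_sum[OF k] m_sum[OF order_refl] VN dim_V[OF k] by (simp add: right_diff_distrib sum_subtractf)
qed

lemma D_le_0: "(\<Sum>i<DIM('b). m i) <= 0" using D_mono[of 0] by simp

lemma D_nonneg: assumes k: "k <= DIM('b)" and "\<And>i. i < k ==> G (e0 i) = 0" shows "0 <= (\<Sum>i<k. m i)"
proof -
  have "G v = 0" if "v \<in> V k" for v
    by (rule linear_eq_0_on_span[OF G(1) _ that[unfolded V_def]]) (use assms(2) in auto)
  then have "real (dim (V k)) <= (\<Sum>j\<in>UNIV. p j * real (dim (L0 j ` V k)))" by (rule ker[OF sub_V])
  then show ?thesis unfolding m_sum[OF k] dim_V[OF k] by simp
qed

lemma local_bound:
  obtains \<epsilon> C where "0 < \<epsilon>"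
    "\<And>e s. onb e ==> (\<And>i. i < DIM('b) ==> norm (e i - e0 i) <= \<epsilon>) ==> (\<And>i. i < DIM('b) ==> 0 < s i) ==> (\<And>i j. i <= j ==> j < DIM('b) ==> s j <= s i) ==>
      (\<Sum>i<DIM('b). (s i)^2 * (G (e i) \<bullet> e i)) <= 2 ==> (\<Sum>i<DIM('b). ln (s i)) <= (\<Sum>j\<in>UNIV. p j * (\<Sum>i\<in>I j. ln (s i))) + C"
proof (cases "\<exists>k<DIM('b). G (e0 k) \<noteq> 0")
  case False
  then have D0: "0 <= (\<Sum>i<k. m i)" if "k <= DIM('b)" for k using that by (intro D_nonneg) auto
  show ?thesis
  proof (rule that[of 1 0])
    fix e :: "nat => 'b" and s :: "nat => real"
    assume s: "\<And>i. i < DIM('b) ==> 0 < s i" "\<And>i j. i <= j ==> j < DIM('b) ==> s j <= s i"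
    obtain N' where N': "DIM('b) = Suc N'" using DIM_positive[where 'a='b] by (cases "DIM('b)") auto
    have "(\<Sum>i<Suc N'. m i) * ln (s N') <= (\<Sum>i<Suc N'. m i * ln (s i))"
    proof (rule abel_lower[where N="DIM('b)"])
      show "ln (s j) <= ln (s i)" if "i <= j" "j < DIM('b)" for i j using s that by (subst ln_le_cancel_iff) auto
      show "0 <= sum m {..<k}" if "k <= N'" for k using D0 that N' by simp
      show "N' < DIM('b)" using N' by simp
    qed
    moreover have "(\<Sum>i<Suc N'. m i) = 0" using D_le_0 D0[of "DIM('b)"] N' by simp
    ultimately have "0 <= (\<Sum>i<DIM('b). m i * ln (s i))" unfolding N' by simp
    then show "(\<Sum>i<DIM('b). ln (s i)) <= (\<Sum>j\<in>UNIV. p j * (\<Sum>i\<in>I j. ln (s i))) + 0" unfolding m_weighted by simp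
  qed simp
next
  case True
  define K where "K = (LEAST k. k < DIM('b) \<and> G (e0 k) \<noteq> 0)"
  have K: "K < DIM('b)" "G (e0 K) \<noteq> 0" using LeastI_ex[OF True] unfolding K_def by auto
  have K': "G (e0 i) = 0" if "i < K" for i using not_less_Least[of i "\<lambda>k. k < DIM('b) \<and> G (e0 k) \<noteq> 0"] that K unfolding K_def by auto
  have D0: "0 <= (\<Sum>i<k. m i)" if "k <= K" for k using that K K' by (intro D_nonneg) auto
  define g where "g = G (e0 K) \<bullet> e0 K"
  have g: "0 < g" unfolding g_def using psd_null[OF G, of "e0 K"] K(2) G(3)[of "e0 K"] by (auto simp: order_le_less)
  obtain b where b: "0 < b" "\<And>v. norm (G v) <= b * norm v" by (rule linear_bounded_pos[OF G(1)], rule that)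
  define \<epsilon> where "\<epsilon> = g / (4 * b)"
  define \<sigma> where "\<sigma> = 2 / sqrt g"
  have \<sigma>: "0 < \<sigma>" unfolding \<sigma>_def using g by simp
  let ?D = "\<Sum>i<DIM('b). m i"
  show ?thesis
  proof (rule that[of \<epsilon> "- ?D * ln \<sigma>"])
    show "0 < \<epsilon>" unfolding \<epsilon>_def using g b(1) by simp
    fix e :: "nat => 'b" and s :: "nat => real"
    assume e: "onb e" "\<And>i. i < DIM('b) ==> norm (e i - e0 i) <= \<epsilon>"
      and s: "\<And>i. i < DIM('b) ==> 0 < s i" "\<And>i j. i <= j ==> j < DIM('b) ==> s j <= s i"
      and sG: "(\<Sum>i<DIM('b). (s i)^2 * (G (e i) \<bullet> e i)) <= 2"
    have "g - G (e K) \<bullet> e K = G (e0 K - e K) \<bullet> e0 K + G (e K) \<bullet> (e0 K - e K)"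
      unfolding g_def by (simp add: linear_diff[OF G(1)] inner_diff_left inner_diff_right)
    also have "... <= norm (G (e0 K - e K)) * norm (e0 K) + norm (G (e K)) * norm (e0 K - e K)" by (intro add_mono norm_cauchy_schwarz)
    also have "... <= (b * \<epsilon>) * 1 + (b * 1) * \<epsilon>"
    proof (intro add_mono mult_mono)
      have d: "norm (e0 K - e K) <= \<epsilon>" using e(2)[OF K(1)] by (simp add: norm_minus_commute)
      then show "norm (e0 K - e K) <= \<epsilon>" .
      have "b * norm (e0 K - e K) <= b * \<epsilon>" using d b(1) by simp
      then show "norm (G (e0 K - e K)) <= b * \<epsilon>" using b(2)[of "e0 K - e K"] by linarith
      show "norm (e0 K) <= 1" using onb_norm[OF e0 K(1)] by simp
      show "norm (G (e K)) <= b * 1" using b(2)[of "e K"] onb_norm[OF e(1) K(1)] by simp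
    qed (use b g \<epsilon>_def in auto)
    also have "... = g / 2" unfolding \<epsilon>_def using b by simp
    finally have gK: "g / 2 <= G (e K) \<bullet> e K" by simp
    have "(s K)^2 * (g / 2) <= (s K)^2 * (G (e K) \<bullet> e K)" using gK by (intro mult_left_mono) auto
    also have "... <= (\<Sum>i<DIM('b). (s i)^2 * (G (e i) \<bullet> e i))" using K(1) G(3) by (intro member_le_sum) auto
    finally have "(s K)^2 * (g / 2) <= 2" using sG by linarith
    then have "(s K)^2 <= \<sigma>\<^sup>2" unfolding \<sigma>_def using g by (simp add: power_divide field_simps)
    then have sK: "s K <= \<sigma>" using \<sigma> by (intro power2_le_imp_le[of "s K"]) auto
    have "?D * ln (s K) <= (\<Sum>i<DIM('b). m i * ln (s i))"
    proof (rule abel_split[where N="DIM('b)"])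
      show "ln (s j) <= ln (s i)" if "i <= j" "j < DIM('b)" for i j using s that by (subst ln_le_cancel_iff) auto
    qed (use D0 D_mono K(1) in auto)
    moreover have "?D * ln \<sigma> <= ?D * ln (s K)" using D_le_0 sK s(1)[OF K(1)] by (intro mult_left_mono_neg) auto
    ultimately show "(\<Sum>i<DIM('b). ln (s i)) <= (\<Sum>j\<in>UNIV. p j * (\<Sum>i\<in>I j. ln (s i))) + - ?D * ln \<sigma>" unfolding m_weighted by simp
  qed
qed

lemma local_good:
  obtains \<epsilon> \<theta> C where "0 < \<epsilon>" "0 < \<theta>"
    "\<And>e L. onb e ==> (\<And>x. norm (rot e x - rot e0 x) <= \<epsilon> * norm x) ==> (\<And>j v. norm (L j v - L0 j v) <= \<epsilon> * norm v) ==> good e \<theta> C L"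
proof (rule local_bound)
  fix \<epsilon>1 C assume \<epsilon>1: "0 < \<epsilon>1" and lb: "\<And>e s. onb e ==> (\<And>i. i < DIM('b) ==> norm (e i - e0 i) <= \<epsilon>1) ==> (\<And>i. i < DIM('b) ==> 0 < s i) ==> (\<And>i j. i <= j ==> j < DIM('b) ==> s j <= s i) ==>
      (\<Sum>i<DIM('b). (s i)^2 * (G (e i) \<bullet> e i)) <= 2 ==> (\<Sum>i<DIM('b). ln (s i)) <= (\<Sum>j\<in>UNIV. p j * (\<Sum>i\<in>I j. ln (s i))) + C"
  obtain \<theta> where \<theta>: "0 < \<theta>" "\<And>j y. y \<in> span (e0 ` I j) ==> \<theta> * norm y <= norm (L0 j y)" using I_lower by blast
  have "\<exists>c>0. \<forall>v. norm (L0 j v) <= c * norm v" for j using linear_bounded_pos[OF L0] by metis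
  then obtain c where c: "\<And>j. 0 < c j" "\<And>j v. norm (L0 j v) <= c j * norm v" by metis
  define c0 where "c0 = (\<Sum>j\<in>UNIV. c j)"
  have cj: "c j <= c0" for j unfolding c0_def using c(1) by (intro member_le_sum) (auto simp: less_imp_le)
  have c0: "0 < c0" unfolding c0_def using c(1) by (intro sum_pos) auto
  define \<epsilon> where "\<epsilon> = min \<epsilon>1 (\<theta> / (2 * (c0 + 1)))"
  have \<epsilon>: "0 < \<epsilon>" "\<epsilon> <= \<epsilon>1" unfolding \<epsilon>_def using \<epsilon>1 \<theta>(1) c0 by auto
  have "\<epsilon> <= \<theta> / (2 * (c0 + 1))" unfolding \<epsilon>_def by simp
  then have \<epsilon>c: "c0 * \<epsilon> + \<epsilon> <= \<theta> / 2" using c0 by (simp add: field_simps)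
  show ?thesis
  proof (rule that[of \<epsilon> "\<theta> / 2" C])
    show "0 < \<epsilon>" "0 < \<theta> / 2" using \<epsilon> \<theta> by auto
    fix e L
    assume e: "onb e" and er: "\<And>x. norm (rot e x - rot e0 x) <= \<epsilon> * norm x" and L: "\<And>j v. norm (L j v - L0 j v) <= \<epsilon> * norm v"
    have ei: "norm (e i - e0 i) <= \<epsilon>1" if "i < DIM('b)" for i
      using er[of "bas i"] \<epsilon>(2) onb_norm[OF onb_bas that] by (simp add: rot_bas[OF that] e e0)
    have low: "\<theta> / 2 * norm y <= norm (L j y)" if y: "y \<in> span (e ` I j)" for j y
    proof -
      obtain x where x: "x \<in> span (bas ` I j)" "y = rot e x" by (rule span_rot[OF e I_sub y], rule that)
      let ?y0 = "rot e0 x"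
      have "e0 ` I j = rot e0 ` bas ` I j" by (rule rot_bas_image[OF e0 I_sub, symmetric])
      then have "?y0 \<in> span (e0 ` I j)" using x(1) by (simp add: linear_span_image[OF linear_rot])
      then have 1: "\<theta> * norm x <= norm (L0 j ?y0)" using \<theta>(2)[of ?y0 j] rot_norm[OF e0, of x] by simp
      have "norm (L0 j (y - ?y0)) <= c0 * (\<epsilon> * norm x)"
        using c(2)[of j "y - ?y0"] er[of x] cj[of j] c(1)[of j] c0 unfolding x(2)
        by (intro order_trans[OF c(2)[of j]] mult_mono) auto
      moreover have "norm (L j y - L0 j y) <= \<epsilon> * norm x" using L[of j y] rot_norm[OF e, of x] x(2) by simp
      moreover have "L0 j ?y0 = L j y - (L j y - L0 j y) - L0 j (y - ?y0)" by (simp add: linear_diff[OF L0])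
      then have "norm (L0 j ?y0) <= norm (L j y) + norm (L j y - L0 j y) + norm (L0 j (y - ?y0))"
        by (smt (verit) norm_triangle_ineq4)
      ultimately have "\<theta> * norm x <= norm (L j y) + (c0 * \<epsilon> + \<epsilon>) * norm x" using 1 by (simp add: algebra_simps)
      moreover have "(c0 * \<epsilon> + \<epsilon>) * norm x <= \<theta> / 2 * norm x" by (rule mult_right_mono[OF \<epsilon>c]) simp
      moreover have "norm y = norm x" using x(2) rot_norm[OF e] by simp
      ultimately show ?thesis by simp
    qed
    show "good e (\<theta> / 2) C L"
      unfolding good_def
    proof (intro allI impI exI[of _ I] conjI)
      fix s :: "nat => real"
      assume s: "(\<forall>i<DIM('b). 0 < s i) \<and> (\<forall>i j. i <= j \<longrightarrow> j < DIM('b) \<longrightarrow> s j <= s i) \<and> (\<Sum>i<DIM('b). (s i)^2 * (G (e i) \<bullet> e i)) <= 2"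
      show "(\<Sum>i<DIM('b). ln (s i)) <= (\<Sum>j\<in>UNIV. p j * (\<Sum>i\<in>I j. ln (s i))) + C" by (rule lb[OF e ei]) (use s in auto)
      show "\<forall>y\<in>span (e ` I j). \<theta> / 2 * norm y <= norm (L j y)" for j using low by blast
    qed (rule I_sub, rule card_I)
  qed
qed

end

lemma compact_isometries: "compact {U :: 'b \<Rightarrow>\<^sub>L 'b. \<forall>x. norm (blinfun_apply U x) = norm x}"
proof -
  have "{U :: 'b \<Rightarrow>\<^sub>L 'b. \<forall>x. norm (blinfun_apply U x) = norm x} = (\<Inter>x. {U. norm (blinfun_apply U x) = norm x})" by auto
  moreover have "closed (\<Inter>x. {U :: 'b \<Rightarrow>\<^sub>L 'b. norm (blinfun_apply U x) = norm x})"
    by (intro closed_INT ballI closed_Collect_eq continuous_intros)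
  moreover have "bounded {U :: 'b \<Rightarrow>\<^sub>L 'b. \<forall>x. norm (blinfun_apply U x) = norm x}"
    unfolding bounded_iff
  proof (intro exI[of _ 1] ballI)
    fix U :: "'b \<Rightarrow>\<^sub>L 'b" assume "U \<in> {U. \<forall>x. norm (blinfun_apply U x) = norm x}"
    then show "norm U <= 1" by (intro norm_blinfun_bound) auto
  qed
  ultimately show ?thesis by (simp add: compact_eq_bounded_closed)
qed

theorem uniform_gauss_cond:
  obtains \<delta> \<theta> C where "0 < \<delta>" "0 < \<theta>"
    "\<And>L. (\<And>j v. norm (L j v - L0 j v) <= \<delta> * norm v) ==> gauss_cond L p G (\<lambda>j. dim (range (L0 j))) \<theta> C"
proof -
  let ?K = "{U :: 'b \<Rightarrow>\<^sub>L 'b. \<forall>x. norm (blinfun_apply U x) = norm x}"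
  define Q where "Q U \<epsilon> \<theta> C \<longleftrightarrow> 0 < \<epsilon> \<and> 0 < \<theta> \<and> (\<forall>e L. onb e \<longrightarrow> (\<forall>x. norm (rot e x - blinfun_apply U x) <= \<epsilon> * norm x) \<longrightarrow> (\<forall>j v. norm (L j v - L0 j v) <= \<epsilon> * norm v) \<longrightarrow> good e \<theta> C L)" for U \<epsilon> \<theta> C
  have "\<exists>\<epsilon> \<theta> C. 0 < \<epsilon> \<and> 0 < \<theta> \<and> (\<forall>e L. onb e \<longrightarrow> (\<forall>x. norm (rot e x - blinfun_apply U x) <= \<epsilon> * norm x) \<longrightarrow> (\<forall>j v. norm (L j v - L0 j v) <= \<epsilon> * norm v) \<longrightarrow> good e \<theta> C L)"
    if U: "U \<in> ?K" for U
  proof -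
    define e0 where "e0 i = blinfun_apply U (bas i)" for i
    have lU: "linear (blinfun_apply U)" by (simp add: bounded_linear.linear blinfun.bounded_linear_right)
    have nU: "norm (blinfun_apply U x) = norm x" for x using U by simp
    have "blinfun_apply U x \<bullet> blinfun_apply U y = x \<bullet> y" for x y by (rule isometry_props(5)[OF lU nU])
    then have e0: "onb e0" unfolding onb_def e0_def by (simp add: onb_inner[OF onb_bas])
    have r: "rot e0 x = blinfun_apply U x" for x
    proof -
      have "rot e0 x = blinfun_apply U (\<Sum>i<DIM('b). (x \<bullet> bas i) *\<^sub>R bas i)"
        unfolding rot_def e0_def by (simp add: linear_sum[OF lU] linear_scale[OF lU])
      then show ?thesis by (simp add: onb_expand[OF onb_bas])
    qed
    show ?thesis
    proof (rule local_good[OF e0])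
      fix \<epsilon> \<theta> C
      assume pos: "0 < \<epsilon>" "0 < \<theta>" and g: "\<And>e L. onb e ==> (\<And>x. norm (rot e x - rot e0 x) <= \<epsilon> * norm x) ==> (\<And>j v. norm (L j v - L0 j v) <= \<epsilon> * norm v) ==> good e \<theta> C L"
      show ?thesis
      proof (rule exI[of _ \<epsilon>], rule exI[of _ \<theta>], rule exI[of _ C], intro conjI allI impI pos)
        fix e L
        assume a: "onb e" "\<forall>x. norm (rot e x - blinfun_apply U x) <= \<epsilon> * norm x" "\<forall>j v. norm (L j v - L0 j v) <= \<epsilon> * norm v"
        show "good e \<theta> C L" by (rule g[OF a(1)]) (simp_all only: r a(2)[rule_format] a(3)[rule_format])
      qed
    qed
  qed
  then have "\<And>U. U \<in> ?K ==> \<exists>\<epsilon> \<theta> C. Q U \<epsilon> \<theta> C" unfolding Q_def by blast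
  then obtain \<epsilon> \<theta> C where Q: "\<And>U. U \<in> ?K ==> Q U (\<epsilon> U) (\<theta> U) (C U)" by metis
  have ex: "\<And>U. U \<in> ?K ==> 0 < \<epsilon> U" "\<And>U. U \<in> ?K ==> 0 < \<theta> U"
    "\<And>U e L. U \<in> ?K ==> onb e ==> (\<And>x. norm (rot e x - blinfun_apply U x) <= \<epsilon> U * norm x) ==> (\<And>j v. norm (L j v - L0 j v) <= \<epsilon> U * norm v) ==> good e (\<theta> U) (C U) L"
    using Q unfolding Q_def by blast+
  obtain T where T: "T \<subseteq> ?K" "finite T" "?K \<subseteq> (\<Union>U\<in>T. ball U (\<epsilon> U))"
  proof (rule compactE_image[OF compact_isometries, where C="?K" and f="\<lambda>U. ball U (\<epsilon> U)"])
    show "?K \<subseteq> (\<Union>U\<in>?K. ball U (\<epsilon> U))" using ex(1) by force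
  qed (auto intro: that)
  define \<delta> where "\<delta> = Min (insert 1 (\<epsilon> ` T))"
  define \<theta>' where "\<theta>' = Min (insert 1 (\<theta> ` T))"
  define C' where "C' = Max (insert 0 (C ` T))"
  have "0 < \<epsilon> U" "0 < \<theta> U" if "U \<in> T" for U using ex(1,2) that T(1) by auto
  then have pos: "0 < \<delta>" "0 < \<theta>'" unfolding \<delta>_def \<theta>'_def using T(2) by auto
  have bd: "\<delta> <= \<epsilon> U" "\<theta>' <= \<theta> U" "C U <= C'" if "U \<in> T" for U unfolding \<delta>_def \<theta>'_def C'_def using that T(2) by auto
  show ?thesis
  proof (rule that[OF pos])
    fix L assume L: "\<And>j v. norm (L j v - L0 j v) <= \<delta> * norm v"
    have "good e \<theta>' C' L" if e: "onb e" for e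
    proof -
      have blr: "bounded_linear (rot e)" using linear_rot linear_conv_bounded_linear by blast
      define U where "U = Blinfun (rot e)"
      have Ur: "blinfun_apply U = rot e" unfolding U_def by (rule bounded_linear_Blinfun_apply[OF blr])
      have "U \<in> ?K" by (simp add: Ur rot_norm[OF e])
      then obtain U0 where U0: "U0 \<in> T" "dist U0 U < \<epsilon> U0" using T(3) by auto
      have "norm (rot e x - blinfun_apply U0 x) <= \<epsilon> U0 * norm x" for x
      proof -
        have "norm (blinfun_apply (U - U0) x) <= norm (U - U0) * norm x" by (rule norm_blinfun)
        also have "... <= \<epsilon> U0 * norm x" using U0(2) by (intro mult_right_mono) (auto simp: dist_norm norm_minus_commute)
        finally show ?thesis by (simp add: blinfun.diff_left Ur)
      qed
      moreover have "norm (L j v - L0 j v) <= \<epsilon> U0 * norm v" for j v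
        using L[of j v] mult_right_mono[OF bd(1)[OF U0(1)] norm_ge_zero[of v]] by linarith
      ultimately have "good e (\<theta> U0) (C U0) L" using U0(1) T(1) e by (intro ex(3)) auto
      then show ?thesis by (rule good_mono) (use bd U0 in auto)
    qed
    then show "gauss_cond L p G (\<lambda>j. dim (range (L0 j))) \<theta>' C'" unfolding gauss_cond_def good_def by blast
  qed
qed

end

locale tuple_norm_space =
  fixes H :: "'a::euclidean_space set" and Hs :: "'b::finite => 'c::euclidean_space set" and N :: "('b => 'a => 'c) => real"
  assumes H: "subspace H" and Hs: "\<And>j. subspace (Hs j)" and N: "tuple_norm H Hs N"
begin

definition X where "X = {L. \<forall>j. linear_map_on H (Hs j) (L j)}"

lemma N_props:
  shows N_nonneg: "\<And>L. L \<in> X ==> 0 <= N L" and N_zero_iff: "\<And>L. L \<in> X ==> N L = 0 \<longleftrightarrow> (\<forall>j. \<forall>x\<in>H. L j x = 0)"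
    and N_scale: "\<And>c L. L \<in> X ==> N (\<lambda>j x. c *\<^sub>R L j x) = \<bar>c\<bar> * N L"
    and N_add: "\<And>L M. L \<in> X ==> M \<in> X ==> N (\<lambda>j x. L j x + M j x) <= N L + N M"
  using N unfolding tuple_norm_def Let_def X_def[symmetric] by blast+

lemma X_add: "L \<in> X ==> M \<in> X ==> (\<lambda>j x. L j x + M j x) \<in> X"
  unfolding X_def linear_map_on_def using Hs
  by (auto simp: subspace_add image_subset_iff scaleR_add_right algebra_simps)

lemma X_scale: "L \<in> X ==> (\<lambda>j x. c *\<^sub>R L j x) \<in> X"
  unfolding X_def linear_map_on_def using Hs
  by (auto simp: subspace_scale image_subset_iff scaleR_add_right algebra_simps)

lemma X_diff: assumes "L \<in> X" "M \<in> X" shows "(\<lambda>j x. L j x - M j x) \<in> X"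
  using X_add[OF assms(1) X_scale[OF assms(2), of "-1"]] by simp

lemma N_cong: assumes L: "L \<in> X" and M: "M \<in> X" and eq: "\<And>j x. x \<in> H ==> L j x = M j x" shows "N L = N M"
proof -
  have "N L <= N M" if L: "L \<in> X" and M: "M \<in> X" and eq: "\<And>j x. x \<in> H ==> L j x = M j x" for L M
  proof -
    have "N (\<lambda>j x. L j x - M j x) = 0" using N_zero_iff[OF X_diff[OF L M]] eq by simp
    then show ?thesis using N_add[OF M X_diff[OF L M]] by simp
  qed
  from this[OF L M eq] this[OF M L eq[symmetric]] show ?thesis by simp
qed

lemma N_sum:
  assumes "finite S" "\<And>k. k \<in> S ==> T k \<in> X"
  shows "(\<lambda>j x. \<Sum>k\<in>S. T k j x) \<in> X \<and> N (\<lambda>j x. \<Sum>k\<in>S. T k j x) <= (\<Sum>k\<in>S. N (T k))"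
  using assms
proof (induction S)
  case empty
  have 0: "(\<lambda>j x. 0) \<in> X" unfolding X_def linear_map_on_def using Hs by (auto simp: subspace_0)
  then show ?case using N_zero_iff[OF 0] by simp
next
  case (insert k S)
  then have IH: "(\<lambda>j x. \<Sum>k\<in>S. T k j x) \<in> X" "N (\<lambda>j x. \<Sum>k\<in>S. T k j x) <= (\<Sum>k\<in>S. N (T k))" and k: "T k \<in> X" by auto
  show ?case using X_add[OF k IH(1)] N_add[OF k IH(1)] IH(2) insert.hyps by simp
qed

definition tup :: "('a \<Rightarrow>\<^sub>L 'c) ^ 'b => 'b => 'a => 'c" where "tup \<Lambda> j x = blinfun_apply (\<Lambda> $ j) x"

definition Z :: "(('a \<Rightarrow>\<^sub>L 'c) ^ 'b) set" where
  "Z = {\<Lambda>. \<forall>j x. blinfun_apply (\<Lambda> $ j) (prj H x) = blinfun_apply (\<Lambda> $ j) x \<and> prj (Hs j) (blinfun_apply (\<Lambda> $ j) x) = blinfun_apply (\<Lambda> $ j) x}"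

lemma closed_Z: "closed Z"
proof -
  have "continuous_on UNIV (\<lambda>\<Lambda>::('a \<Rightarrow>\<^sub>L 'c) ^ 'b. prj (Hs j) (blinfun_apply (\<Lambda> $ j) x))" for j x
    by (rule continuous_on_compose2[OF linear_continuous_on[OF linear_prj[OF Hs, THEN linear_conv_bounded_linear[THEN iffD1]], of UNIV]])
       (auto intro!: continuous_intros)
  then show ?thesis unfolding Z_def by (intro closed_Collect_all closed_Collect_conj closed_Collect_eq continuous_intros)
qed

lemma tup_X: assumes "\<Lambda> \<in> Z" shows "tup \<Lambda> \<in> X"
proof -
  have "tup \<Lambda> j x \<in> Hs j" for j x
  proof -
    have "prj (Hs j) (tup \<Lambda> j x) = tup \<Lambda> j x" using assms by (simp add: Z_def tup_def)
    then show ?thesis using prj(1)[OF Hs, of j "tup \<Lambda> j x"] by simp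
  qed
  then show ?thesis unfolding X_def linear_map_on_def by (auto simp: tup_def blinfun.add_right blinfun.scaleR_right)
qed

lemma Z_scale: "\<Lambda> \<in> Z ==> c *\<^sub>R \<Lambda> \<in> Z"
  by (simp add: Z_def blinfun.scaleR_left linear_scale[OF linear_prj[OF Hs]])

lemma Z_diff: "\<Lambda> \<in> Z ==> \<Lambda>' \<in> Z ==> \<Lambda> - \<Lambda>' \<in> Z"
  by (simp add: Z_def blinfun.diff_left linear_diff[OF linear_prj[OF Hs]])

lemma N_tup_le: "\<exists>K\<ge>0. \<forall>\<Lambda>\<in>Z. N (tup \<Lambda>) <= K * norm \<Lambda>"
proof -
  define S where "S = (UNIV :: 'b set) \<times> (Basis :: 'a set) \<times> (Basis :: 'c set)"
  define E where "E k = (case k of (i, b, c) => \<lambda>j x. if j = i then (prj H x \<bullet> b) *\<^sub>R prj (Hs j) c else 0)" for k :: "'b \<times> 'a \<times> 'c"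
  have finS: "finite S" unfolding S_def by simp
  have EX: "E k \<in> X" for k
    unfolding X_def linear_map_on_def E_def using Hs
    by (auto simp: split_beta subspace_0 subspace_scale prj(1) linear_add[OF linear_prj[OF H]] linear_scale[OF linear_prj[OF H]] inner_add_left scaleR_add_left)
  define K where "K = (\<Sum>k\<in>S. N (E k))"
  have "N (tup \<Lambda>) <= K * norm \<Lambda>" if \<Lambda>: "\<Lambda> \<in> Z" for \<Lambda>
  proof -
    define a where "a k = (case k of (i, b, c) => tup \<Lambda> i b \<bullet> c)" for k :: "'b \<times> 'a \<times> 'c"
    have ak: "\<bar>a k\<bar> <= norm \<Lambda>" if "k \<in> S" for k
    proof -
      obtain i b c where k: "k = (i, b, c)" "b \<in> Basis" "c \<in> Basis" using \<open>k \<in> S\<close> by (auto simp: S_def)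
      have "\<bar>a k\<bar> <= norm (tup \<Lambda> i b)" unfolding a_def k using Basis_le_norm[OF k(3)] by simp
      also have "... <= norm (\<Lambda> $ i) * norm b" unfolding tup_def by (rule norm_blinfun)
      also have "... <= norm \<Lambda>" using k(2) Finite_Cartesian_Product.norm_nth_le[of \<Lambda> i] by simp
      finally show ?thesis .
    qed
    have rep: "tup \<Lambda> j x = (\<Sum>k\<in>S. a k *\<^sub>R E k j x)" if x: "x \<in> H" for j x
    proof -
      have px: "prj H x = x" by (rule prj_id[OF H x])
      have "(\<Sum>k\<in>S. a k *\<^sub>R E k j x) = (\<Sum>i\<in>UNIV. if j = i then (\<Sum>b\<in>Basis. \<Sum>c\<in>Basis. (tup \<Lambda> i b \<bullet> c) *\<^sub>R ((x \<bullet> b) *\<^sub>R prj (Hs j) c)) else 0)"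
        unfolding S_def sum.cartesian_product' by (intro sum.cong refl) (simp add: a_def E_def px)
      also have "... = (\<Sum>b\<in>Basis. \<Sum>c\<in>Basis. (tup \<Lambda> j b \<bullet> c) *\<^sub>R ((x \<bullet> b) *\<^sub>R prj (Hs j) c))" by simp
      also have "... = (\<Sum>b\<in>Basis. (x \<bullet> b) *\<^sub>R prj (Hs j) (\<Sum>c\<in>Basis. (tup \<Lambda> j b \<bullet> c) *\<^sub>R c))"
        by (simp add: linear_sum[OF linear_prj[OF Hs]] linear_scale[OF linear_prj[OF Hs]] scaleR_sum_right mult.commute)
      also have "... = (\<Sum>b\<in>Basis. (x \<bullet> b) *\<^sub>R tup \<Lambda> j b)" using \<Lambda> by (simp add: euclidean_representation Z_def tup_def)
      also have "... = tup \<Lambda> j (\<Sum>b\<in>Basis. (x \<bullet> b) *\<^sub>R b)" by (simp add: tup_def blinfun.sum_right blinfun.scaleR_right)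
      also have "... = tup \<Lambda> j x" by (simp add: euclidean_representation)
      finally show ?thesis ..
    qed
    have s: "(\<lambda>j x. \<Sum>k\<in>S. a k *\<^sub>R E k j x) \<in> X \<and> N (\<lambda>j x. \<Sum>k\<in>S. a k *\<^sub>R E k j x) <= (\<Sum>k\<in>S. N (\<lambda>j x. a k *\<^sub>R E k j x))"
      by (rule N_sum[OF finS]) (rule X_scale[OF EX])
    have "N (tup \<Lambda>) = N (\<lambda>j x. \<Sum>k\<in>S. a k *\<^sub>R E k j x)" by (rule N_cong[OF tup_X[OF \<Lambda>] conjunct1[OF s] rep])
    also have "... <= (\<Sum>k\<in>S. \<bar>a k\<bar> * N (E k))" using s by (simp add: N_scale[OF EX])
    also have "... <= (\<Sum>k\<in>S. norm \<Lambda> * N (E k))" by (intro sum_mono mult_right_mono ak N_nonneg EX)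
    also have "... = K * norm \<Lambda>" unfolding K_def by (simp add: sum_distrib_left mult.commute)
    finally show ?thesis .
  qed
  moreover have "0 <= K" unfolding K_def by (intro sum_nonneg N_nonneg EX)
  ultimately show ?thesis by blast
qed

lemma N_tup_lower: "\<exists>\<mu>>0. \<forall>\<Lambda>\<in>Z. \<mu> * norm \<Lambda> <= N (tup \<Lambda>)"
proof -
  obtain K where K: "0 <= K" "\<And>\<Lambda>. \<Lambda> \<in> Z ==> N (tup \<Lambda>) <= K * norm \<Lambda>" using N_tup_le by blast
  have dif: "N (tup \<Lambda>) <= N (tup \<Lambda>') + K * norm (\<Lambda> - \<Lambda>')" if "\<Lambda> \<in> Z" "\<Lambda>' \<in> Z" for \<Lambda> \<Lambda>'
  proof -
    have Zd: "\<Lambda> - \<Lambda>' \<in> Z" using that by (rule Z_diff)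
    have "tup \<Lambda> = (\<lambda>j x. tup \<Lambda>' j x + tup (\<Lambda> - \<Lambda>') j x)" by (intro ext) (simp add: tup_def blinfun.diff_left)
    then show ?thesis using N_add[OF tup_X[OF that(2)] tup_X[OF Zd]] K(2)[OF Zd] by simp
  qed
  define S where "S = Z \<inter> {\<Lambda>. norm \<Lambda> = 1}"
  have "bounded S" unfolding bounded_iff S_def by (intro exI[of _ 1]) auto
  then have cS: "compact S" unfolding compact_eq_bounded_closed S_def
    by (intro conjI closed_Int closed_Z closed_Collect_eq continuous_intros) simp_all
  have "K-lipschitz_on S (\<lambda>\<Lambda>. N (tup \<Lambda>))"
  proof (rule lipschitz_onI[OF _ K(1)])
    fix \<Lambda> \<Lambda>' assume "\<Lambda> \<in> S" "\<Lambda>' \<in> S"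
    then have "\<Lambda> \<in> Z" "\<Lambda>' \<in> Z" by (auto simp: S_def)
    then show "dist (N (tup \<Lambda>)) (N (tup \<Lambda>')) <= K * dist \<Lambda> \<Lambda>'"
      using dif[of \<Lambda> \<Lambda>'] dif[of \<Lambda>' \<Lambda>] by (simp add: dist_norm norm_minus_commute abs_le_iff)
  qed
  then have cont: "continuous_on S (\<lambda>\<Lambda>. N (tup \<Lambda>))" by (rule lipschitz_on_continuous_on)
  have "\<exists>\<mu>>0. \<forall>\<Lambda>\<in>S. \<mu> <= N (tup \<Lambda>)"
  proof (cases "S = {}")
    case True then show ?thesis by (intro exI[of _ 1]) auto
  next
    case False
    obtain \<Lambda>0 where \<Lambda>0: "\<Lambda>0 \<in> S" "\<And>\<Lambda>. \<Lambda> \<in> S ==> N (tup \<Lambda>0) <= N (tup \<Lambda>)"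
      using continuous_attains_inf[OF cS False cont] by blast
    have Z0: "\<Lambda>0 \<in> Z" and n0: "norm \<Lambda>0 = 1" using \<Lambda>0(1) by (auto simp: S_def)
    have "N (tup \<Lambda>0) \<noteq> 0"
    proof
      assume "N (tup \<Lambda>0) = 0"
      then have z: "tup \<Lambda>0 j x = 0" if "x \<in> H" for j x using N_zero_iff[OF tup_X[OF Z0]] that by blast
      have "blinfun_apply (\<Lambda>0 $ j) x = 0" for j x using z[OF prj(1)[OF H], of j x] Z0 by (simp add: tup_def Z_def)
      then have "\<Lambda>0 = 0" by (intro vec_eq_iff[THEN iffD2] allI blinfun_eqI) simp
      then show False using n0 by simp
    qed
    then have "0 < N (tup \<Lambda>0)" using N_nonneg[OF tup_X[OF Z0]] by simp
    then show ?thesis using \<Lambda>0(2) by blast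
  qed
  then obtain \<mu> where \<mu>: "0 < \<mu>" "\<And>\<Lambda>. \<Lambda> \<in> S ==> \<mu> <= N (tup \<Lambda>)" by blast
  have "\<mu> * norm \<Lambda> <= N (tup \<Lambda>)" if \<Lambda>: "\<Lambda> \<in> Z" for \<Lambda>
  proof (cases "\<Lambda> = 0")
    case True then show ?thesis using N_nonneg[OF tup_X[OF \<Lambda>]] by simp
  next
    case False
    let ?c = "1 / norm \<Lambda>"
    have "?c *\<^sub>R \<Lambda> \<in> S" unfolding S_def using Z_scale[OF \<Lambda>] False by simp
    then have "\<mu> <= N (tup (?c *\<^sub>R \<Lambda>))" by (rule \<mu>(2))
    also have "tup (?c *\<^sub>R \<Lambda>) = (\<lambda>j x. ?c *\<^sub>R tup \<Lambda> j x)" by (intro ext) (simp add: tup_def blinfun.scaleR_left)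
    also have "N ... = \<bar>?c\<bar> * N (tup \<Lambda>)" by (rule N_scale[OF tup_X[OF \<Lambda>]])
    finally show ?thesis using False by (simp add: field_simps)
  qed
  then show ?thesis using \<mu>(1) by blast
qed

theorem tuple_norm_controls_operator_norm:
  assumes e: "0 < \<epsilon>"
  obtains \<delta> where "0 < \<delta>" "\<And>M j v. M \<in> X ==> N M < \<delta> ==> norm (pad H (M j) v) <= \<epsilon> * norm v"
proof -
  obtain \<mu> where \<mu>: "0 < \<mu>" "\<And>\<Lambda>. \<Lambda> \<in> Z ==> \<mu> * norm \<Lambda> <= N (tup \<Lambda>)" using N_tup_lower by blast
  show ?thesis
  proof (rule that[of "\<epsilon> * \<mu>"])
    show "0 < \<epsilon> * \<mu>" using e \<mu>(1) by simp
    fix M j v assume M: "M \<in> X" and NM: "N M < \<epsilon> * \<mu>"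
    have lm: "linear_map_on H (Hs i) (M i)" for i using M by (simp add: X_def)
    define \<Lambda> :: "('a \<Rightarrow>\<^sub>L 'c) ^ 'b" where "\<Lambda> = vec_lambda (\<lambda>i. Blinfun (pad H (M i)))"
    have "bounded_linear (pad H (M i))" for i using linear_pad[OF H lm] linear_conv_bounded_linear by blast
    then have \<Lambda>i: "blinfun_apply (\<Lambda> $ i) = pad H (M i)" for i unfolding \<Lambda>_def by (simp add: bounded_linear_Blinfun_apply)
    have "pad H (M i) x \<in> Hs i" for i x using lm prj(1)[OF H] unfolding pad_def linear_map_on_def by blast
    then have \<Lambda>: "\<Lambda> \<in> Z" unfolding Z_def mem_Collect_eq \<Lambda>i by (auto simp: prj_id[OF Hs] pad_def prj_id[OF H prj(1)[OF H]])
    have "N (tup \<Lambda>) = N M" by (rule N_cong[OF tup_X[OF \<Lambda>] M]) (simp add: tup_def \<Lambda>i pad_def prj_id[OF H])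
    then have "\<mu> * norm \<Lambda> <= \<mu> * \<epsilon>" using \<mu>(2)[OF \<Lambda>] NM by (simp add: mult.commute)
    then have n: "norm \<Lambda> <= \<epsilon>" using \<mu>(1) by simp
    have "norm (pad H (M j) v) <= norm (\<Lambda> $ j) * norm v" using norm_blinfun[of "\<Lambda> $ j" v] by (simp only: \<Lambda>i)
    also have "... <= \<epsilon> * norm v" using n Finite_Cartesian_Product.norm_nth_le[of \<Lambda> j] by (intro mult_right_mono) auto
    finally show "norm (pad H (M j) v) <= \<epsilon> * norm v" .
  qed
qed

end

theorem theorem2p3:
  fixes H :: "'a::euclidean_space set"
    and Hs :: "'j::finite \<Rightarrow> 'b::euclidean_space set"
    and G :: "'a \<Rightarrow> 'a"
    and L0 :: "'j \<Rightarrow> 'a \<Rightarrow> 'b"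
    and p :: "'j \<Rightarrow> real"
    and N :: "('j \<Rightarrow> 'a \<Rightarrow> 'b) \<Rightarrow> real"
  assumes "subspace H"
    and "\<And>j. subspace (Hs j)"
    and "tuple_norm H Hs N"
    and "BL_datum H Hs L0 p"
    and "psd_on H G"
    and "BL_const H Hs G L0 p < \<infinity>"
  shows "\<exists>\<delta>>0. \<exists>C<\<infinity>. \<forall>L.
           BL_datum H Hs L p \<and> N (\<lambda>j x. L j x - L0 j x) < \<delta> \<longrightarrow> BL_const H Hs G L p \<le> C"
proof -
  note H = assms(1) and Hs = assms(2) and N = assms(3) and D0 = assms(4) and psd = assms(5) and fin = assms(6)
  interpret T: tuple_norm_space H Hs N by unfold_locales (fact H, fact Hs, fact N)
  let ?L0 = "\<lambda>j. pad H (L0 j)" and ?G = "padG H G"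
  note pL0 = BL_datum_pad[OF H D0] and pG = padG_props[OF H psd]
  have XL: "M \<in> T.X" if "BL_datum H Hs M p" for M using that by (simp add: BL_datum_def T.X_def)
  show ?thesis
  proof (rule padded_bound_of_BL_const[OF H Hs psd D0 fin])
  fix C
  assume C: "\<And>A a. (\<And>j. A j \<in> sets borel) ==> (\<And>j. emeasure (mm (Hs j)) (A j) <= ennreal (a j)) ==> (\<And>j. 0 < a j)
      ==> emeasure lborel {x. ?G x \<bullet> x < 1 / 2 \<and> (\<forall>j. ?L0 j x \<in> A j)} <= ennreal (C * (\<Prod>j\<in>UNIV. a j powr p j))"
  obtain B where B: "1 <= B" "\<And>v. ?G v \<bullet> v <= B * (norm v)^2" by (rule padG_bounded[OF H psd], rule that)
  have "\<exists>c>0. \<forall>v. norm (?L0 j v) <= c * norm v" for j using linear_bounded_pos[OF pL0(1)] by metis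
  then obtain c where c: "\<And>j. 0 < c j" "\<And>j v. norm (?L0 j v) <= c j * norm v" by metis
  define c0 where "c0 = 1 + (\<Sum>j\<in>UNIV. c j)"
  have "0 <= (\<Sum>j\<in>UNIV. c j)" using c(1) by (intro sum_nonneg) (auto simp: less_imp_le)
  then have c0: "1 <= c0" unfolding c0_def by simp
  have c0L: "norm (?L0 j v) <= c0 * norm v" for j v
  proof -
    have "c j <= (\<Sum>j\<in>UNIV. c j)" using c(1) by (intro member_le_sum) (auto simp: less_imp_le)
    then have "c j * norm v <= c0 * norm v" unfolding c0_def by (intro mult_right_mono) auto
    then show ?thesis using c(2)[of j v] by linarith
  qed
  interpret P: padded_bound ?L0 p ?G Hs c0 B C
  proof (rule padded_bound.intro)
    show "range (?L0 j) \<subseteq> Hs j" for j by (simp only: pL0(2) order_refl)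
    fix A :: "'j => 'b set" and a
    assume "\<And>j. A j \<in> sets borel" "\<And>j. emeasure (mm (Hs j)) (A j) <= ennreal (a j)" "\<And>j. 0 < a j"
    then show "emeasure lborel {x. ?G x \<bullet> x < 1 / 2 \<and> (\<forall>j. ?L0 j x \<in> A j)} <= ennreal (C * (\<Prod>j\<in>UNIV. a j powr p j))" by (rule C)
  qed (rule pL0(1,3) Hs c0L c0 pG(1,2) B)+
  have dH: "dim (range (?L0 j)) = dim (Hs j)" for j by (simp only: pL0(2))
  interpret Q: limit_datum ?L0 p ?G
  proof (rule limit_datum.intro)
    fix V :: "'a set" assume V: "subspace V"
    have "dim (?L0 j ` V) <= dim (Hs j)" for j unfolding dH[symmetric] by (rule dim_subset) auto
    then show "(\<Sum>j\<in>UNIV. p j * (real (dim (range (?L0 j))) - real (dim (?L0 j ` V)))) <= real DIM('a) - real (dim V)"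
      using P.codim_ge[OF V] dim_subset_UNIV[of V] unfolding dH by (simp add: of_nat_diff)
  qed (rule pL0(1,3) pG(1,2,3) P.dim_ker_le | assumption)+
  show ?thesis
  proof (rule Q.uniform_gauss_cond)
  fix \<delta>1 \<theta> C1
  assume \<delta>1: "0 < \<delta>1" "0 < \<theta>" and gc: "\<And>L. (\<And>j v. norm (L j v - ?L0 j v) <= \<delta>1 * norm v) ==> gauss_cond L p ?G (\<lambda>j. dim (range (?L0 j))) \<theta> C1"
  have m1: "0 < min \<delta>1 1" using \<delta>1(1) by simp
  show ?thesis
  proof (rule T.tuple_norm_controls_operator_norm[OF m1])
  fix \<delta>
  assume \<delta>: "0 < \<delta>" "\<And>M j v. M \<in> T.X ==> N M < \<delta> ==> norm (pad H (M j) v) <= min \<delta>1 1 * norm v"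
  show ?thesis
  proof (rule BL_bound_of_gauss_cond[OF H Hs psd])
  fix A :: real
  assume A: "\<And>L c \<theta> C0. BL_datum H Hs L p ==> (\<And>j v. norm (pad H (L j) v) <= c * norm v) ==>
    gauss_cond (\<lambda>j. pad H (L j)) p ?G (\<lambda>j. dim (Hs j)) \<theta> C0 ==> 0 < \<theta> ==>
    BL_bound H Hs G L p (ennreal (A * exp (blC TYPE('a) TYPE('b) p (\<lambda>j. dim (Hs j)) \<theta> C0 c)))"
  let ?C = "ennreal (A * exp (blC TYPE('a) TYPE('b) p (\<lambda>j. dim (Hs j)) \<theta> C1 (c0 + 1)))"
  show ?thesis
  proof (rule exI[of _ \<delta>], rule conjI[OF \<delta>(1)], rule exI[of _ ?C], intro conjI allI impI)
    fix L assume "BL_datum H Hs L p \<and> N (\<lambda>j x. L j x - L0 j x) < \<delta>"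
    then have D: "BL_datum H Hs L p" and NL: "N (\<lambda>j x. L j x - L0 j x) < \<delta>" by auto
    have d: "norm (pad H (L j) v - ?L0 j v) <= min \<delta>1 1 * norm v" for j v
      using \<delta>(2)[OF T.X_diff[OF XL[OF D] XL[OF D0]] NL, of j v] by (simp add: pad_def)
    have d1: "norm (pad H (L j) v - ?L0 j v) <= \<delta>1 * norm v" and d2: "norm (pad H (L j) v - ?L0 j v) <= 1 * norm v" for j v
      using d[of j v] mult_right_mono[of "min \<delta>1 1" \<delta>1 "norm v"] mult_right_mono[of "min \<delta>1 1" 1 "norm v"] by simp_all
    have "norm (pad H (L j) v) <= (c0 + 1) * norm v" for j v
      using d2[of j v] c0L[of j v] norm_triangle_sub[of "pad H (L j) v" "?L0 j v"] by (simp add: distrib_right)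
    moreover have "gauss_cond (\<lambda>j. pad H (L j)) p ?G (\<lambda>j. dim (Hs j)) \<theta> C1" using gc[of "\<lambda>j. pad H (L j)", OF d1] by (simp only: dH)
    ultimately have "BL_bound H Hs G L p ?C" by (intro A D \<delta>1(2))
    then show "BL_const H Hs G L p <= ?C" unfolding BL_const_def by (intro Inf_lower) simp
  qed simp
  qed
  qed
  qed
  qed
qed

end
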